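(* Let $k$ be a field and let $\mathcal{C}$ be a $k$-linear, Hom-finite, Krull-Schmidt, connected triangulated category with stable Auslander-Reiten quiver components $\Gamma_1$ and $\Gamma_2$. Suppose there are objects $X\in\Gamma_1$ and $Y\in\Gamma_2$ such that either $\operatorname{Hom}_{\mathcal{C}}(X,Y)\neq 0$ or $\operatorname{Hom}_{\mathcal{C}}(Y,X)\neq 0$. If the tree class of $\Gamma_1$ is an extended Dynkin diagram, then the tree class of $\Gamma_2$ is either an extended Dynkin diagram or one of the trees $A_\infty$, $B_\infty$, $C_\infty$, $D_\infty$, $A_\infty^\infty$.
   Context: $\mathcal{C}$ is Hom-finite if $\dim_k\operatorname{Hom}_{\mathcal{C}}(X,Y)<\infty$ for all indecomposable $X,Y$. It is Krull-Schmidt if every object is a finite direct sum of indecomposable objects, each with local endomorphism ring. It is connected if the indecomposable objects cannot be partitioned into two (nonempty) classes with no non-zero homomorphisms, in either direction, between objects in different classes. Auslander-Reiten triangles: a distinguished triangle $U\to V\to W\xrightarrow{w}U[1]$ with $U,W$ indecomposable, $w\ne 0$, and such that every morphism $X\to W$ which is not a split epimorphism factors through $V\to W$ (equivalently, every morphism $U\to X$ which is not a split monomorphism factors through $U\to V$). One writes $U=\tau W$, $W=\tau^{-1}U$. Auslander-Reiten quiver: vertices are the isomorphism classes of indecomposable objects; there is an arrow $X\to Y$ if there is an irreducible morphism $X\to Y$. Where Auslander-Reiten triangles exist, the arrow $X\to Y$ is labelled by $(a,b)$, where $a$ is the multiplicity of $X$ as a summand of the middle term of the Auslander-Reiten triangle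 ending at $Y$, and $b$ is the multiplicity of $Y$ in the middle term of the one starting at $X$. A stable component $\Gamma$ is a connected component of the Auslander-Reiten quiver such that for every indecomposable $M\in\Gamma$: (1) for every $n\in\mathbb{Z}$, $\tau^nM$ is defined (the relevant Auslander-Reiten triangles exist) and lies in $\Gamma$; (2) every irreducible morphism beginning or ending at $M$ lies in $\Gamma$. It is not assumed that $\Gamma$ is closed under shift, nor that Auslander-Reiten triangles exist elsewhere in $\mathcal{C}$. Tree class: for a tree $T$ whose edges carry valuations, choose an orientation; $\mathbb{Z}T$ has vertices $(n,x)$, $n\in\mathbb{Z}$, $x\in T_0$, and, for each arrow $x\to y$ of $T$ with valuation $(a,b)$, arrows $(n,x)\to(n,y)$ with valuation $(a,b)$ and $(n,y)\to(n+1,x)$ with valuation $(b,a)$; its translation is $\tau(n,x)=(n-1,x)$. By known theorems (Riedtmann; Xiao-Zhu) $\Gamma\cong\mathbb{Z}T/G$ for a valued tree $T$ and a group $G$ of automorphisms of $\mathbb{Z}T$, where $\mathbb{Z}T\to\Gamma$ is a covering (it commutes with $\tau$, preserves valuations, and is bijective on immediate successors and on immediate predecessors of each vertex). The valued tree $T$ is determined up to isomorphism by $\Gamma$ and is called the tree class of $\Gamma$. Extended Dynkin (Euclidean) diagrams: since tree classes are trees, the relevant ones are the following finite valued trees (edges whose valuation is not mentioned have valuation $(1,1)$): $\tilde A_{11}$ (two vertices, one edge valued $(1,4)$ or $(4,1)$); $\tilde A_{12}$ (two vertices, one edge valued $(2,2)$); $\tilde B_n,\tilde C_n,\widetilde{BC}_n$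 (a line with at least three vertices whose two end edges each have valuation $(1,2)$ or $(2,1)$, in any combination); $\widetilde{BD}_n,\widetilde{CD}_n$ (a line with one end edge valued $(1,2)$ or $(2,1)$ and with the other end forked into two leaves as in $D_n$); $\tilde D_n$ ($n\ge4$); $\tilde E_6,\tilde E_7,\tilde E_8$; $\tilde F_{41},\tilde F_{42}$ (a line with five vertices, whose successive edges are valued $(1,1),(1,1),(1,2)\text{ or }(2,1),(1,1)$); $\tilde G_{21},\tilde G_{22}$ (a line with three vertices, one edge valued $(1,1)$ and the other $(1,3)$ or $(3,1)$). Infinite trees: $A_\infty$ is the half-infinite line and $A_\infty^\infty$ the doubly infinite line, all edges valued $(1,1)$; $B_\infty$ and $C_\infty$ are the half-infinite lines whose first edge is valued $(1,2)$, respectively $(2,1)$ (the two possible directions), all other edges being valued $(1,1)$; $D_\infty$ is the half-infinite line whose end is forked into two leaves, as in $D_n$, all edges valued $(1,1)$. *)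

theory Defs
  imports "HOL-Algebra.Ideal" "HOL-Algebra.Module" "HOL-Algebra.Bij"
begin

section \<open>Linear categories\<close>

text \<open>
  Each \<open>Mor C X Y\<close> is a module record over the base field; only its additive structure and its
  scalar multiplication are used (the fields \<open>mult\<close> and \<open>one\<close> of a module record are irrelevant).
  The sets \<open>Mor C X Y\<close> need not be disjoint, so predicates on morphisms take source and target as
  arguments. \<open>g \<bullet>\<^bsub>C\<^esub> f\<close> means first \<open>f\<close>, then \<open>g\<close>.
\<close>

record ('k, 'o, 'm) lin_cat =
  Obj :: "'o set"
  Mor :: "'o \<Rightarrow> 'o \<Rightarrow> ('k, 'm) module"
  ident :: "'o \<Rightarrow> 'm"
  comp :: "'m \<Rightarrow> 'm \<Rightarrow> 'm"  (infixl \<open>\<bullet>\<index>\<close> 70)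

abbreviation hom_set :: "('k, 'o, 'm, 'z) lin_cat_scheme \<Rightarrow> 'o \<Rightarrow> 'o \<Rightarrow> 'm set" where
  "hom_set C X Y \<equiv> carrier (Mor C X Y)"

abbreviation null :: "('k, 'o, 'm, 'z) lin_cat_scheme \<Rightarrow> 'o \<Rightarrow> 'o \<Rightarrow> 'm" where
  "null C X Y \<equiv> \<zero>\<^bsub>Mor C X Y\<^esub>"

locale linear_category = field K for K :: "('k, 'r) ring_scheme" (structure) +
  fixes C :: "('k, 'o, 'm, 'z) lin_cat_scheme"
  assumes hom_module: "\<lbrakk>X \<in> Obj C; Y \<in> Obj C\<rbrakk> \<Longrightarrow> module K (Mor C X Y)"
    and ident_closed: "X \<in> Obj C \<Longrightarrow> ident C X \<in> hom_set C X X"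
    and comp_closed:
      "\<lbrakk>X \<in> Obj C; Y \<in> Obj C; Z \<in> Obj C; f \<in> hom_set C X Y; g \<in> hom_set C Y Z\<rbrakk>
        \<Longrightarrow> g \<bullet>\<^bsub>C\<^esub> f \<in> hom_set C X Z"
    and comp_ident_right:
      "\<lbrakk>X \<in> Obj C; Y \<in> Obj C; f \<in> hom_set C X Y\<rbrakk> \<Longrightarrow> f \<bullet>\<^bsub>C\<^esub> ident C X = f"
    and comp_ident_left:
      "\<lbrakk>X \<in> Obj C; Y \<in> Obj C; f \<in> hom_set C X Y\<rbrakk> \<Longrightarrow> ident C Y \<bullet>\<^bsub>C\<^esub> f = f"
    and comp_assoc:
      "\<lbrakk>W \<in> Obj C; X \<in> Obj C; Y \<in> Obj C; Z \<in> Obj C;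
        f \<in> hom_set C W X; g \<in> hom_set C X Y; h \<in> hom_set C Y Z\<rbrakk>
        \<Longrightarrow> h \<bullet>\<^bsub>C\<^esub> g \<bullet>\<^bsub>C\<^esub> f = h \<bullet>\<^bsub>C\<^esub> (g \<bullet>\<^bsub>C\<^esub> f)"
    and comp_add_right:
      "\<lbrakk>X \<in> Obj C; Y \<in> Obj C; Z \<in> Obj C;
        f \<in> hom_set C X Y; f' \<in> hom_set C X Y; g \<in> hom_set C Y Z\<rbrakk>
        \<Longrightarrow> g \<bullet>\<^bsub>C\<^esub> (f \<oplus>\<^bsub>Mor C X Y\<^esub> f') = (g \<bullet>\<^bsub>C\<^esub> f) \<oplus>\<^bsub>Mor C X Z\<^esub> (g \<bullet>\<^bsub>C\<^esub> f')"
    and comp_add_left: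
      "\<lbrakk>X \<in> Obj C; Y \<in> Obj C; Z \<in> Obj C;
        f \<in> hom_set C X Y; g \<in> hom_set C Y Z; g' \<in> hom_set C Y Z\<rbrakk>
        \<Longrightarrow> (g \<oplus>\<^bsub>Mor C Y Z\<^esub> g') \<bullet>\<^bsub>C\<^esub> f = (g \<bullet>\<^bsub>C\<^esub> f) \<oplus>\<^bsub>Mor C X Z\<^esub> (g' \<bullet>\<^bsub>C\<^esub> f)"
    and comp_smult_right:
      "\<lbrakk>X \<in> Obj C; Y \<in> Obj C; Z \<in> Obj C;
        a \<in> carrier K; f \<in> hom_set C X Y; g \<in> hom_set C Y Z\<rbrakk>
        \<Longrightarrow> g \<bullet>\<^bsub>C\<^esub> (a \<odot>\<^bsub>Mor C X Y\<^esub> f) = a \<odot>\<^bsub>Mor C X Z\<^esub> (g \<bullet>\<^bsub>C\<^esub> f)"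
    and comp_smult_left:
      "\<lbrakk>X \<in> Obj C; Y \<in> Obj C; Z \<in> Obj C;
        a \<in> carrier K; f \<in> hom_set C X Y; g \<in> hom_set C Y Z\<rbrakk>
        \<Longrightarrow> (a \<odot>\<^bsub>Mor C Y Z\<^esub> g) \<bullet>\<^bsub>C\<^esub> f = a \<odot>\<^bsub>Mor C X Z\<^esub> (g \<bullet>\<^bsub>C\<^esub> f)"

definition split_mono :: "('k, 'o, 'm, 'z) lin_cat_scheme \<Rightarrow> 'o \<Rightarrow> 'o \<Rightarrow> 'm \<Rightarrow> bool" where
  "split_mono C X Y f \<longleftrightarrow> f \<in> hom_set C X Y \<and> (\<exists>r\<in>hom_set C Y X. r \<bullet>\<^bsub>C\<^esub> f = ident C X)"

definition split_epi :: "('k, 'o, 'm, 'z) lin_cat_scheme \<Rightarrow> 'o \<Rightarrow> 'o \<Rightarrow> 'm \<Rightarrow> bool" where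
  "split_epi C X Y f \<longleftrightarrow> f \<in> hom_set C X Y \<and> (\<exists>s\<in>hom_set C Y X. f \<bullet>\<^bsub>C\<^esub> s = ident C Y)"

definition iso_mor :: "('k, 'o, 'm, 'z) lin_cat_scheme \<Rightarrow> 'o \<Rightarrow> 'o \<Rightarrow> 'm \<Rightarrow> bool" where
  "iso_mor C X Y f \<longleftrightarrow> f \<in> hom_set C X Y \<and>
     (\<exists>g\<in>hom_set C Y X. g \<bullet>\<^bsub>C\<^esub> f = ident C X \<and> f \<bullet>\<^bsub>C\<^esub> g = ident C Y)"

definition isomorphic :: "('k, 'o, 'm, 'z) lin_cat_scheme \<Rightarrow> 'o \<Rightarrow> 'o \<Rightarrow> bool" where
  "isomorphic C X Y \<longleftrightarrow> X \<in> Obj C \<and> Y \<in> Obj C \<and> (\<exists>f. iso_mor C X Y f)"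

definition iso_class :: "('k, 'o, 'm, 'z) lin_cat_scheme \<Rightarrow> 'o \<Rightarrow> 'o set" where
  "iso_class C X = {Y. isomorphic C X Y}"

text \<open>\<open>V\<close> is a biproduct of the list \<open>Xs\<close>; for \<open>Xs = []\<close> this says that \<open>V\<close> is a zero object.\<close>

definition direct_sum :: "('k, 'o, 'm, 'z) lin_cat_scheme \<Rightarrow> 'o list \<Rightarrow> 'o \<Rightarrow> bool" where
  "direct_sum C Xs V \<longleftrightarrow> set Xs \<subseteq> Obj C \<and> V \<in> Obj C \<and>
     (\<exists>\<iota> \<pi>. (\<forall>i<length Xs. \<iota> i \<in> hom_set C (Xs ! i) V \<and> \<pi> i \<in> hom_set C V (Xs ! i)) \<and>
        (\<forall>i<length Xs. \<forall>j<length Xs. \<pi> j \<bullet>\<^bsub>C\<^esub> \<iota> i =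
            (if i = j then ident C (Xs ! i) else null C (Xs ! i) (Xs ! j))) \<and>
        (\<Oplus>\<^bsub>Mor C V V\<^esub>i\<in>{..<length Xs}. \<iota> i \<bullet>\<^bsub>C\<^esub> \<pi> i) = ident C V)"

abbreviation zero_object :: "('k, 'o, 'm, 'z) lin_cat_scheme \<Rightarrow> 'o \<Rightarrow> bool" where
  "zero_object C Z \<equiv> direct_sum C [] Z"

definition indecomposable :: "('k, 'o, 'm, 'z) lin_cat_scheme \<Rightarrow> 'o \<Rightarrow> bool" where
  "indecomposable C X \<longleftrightarrow> X \<in> Obj C \<and> \<not> zero_object C X \<and>
     (\<forall>A\<in>Obj C. \<forall>B\<in>Obj C. direct_sum C [A, B] X \<longrightarrow> zero_object C A \<or> zero_object C B)"

locale additive_category = linear_category +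
  assumes ex_direct_sum: "set Xs \<subseteq> Obj C \<Longrightarrow> \<exists>V\<in>Obj C. direct_sum C Xs V"


section \<open>Triangulated categories\<close>

text \<open>\<open>Dist C X Y Z u v w\<close> means that \<open>X \<rightarrow> Y \<rightarrow> Z \<rightarrow> X[1]\<close> with morphisms \<open>u, v, w\<close> is distinguished.\<close>

record ('k, 'o, 'm) tri_cat = "('k, 'o, 'm) lin_cat" +
  shift :: "'o \<Rightarrow> 'o"
  shift_mor :: "'m \<Rightarrow> 'm"
  Dist :: "'o \<Rightarrow> 'o \<Rightarrow> 'o \<Rightarrow> 'm \<Rightarrow> 'm \<Rightarrow> 'm \<Rightarrow> bool"

text \<open>
  The shift is a \<open>k\<close>-linear autoequivalence (this includes the case of an automorphism).
\<close>

locale triangulated_category = additive_category K C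
  for K :: "('k, 'r) ring_scheme" (structure) and C :: "('k, 'o, 'm, 'z) tri_cat_scheme" +
  assumes shift_closed: "X \<in> Obj C \<Longrightarrow> shift C X \<in> Obj C"
    and shift_fully_faithful:
      "\<lbrakk>X \<in> Obj C; Y \<in> Obj C\<rbrakk>
        \<Longrightarrow> bij_betw (shift_mor C) (hom_set C X Y) (hom_set C (shift C X) (shift C Y))"
    and shift_ident: "X \<in> Obj C \<Longrightarrow> shift_mor C (ident C X) = ident C (shift C X)"
    and shift_comp:
      "\<lbrakk>X \<in> Obj C; Y \<in> Obj C; Z \<in> Obj C; f \<in> hom_set C X Y; g \<in> hom_set C Y Z\<rbrakk>
        \<Longrightarrow> shift_mor C (g \<bullet>\<^bsub>C\<^esub> f) = shift_mor C g \<bullet>\<^bsub>C\<^esub> shift_mor C f"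
    and shift_add:
      "\<lbrakk>X \<in> Obj C; Y \<in> Obj C; f \<in> hom_set C X Y; g \<in> hom_set C X Y\<rbrakk>
        \<Longrightarrow> shift_mor C (f \<oplus>\<^bsub>Mor C X Y\<^esub> g)
          = shift_mor C f \<oplus>\<^bsub>Mor C (shift C X) (shift C Y)\<^esub> shift_mor C g"
    and shift_smult:
      "\<lbrakk>X \<in> Obj C; Y \<in> Obj C; a \<in> carrier K; f \<in> hom_set C X Y\<rbrakk>
        \<Longrightarrow> shift_mor C (a \<odot>\<^bsub>Mor C X Y\<^esub> f) = a \<odot>\<^bsub>Mor C (shift C X) (shift C Y)\<^esub> shift_mor C f"
    and shift_ess_surj: "Y \<in> Obj C \<Longrightarrow> \<exists>X\<in>Obj C. isomorphic C (shift C X) Y"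
    and dist_closed:
      "Dist C X Y Z u v w \<Longrightarrow> X \<in> Obj C \<and> Y \<in> Obj C \<and> Z \<in> Obj C \<and>
        u \<in> hom_set C X Y \<and> v \<in> hom_set C Y Z \<and> w \<in> hom_set C Z (shift C X)"
    and TR1_iso:
      "\<lbrakk>Dist C X Y Z u v w; X' \<in> Obj C; Y' \<in> Obj C; Z' \<in> Obj C;
        u' \<in> hom_set C X' Y'; v' \<in> hom_set C Y' Z'; w' \<in> hom_set C Z' (shift C X');
        iso_mor C X X' f; iso_mor C Y Y' g; iso_mor C Z Z' h;
        g \<bullet>\<^bsub>C\<^esub> u = u' \<bullet>\<^bsub>C\<^esub> f; h \<bullet>\<^bsub>C\<^esub> v = v' \<bullet>\<^bsub>C\<^esub> g; shift_mor C f \<bullet>\<^bsub>C\<^esub> w = w' \<bullet>\<^bsub>C\<^esub> h\<rbrakk>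
        \<Longrightarrow> Dist C X' Y' Z' u' v' w'"
    and TR1_ident:
      "\<lbrakk>X \<in> Obj C; zero_object C Z\<rbrakk>
        \<Longrightarrow> Dist C X X Z (ident C X) (null C X Z) (null C Z (shift C X))"
    and TR1_cone:
      "\<lbrakk>X \<in> Obj C; Y \<in> Obj C; u \<in> hom_set C X Y\<rbrakk> \<Longrightarrow> \<exists>Z v w. Dist C X Y Z u v w"
    and TR2:
      "\<lbrakk>X \<in> Obj C; Y \<in> Obj C; Z \<in> Obj C;
        u \<in> hom_set C X Y; v \<in> hom_set C Y Z; w \<in> hom_set C Z (shift C X)\<rbrakk>
        \<Longrightarrow> Dist C X Y Z u v w \<longleftrightarrow>
          Dist C Y Z (shift C X) v w (\<ominus>\<^bsub>Mor C (shift C X) (shift C Y)\<^esub> shift_mor C u)"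
    and TR3:
      "\<lbrakk>Dist C X Y Z u v w; Dist C X' Y' Z' u' v' w';
        f \<in> hom_set C X X'; g \<in> hom_set C Y Y'; g \<bullet>\<^bsub>C\<^esub> u = u' \<bullet>\<^bsub>C\<^esub> f\<rbrakk>
        \<Longrightarrow> \<exists>h\<in>hom_set C Z Z'. h \<bullet>\<^bsub>C\<^esub> v = v' \<bullet>\<^bsub>C\<^esub> g \<and> shift_mor C f \<bullet>\<^bsub>C\<^esub> w = w' \<bullet>\<^bsub>C\<^esub> h"
    and TR4:
      "\<lbrakk>Dist C X Y Z' u i i'; Dist C Y Z X' v j j'; Dist C X Z Y' (v \<bullet>\<^bsub>C\<^esub> u) k k'\<rbrakk>
        \<Longrightarrow> \<exists>f\<in>hom_set C Z' Y'. \<exists>g\<in>hom_set C Y' X'.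
              Dist C Z' Y' X' f g (shift_mor C i \<bullet>\<^bsub>C\<^esub> j') \<and>
              f \<bullet>\<^bsub>C\<^esub> i = k \<bullet>\<^bsub>C\<^esub> v \<and> k' \<bullet>\<^bsub>C\<^esub> f = i' \<and>
              g \<bullet>\<^bsub>C\<^esub> k = j \<and> j' \<bullet>\<^bsub>C\<^esub> g = shift_mor C u \<bullet>\<^bsub>C\<^esub> k'"


section \<open>Finiteness, Krull-Schmidt property, connectedness\<close>

definition fin_dim :: "('k, 'r) ring_scheme \<Rightarrow> ('k, 'm) module \<Rightarrow> bool" where
  "fin_dim K M \<longleftrightarrow> (\<exists>S. finite S \<and> S \<subseteq> carrier M \<and>
     (\<forall>x\<in>carrier M. \<exists>a\<in>S \<rightarrow> carrier K. x = (\<Oplus>\<^bsub>M\<^esub>s\<in>S. a s \<odot>\<^bsub>M\<^esub> s)))"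

definition hom_finite :: "('k, 'r) ring_scheme \<Rightarrow> ('k, 'o, 'm, 'z) lin_cat_scheme \<Rightarrow> bool" where
  "hom_finite K C \<longleftrightarrow>
     (\<forall>X Y. indecomposable C X \<longrightarrow> indecomposable C Y \<longrightarrow> fin_dim K (Mor C X Y))"

definition End_ring :: "('k, 'o, 'm, 'z) lin_cat_scheme \<Rightarrow> 'o \<Rightarrow> 'm ring" where
  "End_ring C X = \<lparr>carrier = hom_set C X X, monoid.mult = comp C, one = ident C X,
     zero = null C X X, add = add (Mor C X X)\<rparr>"

text \<open>A (not necessarily commutative) ring is local iff its non-units form a two-sided ideal.\<close>

definition local_ring :: "('a, 'r) ring_scheme \<Rightarrow> bool" where
  "local_ring R \<longleftrightarrow> ideal (carrier R - Units R) R"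

definition krull_schmidt :: "('k, 'o, 'm, 'z) lin_cat_scheme \<Rightarrow> bool" where
  "krull_schmidt C \<longleftrightarrow> (\<forall>V\<in>Obj C. \<exists>Xs. direct_sum C Xs V \<and>
     (\<forall>X\<in>set Xs. indecomposable C X \<and> local_ring (End_ring C X)))"

definition hom_nonzero :: "('k, 'o, 'm, 'z) lin_cat_scheme \<Rightarrow> 'o \<Rightarrow> 'o \<Rightarrow> bool" where
  "hom_nonzero C X Y \<longleftrightarrow> hom_set C X Y \<noteq> {null C X Y}"

definition connected_category :: "('k, 'o, 'm, 'z) lin_cat_scheme \<Rightarrow> bool" where
  "connected_category C \<longleftrightarrow> (\<nexists>A B. A \<union> B = {X. indecomposable C X} \<and> A \<inter> B = {} \<and>
     A \<noteq> {} \<and> B \<noteq> {} \<and> (\<forall>X\<in>A. \<forall>Y\<in>B. \<not> hom_nonzero C X Y \<and> \<not> hom_nonzero C Y X))"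


section \<open>Auslander-Reiten triangles and the Auslander-Reiten quiver\<close>

definition AR_triangle ::
    "('k, 'o, 'm, 'z) tri_cat_scheme \<Rightarrow> 'o \<Rightarrow> 'o \<Rightarrow> 'o \<Rightarrow> 'm \<Rightarrow> 'm \<Rightarrow> 'm \<Rightarrow> bool" where
  "AR_triangle C U V W u v w \<longleftrightarrow> Dist C U V W u v w \<and>
     indecomposable C U \<and> indecomposable C W \<and> w \<noteq> null C W (shift C U) \<and>
     (\<forall>X\<in>Obj C. \<forall>f\<in>hom_set C X W. \<not> split_epi C X W f \<longrightarrow>
        (\<exists>g\<in>hom_set C X V. f = v \<bullet>\<^bsub>C\<^esub> g))"

definition irreducible_mor :: "('k, 'o, 'm, 'z) lin_cat_scheme \<Rightarrow> 'o \<Rightarrow> 'o \<Rightarrow> 'm \<Rightarrow> bool" where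
  "irreducible_mor C X Y f \<longleftrightarrow> f \<in> hom_set C X Y \<and> \<not> split_mono C X Y f \<and> \<not> split_epi C X Y f \<and>
     (\<forall>Z\<in>Obj C. \<forall>g\<in>hom_set C X Z. \<forall>h\<in>hom_set C Z Y. f = h \<bullet>\<^bsub>C\<^esub> g \<longrightarrow>
        split_mono C X Z g \<or> split_epi C Z Y h)"

text \<open>
  The number of indecomposable summands of \<open>V\<close> isomorphic to \<open>X\<close>; in a Krull-Schmidt category it
  does not depend on the chosen decomposition of \<open>V\<close>.
\<close>

definition summand_mult :: "('k, 'o, 'm, 'z) lin_cat_scheme \<Rightarrow> 'o \<Rightarrow> 'o \<Rightarrow> nat" where
  "summand_mult C X V = (THE n. \<exists>Xs. direct_sum C Xs V \<and> (\<forall>Z\<in>set Xs. indecomposable C Z) \<and>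
     n = length (filter (isomorphic C X) Xs))"

text \<open>
  Valued translation quivers. Values of \<open>qval\<close> matter only on arrows; \<open>qtrans\<close> is the
  translation.
\<close>

record 'v vtquiver =
  qverts :: "'v set"
  qarr :: "'v \<Rightarrow> 'v \<Rightarrow> bool"
  qval :: "'v \<Rightarrow> 'v \<Rightarrow> nat \<times> nat"
  qtrans :: "'v \<Rightarrow> 'v"

definition is_tau :: "('k, 'o, 'm, 'z) tri_cat_scheme \<Rightarrow> 'o set \<Rightarrow> 'o set \<Rightarrow> bool" where
  "is_tau C x y \<longleftrightarrow> (\<exists>U V W u v w. AR_triangle C U V W u v w \<and> x = iso_class C U \<and> y = iso_class C W)"

text \<open>
  \<open>is_tau C x y\<close> says that the translate of \<open>y\<close> is defined and equal to \<open>x\<close>. In the quiver below the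
  definite descriptions are meaningful only where the Auslander-Reiten triangles in question exist,
  e.g. on a stable component.
\<close>

definition ar_quiver :: "('k, 'o, 'm, 'z) tri_cat_scheme \<Rightarrow> 'o set vtquiver" where
  "ar_quiver C =
     \<lparr>qverts = {iso_class C X |X. indecomposable C X},
      qarr = (\<lambda>x y. \<exists>X Y f. x = iso_class C X \<and> y = iso_class C Y \<and>
                indecomposable C X \<and> indecomposable C Y \<and> irreducible_mor C X Y f),
      qval = (\<lambda>x y.
        (THE a. \<exists>X\<in>x. \<exists>U V Y u v w. Y \<in> y \<and> AR_triangle C U V Y u v w \<and> a = summand_mult C X V,
         THE b. \<exists>Y\<in>y. \<exists>X V W u v w. X \<in> x \<and> AR_triangle C X V W u v w \<and> b = summand_mult C Y V)),
      qtrans = (\<lambda>y. THE x. is_tau C x y)\<rparr>"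

definition quiver_component :: "'v vtquiver \<Rightarrow> 'v set \<Rightarrow> bool" where
  "quiver_component Q \<Gamma> \<longleftrightarrow> (\<exists>x\<in>qverts Q. \<Gamma> = {y \<in> qverts Q. equivclp (qarr Q) x y})"

text \<open>
  In the first clause \<open>t n\<close> is the \<open>n\<close>-th translate of \<open>M\<close>, for every integer \<open>n\<close>.
\<close>

definition stable_component :: "('k, 'o, 'm, 'z) tri_cat_scheme \<Rightarrow> 'o set set \<Rightarrow> bool" where
  "stable_component C \<Gamma> \<longleftrightarrow> quiver_component (ar_quiver C) \<Gamma> \<and>
     (\<forall>M\<in>\<Gamma>.
       (\<exists>t :: int \<Rightarrow> 'o set. t 0 = M \<and> (\<forall>n. is_tau C (t (n + 1)) (t n) \<and> t n \<in> \<Gamma>)) \<and>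
       (\<forall>N\<in>qverts (ar_quiver C). qarr (ar_quiver C) M N \<or> qarr (ar_quiver C) N M \<longrightarrow> N \<in> \<Gamma>))"

definition full_subquiver :: "'v vtquiver \<Rightarrow> 'v set \<Rightarrow> 'v vtquiver" where
  "full_subquiver Q \<Gamma> = Q\<lparr>qverts := \<Gamma>, qarr := (\<lambda>x y. x \<in> \<Gamma> \<and> y \<in> \<Gamma> \<and> qarr Q x y)\<rparr>"


section \<open>Valued trees and tree classes\<close>

text \<open>
  \<open>tedge T x y\<close> is \<open>None\<close> if \<open>x\<close> and \<open>y\<close> are not adjacent, and \<open>Some (a, b)\<close> if the edge between
  them, read from \<open>x\<close> to \<open>y\<close>, has valuation \<open>(a, b)\<close>; read from \<open>y\<close> to \<open>x\<close> it has valuation \<open>(b, a)\<close>.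
\<close>

record 'v vtree =
  tverts :: "'v set"
  tedge :: "'v \<Rightarrow> 'v \<Rightarrow> (nat \<times> nat) option"

abbreviation tadj :: "'v vtree \<Rightarrow> 'v \<Rightarrow> 'v \<Rightarrow> bool" where
  "tadj T x y \<equiv> tedge T x y \<noteq> None"

definition valued_tree :: "'v vtree \<Rightarrow> bool" where
  "valued_tree T \<longleftrightarrow> tverts T \<noteq> {} \<and>
     (\<forall>x y. tadj T x y \<longrightarrow> x \<in> tverts T \<and> y \<in> tverts T) \<and>
     (\<forall>x. \<not> tadj T x x) \<and>
     (\<forall>x y. tedge T y x = map_option prod.swap (tedge T x y)) \<and>
     (\<forall>x y a b. tedge T x y = Some (a, b) \<longrightarrow> a > 0 \<and> b > 0) \<and>
     (\<forall>x\<in>tverts T. \<forall>y\<in>tverts T. (tadj T)\<^sup>*\<^sup>* x y) \<and>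
     (\<nexists>xs. distinct xs \<and> length xs \<ge> 3 \<and> successively (tadj T) xs \<and> tadj T (last xs) (hd xs))"

definition vtree_iso :: "'v vtree \<Rightarrow> 'w vtree \<Rightarrow> bool"  (infix \<open>\<cong>\<^sub>T\<close> 50) where
  "T \<cong>\<^sub>T T' \<longleftrightarrow> (\<exists>f. bij_betw f (tverts T) (tverts T') \<and>
     (\<forall>x\<in>tverts T. \<forall>y\<in>tverts T. tedge T' (f x) (f y) = tedge T x y))"

definition orientation :: "'v vtree \<Rightarrow> ('v \<Rightarrow> 'v \<Rightarrow> bool) \<Rightarrow> bool" where
  "orientation T ori \<longleftrightarrow> (\<forall>x y. ori x y \<longrightarrow> tadj T x y) \<and> (\<forall>x y. tadj T x y \<longrightarrow> ori x y \<noteq> ori y x)"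

text \<open>
  The translation quiver of a valued tree with orientation. An arrow from \<open>x\<close> to \<open>y\<close> of valuation
  \<open>(a, b)\<close> gives arrows \<open>(n, x) \<rightarrow> (n, y)\<close> of valuation \<open>(a, b)\<close> and \<open>(n, y) \<rightarrow> (n + 1, x)\<close> of valuation
  \<open>(b, a)\<close>, which is in both cases the valuation of the edge read in the direction of the arrow.
\<close>

definition ZT :: "'v vtree \<Rightarrow> ('v \<Rightarrow> 'v \<Rightarrow> bool) \<Rightarrow> (int \<times> 'v) vtquiver" where
  "ZT T ori =
     \<lparr>qverts = UNIV \<times> tverts T,
      qarr = (\<lambda>(n, x) (m, y). m = n \<and> ori x y \<or> m = n + 1 \<and> ori y x),
      qval = (\<lambda>(n, x) (m, y). the (tedge T x y)),
      qtrans = (\<lambda>(n, x). (n - 1, x))\<rparr>"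

definition quiver_aut :: "'v vtquiver \<Rightarrow> ('v \<Rightarrow> 'v) \<Rightarrow> bool" where
  "quiver_aut Q g \<longleftrightarrow> bij_betw g (qverts Q) (qverts Q) \<and>
     (\<forall>x\<in>qverts Q. g (qtrans Q x) = qtrans Q (g x)) \<and>
     (\<forall>x\<in>qverts Q. \<forall>y\<in>qverts Q. qarr Q (g x) (g y) = qarr Q x y \<and>
        (qarr Q x y \<longrightarrow> qval Q (g x) (g y) = qval Q x y))"

definition aut_group :: "'v vtquiver \<Rightarrow> ('v \<Rightarrow> 'v) set \<Rightarrow> bool" where
  "aut_group Q G \<longleftrightarrow> subgroup G (BijGroup (qverts Q)) \<and> (\<forall>g\<in>G. quiver_aut Q g)"

definition qsucc :: "'v vtquiver \<Rightarrow> 'v \<Rightarrow> 'v set" where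
  "qsucc Q x = {y \<in> qverts Q. qarr Q x y}"

definition qpred :: "'v vtquiver \<Rightarrow> 'v \<Rightarrow> 'v set" where
  "qpred Q x = {y \<in> qverts Q. qarr Q y x}"

definition quiver_covering :: "'v vtquiver \<Rightarrow> 'w vtquiver \<Rightarrow> ('v \<Rightarrow> 'w) \<Rightarrow> bool" where
  "quiver_covering Q Q' \<phi> \<longleftrightarrow> \<phi> ` qverts Q = qverts Q' \<and>
     (\<forall>x\<in>qverts Q. \<phi> (qtrans Q x) = qtrans Q' (\<phi> x) \<and>
        bij_betw \<phi> (qsucc Q x) (qsucc Q' (\<phi> x)) \<and>
        bij_betw \<phi> (qpred Q x) (qpred Q' (\<phi> x)) \<and>
        (\<forall>y\<in>qsucc Q x. qval Q' (\<phi> x) (\<phi> y) = qval Q x y))"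

text \<open>
  \<open>T\<close> is a tree class of \<open>Q\<close> if \<open>Q\<close> is the quotient of \<open>ZT T ori\<close> by a group \<open>G\<close> of automorphisms,
  with the projection \<open>\<phi>\<close> a covering. The fibres of \<open>\<phi>\<close> are the \<open>G\<close>-orbits, and since \<open>\<phi>\<close> is a covering
  the induced bijection from the set of orbits to \<open>qverts Q\<close> is an isomorphism of quivers.
\<close>

definition tree_class :: "'w vtquiver \<Rightarrow> 'v vtree \<Rightarrow> bool" where
  "tree_class Q T \<longleftrightarrow> valued_tree T \<and>
     (\<exists>ori G \<phi>. orientation T ori \<and> aut_group (ZT T ori) G \<and> quiver_covering (ZT T ori) Q \<phi> \<and>
        (\<forall>p\<in>qverts (ZT T ori). \<forall>q\<in>qverts (ZT T ori). \<phi> p = \<phi> q \<longleftrightarrow> (\<exists>g\<in>G. q = g p)))"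


section \<open>Extended Dynkin diagrams and infinite trees\<close>

text \<open>The valued tree with vertex set \<open>V\<close> given by valuations \<open>E\<close> of edges listed in one direction each.\<close>

definition vtree_of :: "'v set \<Rightarrow> ('v \<times> 'v \<Rightarrow> (nat \<times> nat) option) \<Rightarrow> 'v vtree" where
  "vtree_of V E = \<lparr>tverts = V, tedge = (\<lambda>x y.
     case E (x, y) of Some p \<Rightarrow> Some p | None \<Rightarrow> map_option prod.swap (E (y, x)))\<rparr>"

text \<open>The line \<open>0, 1, \<dots>, n - 1\<close>, where the edge from \<open>i\<close> to \<open>i + 1\<close> has valuation \<open>l i\<close>.\<close>

definition line :: "nat \<Rightarrow> (nat \<Rightarrow> nat \<times> nat) \<Rightarrow> ((nat \<times> nat) \<times> (nat \<times> nat)) list" where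
  "line n l = map (\<lambda>i. ((i, Suc i), l i)) [0..<n - 1]"

definition line_tree :: "nat \<Rightarrow> (nat \<Rightarrow> nat \<times> nat) \<Rightarrow> nat vtree" where
  "line_tree n l = vtree_of {..<n} (map_of (line n l))"

abbreviation unvalued :: "nat \<Rightarrow> nat \<times> nat" where
  "unvalued \<equiv> \<lambda>_. (1, 1)"

text \<open>
  In the forked trees, the vertices beyond the line are extra leaves attached to a vertex of the
  line; \<open>BD_CD_tilde\<close> has \<open>n\<close> vertices, \<open>D_tilde\<close> has \<open>n + 1\<close> vertices.
\<close>

inductive euclidean_diagram :: "nat vtree \<Rightarrow> bool" where
  A11_tilde: "p \<in> {(1, 4), (4, 1)} \<Longrightarrow> euclidean_diagram (line_tree 2 (\<lambda>_. p))"
| A12_tilde: "euclidean_diagram (line_tree 2 (\<lambda>_. (2, 2)))"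
| B_C_BC_tilde:
    "\<lbrakk>n \<ge> 3; p \<in> {(1, 2), (2, 1)}; q \<in> {(1, 2), (2, 1)}\<rbrakk>
      \<Longrightarrow> euclidean_diagram (line_tree n (unvalued(0 := p, n - 2 := q)))"
| BD_CD_tilde:
    "\<lbrakk>n \<ge> 4; p \<in> {(1, 2), (2, 1)}\<rbrakk>
      \<Longrightarrow> euclidean_diagram
            (vtree_of {..<n} (map_of (line (n - 1) (unvalued(0 := p)) @ [((n - 3, n - 1), (1, 1))])))"
| D_tilde:
    "n \<ge> 4 \<Longrightarrow> euclidean_diagram
       (vtree_of {..n} (map_of (line (n - 1) unvalued @ [((1, n - 1), (1, 1)), ((n - 3, n), (1, 1))])))"
| E6_tilde:
    "euclidean_diagram
       (vtree_of {..<7} (map_of (line 5 unvalued @ [((2, 5), (1, 1)), ((5, 6), (1, 1))])))"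
| E7_tilde: "euclidean_diagram (vtree_of {..<8} (map_of (line 7 unvalued @ [((3, 7), (1, 1))])))"
| E8_tilde: "euclidean_diagram (vtree_of {..<9} (map_of (line 8 unvalued @ [((2, 8), (1, 1))])))"
| F4_tilde: "p \<in> {(1, 2), (2, 1)} \<Longrightarrow> euclidean_diagram (line_tree 5 (unvalued(2 := p)))"
| G2_tilde: "p \<in> {(1, 3), (3, 1)} \<Longrightarrow> euclidean_diagram (line_tree 3 (unvalued(1 := p)))"

definition extended_dynkin :: "'v vtree \<Rightarrow> bool" where
  "extended_dynkin T \<longleftrightarrow> (\<exists>D. euclidean_diagram D \<and> T \<cong>\<^sub>T D)"

definition half_line :: "(nat \<Rightarrow> nat \<times> nat) \<Rightarrow> nat vtree" where
  "half_line l = vtree_of UNIV (\<lambda>(i, j). if j = Suc i then Some (l i) else None)"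

definition A_inf :: "nat vtree" where
  "A_inf = half_line unvalued"

definition B_inf :: "nat vtree" where
  "B_inf = half_line (unvalued(0 := (1, 2)))"

definition C_inf :: "nat vtree" where
  "C_inf = half_line (unvalued(0 := (2, 1)))"

text \<open>Here \<open>0\<close> and \<open>1\<close> are the two leaves, both adjacent to \<open>2\<close>.\<close>

definition D_inf :: "nat vtree" where
  "D_inf = vtree_of UNIV
     (\<lambda>(i, j). if (i, j) = (0, 2) \<or> 1 \<le> i \<and> j = Suc i then Some (1, 1) else None)"

definition A_inf_inf :: "int vtree" where
  "A_inf_inf = vtree_of UNIV (\<lambda>(i, j). if j = i + 1 then Some (1, 1) else None)"

end

theory Submission
  imports Complex_Main "Jordan_Normal_Form.Missing_VectorSpace" Defs
begin

text \<open>
  For an object \<open>X\<close> the function \<open>dim Hom(X, -)\<close> is additive on Auslander-Reiten triangles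
  \<open>U \<rightarrow> V \<rightarrow> W\<close> unless \<open>W\<close> is \<open>X\<close> or \<open>X[1]\<close>, and \<open>dim Hom(\<tau>X, \<tau>Y) = dim Hom(X, Y)\<close> by Serre duality. If
  \<open>\<Gamma>2\<close> is disjoint from \<open>\<Gamma>1\<close> and its shifts, then \<open>dim Hom(X, Y)\<close>, pulled back along the coverings, is
  additive in both variables. On \<open>\<int>T\<close> for a Euclidean tree \<open>T\<close> an additive function with values in \<open>\<nat>\<close> is
  periodic: the quadratic form of \<open>T\<close> is constant along the slices and semidefinite, so modulo the
  null root \<open>\<delta>\<close> only finitely many slices occur, and a nonzero drift along \<open>\<delta>\<close> would produce negative
  values. Averaging over a period in the \<open>\<Gamma>2\<close>-direction gives a positive additive function on \<open>T2\<close>. If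
  \<open>\<Gamma>2\<close> is \<open>\<Gamma>1\<close> up to a shift, then the minimum of \<open>\<delta>\<close> over the fibres of the covering of \<open>\<Gamma>1\<close> is a
  \<open>\<tau>\<close>-invariant additive function, which is transported to \<open>\<Gamma>2\<close>. Finally, a valued tree with a positive
  additive function \<open>F\<close> is Euclidean or one of the infinite trees: the ratios
  \<open>r x y = a\<^sub>x\<^sub>y F y / F x\<close> satisfy \<open>\<Sum>\<^sub>y r x y = 2\<close> and determine the branches of the tree.
\<close>

section \<open>Dimensions of subspaces\<close>

text \<open>Auslander-Reiten triangles are available only on the two components, so there is no
  Serre functor. Duality is extracted from a single triangle ending at \<open>W\<close>, against an
  arbitrary second argument, and additivity of Hom fails only at an object and its shift by one.
  Hence \<open>\<Gamma>2\<close> has to be compared only with the shifts of \<open>\<Gamma>1\<close>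
  by -1, 0 and 1; any other coincidence falls under the disjoint case.

  Periodicity comes from the Euclidean variable. It passes to the other one because Hom dimensions
  do not change when \<tau> acts on both arguments, so moving one argument forwards amounts to
  moving the other backwards. As \<open>T2\<close> may be infinite, the periods at its vertices need
  not have a common multiple; averages are formed vertex by vertex, and a common multiple only over
  a vertex and its neighbours.

  The null root \<delta> is not known to descend to \<open>\<Gamma>1\<close> before the action of
  the covering group is understood. Its minimum over the fibres does descend and is visibly
  subadditive; pairing with a positive null vector then forces equality.\<close>

definition kdim :: "('k, 'r) ring_scheme \<Rightarrow> ('k, 'm, 'z) module_scheme \<Rightarrow> 'm set \<Rightarrow> nat" where
  "kdim K M S = vectorspace.dim K (M\<lparr>carrier := S\<rparr>)"

definition fin_subspace :: "('k, 'r) ring_scheme \<Rightarrow> ('k, 'm, 'z) module_scheme \<Rightarrow> 'm set \<Rightarrow> bool" where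
  "fin_subspace K M S \<longleftrightarrow> subspace K S M \<and> vectorspace.fin_dim K (M\<lparr>carrier := S\<rparr>)"

lemma subspaceI:
  assumes "vectorspace K M" "S \<subseteq> carrier M" "\<zero>\<^bsub>M\<^esub> \<in> S"
    "\<And>x y. x \<in> S \<Longrightarrow> y \<in> S \<Longrightarrow> x \<oplus>\<^bsub>M\<^esub> y \<in> S"
    "\<And>a x. a \<in> carrier K \<Longrightarrow> x \<in> S \<Longrightarrow> a \<odot>\<^bsub>M\<^esub> x \<in> S"
  shows "subspace K S M"
proof -
  interpret vectorspace K M by fact
  show ?thesis unfolding subspace_def submodule_def
    using assms module_axioms by auto
qed

lemma subspaceD:
  assumes "subspace K S M"
  shows "vectorspace K M" "S \<subseteq> carrier M" "\<zero>\<^bsub>M\<^esub> \<in> S"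
    "\<And>x y. x \<in> S \<Longrightarrow> y \<in> S \<Longrightarrow> x \<oplus>\<^bsub>M\<^esub> y \<in> S"
    "\<And>a x. a \<in> carrier K \<Longrightarrow> x \<in> S \<Longrightarrow> a \<odot>\<^bsub>M\<^esub> x \<in> S"
  using assms unfolding subspace_def submodule_def by auto

lemma linear_mapI:
  assumes "subspace K S M" "vectorspace K N"
    "\<And>x. x \<in> S \<Longrightarrow> T x \<in> carrier N"
    "\<And>x y. x \<in> S \<Longrightarrow> y \<in> S \<Longrightarrow> T (x \<oplus>\<^bsub>M\<^esub> y) = T x \<oplus>\<^bsub>N\<^esub> T y"
    "\<And>a x. a \<in> carrier K \<Longrightarrow> x \<in> S \<Longrightarrow> T (a \<odot>\<^bsub>M\<^esub> x) = a \<odot>\<^bsub>N\<^esub> T x"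
  shows "linear_map K (M\<lparr>carrier := S\<rparr>) N T"
proof -
  interpret M: vectorspace K M using assms(1) subspaceD by blast
  interpret S: vectorspace K "M\<lparr>carrier := S\<rparr>" using assms(1) M.subspace_is_vs by blast
  interpret N: vectorspace K N by fact
  show ?thesis
    by unfold_locales (use assms in \<open>auto simp: module_hom_def\<close>)
qed

text \<open>Sets independent in \<open>S\<close> are independent in \<open>V\<close>, so their size
  is bounded by the dimension of \<open>V\<close>; a maximal one exists and is a basis of
  \<open>S\<close>.\<close>

lemma fin_subspace_subspace:
  assumes V: "fin_subspace K M V" and S: "subspace K S M" and SV: "S \<subseteq> V"
  shows "fin_subspace K M S" "kdim K M S \<le> kdim K M V"
proof -
  have subV: "subspace K V M" using V fin_subspace_def by blast
  interpret M: vectorspace K M using subV subspaceD by blast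
  interpret V: vectorspace K "M\<lparr>carrier := V\<rparr>" using subV M.subspace_is_vs by blast
  interpret S: vectorspace K "M\<lparr>carrier := S\<rparr>" using S M.subspace_is_vs by blast
  have fd: "V.fin_dim" using V fin_subspace_def by blast
  have sV: "submodule K V M" and sS: "submodule K S M" using subV S M.is_module by auto
  have li: "finite A \<and> card A \<le> V.dim" if "A \<subseteq> S \<and> S.lin_indpt A" for A
  proof -
    have "V.lin_indpt A"
      using M.span_li_not_depend(2)[OF _ sS, of A] M.span_li_not_depend(2)[OF _ sV, of A] that SV by auto
    then show ?thesis using V.li_le_dim[OF fd, of A] that SV by auto
  qed
  have "\<exists>A. finite A \<and> maximal A (\<lambda>B. B \<subseteq> S \<and> S.lin_indpt B)"
  proof (rule maximal_exists[where N = "V.dim" and B = "{}"])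
    show "{} \<subseteq> S \<and> S.lin_indpt {}" by (simp add: S.lin_dep_def)
  qed (fact li)
  then obtain A where A: "finite A" "maximal A (\<lambda>B. B \<subseteq> S \<and> S.lin_indpt B)" by blast
  then have "S.basis A" using S.max_li_is_basis[of A] by simp
  then have "S.fin_dim" "S.dim = card A" using A(1) S.dim_basis unfolding S.fin_dim_def S.basis_def by blast+
  then show "fin_subspace K M S" "kdim K M S \<le> kdim K M V"
    using S li[of A] A(2) by (auto simp: fin_subspace_def kdim_def maximal_def)
qed

text \<open>Linearity is asked of \<open>T\<close> on \<open>S\<close> only, because the maps to
  which this is applied are compositions, meaningful only on hom sets.\<close>

lemma rank_nullity_on:
  assumes S: "fin_subspace K M S" and N: "vectorspace K N"
    and T: "\<And>x. x \<in> S \<Longrightarrow> T x \<in> carrier N"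
    "\<And>x y. x \<in> S \<Longrightarrow> y \<in> S \<Longrightarrow> T (x \<oplus>\<^bsub>M\<^esub> y) = T x \<oplus>\<^bsub>N\<^esub> T y"
    "\<And>a x. a \<in> carrier K \<Longrightarrow> x \<in> S \<Longrightarrow> T (a \<odot>\<^bsub>M\<^esub> x) = a \<odot>\<^bsub>N\<^esub> T x"
  shows "fin_subspace K M {x \<in> S. T x = \<zero>\<^bsub>N\<^esub>}" "fin_subspace K N (T ` S)"
    "kdim K M S = kdim K M {x \<in> S. T x = \<zero>\<^bsub>N\<^esub>} + kdim K N (T ` S)"
proof -
  have sub: "subspace K S M" using S fin_subspace_def by blast
  interpret L: linear_map K "M\<lparr>carrier := S\<rparr>" N T
    by (rule linear_mapI) (use sub N T in auto)
  have fd: "L.V.fin_dim" using S fin_subspace_def by blast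
  have ker: "L.kerT = {x \<in> S. T x = \<zero>\<^bsub>N\<^esub>}" by (auto simp: L.ker_def)
  have im: "L.imT = T ` S" by (auto simp: L.im_def)
  have imsub: "subspace K (T ` S) N" using L.imT_is_subspace im by simp
  have kersub0: "subspace K {x \<in> S. T x = \<zero>\<^bsub>N\<^esub>} (M\<lparr>carrier := S\<rparr>)" using L.kerT_is_subspace ker by simp
  have kersub: "subspace K {x \<in> S. T x = \<zero>\<^bsub>N\<^esub>} M"
    by (rule subspaceI) (use subspaceD[OF sub] subspaceD[OF kersub0] in auto)
  show "fin_subspace K M {x \<in> S. T x = \<zero>\<^bsub>N\<^esub>}"
    by (rule fin_subspace_subspace(1)[OF S kersub]) auto
  \<comment> \<open>With the codomain cut down to the image the map is onto, which yields finite
    dimension of the image.\<close>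
  interpret L2: linear_map K "M\<lparr>carrier := S\<rparr>" "N\<lparr>carrier := T ` S\<rparr>" T
    apply (rule linear_mapI) using sub N T L.W.subspace_is_vs[OF imsub] by auto
  show "fin_subspace K N (T ` S)"
    using L2.surj_fin_dim[OF fd] imsub by (simp add: fin_subspace_def)
  show "kdim K M S = kdim K M {x \<in> S. T x = \<zero>\<^bsub>N\<^esub>} + kdim K N (T ` S)"
    using L.rank_nullity[OF fd] by (simp add: ker im kdim_def)
qed

lemma kdim_zero_iff:
  assumes "fin_subspace K M S"
  shows "kdim K M S = 0 \<longleftrightarrow> S = {\<zero>\<^bsub>M\<^esub>}"
proof -
  have sub: "subspace K S M" using assms fin_subspace_def by blast
  interpret M: vectorspace K M using sub subspaceD by blast
  interpret S: vectorspace K "M\<lparr>carrier := S\<rparr>" using sub M.subspace_is_vs by blast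
  have "S.fin_dim" using assms fin_subspace_def by blast
  then obtain B where B: "finite B" "S.basis B" using S.finite_basis_exists by blast
  have d: "S.dim = card B" using S.dim_basis B by blast
  have e: "S.span {} = {\<zero>\<^bsub>M\<^esub>}" using S.span_empty by simp
  show ?thesis
  proof
    assume "kdim K M S = 0"
    then have "B = {}" using d B(1) by (simp add: kdim_def)
    then show "S = {\<zero>\<^bsub>M\<^esub>}" using B(2) e by (simp add: S.basis_def)
  next
    assume S0: "S = {\<zero>\<^bsub>M\<^esub>}"
    have "\<zero>\<^bsub>M\<^esub> \<notin> B" using B(2) S.vs_zero_lin_dep[of B] by (auto simp: S.basis_def)
    moreover have "B \<subseteq> S" using B(2) by (simp add: S.basis_def)
    ultimately have "B = {}" using S0 by blast
    then show "kdim K M S = 0" using d by (simp add: kdim_def)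
  qed
qed

lemma kdim_linear_image:
  assumes "fin_subspace K M S" "vectorspace K N"
    and "\<And>x. x \<in> S \<Longrightarrow> T x \<in> carrier N"
    "\<And>x y. x \<in> S \<Longrightarrow> y \<in> S \<Longrightarrow> T (x \<oplus>\<^bsub>M\<^esub> y) = T x \<oplus>\<^bsub>N\<^esub> T y"
    "\<And>a x. a \<in> carrier K \<Longrightarrow> x \<in> S \<Longrightarrow> T (a \<odot>\<^bsub>M\<^esub> x) = a \<odot>\<^bsub>N\<^esub> T x"
    and inj: "\<And>x. x \<in> S \<Longrightarrow> T x = \<zero>\<^bsub>N\<^esub> \<Longrightarrow> x = \<zero>\<^bsub>M\<^esub>"
  shows "kdim K N (T ` S) = kdim K M S"
proof -
  note rn = rank_nullity_on[OF assms(1,2), of T, OF assms(3,4,5)]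
  have sub: "subspace K {x \<in> S. T x = \<zero>\<^bsub>N\<^esub>} M" using rn(1) fin_subspace_def by blast
  have "{x \<in> S. T x = \<zero>\<^bsub>N\<^esub>} = {\<zero>\<^bsub>M\<^esub>}"
    using inj subspaceD(3)[OF sub] by blast
  then have "kdim K M {x \<in> S. T x = \<zero>\<^bsub>N\<^esub>} = 0" using kdim_zero_iff[OF rn(1)] by simp
  then show ?thesis using rn(3) by simp
qed

text \<open>Dimension count for an exact sequence 0 -> \<open>R\<close> -> \<open>S\<close> ->
  \<open>N\<close>. Surjectivity of the last map is left to the caller, since for Hom sequences it
  has a reason of its own.\<close>

lemma kdim_exact:
  assumes "fin_subspace K M S" "fin_subspace K L R" "vectorspace K N"
    and "\<And>x. x \<in> S \<Longrightarrow> T x \<in> carrier N"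
    "\<And>x y. x \<in> S \<Longrightarrow> y \<in> S \<Longrightarrow> T (x \<oplus>\<^bsub>M\<^esub> y) = T x \<oplus>\<^bsub>N\<^esub> T y"
    "\<And>a x. a \<in> carrier K \<Longrightarrow> x \<in> S \<Longrightarrow> T (a \<odot>\<^bsub>M\<^esub> x) = a \<odot>\<^bsub>N\<^esub> T x"
    and "\<And>x. x \<in> R \<Longrightarrow> J x \<in> carrier M"
    "\<And>x y. x \<in> R \<Longrightarrow> y \<in> R \<Longrightarrow> J (x \<oplus>\<^bsub>L\<^esub> y) = J x \<oplus>\<^bsub>M\<^esub> J y"
    "\<And>a x. a \<in> carrier K \<Longrightarrow> x \<in> R \<Longrightarrow> J (a \<odot>\<^bsub>L\<^esub> x) = a \<odot>\<^bsub>M\<^esub> J x"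
    and inj: "\<And>x. x \<in> R \<Longrightarrow> J x = \<zero>\<^bsub>M\<^esub> \<Longrightarrow> x = \<zero>\<^bsub>L\<^esub>"
    and exact: "J ` R = {x \<in> S. T x = \<zero>\<^bsub>N\<^esub>}"
  shows "kdim K M S = kdim K L R + kdim K N (T ` S)"
proof -
  have M: "vectorspace K M" using assms(1) fin_subspace_def subspaceD by blast
  show ?thesis
    using rank_nullity_on(3)[OF assms(1,3), of T, OF assms(4,5,6)]
      kdim_linear_image[OF assms(2) M, of J, OF assms(7-10)] unfolding exact by linarith
qed

text \<open>Cutting down by the functionals \<open>B _ y\<close>, one for each \<open>y\<close> in a finite spanning set, lowers the
  dimension by at most one at each step.\<close>
lemma kdim_cut:
  assumes K: "field K" and S: "fin_subspace K M S" and fin: "finite Y"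
    and B: "\<And>x y. x \<in> S \<Longrightarrow> y \<in> Y \<Longrightarrow> B x y \<in> carrier K"
    "\<And>x x' y. x \<in> S \<Longrightarrow> x' \<in> S \<Longrightarrow> y \<in> Y \<Longrightarrow> B (x \<oplus>\<^bsub>M\<^esub> x') y = B x y \<oplus>\<^bsub>K\<^esub> B x' y"
    "\<And>a x y. a \<in> carrier K \<Longrightarrow> x \<in> S \<Longrightarrow> y \<in> Y \<Longrightarrow> B (a \<odot>\<^bsub>M\<^esub> x) y = a \<otimes>\<^bsub>K\<^esub> B x y"
  shows "fin_subspace K M {x \<in> S. \<forall>y\<in>Y. B x y = \<zero>\<^bsub>K\<^esub>} \<and>
    kdim K M S \<le> card Y + kdim K M {x \<in> S. \<forall>y\<in>Y. B x y = \<zero>\<^bsub>K\<^esub>}"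
  using fin B
proof (induction Y)
  case empty
  then show ?case using S by simp
next
  case (insert y Y)
  let ?S = "{x \<in> S. \<forall>y\<in>Y. B x y = \<zero>\<^bsub>K\<^esub>}"
  interpret field K by fact
  \<comment> \<open>The field as a one-dimensional space over itself, so that a functional becomes a
    linear map into a vector space and rank-nullity applies.\<close>
  define K1 where "K1 = \<lparr>carrier = carrier K, mult = mult K, one = \<one>\<^bsub>K\<^esub>, zero = \<zero>\<^bsub>K\<^esub>, add = add K, smult = mult K\<rparr>"
  have K1[simp]: "carrier K1 = carrier K" "\<zero>\<^bsub>K1\<^esub> = \<zero>\<^bsub>K\<^esub>" "add K1 = add K" "smult K1 = mult K"
    by (simp_all add: K1_def)
  have "abelian_group K1"
  proof (rule abelian_groupI)
    show "\<exists>y\<in>carrier K1. y \<oplus>\<^bsub>K1\<^esub> x = \<zero>\<^bsub>K1\<^esub>" if "x \<in> carrier K1" for x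
      using that l_neg[of x] a_inv_closed[of x] by (auto simp: K1)
  qed (auto simp: K1 a_assoc a_comm a_lcomm)
  then have "module K K1"
    by (intro moduleI is_cring) (auto simp: K1 m_assoc l_distr r_distr)
  then have vs: "vectorspace K K1"
    unfolding vectorspace_def using field_axioms by blast
  interpret V: vectorspace K K1 by fact
  have IH: "fin_subspace K M ?S" "kdim K M S \<le> card Y + kdim K M ?S"
    using insert by auto
  have lin: "\<And>x. x \<in> ?S \<Longrightarrow> B x y \<in> carrier K1"
    "\<And>x x'. x \<in> ?S \<Longrightarrow> x' \<in> ?S \<Longrightarrow> B (x \<oplus>\<^bsub>M\<^esub> x') y = B x y \<oplus>\<^bsub>K1\<^esub> B x' y"
    "\<And>a x. a \<in> carrier K \<Longrightarrow> x \<in> ?S \<Longrightarrow> B (a \<odot>\<^bsub>M\<^esub> x) y = a \<odot>\<^bsub>K1\<^esub> B x y"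
    using insert.prems unfolding K1 by auto
  note rn = rank_nullity_on[OF IH(1) vs, of "\<lambda>x. B x y", OF lin]
  have eq: "{x \<in> ?S. B x y = \<zero>\<^bsub>K1\<^esub>} = {x \<in> S. \<forall>y\<in>insert y Y. B x y = \<zero>\<^bsub>K\<^esub>}"
    by (auto simp: K1)
  have g: "V.gen_set {\<one>\<^bsub>K\<^esub>}"
  proof -
    have one: "{\<one>\<^bsub>K\<^esub>} \<subseteq> carrier K1" by (simp add: K1)
    have "x \<in> V.span {\<one>\<^bsub>K\<^esub>}" if "x \<in> carrier K1" for x
    proof -
      have "V.lincomb (\<lambda>_. x) {\<one>\<^bsub>K\<^esub>} = x"
        using that by (auto simp: V.lincomb_def K1)
      then show ?thesis unfolding V.finite_span[OF finite.insertI[OF finite.emptyI] one]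
        using that by (auto simp: K1 intro!: exI[of _ "\<lambda>_. x"])
    qed
    then show ?thesis using V.span_closed[OF one] by blast
  qed
  have d1: "V.dim \<le> 1" "V.fin_dim"
    using V.dim_le1I[OF g] g unfolding V.fin_dim_def by (simp, intro exI[of _ "{\<one>\<^bsub>K\<^esub>}"], simp)
  have K1r: "K1\<lparr>carrier := carrier K1\<rparr> = K1" by simp
  have top: "fin_subspace K K1 (carrier K1)"
    using d1(2) subspaceI[OF vs, of "carrier K1"] unfolding fin_subspace_def K1r by auto
  have sub: "subspace K ((\<lambda>x. B x y) ` ?S) K1" using rn(2) fin_subspace_def by blast
  have "kdim K K1 ((\<lambda>x. B x y) ` ?S) \<le> 1"
    using fin_subspace_subspace(2)[OF _ sub, of "carrier K1"] top d1(1) subspaceD(2)[OF sub]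
    unfolding kdim_def K1r by linarith
  then show ?case using rn(1,3) IH(2) insert.hyps unfolding eq by simp
qed

lemma kdim_basis:
  assumes "fin_subspace K M S"
  obtains B where "finite B" "card B = kdim K M S" "B \<subseteq> S"
    "\<And>x. x \<in> S \<Longrightarrow> \<exists>a\<in>B \<rightarrow> carrier K. x = (\<Oplus>\<^bsub>M\<^esub>b\<in>B. a b \<odot>\<^bsub>M\<^esub> b)"
proof -
  have sub: "subspace K S M" using assms fin_subspace_def by blast
  interpret M: vectorspace K M using sub subspaceD by blast
  interpret S: vectorspace K "M\<lparr>carrier := S\<rparr>" using sub M.subspace_is_vs by blast
  have "S.fin_dim" using assms fin_subspace_def by blast
  then obtain B where B: "finite B" "S.basis B" using S.finite_basis_exists by blast
  have d: "S.dim = card B" using S.dim_basis B by blast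
  have BS: "B \<subseteq> S" using B(2) by (simp add: S.basis_def)
  have sp: "M.span B = S" using B(2) M.span_li_not_depend(1)[OF BS] sub M.is_module
    by (simp add: S.basis_def)
  show thesis
  proof (rule that[OF B(1) _ BS])
    show "card B = kdim K M S" using d by (simp add: kdim_def)
    show "\<exists>a\<in>B \<rightarrow> carrier K. x = (\<Oplus>\<^bsub>M\<^esub>b\<in>B. a b \<odot>\<^bsub>M\<^esub> b)" if "x \<in> S" for x
      using that sp M.finite_span[OF B(1)] BS subspaceD(2)[OF sub] by (auto simp: M.lincomb_def)
  qed
qed

lemma fin_subspaceI_span:
  assumes S: "subspace K S M" and fin: "finite B" "B \<subseteq> S"
    and sp: "\<And>x. x \<in> S \<Longrightarrow> \<exists>a\<in>B \<rightarrow> carrier K. x = (\<Oplus>\<^bsub>M\<^esub>b\<in>B. a b \<odot>\<^bsub>M\<^esub> b)"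
  shows "fin_subspace K M S"
proof -
  interpret M: vectorspace K M using S subspaceD by blast
  interpret S: vectorspace K "M\<lparr>carrier := S\<rparr>" using S M.subspace_is_vs by blast
  have sub: "submodule K S M" using S M.is_module by blast
  have BM: "B \<subseteq> carrier M" using fin(2) subspaceD(2)[OF S] by blast
  have "S.span B \<subseteq> S" using S.span_closed[of B] fin by auto
  moreover have "S \<subseteq> M.span B"
    using sp unfolding M.finite_span[OF fin(1) BM] M.lincomb_def by blast
  ultimately have "S.span B = S" using M.span_li_not_depend(1)[OF fin(2) sub] by auto
  then have "S.fin_dim" using fin unfolding S.fin_dim_def by auto
  then show ?thesis using S fin_subspace_def by blast
qed

lemma span_in_subspace:
  assumes S: "subspace K S M" and B: "finite B" "B \<subseteq> S" "a \<in> B \<rightarrow> carrier K"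
  shows "(\<Oplus>\<^bsub>M\<^esub>b\<in>B. a b \<odot>\<^bsub>M\<^esub> b) \<in> S"
proof -
  interpret M: vectorspace K M using S subspaceD by blast
  show ?thesis using B
  proof (induction B)
    case empty
    then show ?case using subspaceD[OF S] by simp
  next
    case (insert b B)
    then have "(\<Oplus>\<^bsub>M\<^esub>b\<in>insert b B. a b \<odot>\<^bsub>M\<^esub> b) = a b \<odot>\<^bsub>M\<^esub> b \<oplus>\<^bsub>M\<^esub> (\<Oplus>\<^bsub>M\<^esub>b\<in>B. a b \<odot>\<^bsub>M\<^esub> b)"
      using subspaceD(2)[OF S] by (intro M.M.finsum_insert) (auto simp: Pi_def subset_iff)
    then show ?case using insert subspaceD(4,5)[OF S] by auto
  qed
qed

text \<open>Elements of \<open>S\<close> that pair to zero with a basis of \<open>R\<close> pair to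
  zero with all of \<open>R\<close>, hence vanish, and \<open>kdim_cut\<close> removes at most one
  dimension per basis element. Nondegeneracy is assumed on one side only; two uses with exchanged
  roles give equality of dimensions.\<close>

lemma kdim_pairing_le:
  assumes K: "field K" and S: "fin_subspace K M S" and R: "fin_subspace K L R"
    and B: "\<And>x y. x \<in> S \<Longrightarrow> y \<in> R \<Longrightarrow> B x y \<in> carrier K"
    "\<And>x x' y. x \<in> S \<Longrightarrow> x' \<in> S \<Longrightarrow> y \<in> R \<Longrightarrow> B (x \<oplus>\<^bsub>M\<^esub> x') y = B x y \<oplus>\<^bsub>K\<^esub> B x' y"
    "\<And>a x y. a \<in> carrier K \<Longrightarrow> x \<in> S \<Longrightarrow> y \<in> R \<Longrightarrow> B (a \<odot>\<^bsub>M\<^esub> x) y = a \<otimes>\<^bsub>K\<^esub> B x y"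
    "\<And>x y y'. x \<in> S \<Longrightarrow> y \<in> R \<Longrightarrow> y' \<in> R \<Longrightarrow> B x (y \<oplus>\<^bsub>L\<^esub> y') = B x y \<oplus>\<^bsub>K\<^esub> B x y'"
    "\<And>a x y. a \<in> carrier K \<Longrightarrow> x \<in> S \<Longrightarrow> y \<in> R \<Longrightarrow> B x (a \<odot>\<^bsub>L\<^esub> y) = a \<otimes>\<^bsub>K\<^esub> B x y"
    and nd: "\<And>x. x \<in> S \<Longrightarrow> \<forall>y\<in>R. B x y = \<zero>\<^bsub>K\<^esub> \<Longrightarrow> x = \<zero>\<^bsub>M\<^esub>"
  shows "kdim K M S \<le> kdim K L R"
proof -
  interpret field K by fact
  have subR: "subspace K R L" using R fin_subspace_def by blast
  obtain Y where Y: "finite Y" "card Y = kdim K L R" "Y \<subseteq> R"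
    "\<And>x. x \<in> R \<Longrightarrow> \<exists>a\<in>Y \<rightarrow> carrier K. x = (\<Oplus>\<^bsub>L\<^esub>b\<in>Y. a b \<odot>\<^bsub>L\<^esub> b)"
    by (rule kdim_basis[OF R]) blast
  let ?S = "{x \<in> S. \<forall>y\<in>Y. B x y = \<zero>\<^bsub>K\<^esub>}"
  have cut: "fin_subspace K M ?S" "kdim K M S \<le> card Y + kdim K M ?S"
    using kdim_cut[OF K S Y(1), of B, OF B(1,2,3)] Y(3) by (simp_all add: subset_iff)
  have "x = \<zero>\<^bsub>M\<^esub>" if x: "x \<in> ?S" for x
  proof (rule nd)
    show "x \<in> S" using x by simp
    interpret L: vectorspace K L using subR subspaceD by blast
    have RL: "R \<subseteq> carrier L" using subspaceD[OF subR] by simp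
    have z: "B x \<zero>\<^bsub>L\<^esub> = \<zero>\<^bsub>K\<^esub>"
    proof -
      have "B x (\<zero>\<^bsub>K\<^esub> \<odot>\<^bsub>L\<^esub> \<zero>\<^bsub>L\<^esub>) = \<zero>\<^bsub>K\<^esub> \<otimes>\<^bsub>K\<^esub> B x \<zero>\<^bsub>L\<^esub>"
        using B(5)[of "\<zero>\<^bsub>K\<^esub>" x "\<zero>\<^bsub>L\<^esub>"] x subspaceD(3)[OF subR] by simp
      then show ?thesis using B(1)[of x "\<zero>\<^bsub>L\<^esub>"] x subspaceD(3)[OF subR] by simp
    qed
    have "subspace K {y \<in> R. B x y = \<zero>\<^bsub>K\<^esub>} L"
      by (rule subspaceI) (use x z B(4,5) subspaceD[OF subR] L.vectorspace_axioms in auto)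
    then show "\<forall>y\<in>R. B x y = \<zero>\<^bsub>K\<^esub>"
      using span_in_subspace[of K "{y \<in> R. B x y = \<zero>\<^bsub>K\<^esub>}" L Y] Y x by fastforce
  qed
  moreover have "\<zero>\<^bsub>M\<^esub> \<in> ?S" using cut(1) subspaceD(3) fin_subspace_def by blast
  ultimately have "?S = {\<zero>\<^bsub>M\<^esub>}" by blast
  then show ?thesis using cut kdim_zero_iff[OF cut(1)] Y(2) by simp
qed

text \<open>\<open>l\<close> is a coordinate, in some basis of \<open>S\<close>, at which
  \<open>w\<close> has a nonzero entry.\<close>

lemma ex_functional:
  assumes S: "fin_subspace K M S" and w: "w \<in> S" "w \<noteq> \<zero>\<^bsub>M\<^esub>"
  obtains l where "\<And>x. x \<in> S \<Longrightarrow> l x \<in> carrier K"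
    "\<And>x y. x \<in> S \<Longrightarrow> y \<in> S \<Longrightarrow> l (x \<oplus>\<^bsub>M\<^esub> y) = l x \<oplus>\<^bsub>K\<^esub> l y"
    "\<And>a x. a \<in> carrier K \<Longrightarrow> x \<in> S \<Longrightarrow> l (a \<odot>\<^bsub>M\<^esub> x) = a \<otimes>\<^bsub>K\<^esub> l x" "l w \<noteq> \<zero>\<^bsub>K\<^esub>"
proof -
  have sub: "subspace K S M" using assms fin_subspace_def by blast
  interpret M: vectorspace K M using sub subspaceD by blast
  interpret S: vectorspace K "M\<lparr>carrier := S\<rparr>" using sub M.subspace_is_vs by blast
  have "S.fin_dim" using S fin_subspace_def by blast
  then obtain B where B: "finite B" "S.basis B" using S.finite_basis_exists by blast
  have BS: "B \<subseteq> S" using B by (simp add: S.basis_def)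
  have ex: "\<exists>!a. a \<in> B \<rightarrow>\<^sub>E carrier K \<and> S.lincomb a B = v" if "v \<in> S" for v
    using S.basis_criterion[OF B(1)] BS B(2) that by simp
  define c where "c v = (THE a. a \<in> B \<rightarrow>\<^sub>E carrier K \<and> S.lincomb a B = v)" for v
  have c: "c v \<in> B \<rightarrow>\<^sub>E carrier K" "S.lincomb (c v) B = v" if "v \<in> S" for v
    using theI'[OF ex[OF that]] unfolding c_def by auto
  have cu: "c v = a" if "a \<in> B \<rightarrow>\<^sub>E carrier K" "S.lincomb a B = v" "v \<in> S" for a v
    using ex[OF that(3)] c[OF that(3)] that by blast
  have ck: "c v b \<in> carrier K" if "v \<in> S" "b \<in> B" for v b using c(1)[OF that(1)] that(2) by auto
  have BS': "B \<subseteq> carrier (M\<lparr>carrier := S\<rparr>)" using BS by simp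
  have "\<exists>b\<in>B. c w b \<noteq> \<zero>\<^bsub>K\<^esub>"
  proof (rule ccontr)
    assume "\<not> (\<exists>b\<in>B. c w b \<noteq> \<zero>\<^bsub>K\<^esub>)"
    then have "S.lincomb (c w) B = \<zero>\<^bsub>M\<lparr>carrier := S\<rparr>\<^esub>" using S.lincomb_zero[OF BS', of "c w"] by blast
    then show False using c(2)[OF w(1)] w(2) by simp
  qed
  then obtain b where b: "b \<in> B" "c w b \<noteq> \<zero>\<^bsub>K\<^esub>" by blast
  show thesis
  proof (rule that[of "\<lambda>v. c v b"])
    show "c x b \<in> carrier K" if "x \<in> S" for x using ck that b by blast
    show "c w b \<noteq> \<zero>\<^bsub>K\<^esub>" by fact
    fix x y assume xy: "x \<in> S" "y \<in> S"
    have "c (x \<oplus>\<^bsub>M\<^esub> y) = restrict (\<lambda>b. c x b \<oplus>\<^bsub>K\<^esub> c y b) B"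
    proof (rule cu)
      show "x \<oplus>\<^bsub>M\<^esub> y \<in> S" using xy subspaceD(4)[OF sub] by simp
      have "S.lincomb (restrict (\<lambda>b. c x b \<oplus>\<^bsub>K\<^esub> c y b) B) B = S.lincomb (\<lambda>b. c x b \<oplus>\<^bsub>K\<^esub> c y b) B"
        by (rule S.lincomb_restrict[OF BS']) (use ck xy in auto)
      also have "\<dots> = S.lincomb (c x) B \<oplus>\<^bsub>M\<^esub> S.lincomb (c y) B"
        using S.lincomb_sum[OF B(1) BS', of "c x" "c y"] ck xy by simp
      finally show "S.lincomb (restrict (\<lambda>b. c x b \<oplus>\<^bsub>K\<^esub> c y b) B) B = x \<oplus>\<^bsub>M\<^esub> y" using c(2) xy by simp
    qed (use ck xy in auto)
    then show "c (x \<oplus>\<^bsub>M\<^esub> y) b = c x b \<oplus>\<^bsub>K\<^esub> c y b" using b by simp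
  next
    fix a x assume xy: "a \<in> carrier K" "x \<in> S"
    have "c (a \<odot>\<^bsub>M\<^esub> x) = restrict (\<lambda>b. a \<otimes>\<^bsub>K\<^esub> c x b) B"
    proof (rule cu)
      show "a \<odot>\<^bsub>M\<^esub> x \<in> S" using xy subspaceD(5)[OF sub] by simp
      have "S.lincomb (restrict (\<lambda>b. a \<otimes>\<^bsub>K\<^esub> c x b) B) B = S.lincomb (\<lambda>b. a \<otimes>\<^bsub>K\<^esub> c x b) B"
        by (rule S.lincomb_restrict[OF BS']) (use ck xy in auto)
      also have "\<dots> = a \<odot>\<^bsub>M\<^esub> S.lincomb (c x) B"
        using S.lincomb_distrib[OF BS', of "c x" a] ck xy by simp
      finally show "S.lincomb (restrict (\<lambda>b. a \<otimes>\<^bsub>K\<^esub> c x b) B) B = a \<odot>\<^bsub>M\<^esub> x" using c(2) xy by simp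
    qed (use ck xy in auto)
    then show "c (a \<odot>\<^bsub>M\<^esub> x) b = a \<otimes>\<^bsub>K\<^esub> c x b" using b by simp
  qed
qed

section \<open>Linear categories\<close>

text \<open>Generation is expressed by subspaces containing \<open>B\<close> instead of linear
  combinations, so that generators of a kernel and of an image can be combined in
  \<open>fin_subspace_extension\<close> without handling coefficients.\<close>

lemma fin_subspace_generated:
  assumes S: "subspace K S M"
  shows "fin_subspace K M S \<longleftrightarrow> (\<exists>B. finite B \<and> B \<subseteq> S \<and> (\<forall>W. subspace K W M \<longrightarrow> B \<subseteq> W \<longrightarrow> S \<subseteq> W))"
proof
  assume "fin_subspace K M S"
  then obtain B where B: "finite B" "B \<subseteq> S"
    "\<And>x. x \<in> S \<Longrightarrow> \<exists>a\<in>B \<rightarrow> carrier K. x = (\<Oplus>\<^bsub>M\<^esub>b\<in>B. a b \<odot>\<^bsub>M\<^esub> b)"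
    by (rule kdim_basis) blast
  have "S \<subseteq> W" if "subspace K W M" "B \<subseteq> W" for W
    using span_in_subspace[OF that(1) B(1) that(2)] B(3) by blast
  then show "\<exists>B. finite B \<and> B \<subseteq> S \<and> (\<forall>W. subspace K W M \<longrightarrow> B \<subseteq> W \<longrightarrow> S \<subseteq> W)" using B by blast
next
  assume "\<exists>B. finite B \<and> B \<subseteq> S \<and> (\<forall>W. subspace K W M \<longrightarrow> B \<subseteq> W \<longrightarrow> S \<subseteq> W)"
  then obtain B where B: "finite B" "B \<subseteq> S" "\<forall>W. subspace K W M \<longrightarrow> B \<subseteq> W \<longrightarrow> S \<subseteq> W" by blast
  interpret M: vectorspace K M using S subspaceD by blast
  have BM: "B \<subseteq> carrier M" using B(2) subspaceD(2)[OF S] by blast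
  have "S \<subseteq> M.span B" using B(3) M.span_is_subspace[OF BM] M.in_own_span[OF BM] by blast
  then have "\<exists>a\<in>B \<rightarrow> carrier K. x = (\<Oplus>\<^bsub>M\<^esub>b\<in>B. a b \<odot>\<^bsub>M\<^esub> b)" if "x \<in> S" for x
    using that unfolding M.finite_span[OF B(1) BM] M.lincomb_def by blast
  then show "fin_subspace K M S" by (rule fin_subspaceI_span[OF S B(1,2)])
qed

text \<open>The converse of \<open>rank_nullity_on\<close>: generators of the kernel together with
  preimages of generators of the image generate \<open>S\<close>.\<close>

lemma fin_subspace_extension:
  assumes S: "subspace K S M" and N: "vectorspace K N"
    and T: "\<And>x. x \<in> S \<Longrightarrow> T x \<in> carrier N"
    "\<And>x y. x \<in> S \<Longrightarrow> y \<in> S \<Longrightarrow> T (x \<oplus>\<^bsub>M\<^esub> y) = T x \<oplus>\<^bsub>N\<^esub> T y"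
    "\<And>a x. a \<in> carrier K \<Longrightarrow> x \<in> S \<Longrightarrow> T (a \<odot>\<^bsub>M\<^esub> x) = a \<odot>\<^bsub>N\<^esub> T x"
    and ker: "fin_subspace K M {x \<in> S. T x = \<zero>\<^bsub>N\<^esub>}" and im: "fin_subspace K N (T ` S)"
  shows "fin_subspace K M S"
proof -
  interpret M: vectorspace K M using S subspaceD by blast
  interpret N: vectorspace K N by fact
  let ?k = "{x \<in> S. T x = \<zero>\<^bsub>N\<^esub>}"
  have sk: "subspace K ?k M" and si: "subspace K (T ` S) N" using ker im fin_subspace_def by blast+
  obtain B1 where B1: "finite B1" "B1 \<subseteq> ?k" "\<forall>W. subspace K W M \<longrightarrow> B1 \<subseteq> W \<longrightarrow> ?k \<subseteq> W"
    using ker fin_subspace_generated[OF sk] by blast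
  obtain B2 where B2: "finite B2" "B2 \<subseteq> T ` S" "\<forall>W. subspace K W N \<longrightarrow> B2 \<subseteq> W \<longrightarrow> T ` S \<subseteq> W"
    using im fin_subspace_generated[OF si] by blast
  obtain B3 where B3: "finite B3" "B3 \<subseteq> S" "B2 = T ` B3" using finite_subset_image[OF B2(1,2)] by blast
  have "S \<subseteq> W" if W: "subspace K W M" "B1 \<union> B3 \<subseteq> W" for W
  proof
    fix x assume x: "x \<in> S"
    note sS = subspaceD[OF S] and sW = subspaceD[OF W(1)]
    have "subspace K (T ` (W \<inter> S)) N"
    proof (rule subspaceI[OF N])
      show "\<zero>\<^bsub>N\<^esub> \<in> T ` (W \<inter> S)"
      proof -
        have "T (\<zero>\<^bsub>K\<^esub> \<odot>\<^bsub>M\<^esub> \<zero>\<^bsub>M\<^esub>) = \<zero>\<^bsub>K\<^esub> \<odot>\<^bsub>N\<^esub> T \<zero>\<^bsub>M\<^esub>" by (rule T(3)[OF _ sS(3)]) simp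
        then have "T \<zero>\<^bsub>M\<^esub> = \<zero>\<^bsub>N\<^esub>" using T(1)[OF sS(3)] by simp
        then show ?thesis using sS(3) sW(3) by (metis IntI image_eqI)
      qed
      show "u \<oplus>\<^bsub>N\<^esub> v \<in> T ` (W \<inter> S)" if uv: "u \<in> T ` (W \<inter> S)" "v \<in> T ` (W \<inter> S)" for u v
      proof -
        obtain a b where "a \<in> W \<inter> S" "b \<in> W \<inter> S" "u = T a" "v = T b" using uv by blast
        then show ?thesis using T(2)[of a b] sS(4)[of a b] sW(4)[of a b] by (metis IntE IntI image_eqI)
      qed
      show "c \<odot>\<^bsub>N\<^esub> u \<in> T ` (W \<inter> S)" if uv: "c \<in> carrier K" "u \<in> T ` (W \<inter> S)" for c u
      proof -
        obtain a where "a \<in> W \<inter> S" "u = T a" using uv by blast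
        then show ?thesis using T(3)[OF uv(1), of a] sS(5)[OF uv(1), of a] sW(5)[OF uv(1), of a] by (metis IntE IntI image_eqI)
      qed
    qed (use T(1) in blast)
    moreover have "B2 \<subseteq> T ` (W \<inter> S)" using B3 W(2) by blast
    ultimately have "T x \<in> T ` (W \<inter> S)" using B2(3) x by blast
    then obtain w where w: "w \<in> W" "w \<in> S" "T x = T w" by blast
    \<comment> \<open>\<open>?m\<close> is the negative of \<open>w\<close>: since \<open>x\<close>
      and \<open>w\<close> have the same image, their difference lies in the kernel and hence in
      \<open>W\<close>.\<close>
    let ?m = "(\<ominus>\<^bsub>K\<^esub> \<one>\<^bsub>K\<^esub>) \<odot>\<^bsub>M\<^esub> w"
    have mS: "?m \<in> S" "?m \<in> W" using sS(5) sW(5) w by simp_all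
    have "T (x \<oplus>\<^bsub>M\<^esub> ?m) = T x \<oplus>\<^bsub>N\<^esub> (\<ominus>\<^bsub>K\<^esub> \<one>\<^bsub>K\<^esub>) \<odot>\<^bsub>N\<^esub> T x"
      using T(2)[OF x mS(1)] T(3)[of "\<ominus>\<^bsub>K\<^esub> \<one>\<^bsub>K\<^esub>" w] w by simp
    also have "\<dots> = \<zero>\<^bsub>N\<^esub>" using N.smult_l_minus[of "\<one>\<^bsub>K\<^esub>" "T x"] T(1)[OF x] by (simp add: N.M.r_neg)
    finally have "x \<oplus>\<^bsub>M\<^esub> ?m \<in> ?k" using sS(4)[OF x mS(1)] by simp
    then have "x \<oplus>\<^bsub>M\<^esub> ?m \<in> W" using B1(3) W by blast
    then have "(x \<oplus>\<^bsub>M\<^esub> ?m) \<oplus>\<^bsub>M\<^esub> w \<in> W" using sW(4) w by blast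
    moreover have "(x \<oplus>\<^bsub>M\<^esub> ?m) \<oplus>\<^bsub>M\<^esub> w = x"
    proof -
      have c: "x \<in> carrier M" "w \<in> carrier M" using sS(2) x w by auto
      show ?thesis using M.smult_l_minus[of "\<one>\<^bsub>K\<^esub>" w] c by (simp add: M.M.a_assoc M.M.l_neg)
    qed
    ultimately show "x \<in> W" by simp
  qed
  moreover have "finite (B1 \<union> B3)" "B1 \<union> B3 \<subseteq> S" using B1 B3 by auto
  ultimately show ?thesis unfolding fin_subspace_generated[OF S] by blast
qed

text \<open>A basis of \<open>S\<close> is independent in \<open>V\<close> and already has the size
  of a basis of \<open>V\<close>.\<close>

lemma kdim_eq_subspace:
  assumes V: "fin_subspace K M V" and S: "subspace K S M" and SV: "S \<subseteq> V" and d: "kdim K M S = kdim K M V"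
  shows "S = V"
proof -
  have fS: "fin_subspace K M S" by (rule fin_subspace_subspace(1)[OF V S SV])
  have subV: "subspace K V M" using V fin_subspace_def by blast
  interpret M: vectorspace K M using subV subspaceD by blast
  interpret V: vectorspace K "M\<lparr>carrier := V\<rparr>" using subV M.subspace_is_vs by blast
  interpret S: vectorspace K "M\<lparr>carrier := S\<rparr>" using S M.subspace_is_vs by blast
  have fd: "V.fin_dim" "S.fin_dim" using V fS fin_subspace_def by blast+
  have sV: "submodule K V M" and sS: "submodule K S M" using subV S M.is_module by auto
  obtain B where B: "finite B" "S.basis B" using S.finite_basis_exists[OF fd(2)] by blast
  have BS: "B \<subseteq> S" and li: "S.lin_indpt B" and sp: "S.span B = S" using B by (auto simp: S.basis_def)
  have cB: "card B = V.dim" using S.dim_basis[OF B] d by (simp add: kdim_def)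
  have BV: "B \<subseteq> V" using BS SV by blast
  have "V.lin_indpt B"
    using M.span_li_not_depend(2)[OF BS sS] M.span_li_not_depend(2)[OF BV sV] li by simp
  then have "V.basis B" using V.dim_li_is_basis[OF fd(1) B(1)] BV cB by simp
  then have "V.span B = V" by (simp add: V.basis_def)
  then show ?thesis using sp M.span_li_not_depend(1)[OF BS sS] M.span_li_not_depend(1)[OF BV sV] by simp
qed

section \<open>Calculus of morphisms with explicit source and target\<close>

context linear_category
begin

abbreviation cmp (infixl \<open>\<cdot>\<close> 70) where "g \<cdot> f \<equiv> g \<bullet>\<^bsub>C\<^esub> f"
abbreviation H where "H X Y \<equiv> hom_set C X Y"
abbreviation zr where "zr X Y \<equiv> null C X Y"
abbreviation pls where "pls X Y f g \<equiv> f \<oplus>\<^bsub>Mor C X Y\<^esub> g"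
abbreviation dif where "dif X Y f g \<equiv> f \<ominus>\<^bsub>Mor C X Y\<^esub> g"
abbreviation idm where "idm X \<equiv> ident C X"

text \<open>Hom sets may overlap, so a morphism does not determine its source and target; bundling
  both with membership in \<open>Obj C\<close> leaves one premise per morphism.\<close>

definition arr :: "'o \<Rightarrow> 'o \<Rightarrow> 'm \<Rightarrow> bool" where
  "arr X Y f \<longleftrightarrow> X \<in> Obj C \<and> Y \<in> Obj C \<and> f \<in> H X Y"

lemma arrD: "arr X Y f \<Longrightarrow> X \<in> Obj C" "arr X Y f \<Longrightarrow> Y \<in> Obj C" "arr X Y f \<Longrightarrow> f \<in> H X Y"
  by (simp_all add: arr_def)

lemma arrI: "X \<in> Obj C \<Longrightarrow> Y \<in> Obj C \<Longrightarrow> f \<in> H X Y \<Longrightarrow> arr X Y f"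
  by (simp add: arr_def)

lemma hom_vs: "X \<in> Obj C \<Longrightarrow> Y \<in> Obj C \<Longrightarrow> vectorspace K (Mor C X Y)"
  using hom_module field_axioms by (simp add: vectorspace_def)

lemma hom_ab: "X \<in> Obj C \<Longrightarrow> Y \<in> Obj C \<Longrightarrow> abelian_group (Mor C X Y)"
  using hom_module module.axioms(2) by blast

lemma arr_comp: "arr X Y f \<Longrightarrow> arr Y Z g \<Longrightarrow> arr X Z (g \<cdot> f)"
  unfolding arr_def using comp_closed by blast

lemma arr_id: "X \<in> Obj C \<Longrightarrow> arr X X (idm X)"
  by (simp add: arr_def ident_closed)

lemma arr_zero: "X \<in> Obj C \<Longrightarrow> Y \<in> Obj C \<Longrightarrow> arr X Y (zr X Y)"
  using abelian_group.a_group[OF hom_ab] group.is_monoid monoid.one_closed by (fastforce simp: arr_def)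

lemma arr_pls: "arr X Y f \<Longrightarrow> arr X Y g \<Longrightarrow> arr X Y (pls X Y f g)"
  using abelian_monoid.a_closed[OF abelian_group.axioms(1)[OF hom_ab]] by (simp add: arr_def)

lemma arr_neg: "arr X Y f \<Longrightarrow> arr X Y (\<ominus>\<^bsub>Mor C X Y\<^esub> f)"
  using abelian_group.a_inv_closed[OF hom_ab] by (simp add: arr_def)

lemma arr_dif: "arr X Y f \<Longrightarrow> arr X Y g \<Longrightarrow> arr X Y (dif X Y f g)"
  using abelian_group.minus_closed[OF hom_ab] by (simp add: arr_def)

lemma assoc: "arr W X f \<Longrightarrow> arr X Y g \<Longrightarrow> arr Y Z h \<Longrightarrow> h \<cdot> g \<cdot> f = h \<cdot> (g \<cdot> f)"
  unfolding arr_def using comp_assoc by blast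

lemma id_right: "arr X Y f \<Longrightarrow> f \<cdot> idm X = f"
  unfolding arr_def using comp_ident_right by blast

lemma id_left: "arr X Y f \<Longrightarrow> idm Y \<cdot> f = f"
  unfolding arr_def using comp_ident_left by blast

lemma pls_right: "arr X Y f \<Longrightarrow> arr X Y f' \<Longrightarrow> arr Y Z g \<Longrightarrow> g \<cdot> pls X Y f f' = pls X Z (g \<cdot> f) (g \<cdot> f')"
  unfolding arr_def using comp_add_right by blast

lemma pls_left: "arr X Y f \<Longrightarrow> arr Y Z g \<Longrightarrow> arr Y Z g' \<Longrightarrow> pls Y Z g g' \<cdot> f = pls X Z (g \<cdot> f) (g' \<cdot> f)"
  unfolding arr_def using comp_add_left by blast

lemma zero_right: assumes "X \<in> Obj C" "arr Y Z g" shows "g \<cdot> zr X Y = zr X Z"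
proof -
  interpret A: abelian_group "Mor C X Y" using hom_ab assms arrD by blast
  interpret B: abelian_group "Mor C X Z" using hom_ab assms arrD by blast
  have z: "arr X Y (zr X Y)" using arr_zero assms arrD by blast
  have c: "g \<cdot> zr X Y \<in> H X Z" using arr_comp[OF z assms(2)] arrD by blast
  have "g \<cdot> pls X Y (zr X Y) (zr X Y) = pls X Z (g \<cdot> zr X Y) (g \<cdot> zr X Y)" by (rule pls_right[OF z z assms(2)])
  then show ?thesis using c by simp
qed

lemma zero_left: assumes "Z \<in> Obj C" "arr X Y f" shows "zr Y Z \<cdot> f = zr X Z"
proof -
  interpret A: abelian_group "Mor C Y Z" using hom_ab assms arrD by blast
  interpret B: abelian_group "Mor C X Z" using hom_ab assms arrD by blast
  have z: "arr Y Z (zr Y Z)" using arr_zero assms arrD by blast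
  have c: "zr Y Z \<cdot> f \<in> H X Z" using arr_comp[OF assms(2) z] arrD by blast
  have "pls Y Z (zr Y Z) (zr Y Z) \<cdot> f = pls X Z (zr Y Z \<cdot> f) (zr Y Z \<cdot> f)" by (rule pls_left[OF assms(2) z z])
  then show ?thesis using c by simp
qed

lemma neg_right: assumes "arr X Y f" "arr Y Z g" shows "g \<cdot> (\<ominus>\<^bsub>Mor C X Y\<^esub> f) = \<ominus>\<^bsub>Mor C X Z\<^esub> (g \<cdot> f)"
proof -
  interpret A: abelian_group "Mor C X Y" using hom_ab assms arrD by blast
  interpret B: abelian_group "Mor C X Z" using hom_ab assms arrD by blast
  have "g \<cdot> pls X Y (\<ominus>\<^bsub>Mor C X Y\<^esub> f) f = pls X Z (g \<cdot> (\<ominus>\<^bsub>Mor C X Y\<^esub> f)) (g \<cdot> f)"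
    by (rule pls_right[OF arr_neg[OF assms(1)] assms])
  then have "pls X Z (g \<cdot> (\<ominus>\<^bsub>Mor C X Y\<^esub> f)) (g \<cdot> f) = zr X Z"
    using zero_right[OF _ assms(2), of X] arrD[OF assms(1)] by (simp add: A.l_neg)
  then show ?thesis
    using B.minus_equality[of "g \<cdot> (\<ominus>\<^bsub>Mor C X Y\<^esub> f)" "g \<cdot> f"] arrD(3)[OF arr_comp[OF assms]] arrD(3)[OF arr_comp[OF arr_neg[OF assms(1)] assms(2)]]
    by simp
qed

lemma neg_left: assumes "arr X Y f" "arr Y Z g" shows "(\<ominus>\<^bsub>Mor C Y Z\<^esub> g) \<cdot> f = \<ominus>\<^bsub>Mor C X Z\<^esub> (g \<cdot> f)"
proof -
  interpret A: abelian_group "Mor C Y Z" using hom_ab assms arrD by blast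
  interpret B: abelian_group "Mor C X Z" using hom_ab assms arrD by blast
  have "pls Y Z (\<ominus>\<^bsub>Mor C Y Z\<^esub> g) g \<cdot> f = pls X Z ((\<ominus>\<^bsub>Mor C Y Z\<^esub> g) \<cdot> f) (g \<cdot> f)"
    by (rule pls_left[OF assms(1) arr_neg[OF assms(2)] assms(2)])
  then have "pls X Z ((\<ominus>\<^bsub>Mor C Y Z\<^esub> g) \<cdot> f) (g \<cdot> f) = zr X Z"
    using zero_left[OF _ assms(1), of Z] arrD[OF assms(2)] by (simp add: A.l_neg)
  then show ?thesis
    using B.minus_equality[of "(\<ominus>\<^bsub>Mor C Y Z\<^esub> g) \<cdot> f" "g \<cdot> f"] arrD(3)[OF arr_comp[OF assms]] arrD(3)[OF arr_comp[OF assms(1) arr_neg[OF assms(2)]]]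
    by simp
qed

lemma dif_right: assumes "arr X Y f" "arr X Y f'" "arr Y Z g" shows "g \<cdot> dif X Y f f' = dif X Z (g \<cdot> f) (g \<cdot> f')"
  unfolding a_minus_def using pls_right[OF assms(1) arr_neg[OF assms(2)] assms(3)] neg_right[OF assms(2,3)] by simp

lemma dif_left: assumes "arr X Y f" "arr Y Z g" "arr Y Z g'" shows "dif Y Z g g' \<cdot> f = dif X Z (g \<cdot> f) (g' \<cdot> f)"
  unfolding a_minus_def using pls_left[OF assms(1,2) arr_neg[OF assms(3)]] neg_left[OF assms(1,3)] by simp

lemma dif_eq_zero_iff: assumes "arr X Y f" "arr X Y g" shows "dif X Y f g = zr X Y \<longleftrightarrow> f = g"
proof -
  interpret A: abelian_group "Mor C X Y" using hom_ab assms arrD by blast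
  show ?thesis using arrD[OF assms(1)] arrD[OF assms(2)] A.minus_equality[of f "\<ominus>\<^bsub>Mor C X Y\<^esub> g"]
    by (auto simp: A.minus_eq A.r_neg)
qed

lemma neg_eq_zero_iff: assumes "arr X Y f" shows "\<ominus>\<^bsub>Mor C X Y\<^esub> f = zr X Y \<longleftrightarrow> f = zr X Y"
proof -
  interpret A: abelian_group "Mor C X Y" using hom_ab assms arrD by blast
  have "\<ominus>\<^bsub>Mor C X Y\<^esub> zr X Y = zr X Y" using A.minus_equality[of "zr X Y" "zr X Y"] by simp
  then show ?thesis using arrD[OF assms] by (metis A.minus_minus)
qed

lemma neg_neg: assumes "arr X Y f" shows "\<ominus>\<^bsub>Mor C X Y\<^esub> (\<ominus>\<^bsub>Mor C X Y\<^esub> f) = f"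
proof -
  interpret A: abelian_group "Mor C X Y" using hom_ab assms arrD by blast
  show ?thesis using arrD[OF assms] by simp
qed

lemma pls_dif_cancel: assumes "arr X Y f" "arr X Y g" shows "pls X Y g (dif X Y f g) = f"
proof -
  interpret A: abelian_group "Mor C X Y" using hom_ab assms arrD by blast
  show ?thesis using arrD[OF assms(1)] arrD[OF assms(2)]
    by (metis A.a_comm A.a_inv_closed A.minus_eq A.r_neg2 A.a_lcomm A.r_neg A.r_zero)
qed

definition inverse_of :: "'o \<Rightarrow> 'o \<Rightarrow> 'm \<Rightarrow> 'm \<Rightarrow> bool" where
  "inverse_of X Y f g \<longleftrightarrow> arr X Y f \<and> arr Y X g \<and> g \<cdot> f = idm X \<and> f \<cdot> g = idm Y"

definition isom :: "'o \<Rightarrow> 'o \<Rightarrow> 'm \<Rightarrow> bool" where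
  "isom X Y f \<longleftrightarrow> (\<exists>g. inverse_of X Y f g)"

lemma isom_iff: "isom X Y f \<longleftrightarrow> X \<in> Obj C \<and> Y \<in> Obj C \<and> iso_mor C X Y f"
  by (auto simp: isom_def iso_mor_def inverse_of_def arr_def)

lemma isomorphic_iff: "isomorphic C X Y \<longleftrightarrow> (\<exists>f. isom X Y f)"
  by (auto simp: isomorphic_def isom_iff)

lemma isom_arr: "isom X Y f \<Longrightarrow> arr X Y f"
  by (auto simp: isom_def inverse_of_def)

lemma isom_id: "X \<in> Obj C \<Longrightarrow> isom X X (idm X)"
  unfolding isom_def inverse_of_def using arr_id id_left by blast

lemma isom_comp: assumes "isom X Y f" "isom Y Z g" shows "isom X Z (g \<cdot> f)"
proof -
  obtain f' where f: "arr X Y f" "arr Y X f'" "f' \<cdot> f = idm X" "f \<cdot> f' = idm Y" using assms(1) by (auto simp: isom_def inverse_of_def)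
  obtain g' where g: "arr Y Z g" "arr Z Y g'" "g' \<cdot> g = idm Y" "g \<cdot> g' = idm Z" using assms(2) by (auto simp: isom_def inverse_of_def)
  have "f' \<cdot> g' \<cdot> (g \<cdot> f) = f' \<cdot> (g' \<cdot> (g \<cdot> f))" using assoc[OF arr_comp[OF f(1) g(1)] g(2) f(2)] .
  also have "g' \<cdot> (g \<cdot> f) = f" using assoc[OF f(1) g(1) g(2)] g(3) id_left[OF f(1)] by simp
  finally have 1: "f' \<cdot> g' \<cdot> (g \<cdot> f) = idm X" using f by simp
  have "g \<cdot> f \<cdot> (f' \<cdot> g') = g \<cdot> (f \<cdot> (f' \<cdot> g'))" using assoc[OF arr_comp[OF g(2) f(2)] f(1) g(1)] .
  also have "f \<cdot> (f' \<cdot> g') = g'" using assoc[OF g(2) f(2) f(1)] f(4) id_left[OF g(2)] by simp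
  finally have 2: "g \<cdot> f \<cdot> (f' \<cdot> g') = idm Z" using g by simp
  show ?thesis unfolding isom_def inverse_of_def using 1 2 arr_comp f g by blast
qed

lemma isomorphic_refl: "X \<in> Obj C \<Longrightarrow> isomorphic C X X"
  unfolding isomorphic_iff using isom_id by blast

lemma isomorphic_sym: "isomorphic C X Y \<Longrightarrow> isomorphic C Y X"
  unfolding isomorphic_iff isom_def inverse_of_def by blast

lemma isomorphic_trans: "isomorphic C X Y \<Longrightarrow> isomorphic C Y Z \<Longrightarrow> isomorphic C X Z"
  unfolding isomorphic_iff using isom_comp by blast

lemma iso_class_eq_iff: "X \<in> Obj C \<Longrightarrow> Y \<in> Obj C \<Longrightarrow> iso_class C X = iso_class C Y \<longleftrightarrow> isomorphic C X Y"
  unfolding iso_class_def using isomorphic_refl isomorphic_sym isomorphic_trans by blast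

lemma isom_of_split:
  assumes f: "arr X Y f" and l: "arr Y X l" "l \<cdot> f = idm X" and r: "arr Y X r" "f \<cdot> r = idm Y"
  shows "isom X Y f"
proof -
  have "l = l \<cdot> (f \<cdot> r)" using r id_right[OF l(1)] by simp
  also have "\<dots> = r" using assoc[OF r(1) f l(1)] l id_left[OF r(1)] by simp
  finally show ?thesis unfolding isom_def inverse_of_def using assms by blast
qed

lemma split_mono_iff: "arr X Y f \<Longrightarrow> split_mono C X Y f \<longleftrightarrow> (\<exists>l. arr Y X l \<and> l \<cdot> f = idm X)"
  by (auto simp: split_mono_def arr_def)

lemma split_epi_iff: "arr X Y f \<Longrightarrow> split_epi C X Y f \<longleftrightarrow> (\<exists>s. arr Y X s \<and> f \<cdot> s = idm Y)"
  by (auto simp: split_epi_def arr_def)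

end

lemma fin_subspace_zero:
  assumes "vectorspace K M"
  shows "fin_subspace K M {\<zero>\<^bsub>M\<^esub>}" "kdim K M {\<zero>\<^bsub>M\<^esub>} = 0"
proof -
  interpret M: vectorspace K M by fact
  have sub: "subspace K {\<zero>\<^bsub>M\<^esub>} M" by (rule subspaceI[OF assms]) auto
  show f: "fin_subspace K M {\<zero>\<^bsub>M\<^esub>}"
    unfolding fin_subspace_generated[OF sub] by (intro exI[of _ "{\<zero>\<^bsub>M\<^esub>}"]) simp
  show "kdim K M {\<zero>\<^bsub>M\<^esub>} = 0" using kdim_zero_iff[OF f] by simp
qed

lemma linear_zero:
  assumes S: "subspace K S M" and N: "vectorspace K N" and T: "T \<zero>\<^bsub>M\<^esub> \<in> carrier N"
    "\<And>a x. a \<in> carrier K \<Longrightarrow> x \<in> S \<Longrightarrow> T (a \<odot>\<^bsub>M\<^esub> x) = a \<odot>\<^bsub>N\<^esub> T x"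
  shows "T \<zero>\<^bsub>M\<^esub> = \<zero>\<^bsub>N\<^esub>"
proof -
  interpret M: vectorspace K M using S subspaceD by blast
  interpret N: vectorspace K N by fact
  have "T (\<zero>\<^bsub>K\<^esub> \<odot>\<^bsub>M\<^esub> \<zero>\<^bsub>M\<^esub>) = \<zero>\<^bsub>K\<^esub> \<odot>\<^bsub>N\<^esub> T \<zero>\<^bsub>M\<^esub>" by (rule T(2)[OF _ subspaceD(3)[OF S]]) simp
  then show ?thesis using T(1) by simp
qed

text \<open>\<open>S\<close> behaves like the product of the spaces \<open>R i\<close>: the maps
  \<open>T i\<close> are jointly injective, and \<open>sect\<close> lifts an element of one factor
  with all other components zero. Hom into or out of a biproduct is given in this form.\<close>

lemma kdim_joint:
  fixes n :: nat
  assumes S: "subspace K S M"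
    and N: "\<And>i. i < n \<Longrightarrow> vectorspace K (N i)" and R: "\<And>i. i < n \<Longrightarrow> fin_subspace K (N i) (R i)"
    and T: "\<And>i x. i < n \<Longrightarrow> x \<in> S \<Longrightarrow> T i x \<in> R i"
    "\<And>i x y. i < n \<Longrightarrow> x \<in> S \<Longrightarrow> y \<in> S \<Longrightarrow> T i (x \<oplus>\<^bsub>M\<^esub> y) = T i x \<oplus>\<^bsub>N i\<^esub> T i y"
    "\<And>i a x. i < n \<Longrightarrow> a \<in> carrier K \<Longrightarrow> x \<in> S \<Longrightarrow> T i (a \<odot>\<^bsub>M\<^esub> x) = a \<odot>\<^bsub>N i\<^esub> T i x"
    and sect: "\<And>j y. j < n \<Longrightarrow> y \<in> R j \<Longrightarrow> \<exists>x\<in>S. T j x = y \<and> (\<forall>i<n. i \<noteq> j \<longrightarrow> T i x = \<zero>\<^bsub>N i\<^esub>)"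
    and inj: "\<And>x. x \<in> S \<Longrightarrow> \<forall>i<n. T i x = \<zero>\<^bsub>N i\<^esub> \<Longrightarrow> x = \<zero>\<^bsub>M\<^esub>"
  shows "fin_subspace K M S \<and> kdim K M S = (\<Sum>i<n. kdim K (N i) (R i))"
proof -
  have M: "vectorspace K M" using S subspaceD by blast
  have RN: "R i \<subseteq> carrier (N i)" if "i < n" for i using R[OF that] subspaceD(2) fin_subspace_def by blast
  have T0: "T i \<zero>\<^bsub>M\<^esub> = \<zero>\<^bsub>N i\<^esub>" if i: "i < n" for i
    by (rule linear_zero[OF S N[OF i]]) (use T(1,3)[OF i] subspaceD(3)[OF S] RN[OF i] in blast)+
  \<comment> \<open>Elements whose components from index \<open>j\<close> on vanish. In this
    filtration the kernel of \<open>T j\<close> on \<open>Q (Suc j)\<close> is \<open>Q j\<close>,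
    and its image is \<open>R j\<close>.\<close>
  define Q where "Q j = {x \<in> S. \<forall>i<n. j \<le> i \<longrightarrow> T i x = \<zero>\<^bsub>N i\<^esub>}" for j
  have Qsub: "subspace K (Q j) M" for j
  proof (rule subspaceI[OF M])
    show "Q j \<subseteq> carrier M" using subspaceD(2)[OF S] by (auto simp: Q_def)
    show "\<zero>\<^bsub>M\<^esub> \<in> Q j" using subspaceD(3)[OF S] T0 by (simp add: Q_def)
    show "x \<oplus>\<^bsub>M\<^esub> y \<in> Q j" if "x \<in> Q j" "y \<in> Q j" for x y
    proof -
      have "T i (x \<oplus>\<^bsub>M\<^esub> y) = \<zero>\<^bsub>N i\<^esub>" if i: "i < n" "j \<le> i" for i
      proof -
        interpret N: vectorspace K "N i" using N i by blast
        show ?thesis using T(2)[OF i(1), of x y] \<open>x \<in> Q j\<close> \<open>y \<in> Q j\<close> i by (simp add: Q_def)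
      qed
      then show ?thesis using that subspaceD(4)[OF S] by (simp add: Q_def)
    qed
    show "a \<odot>\<^bsub>M\<^esub> x \<in> Q j" if "a \<in> carrier K" "x \<in> Q j" for a x
    proof -
      have "T i (a \<odot>\<^bsub>M\<^esub> x) = \<zero>\<^bsub>N i\<^esub>" if i: "i < n" "j \<le> i" for i
      proof -
        interpret N: vectorspace K "N i" using N i by blast
        show ?thesis using T(3)[OF i(1) \<open>a \<in> carrier K\<close>, of x] \<open>a \<in> carrier K\<close> \<open>x \<in> Q j\<close> i by (simp add: Q_def)
      qed
      then show ?thesis using that subspaceD(5)[OF S] by (simp add: Q_def)
    qed
  qed
  have "j \<le> n \<Longrightarrow> fin_subspace K M (Q j) \<and> kdim K M (Q j) = (\<Sum>i<j. kdim K (N i) (R i))" for j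
  proof (induction j)
    case 0
    have "Q 0 = {\<zero>\<^bsub>M\<^esub>}"
    proof
      show "Q 0 \<subseteq> {\<zero>\<^bsub>M\<^esub>}" using inj by (auto simp: Q_def)
      show "{\<zero>\<^bsub>M\<^esub>} \<subseteq> Q 0" using subspaceD(3)[OF Qsub] by blast
    qed
    then show ?case using fin_subspace_zero[OF M] by simp
  next
    case (Suc j)
    then have j: "j < n" and IH: "fin_subspace K M (Q j)" "kdim K M (Q j) = (\<Sum>i<j. kdim K (N i) (R i))" by auto
    have QS: "Q (Suc j) \<subseteq> S" by (auto simp: Q_def)
    have ker: "{x \<in> Q (Suc j). T j x = \<zero>\<^bsub>N j\<^esub>} = Q j"
      using j by (auto simp: Q_def le_eq_less_or_eq Suc_le_eq)
    have im: "T j ` Q (Suc j) = R j"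
    proof
      show "T j ` Q (Suc j) \<subseteq> R j" using T(1)[OF j] QS by blast
      show "R j \<subseteq> T j ` Q (Suc j)"
      proof
        fix y assume "y \<in> R j"
        then obtain x where "x \<in> S" "T j x = y" "\<forall>i<n. i \<noteq> j \<longrightarrow> T i x = \<zero>\<^bsub>N i\<^esub>" using sect[OF j] by blast
        then show "y \<in> T j ` Q (Suc j)" by (intro image_eqI[of _ _ x]) (auto simp: Q_def)
      qed
    qed
    have lin: "\<And>x. x \<in> Q (Suc j) \<Longrightarrow> T j x \<in> carrier (N j)"
      "\<And>x y. x \<in> Q (Suc j) \<Longrightarrow> y \<in> Q (Suc j) \<Longrightarrow> T j (x \<oplus>\<^bsub>M\<^esub> y) = T j x \<oplus>\<^bsub>N j\<^esub> T j y"
      "\<And>a x. a \<in> carrier K \<Longrightarrow> x \<in> Q (Suc j) \<Longrightarrow> T j (a \<odot>\<^bsub>M\<^esub> x) = a \<odot>\<^bsub>N j\<^esub> T j x"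
      using T(1)[OF j] T(2)[OF j] T(3)[OF j] QS RN[OF j] by blast+
    have f: "fin_subspace K M (Q (Suc j))"
      by (rule fin_subspace_extension[OF Qsub N[OF j] lin]) (use ker im IH(1) R[OF j] in simp_all)
    have "kdim K M (Q (Suc j)) = kdim K M (Q j) + kdim K (N j) (R j)"
      using rank_nullity_on(3)[OF f N[OF j] lin] unfolding ker im .
    then show ?case using f IH(2) by simp
  qed
  from this[of n] show ?thesis by (auto simp: Q_def)
qed

section \<open>Biproducts and additivity of Hom dimensions\<close>

context linear_category
begin

definition ds :: "'o list \<Rightarrow> 'o \<Rightarrow> (nat \<Rightarrow> 'm) \<Rightarrow> (nat \<Rightarrow> 'm) \<Rightarrow> bool" where
  "ds Xs V \<iota> \<pi> \<longleftrightarrow> V \<in> Obj C \<and> set Xs \<subseteq> Obj C \<and>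
     (\<forall>i<length Xs. arr (Xs ! i) V (\<iota> i) \<and> arr V (Xs ! i) (\<pi> i)) \<and>
     (\<forall>i<length Xs. \<pi> i \<cdot> \<iota> i = idm (Xs ! i)) \<and>
     (\<forall>i<length Xs. \<forall>j<length Xs. i \<noteq> j \<longrightarrow> \<pi> j \<cdot> \<iota> i = zr (Xs ! i) (Xs ! j)) \<and>
     finsum (Mor C V V) (\<lambda>i. \<iota> i \<cdot> \<pi> i) {..<length Xs} = idm V"

lemma direct_sum_iff: "Defs.direct_sum C Xs V \<longleftrightarrow> (\<exists>\<iota> \<pi>. ds Xs V \<iota> \<pi>)"
  unfolding Defs.direct_sum_def ds_def arr_def using nth_mem by (auto 4 4 simp: subset_iff)

lemma finsum_left:
  assumes "finite A" "\<And>i. i \<in> A \<Longrightarrow> arr Y Z (a i)" "arr X Y f" "Z \<in> Obj C" "\<And>i. i \<in> A \<Longrightarrow> a i \<cdot> f = zr X Z"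
  shows "finsum (Mor C Y Z) a A \<cdot> f = zr X Z \<and> arr Y Z (finsum (Mor C Y Z) a A)"
  using assms(1,2,5)
proof (induction A)
  case empty
  interpret A: abelian_group "Mor C Y Z" using hom_ab assms arrD by blast
  show ?case using zero_left[OF assms(4,3)] arr_zero assms(4) arrD[OF assms(3)] by simp
next
  case (insert i A)
  interpret A: abelian_group "Mor C Y Z" using hom_ab assms arrD by blast
  interpret B: abelian_group "Mor C X Z" using hom_ab assms arrD by blast
  have IH: "finsum (Mor C Y Z) a A \<cdot> f = zr X Z" "arr Y Z (finsum (Mor C Y Z) a A)" using insert by auto
  have ai: "arr Y Z (a i)" "a i \<cdot> f = zr X Z" using insert by auto
  have e: "finsum (Mor C Y Z) a (insert i A) = pls Y Z (a i) (finsum (Mor C Y Z) a A)"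
    using insert arrD(3) by (intro A.finsum_insert) blast+
  show ?case unfolding e using pls_left[OF assms(3) ai(1) IH(2)] IH ai arr_pls by simp
qed

lemma finsum_right:
  assumes "finite A" "\<And>i. i \<in> A \<Longrightarrow> arr X Y (a i)" "arr Y Z g" "X \<in> Obj C" "\<And>i. i \<in> A \<Longrightarrow> g \<cdot> a i = zr X Z"
  shows "g \<cdot> finsum (Mor C X Y) a A = zr X Z \<and> arr X Y (finsum (Mor C X Y) a A)"
  using assms(1,2,5)
proof (induction A)
  case empty
  interpret A: abelian_group "Mor C X Y" using hom_ab assms arrD by blast
  show ?case using zero_right[OF assms(4,3)] arr_zero assms(4) arrD[OF assms(3)] by simp
next
  case (insert i A)
  interpret A: abelian_group "Mor C X Y" using hom_ab assms arrD by blast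
  interpret B: abelian_group "Mor C X Z" using hom_ab assms arrD by blast
  have IH: "g \<cdot> finsum (Mor C X Y) a A = zr X Z" "arr X Y (finsum (Mor C X Y) a A)" using insert by auto
  have ai: "arr X Y (a i)" "g \<cdot> a i = zr X Z" using insert by auto
  have e: "finsum (Mor C X Y) a (insert i A) = pls X Y (a i) (finsum (Mor C X Y) a A)"
    using insert arrD(3) by (intro A.finsum_insert) blast+
  show ?case unfolding e using pls_right[OF ai(1) IH(2) assms(3)] IH ai arr_pls by simp
qed

lemma dsD:
  assumes "ds Xs V \<iota> \<pi>"
  shows "V \<in> Obj C" "set Xs \<subseteq> Obj C"
    "\<And>i. i < length Xs \<Longrightarrow> arr (Xs ! i) V (\<iota> i)" "\<And>i. i < length Xs \<Longrightarrow> arr V (Xs ! i) (\<pi> i)"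
    "\<And>i. i < length Xs \<Longrightarrow> \<pi> i \<cdot> \<iota> i = idm (Xs ! i)"
    "\<And>i j. i < length Xs \<Longrightarrow> j < length Xs \<Longrightarrow> i \<noteq> j \<Longrightarrow> \<pi> j \<cdot> \<iota> i = zr (Xs ! i) (Xs ! j)"
    "finsum (Mor C V V) (\<lambda>i. \<iota> i \<cdot> \<pi> i) {..<length Xs} = idm V"
  using assms unfolding ds_def by auto

lemma ds_zero:
  assumes d: "ds Xs V \<iota> \<pi>" and f: "arr W V f" and z: "\<And>i. i < length Xs \<Longrightarrow> \<pi> i \<cdot> f = zr W (Xs ! i)"
  shows "f = zr W V"
proof -
  note d = dsD[OF d]
  have a: "arr V V (\<iota> i \<cdot> \<pi> i)" if "i < length Xs" for i using arr_comp d(3,4) that by blast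
  have "\<iota> i \<cdot> \<pi> i \<cdot> f = zr W V" if "i < length Xs" for i
    using assoc[OF f d(4)[OF that] d(3)[OF that]] z[OF that] zero_right[OF arrD(1)[OF f] d(3)[OF that]] by simp
  then have "finsum (Mor C V V) (\<lambda>i. \<iota> i \<cdot> \<pi> i) {..<length Xs} \<cdot> f = zr W V"
    using finsum_left[of "{..<length Xs}" V V "\<lambda>i. \<iota> i \<cdot> \<pi> i" W f] a f d(1) by blast
  then show ?thesis using d(7) id_left[OF f] by simp
qed

lemma ds_zero':
  assumes d: "ds Xs V \<iota> \<pi>" and g: "arr V Y g" and z: "\<And>i. i < length Xs \<Longrightarrow> g \<cdot> \<iota> i = zr (Xs ! i) Y"
  shows "g = zr V Y"
proof -
  note d = dsD[OF d]
  have a: "arr V V (\<iota> i \<cdot> \<pi> i)" if "i < length Xs" for i using arr_comp d(3,4) that by blast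
  have "g \<cdot> (\<iota> i \<cdot> \<pi> i) = zr V Y" if "i < length Xs" for i
    using assoc[OF d(4)[OF that] d(3)[OF that] g] z[OF that] zero_left[OF arrD(2)[OF g] d(4)[OF that]] by simp
  then have "g \<cdot> finsum (Mor C V V) (\<lambda>i. \<iota> i \<cdot> \<pi> i) {..<length Xs} = zr V Y"
    using finsum_right[of "{..<length Xs}" V V "\<lambda>i. \<iota> i \<cdot> \<pi> i" Y g] a g d(1) by blast
  then show ?thesis using d(7) id_right[OF g] by simp
qed

lemma ds_eq:
  assumes d: "ds Xs V \<iota> \<pi>" and f: "arr W V f" "arr W V f'" and z: "\<And>i. i < length Xs \<Longrightarrow> \<pi> i \<cdot> f = \<pi> i \<cdot> f'"
  shows "f = f'"
proof -
  have "dif W V f f' = zr W V"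
  proof (rule ds_zero[OF d arr_dif[OF f]])
    fix i assume i: "i < length Xs"
    note p = dsD(4)[OF d i]
    show "\<pi> i \<cdot> dif W V f f' = zr W (Xs ! i)"
      using dif_right[OF f p] z[OF i] dif_eq_zero_iff[OF arr_comp[OF f(1) p] arr_comp[OF f(2) p]] by simp
  qed
  then show ?thesis using dif_eq_zero_iff[OF f] by simp
qed

lemma ds_univ:
  assumes d: "ds Xs V \<iota> \<pi>" and W: "W \<in> Obj C" and f: "\<And>i. i < length Xs \<Longrightarrow> arr W (Xs ! i) (f i)"
  obtains h where "arr W V h" "\<And>i. i < length Xs \<Longrightarrow> \<pi> i \<cdot> h = f i"
proof -
  note d = dsD[OF d]
  \<comment> \<open>The mediating morphism is built one component at a time, by adding
    \<open>\<iota> m \<cdot> f m\<close> at stage \<open>m\<close>.\<close>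
  have "m \<le> length Xs \<Longrightarrow> \<exists>h. arr W V h \<and> (\<forall>i<length Xs. \<pi> i \<cdot> h = (if i < m then f i else zr W (Xs ! i)))" for m
  proof (induction m)
    case 0
    show ?case using arr_zero[OF W d(1)] zero_right[OF W d(4)] by (intro exI[of _ "zr W V"]) simp
  next
    case (Suc m)
    then obtain h where h: "arr W V h" "\<And>i. i < length Xs \<Longrightarrow> \<pi> i \<cdot> h = (if i < m then f i else zr W (Xs ! i))" by auto
    have m: "m < length Xs" using Suc by simp
    let ?g = "\<iota> m \<cdot> f m"
    have g: "arr W V ?g" using arr_comp[OF f[OF m] d(3)[OF m]] .
    have "\<pi> i \<cdot> pls W V h ?g = (if i < Suc m then f i else zr W (Xs ! i))" if i: "i < length Xs" for i
    proof -
      interpret A: abelian_group "Mor C W (Xs ! i)" using hom_ab W arrD(2)[OF d(4)[OF i]] by blast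
      have e: "\<pi> i \<cdot> pls W V h ?g = pls W (Xs ! i) (\<pi> i \<cdot> h) (\<pi> i \<cdot> \<iota> m \<cdot> f m)"
        using pls_right[OF h(1) g d(4)[OF i]] assoc[OF f[OF m] d(3)[OF m] d(4)[OF i]] by simp
      show ?thesis
      proof (cases "i = m")
        case True
        then show ?thesis using e h(2)[OF i] d(5)[OF i] id_left[OF f[OF m]] A.l_zero[of "f i"] arrD(3)[OF f[OF m]] by simp
      next
        case False
        have "\<pi> i \<cdot> \<iota> m \<cdot> f m = zr W (Xs ! i)"
          using d(6)[OF m i] False zero_left[OF arrD(2)[OF d(4)[OF i]] f[OF m]] by simp
        then show ?thesis using e h(2)[OF i] False arrD(3)[OF f[OF i]] by (auto simp: less_Suc_eq)
      qed
    qed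
    then show ?case using arr_pls[OF h(1) g] by blast
  qed
  from this[of "length Xs"] show thesis using that by auto
qed

lemma hom_subspace: "X \<in> Obj C \<Longrightarrow> Y \<in> Obj C \<Longrightarrow> subspace K (H X Y) (Mor C X Y)"
proof -
  assume xy: "X \<in> Obj C" "Y \<in> Obj C"
  interpret M: vectorspace K "Mor C X Y" using hom_vs xy by blast
  show ?thesis by (rule subspaceI[OF M.vectorspace_axioms]) auto
qed

text \<open>\<open>R\<close> is a subfunctor of Hom(\<open>W\<close>, -): closure under
  postcomposition lets the injections and projections of the biproduct act on it. This serves both
  the whole Hom functor and its radical.\<close>

lemma kdim_subfunctor_direct_sum:
  assumes d: "ds Xs V \<iota> \<pi>" and W: "W \<in> Obj C"
    and R: "\<And>Z. Z \<in> Obj C \<Longrightarrow> subspace K (R Z) (Mor C W Z)"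
    and fin: "\<And>Z. Z \<in> set Xs \<Longrightarrow> fin_subspace K (Mor C W Z) (R Z)"
    and post: "\<And>Y Z f h. arr Y Z h \<Longrightarrow> f \<in> R Y \<Longrightarrow> h \<cdot> f \<in> R Z"
  shows "fin_subspace K (Mor C W V) (R V) \<and> kdim K (Mor C W V) (R V) = (\<Sum>Z\<leftarrow>Xs. kdim K (Mor C W Z) (R Z))"
proof -
  note D = dsD[OF d]
  have RH: "f \<in> R Z \<Longrightarrow> Z \<in> Obj C \<Longrightarrow> arr W Z f" for f Z using subspaceD(2)[OF R] W by (auto simp: arr_def)
  have XO: "Xs ! i \<in> Obj C" if "i < length Xs" for i using arrD(2)[OF D(4)[OF that]] .
  have "fin_subspace K (Mor C W V) (R V) \<and>
    kdim K (Mor C W V) (R V) = (\<Sum>i<length Xs. kdim K (Mor C W (Xs ! i)) (R (Xs ! i)))"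
  proof (rule kdim_joint[where T = "\<lambda>i f. \<pi> i \<cdot> f"])
    show "subspace K (R V) (Mor C W V)" using R D(1) by blast
    fix i assume i: "i < length Xs"
    show "vectorspace K (Mor C W (Xs ! i))" using hom_vs W XO[OF i] by blast
    show "fin_subspace K (Mor C W (Xs ! i)) (R (Xs ! i))" using fin i by simp
    show "\<pi> i \<cdot> x \<in> R (Xs ! i)" if "x \<in> R V" for x using post[OF D(4)[OF i] that] .
    show "\<pi> i \<cdot> (x \<oplus>\<^bsub>Mor C W V\<^esub> y) = \<pi> i \<cdot> x \<oplus>\<^bsub>Mor C W (Xs ! i)\<^esub> \<pi> i \<cdot> y" if "x \<in> R V" "y \<in> R V" for x y
      using pls_right[OF RH[OF that(1) D(1)] RH[OF that(2) D(1)] D(4)[OF i]] .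
    show "\<pi> i \<cdot> (a \<odot>\<^bsub>Mor C W V\<^esub> x) = a \<odot>\<^bsub>Mor C W (Xs ! i)\<^esub> (\<pi> i \<cdot> x)" if "a \<in> carrier K" "x \<in> R V" for a x
      using comp_smult_right[OF W D(1) XO[OF i] that(1)] RH[OF that(2) D(1)] D(4)[OF i] by (simp add: arr_def)
    show "\<exists>x\<in>R V. \<pi> i \<cdot> x = y \<and> (\<forall>j<length Xs. j \<noteq> i \<longrightarrow> \<pi> j \<cdot> x = zr W (Xs ! j))" if y: "y \<in> R (Xs ! i)" for y
    proof (rule bexI[of _ "\<iota> i \<cdot> y"])
      note ya = RH[OF y XO[OF i]]
      have "\<pi> j \<cdot> (\<iota> i \<cdot> y) = zr W (Xs ! j)" if j: "j < length Xs" "j \<noteq> i" for j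
        using assoc[OF ya D(3)[OF i] D(4)[OF j(1)]] D(6)[OF i j(1)] j zero_left[OF XO[OF j(1)] ya] by simp
      then show "\<pi> i \<cdot> (\<iota> i \<cdot> y) = y \<and> (\<forall>j<length Xs. j \<noteq> i \<longrightarrow> \<pi> j \<cdot> (\<iota> i \<cdot> y) = zr W (Xs ! j))"
        using assoc[OF ya D(3)[OF i] D(4)[OF i]] D(5)[OF i] id_left[OF ya] by simp
      show "\<iota> i \<cdot> y \<in> R V" using post[OF D(3)[OF i] y] .
    qed
  next
    show "x = zr W V" if "x \<in> R V" "\<forall>i<length Xs. \<pi> i \<cdot> x = zr W (Xs ! i)" for x
      using ds_zero[OF d RH[OF that(1) D(1)]] that(2) by blast
  qed
  then show ?thesis by (simp add: sum_list_sum_nth lessThan_atLeast0)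
qed

lemma kdim_hom_direct_sum_left:
  assumes d: "ds Xs V \<iota> \<pi>" and Y: "Y \<in> Obj C" and fin: "\<And>Z. Z \<in> set Xs \<Longrightarrow> fin_subspace K (Mor C Z Y) (H Z Y)"
  shows "fin_subspace K (Mor C V Y) (H V Y) \<and> kdim K (Mor C V Y) (H V Y) = (\<Sum>Z\<leftarrow>Xs. kdim K (Mor C Z Y) (H Z Y))"
proof -
  note D = dsD[OF d]
  have RH: "f \<in> H Z Y \<Longrightarrow> Z \<in> Obj C \<Longrightarrow> arr Z Y f" for f Z using Y by (auto simp: arr_def)
  have XO: "Xs ! i \<in> Obj C" if "i < length Xs" for i using arrD(2)[OF D(4)[OF that]] .
  have "fin_subspace K (Mor C V Y) (H V Y) \<and>
    kdim K (Mor C V Y) (H V Y) = (\<Sum>i<length Xs. kdim K (Mor C (Xs ! i) Y) (H (Xs ! i) Y))"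
  proof (rule kdim_joint[where T = "\<lambda>i f. f \<cdot> \<iota> i"])
    show "subspace K (H V Y) (Mor C V Y)" using hom_subspace D(1) Y by blast
    fix i assume i: "i < length Xs"
    show "vectorspace K (Mor C (Xs ! i) Y)" using hom_vs Y XO[OF i] by blast
    show "fin_subspace K (Mor C (Xs ! i) Y) (H (Xs ! i) Y)" using fin i by simp
    show "x \<cdot> \<iota> i \<in> H (Xs ! i) Y" if "x \<in> H V Y" for x using arrD(3)[OF arr_comp[OF D(3)[OF i] RH[OF that D(1)]]] .
    show "(x \<oplus>\<^bsub>Mor C V Y\<^esub> y) \<cdot> \<iota> i = x \<cdot> \<iota> i \<oplus>\<^bsub>Mor C (Xs ! i) Y\<^esub> y \<cdot> \<iota> i" if "x \<in> H V Y" "y \<in> H V Y" for x y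
      using pls_left[OF D(3)[OF i] RH[OF that(1) D(1)] RH[OF that(2) D(1)]] .
    show "(a \<odot>\<^bsub>Mor C V Y\<^esub> x) \<cdot> \<iota> i = a \<odot>\<^bsub>Mor C (Xs ! i) Y\<^esub> (x \<cdot> \<iota> i)" if "a \<in> carrier K" "x \<in> H V Y" for a x
      using comp_smult_left[OF XO[OF i] D(1) Y that(1)] that(2) D(3)[OF i] by (simp add: arr_def)
    show "\<exists>x\<in>H V Y. x \<cdot> \<iota> i = y \<and> (\<forall>j<length Xs. j \<noteq> i \<longrightarrow> x \<cdot> \<iota> j = zr (Xs ! j) Y)" if y: "y \<in> H (Xs ! i) Y" for y
    proof (rule bexI[of _ "y \<cdot> \<pi> i"])
      note ya = RH[OF y XO[OF i]]
      have "y \<cdot> \<pi> i \<cdot> \<iota> j = zr (Xs ! j) Y" if j: "j < length Xs" "j \<noteq> i" for j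
        using assoc[OF D(3)[OF j(1)] D(4)[OF i] ya] D(6)[OF j(1) i j(2)] zero_right[OF XO[OF j(1)] ya] by simp
      then show "y \<cdot> \<pi> i \<cdot> \<iota> i = y \<and> (\<forall>j<length Xs. j \<noteq> i \<longrightarrow> y \<cdot> \<pi> i \<cdot> \<iota> j = zr (Xs ! j) Y)"
        using assoc[OF D(3)[OF i] D(4)[OF i] ya] D(5)[OF i] id_right[OF ya] by simp
      show "y \<cdot> \<pi> i \<in> H V Y" using arrD(3)[OF arr_comp[OF D(4)[OF i] ya]] .
    qed
  next
    show "x = zr V Y" if "x \<in> H V Y" "\<forall>i<length Xs. x \<cdot> \<iota> i = zr (Xs ! i) Y" for x
      using ds_zero'[OF d RH[OF that(1) D(1)]] that(2) by blast
  qed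
  then show ?thesis by (simp add: sum_list_sum_nth lessThan_atLeast0)
qed

lemma zero_object_iff: "zero_object C Z \<longleftrightarrow> Z \<in> Obj C \<and> idm Z = zr Z Z"
proof -
  have "finsum (Mor C Z Z) f {} = zr Z Z" if "Z \<in> Obj C" for f :: "nat \<Rightarrow> 'm"
  proof -
    interpret A: abelian_group "Mor C Z Z" using hom_ab that by blast
    show ?thesis by simp
  qed
  then show ?thesis unfolding Defs.direct_sum_def by auto
qed

lemma zero_object_arr: "zero_object C Z \<Longrightarrow> arr X Z f \<Longrightarrow> f = zr X Z"
  using id_left[of X Z f] zero_left[of Z X Z f] by (simp add: zero_object_iff)

end

section \<open>Krull-Schmidt categories\<close>

locale ks_category = additive_category K C
  for K :: "('k, 'r) ring_scheme" (structure) and C :: "('k, 'o, 'm, 'z) lin_cat_scheme" +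
  assumes hom_fin: "hom_finite K C" and ks: "krull_schmidt C"
begin

text \<open>Locality of the endomorphism ring in elementwise form, which moves easily along
  isomorphisms and along the shift.\<close>

definition local_obj :: "'o \<Rightarrow> bool" where
  "local_obj X \<longleftrightarrow> X \<in> Obj C \<and> idm X \<noteq> zr X X \<and> (\<forall>f. arr X X f \<longrightarrow> isom X X f \<or> isom X X (dif X X (idm X) f))"

lemma local_objD: "local_obj X \<Longrightarrow> X \<in> Obj C" "local_obj X \<Longrightarrow> idm X \<noteq> zr X X"
    "local_obj X \<Longrightarrow> arr X X f \<Longrightarrow> isom X X f \<or> isom X X (dif X X (idm X) f)"
  unfolding local_obj_def by blast+

lemma indec_obj: "indecomposable C X \<Longrightarrow> X \<in> Obj C"
  by (simp add: indecomposable_def)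

text \<open>If neither \<open>f\<close> nor \<open>1 - f\<close> were invertible, both would lie in
  the ideal of non-units, and so would their sum, the identity.\<close>

lemma local_ring_local_obj:
  assumes X: "indecomposable C X" and l: "local_ring (End_ring C X)"
  shows "local_obj X"
proof -
  have O: "X \<in> Obj C" using X by (rule indec_obj)
  have n: "idm X \<noteq> zr X X" using X zero_object_iff by (auto simp: indecomposable_def)
  let ?R = "End_ring C X"
  have U: "f \<in> Units ?R \<longleftrightarrow> isom X X f" for f
    by (auto simp: Units_def End_ring_def isom_def inverse_of_def arr_def O)
  have I: "ideal (carrier ?R - Units ?R) ?R" using l by (simp add: local_ring_def)
  have "isom X X f \<or> isom X X (dif X X (idm X) f)" if f: "arr X X f" for f
  proof (rule ccontr)
    assume a: "\<not> (isom X X f \<or> isom X X (dif X X (idm X) f))"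
    have c: "carrier ?R = H X X" by (simp add: End_ring_def)
    have "f \<in> carrier ?R - Units ?R" "dif X X (idm X) f \<in> carrier ?R - Units ?R"
      using a U c arrD(3)[OF f] arrD(3)[OF arr_dif[OF arr_id[OF O] f]] by auto
    then have "f \<oplus>\<^bsub>?R\<^esub> dif X X (idm X) f \<in> carrier ?R - Units ?R"
      using additive_subgroup.a_closed[OF ideal.axioms(1)[OF I]] by blast
    moreover have "f \<oplus>\<^bsub>?R\<^esub> dif X X (idm X) f = idm X"
      using pls_dif_cancel[OF arr_id[OF O] f] by (simp add: End_ring_def)
    ultimately show False using U isom_id[OF O] by simp
  qed
  then show ?thesis using O n by (simp add: local_obj_def)
qed

lemma local_obj_iso:
  assumes X: "local_obj X" and i: "inverse_of X Y a b"
  shows "local_obj Y"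
proof -
  have ab: "arr X Y a" "arr Y X b" "b \<cdot> a = idm X" "a \<cdot> b = idm Y" using i by (auto simp: inverse_of_def)
  note O = local_objD(1)[OF X]
  have OY: "Y \<in> Obj C" using ab arrD by blast
  have ia: "isom X Y a" "isom Y X b" using ab unfolding isom_def inverse_of_def by blast+
  have conj_id: "a \<cdot> (b \<cdot> f \<cdot> a) \<cdot> b = f" if f: "arr Y Y f" for f
  proof -
    have bf: "arr Y X (b \<cdot> f)" using arr_comp[OF f ab(2)] .
    have "a \<cdot> (b \<cdot> f \<cdot> a) = f \<cdot> a"
      using assoc[OF ab(1) bf ab(1)] assoc[OF f ab(2) ab(1)] ab(4) id_left[OF f] by simp
    then show ?thesis using assoc[OF ab(2) ab(1) f] ab(4) id_right[OF f] by simp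
  qed
  have bk: "isom Y Y f" if f: "arr Y Y f" "isom X X (b \<cdot> f \<cdot> a)" for f
    using isom_comp[OF ia(2) isom_comp[OF f(2) ia(1)]] conj_id[OF f(1)] by simp
  have "isom Y Y f \<or> isom Y Y (dif Y Y (idm Y) f)" if f: "arr Y Y f" for f
  proof -
    have fa: "arr X X (b \<cdot> f \<cdot> a)" using arr_comp ab f by blast
    have "b \<cdot> dif Y Y (idm Y) f \<cdot> a = dif X X (idm X) (b \<cdot> f \<cdot> a)"
      using dif_right[OF arr_id[OF OY] f ab(2)] id_right[OF ab(2)]
        dif_left[OF ab(1) ab(2) arr_comp[OF f ab(2)]] ab(3) by simp
    then show ?thesis using local_objD(3)[OF X fa] bk[OF f] bk[OF arr_dif[OF arr_id[OF OY] f]] by auto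
  qed
  moreover have "idm Y \<noteq> zr Y Y"
  proof
    assume "idm Y = zr Y Y"
    then have "a = zr X Y" using id_left[OF ab(1)] zero_left[OF OY ab(1)] by simp
    then show False using ab(3) zero_right[OF O ab(2)] local_objD(2)[OF X] by simp
  qed
  ultimately show ?thesis using OY by (simp add: local_obj_def)
qed

text \<open>Regroups a decomposition into its first summand and a biproduct of the others, because
  indecomposability speaks of two summands only.\<close>

lemma ds_Cons_split:
  assumes d: "ds (Z # Zs) X \<iota> \<pi>" and b: "ds Zs B \<iota>' \<pi>'"
  obtains j q where "ds [Z, B] X (\<lambda>i. if i = 0 then \<iota> 0 else j) (\<lambda>i. if i = 0 then \<pi> 0 else q)"
proof -
  note D = dsD[OF d] and E = dsD[OF b]
  have Z: "arr Z X (\<iota> 0)" "arr X Z (\<pi> 0)" "\<pi> 0 \<cdot> \<iota> 0 = idm Z" using D(3)[of 0] D(4)[of 0] D(5)[of 0] by simp_all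
  have ZO: "Z \<in> Obj C" using D(2) by simp
  have P: "arr X (Zs ! i) (\<pi> (Suc i))" if "i < length Zs" for i using D(4)[of "Suc i"] that by simp
  obtain q where q: "arr X B q" "\<And>i. i < length Zs \<Longrightarrow> \<pi>' i \<cdot> q = \<pi> (Suc i)"
    using ds_univ[OF b D(1), of "\<lambda>i. \<pi> (Suc i)"] P by blast
  have f: "arr B ((Z # Zs) ! i) (case i of 0 \<Rightarrow> zr B Z | Suc k \<Rightarrow> \<pi>' k)" if "i < length (Z # Zs)" for i
    using that E(4) arr_zero[OF E(1) ZO] by (auto split: nat.splits)
  obtain j where j: "arr B X j" "\<And>i. i < length (Z # Zs) \<Longrightarrow> \<pi> i \<cdot> j = (case i of 0 \<Rightarrow> zr B Z | Suc k \<Rightarrow> \<pi>' k)"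
    using ds_univ[OF d E(1) f] by blast
  have qj: "q \<cdot> j = idm B"
  proof (rule ds_eq[OF b arr_comp[OF j(1) q(1)] arr_id[OF E(1)]])
    fix i assume i: "i < length Zs"
    show "\<pi>' i \<cdot> (q \<cdot> j) = \<pi>' i \<cdot> idm B"
      using assoc[OF j(1) q(1) E(4)[OF i]] q(2)[OF i] j(2)[of "Suc i"] i id_right[OF E(4)[OF i]] by simp
  qed
  have qi: "q \<cdot> \<iota> 0 = zr Z B"
  proof (rule ds_zero[OF b arr_comp[OF Z(1) q(1)]])
    fix i assume i: "i < length Zs"
    show "\<pi>' i \<cdot> (q \<cdot> \<iota> 0) = zr Z (Zs ! i)"
      using assoc[OF Z(1) q(1) E(4)[OF i]] q(2)[OF i] D(6)[of 0 "Suc i"] i by simp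
  qed
  have pj: "\<pi> 0 \<cdot> j = zr B Z" using j(2)[of 0] by simp
  have s: "pls X X (\<iota> 0 \<cdot> \<pi> 0) (j \<cdot> q) = idm X"
  proof (rule ds_eq[OF d _ arr_id[OF D(1)]])
    have a1: "arr X X (\<iota> 0 \<cdot> \<pi> 0)" and a2: "arr X X (j \<cdot> q)" using arr_comp Z j q by blast+
    show "arr X X (pls X X (\<iota> 0 \<cdot> \<pi> 0) (j \<cdot> q))" using arr_pls[OF a1 a2] .
    fix i assume i: "i < length (Z # Zs)"
    interpret A: abelian_group "Mor C X ((Z # Zs) ! i)" using hom_ab[OF D(1)] arrD(2)[OF D(4)[OF i]] by blast
    have e: "\<pi> i \<cdot> pls X X (\<iota> 0 \<cdot> \<pi> 0) (j \<cdot> q) = pls X ((Z # Zs) ! i) (\<pi> i \<cdot> \<iota> 0 \<cdot> \<pi> 0) (\<pi> i \<cdot> j \<cdot> q)"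
      using pls_right[OF a1 a2 D(4)[OF i]] assoc[OF Z(2) Z(1) D(4)[OF i]] assoc[OF q(1) j(1) D(4)[OF i]] by simp
    show "\<pi> i \<cdot> pls X X (\<iota> 0 \<cdot> \<pi> 0) (j \<cdot> q) = \<pi> i \<cdot> idm X"
    proof (cases i)
      case 0
      then show ?thesis using e Z(3) id_left[OF Z(2)] pj zero_left[OF ZO q(1)] id_right[OF D(4)[OF i]]
          arrD(3)[OF Z(2)] A.r_zero by simp
    next
      case (Suc k)
      have "\<pi> i \<cdot> \<iota> 0 = zr Z (Zs ! k)" "\<pi> i \<cdot> j = \<pi>' k" using D(6)[of 0 "Suc k"] j(2)[OF i] Suc i by simp_all
      then show ?thesis using e zero_left[OF _ Z(2), of "Zs ! k"] q(2)[of k] Suc i id_right[OF D(4)[OF i]]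
          arrD(3)[OF D(4)[OF i]] arrD(2)[OF D(4)[OF i]] A.l_zero by simp
    qed
  qed
  have "ds [Z, B] X (\<lambda>i. if i = 0 then \<iota> 0 else j) (\<lambda>i. if i = 0 then \<pi> 0 else q)"
  proof -
    interpret A: abelian_group "Mor C X X" using hom_ab[OF D(1) D(1)] .
    have "{..<length [Z, B]} = {0, 1}" by auto
    then have fs: "finsum (Mor C X X) (\<lambda>i. (if i = 0 then \<iota> 0 else j) \<cdot> (if i = 0 then \<pi> 0 else q)) {..<length [Z, B]} = idm X"
      using s arrD(3)[OF arr_comp[OF Z(2,1)]] arrD(3)[OF arr_comp[OF q(1) j(1)]] by (simp add: A.r_zero)
    show ?thesis unfolding ds_def using fs Z j(1) q(1) qj qi pj D(1) E(1) ZO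
      by (auto simp: less_Suc_eq nth_Cons split: nat.splits)
  qed
  then show thesis by (rule that)
qed

text \<open>The Krull-Schmidt property provides local rings only for the summands of some
  decomposition of \<open>X\<close>. As \<open>X\<close> is indecomposable, all of them but the
  first add up to zero, so \<open>X\<close> is isomorphic to that first summand.\<close>

lemma indec_local: assumes X: "indecomposable C X" shows "local_obj X"
proof -
  note O = indec_obj[OF X]
  have nz: "idm X \<noteq> zr X X" using X zero_object_iff by (auto simp: indecomposable_def)
  obtain Xs where Xs: "Defs.direct_sum C Xs X" "\<forall>Z\<in>set Xs. indecomposable C Z \<and> local_ring (End_ring C Z)"
    using ks O unfolding krull_schmidt_def by blast
  then obtain \<iota> \<pi> where d: "ds Xs X \<iota> \<pi>" unfolding direct_sum_iff by blast
  show ?thesis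
  proof (cases Xs)
    case Nil
    then show ?thesis using ds_zero[OF d arr_id[OF O]] nz by simp
  next
    case (Cons Z Zs)
    have "set Zs \<subseteq> Obj C" using dsD(2)[OF d] Cons by simp
    then obtain B \<iota>' \<pi>' where b: "ds Zs B \<iota>' \<pi>'" using ex_direct_sum[of Zs] unfolding direct_sum_iff by blast
    obtain j q where jq: "ds [Z, B] X (\<lambda>i. if i = 0 then \<iota> 0 else j) (\<lambda>i. if i = 0 then \<pi> 0 else q)"
      using ds_Cons_split[OF d[unfolded Cons] b] .
    have Zi: "indecomposable C Z" "local_ring (End_ring C Z)" using Xs Cons by auto
    have "Defs.direct_sum C [Z, B] X" using jq unfolding direct_sum_iff by blast
    then have "zero_object C Z \<or> zero_object C B" using X dsD(1)[OF b] indec_obj[OF Zi(1)] unfolding indecomposable_def by blast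
    then have B: "zero_object C B" using Zi(1) by (auto simp: indecomposable_def)
    note D = dsD[OF jq]
    have Z: "arr Z X (\<iota> 0)" "arr X Z (\<pi> 0)" "\<pi> 0 \<cdot> \<iota> 0 = idm Z" using D(3)[of 0] D(4)[of 0] D(5)[of 0] by simp_all
    have "\<iota> 0 \<cdot> \<pi> 0 = idm X"
    proof (rule ds_eq[OF jq arr_comp[OF Z(2,1)] arr_id[OF O]])
      fix i assume "i < length [Z, B]"
      then consider "i = 0" | "i = 1" by fastforce
      then show "(if i = 0 then \<pi> 0 else q) \<cdot> (\<iota> 0 \<cdot> \<pi> 0) = (if i = 0 then \<pi> 0 else q) \<cdot> idm X"
      proof cases
        case 1
        then show ?thesis using assoc[OF Z(2) Z(1) Z(2)] Z(3) id_left[OF Z(2)] id_right[OF Z(2)] by simp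
      next
        case 2
        have q: "arr X B q" using D(4)[of 1] by simp
        show ?thesis using 2 zero_object_arr[OF B arr_comp[OF arr_comp[OF Z(2,1)] q]] zero_object_arr[OF B arr_comp[OF arr_id[OF O] q]] by simp
      qed
    qed
    then have "inverse_of Z X (\<iota> 0) (\<pi> 0)" using Z by (simp add: inverse_of_def)
    then show ?thesis using local_obj_iso local_ring_local_obj Zi by blast
  qed
qed

lemma ks_decomp:
  assumes "V \<in> Obj C"
  obtains Xs where "Defs.direct_sum C Xs V" "\<forall>Z\<in>set Xs. indecomposable C Z"
  using ks assms unfolding krull_schmidt_def by blast

text \<open>\<open>1 - f\<close> kills the nonzero morphism \<open>w\<close> and cannot be
  invertible. Applied to the connecting morphism of an Auslander-Reiten triangle, this turns
  endomorphisms fixing it into automorphisms.\<close>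

lemma isom_unit_kill:
  assumes X: "local_obj X" and f: "arr X X f" and w: "arr W X w" "w \<noteq> zr W X" "f \<cdot> w = w"
  shows "isom X X f"
proof (rule ccontr)
  note O = local_objD(1)[OF X]
  assume "\<not> isom X X f"
  then obtain g where g: "inverse_of X X (dif X X (idm X) f) g" using local_objD(3)[OF X f] unfolding isom_def by blast
  have d: "arr X X (dif X X (idm X) f)" using arr_dif arr_id O f by blast
  have ga: "arr X X g" using g by (simp add: inverse_of_def)
  have "dif X X (idm X) f \<cdot> w = zr W X"
    using dif_left[OF w(1) arr_id[OF O] f] id_left[OF w(1)] w(3) dif_eq_zero_iff[OF w(1) w(1)] by simp
  then have "g \<cdot> (dif X X (idm X) f \<cdot> w) = zr W X" using g zero_right[OF arrD(1)[OF w(1)]] by (simp add: inverse_of_def)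
  moreover have "g \<cdot> (dif X X (idm X) f \<cdot> w) = w"
    using assoc[OF w(1) d ga] g id_left[OF w(1)] by (simp add: inverse_of_def)
  ultimately show False using w(2) by simp
qed

text \<open>\<open>f \<cdot> l\<close> fixes the nonzero morphism \<open>f\<close>, so it is
  invertible, and \<open>f\<close> has a right inverse as well.\<close>

lemma split_mono_isom:
  assumes X: "local_obj X" and Y: "local_obj Y" and f: "arr X Y f" and l: "arr Y X l" "l \<cdot> f = idm X"
  shows "isom X Y f"
proof -
  note O = local_objD(1)[OF X] local_objD(1)[OF Y]
  have f0: "f \<noteq> zr X Y" using l zero_right[OF O(1) l(1)] local_objD(2)[OF X] by auto
  have "f \<cdot> l \<cdot> f = f" using assoc[OF f l(1) f] l(2) id_right[OF f] by simp
  then have "isom Y Y (f \<cdot> l)" using isom_unit_kill[OF Y arr_comp[OF l(1) f] f f0] by simp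
  then obtain g where g: "arr Y Y g" "f \<cdot> l \<cdot> g = idm Y" unfolding isom_def inverse_of_def by blast
  have "f \<cdot> (l \<cdot> g) = idm Y" using assoc[OF g(1) l(1) f] g by simp
  then show ?thesis using isom_of_split[OF f l arr_comp[OF g(1) l(1)]] by blast
qed

lemma split_epi_isom:
  assumes X: "local_obj X" and Y: "local_obj Y" and f: "arr X Y f" and s: "arr Y X s" "f \<cdot> s = idm Y"
  shows "isom X Y f"
proof -
  obtain t where t: "inverse_of Y X s t" using split_mono_isom[OF Y X s(1) f s(2)] unfolding isom_def by blast
  then have t: "arr X Y t" "t \<cdot> s = idm Y" "s \<cdot> t = idm X" by (auto simp: inverse_of_def)
  have "f = f \<cdot> s \<cdot> t" using assoc[OF t(1) s(1) f] t id_right[OF f] by simp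
  then have "f = t" using s id_left[OF t(1)] by simp
  then show ?thesis using t s(1) unfolding isom_def inverse_of_def by blast
qed

text \<open>Multiplication with the inverse of the sum reduces to the case \<open>a + b = 1\<close>,
  which is the definition of locality.\<close>

lemma isom_sum:
  assumes X: "local_obj X" and a: "arr X X a" and b: "arr X X b" and ab: "isom X X (pls X X a b)"
  shows "isom X X a \<or> isom X X b"
proof -
  note O = local_objD(1)[OF X]
  obtain u where u: "inverse_of X X (pls X X a b) u" using ab isom_def by blast
  then have ua: "arr X X u" "u \<cdot> pls X X a b = idm X" "pls X X a b \<cdot> u = idm X" by (auto simp: inverse_of_def)
  have iu: "isom X X (pls X X a b)" by fact
  have s: "pls X X (u \<cdot> a) (u \<cdot> b) = idm X" using pls_right[OF a b ua(1)] ua(2) by simp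
  have bk: "isom X X c" if c: "arr X X c" "isom X X (u \<cdot> c)" for c
  proof -
    have "pls X X a b \<cdot> (u \<cdot> c) = c" using assoc[OF c(1) ua(1) arr_pls[OF a b]] ua(3) id_left[OF c(1)] by simp
    then show ?thesis using isom_comp[OF c(2) iu] by simp
  qed
  interpret A: abelian_group "Mor C X X" using hom_ab[OF O O] .
  have "dif X X (idm X) (u \<cdot> a) = u \<cdot> b"
    using s arrD(3)[OF arr_comp[OF a ua(1)]] arrD(3)[OF arr_comp[OF b ua(1)]]
    by (metis A.a_comm A.add.inv_solve_right A.a_closed a_minus_def)
  then show ?thesis using local_objD(3)[OF X arr_comp[OF a ua(1)]] bk[OF a] bk[OF b] by auto
qed

section \<open>Dimensions of Hom spaces\<close>

definition hd :: "'o \<Rightarrow> 'o \<Rightarrow> nat" where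
  "hd X Y = kdim K (Mor C X Y) (H X Y)"

lemma hom_fin_indec: "indecomposable C X \<Longrightarrow> indecomposable C Y \<Longrightarrow> fin_subspace K (Mor C X Y) (H X Y)"
proof -
  assume a: "indecomposable C X" "indecomposable C Y"
  then have "Defs.fin_dim K (Mor C X Y)" using hom_fin by (simp add: hom_finite_def)
  then obtain S where S: "finite S" "S \<subseteq> H X Y"
    "\<forall>x\<in>H X Y. \<exists>a\<in>S \<rightarrow> carrier K. x = (\<Oplus>\<^bsub>Mor C X Y\<^esub>s\<in>S. a s \<odot>\<^bsub>Mor C X Y\<^esub> s)" unfolding Defs.fin_dim_def by blast
  show ?thesis
    by (rule fin_subspaceI_span[OF hom_subspace[OF indec_obj[OF a(1)] indec_obj[OF a(2)]] S(1,2)]) (use S(3) in blast)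
qed

lemma hom_post: "W \<in> Obj C \<Longrightarrow> Y \<in> Obj C \<Longrightarrow> arr Y Z h \<Longrightarrow> f \<in> H W Y \<Longrightarrow> h \<cdot> f \<in> H W Z"
  using arr_comp[of W Y f Z h] by (simp add: arr_def)

lemma hom_fin_all: assumes "X \<in> Obj C" "Y \<in> Obj C" shows "fin_subspace K (Mor C X Y) (H X Y)"
proof -
  obtain Xs where Xs0: "Defs.direct_sum C Xs X" "\<forall>Z\<in>set Xs. indecomposable C Z"
    by (rule ks_decomp[OF assms(1)])
  then obtain \<iota> \<pi> where Xs: "ds Xs X \<iota> \<pi>" "\<forall>Z\<in>set Xs. indecomposable C Z"
    unfolding direct_sum_iff by blast
  obtain Ys where Ys0: "Defs.direct_sum C Ys Y" "\<forall>Z\<in>set Ys. indecomposable C Z"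
    by (rule ks_decomp[OF assms(2)])
  then obtain \<iota>' \<pi>' where Ys: "ds Ys Y \<iota>' \<pi>'" "\<forall>Z\<in>set Ys. indecomposable C Z"
    unfolding direct_sum_iff by blast
  have "fin_subspace K (Mor C Z Y) (H Z Y)" if Z: "Z \<in> set Xs" for Z
  proof -
    have Zi: "indecomposable C Z" using Xs(2) Z by blast
    note ZO = indec_obj[OF Zi]
    have "fin_subspace K (Mor C Z Y) (H Z Y) \<and>
      kdim K (Mor C Z Y) (H Z Y) = (\<Sum>Z'\<leftarrow>Ys. kdim K (Mor C Z Z') (H Z Z'))"
    proof (rule kdim_subfunctor_direct_sum[OF Ys(1) ZO])
      show "subspace K (H Z Z') (Mor C Z Z')" if "Z' \<in> Obj C" for Z' using hom_subspace ZO that .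
      show "fin_subspace K (Mor C Z Z') (H Z Z')" if "Z' \<in> set Ys" for Z' using hom_fin_indec[OF Zi] Ys(2) that by blast
      show "h \<cdot> f \<in> H Z Z2" if "arr Z1 Z2 h" "f \<in> H Z Z1" for Z1 Z2 f h using hom_post[OF ZO arrD(1)[OF that(1)] that] .
    qed
    then show ?thesis ..
  qed
  then show ?thesis using kdim_hom_direct_sum_left[OF Xs(1) assms(2)] by blast
qed

lemma hd_direct_sum_right:
  assumes d: "Defs.direct_sum C Zs V" and W: "W \<in> Obj C"
  shows "hd W V = (\<Sum>Z\<leftarrow>Zs. hd W Z)"
proof -
  obtain \<iota> \<pi> where d: "ds Zs V \<iota> \<pi>" using d unfolding direct_sum_iff by blast
  have "fin_subspace K (Mor C W V) (H W V) \<and>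
      kdim K (Mor C W V) (H W V) = (\<Sum>Z\<leftarrow>Zs. kdim K (Mor C W Z) (H W Z))"
  proof (rule kdim_subfunctor_direct_sum[OF d W])
    show "subspace K (H W Z) (Mor C W Z)" if "Z \<in> Obj C" for Z using hom_subspace W that .
    show "fin_subspace K (Mor C W Z) (H W Z)" if "Z \<in> set Zs" for Z
      using hom_fin_all[OF W] dsD(2)[OF d] that by blast
    show "h \<cdot> f \<in> H W Z2" if "arr Z1 Z2 h" "f \<in> H W Z1" for Z1 Z2 f h using hom_post[OF W arrD(1)[OF that(1)] that] .
  qed
  then show ?thesis unfolding hd_def ..
qed

lemma hd_direct_sum_left:
  assumes d: "Defs.direct_sum C Zs V" and W: "W \<in> Obj C"
  shows "hd V W = (\<Sum>Z\<leftarrow>Zs. hd Z W)"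
proof -
  obtain \<iota> \<pi> where d: "ds Zs V \<iota> \<pi>" using d unfolding direct_sum_iff by blast
  have "fin_subspace K (Mor C Z W) (H Z W)" if "Z \<in> set Zs" for Z
    using hom_fin_all[OF _ W] dsD(2)[OF d] that by blast
  then show ?thesis unfolding hd_def using kdim_hom_direct_sum_left[OF d W] by blast
qed

text \<open>An isomorphism counts as a biproduct with one summand, so additivity over direct sums
  also yields invariance under isomorphism.\<close>

lemma direct_sum_single:
  assumes "isomorphic C V V'"
  shows "Defs.direct_sum C [V] V'"
proof -
  obtain a b where ab: "arr V V' a" "arr V' V b" "b \<cdot> a = idm V" "a \<cdot> b = idm V'"
    using assms unfolding isomorphic_iff isom_def inverse_of_def by blast
  note O = arrD(1)[OF ab(1)] arrD(1)[OF ab(2)]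
  interpret A: abelian_group "Mor C V' V'" using hom_ab[OF O(2) O(2)] .
  have "{..<length [V]} = {0}" by auto
  then have "finsum (Mor C V' V') (\<lambda>i. a \<cdot> b) {..<length [V]} = idm V'"
    using ab(4) arrD(3)[OF arr_id[OF O(2)]] by (simp add: A.r_zero)
  then have "ds [V] V' (\<lambda>_. a) (\<lambda>_. b)" unfolding ds_def using ab O by simp
  then show ?thesis unfolding direct_sum_iff by blast
qed

lemma hd_iso:
  assumes "isomorphic C X X'" "isomorphic C Y Y'"
  shows "hd X Y = hd X' Y'"
proof -
  have O: "X \<in> Obj C" "X' \<in> Obj C" "Y \<in> Obj C" "Y' \<in> Obj C" using assms by (auto simp: isomorphic_def)
  have "hd X' Y = hd X Y" using hd_direct_sum_left[OF direct_sum_single[OF assms(1)] O(3)] by simp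
  moreover have "hd X' Y' = hd X' Y" using hd_direct_sum_right[OF direct_sum_single[OF assms(2)] O(2)] by simp
  ultimately show ?thesis by simp
qed

section \<open>The radical and multiplicities of indecomposable summands\<close>

definition rad :: "'o \<Rightarrow> 'o \<Rightarrow> 'm set" where
  "rad X V = {f \<in> H X V. \<forall>g. arr V X g \<longrightarrow> \<not> isom X X (g \<cdot> f)}"

lemma zr_not_isom: "local_obj X \<Longrightarrow> \<not> isom X X (zr X X)"
  unfolding isom_def inverse_of_def using zero_right local_objD(1,2) by metis

lemma arr_smult: "a \<in> carrier K \<Longrightarrow> arr X Y f \<Longrightarrow> arr X Y (a \<odot>\<^bsub>Mor C X Y\<^esub> f)"
  using module.smult_closed[OF hom_module] by (simp add: arr_def)

lemma smult_right: "a \<in> carrier K \<Longrightarrow> arr X Y f \<Longrightarrow> arr Y Z g \<Longrightarrow> g \<cdot> (a \<odot>\<^bsub>Mor C X Y\<^esub> f) = a \<odot>\<^bsub>Mor C X Z\<^esub> (g \<cdot> f)"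
  unfolding arr_def using comp_smult_right by blast

lemma smult_left: "a \<in> carrier K \<Longrightarrow> arr X Y f \<Longrightarrow> arr Y Z g \<Longrightarrow> (a \<odot>\<^bsub>Mor C Y Z\<^esub> g) \<cdot> f = a \<odot>\<^bsub>Mor C X Z\<^esub> (g \<cdot> f)"
  unfolding arr_def using comp_smult_left by blast

lemma isom_smultD:
  assumes a: "a \<in> carrier K" and e: "arr X X e" and i: "isom X X (a \<odot>\<^bsub>Mor C X X\<^esub> e)"
  shows "isom X X e"
proof -
  obtain h where h: "arr X X h" "h \<cdot> (a \<odot>\<^bsub>Mor C X X\<^esub> e) = idm X" "(a \<odot>\<^bsub>Mor C X X\<^esub> e) \<cdot> h = idm X"
    using i unfolding isom_def inverse_of_def by blast
  have "inverse_of X X e (a \<odot>\<^bsub>Mor C X X\<^esub> h)"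
    unfolding inverse_of_def
    using e arr_smult[OF a h(1)] smult_left[OF a e h(1)] smult_right[OF a e h(1)] h(2,3)
      smult_right[OF a h(1) e] smult_left[OF a h(1) e] by simp
  then show ?thesis unfolding isom_def by blast
qed

lemma rad_subspace:
  assumes X: "local_obj X" and V: "V \<in> Obj C"
  shows "subspace K (rad X V) (Mor C X V)"
proof (rule subspaceI)
  note O = local_objD(1)[OF X]
  have ra: "arr X V f" if "f \<in> rad X V" for f using that O V by (simp add: rad_def arr_def)
  show "vectorspace K (Mor C X V)" using hom_vs O V .
  show "rad X V \<subseteq> carrier (Mor C X V)" by (auto simp: rad_def)
  show "zr X V \<in> rad X V"
    using arrD(3)[OF arr_zero[OF O V]] zero_right[OF O] zr_not_isom[OF X] by (simp add: rad_def)
  show "f \<oplus>\<^bsub>Mor C X V\<^esub> f' \<in> rad X V" if f: "f \<in> rad X V" "f' \<in> rad X V" for f f'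
  proof -
    have "\<not> isom X X (g \<cdot> pls X V f f')" if g: "arr V X g" for g
      using pls_right[OF ra[OF f(1)] ra[OF f(2)] g] isom_sum[OF X arr_comp[OF ra[OF f(1)] g] arr_comp[OF ra[OF f(2)] g]] f g
      by (auto simp: rad_def)
    then show ?thesis using arrD(3)[OF arr_pls[OF ra[OF f(1)] ra[OF f(2)]]] by (simp add: rad_def)
  qed
  show "a \<odot>\<^bsub>Mor C X V\<^esub> f \<in> rad X V" if a: "a \<in> carrier K" "f \<in> rad X V" for a f
  proof -
    have "\<not> isom X X (g \<cdot> (a \<odot>\<^bsub>Mor C X V\<^esub> f))" if g: "arr V X g" for g
      using smult_right[OF a(1) ra[OF a(2)] g] isom_smultD[OF a(1) arr_comp[OF ra[OF a(2)] g]] a(2) g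
      by (auto simp: rad_def)
    then show ?thesis using arrD(3)[OF arr_smult[OF a(1) ra[OF a(2)]]] by (simp add: rad_def)
  qed
qed

lemma rad_post:
  assumes X: "X \<in> Obj C" and h: "arr Y Z h" and f: "f \<in> rad X Y"
  shows "h \<cdot> f \<in> rad X Z"
proof -
  have fa: "arr X Y f" using f X arrD(1)[OF h] by (simp add: rad_def arr_def)
  have "\<not> isom X X (g \<cdot> (h \<cdot> f))" if g: "arr Z X g" for g
    using assoc[OF fa h g] arr_comp[OF h g] f by (auto simp: rad_def)
  then show ?thesis using arrD(3)[OF arr_comp[OF fa h]] by (simp add: rad_def)
qed

text \<open>Despite its name this is the dimension of Hom/rad, not of rad/rad^2: it counts the
  copies of \<open>X\<close> in \<open>V\<close>, each weighted by the dimension of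
  End(\<open>X\<close>) modulo its radical.\<close>

definition irr_dim :: "'o \<Rightarrow> 'o \<Rightarrow> nat" where
  "irr_dim X V = hd X V - kdim K (Mor C X V) (rad X V)"

lemma rad_fin:
  assumes X: "local_obj X" and V: "V \<in> Obj C"
  shows "fin_subspace K (Mor C X V) (rad X V)" "kdim K (Mor C X V) (rad X V) \<le> hd X V"
  using fin_subspace_subspace[OF hom_fin_all[OF local_objD(1)[OF X] V] rad_subspace[OF X V]]
  by (auto simp: rad_def hd_def)

lemma irr_dim_direct_sum:
  assumes X: "local_obj X" and d: "Defs.direct_sum C Zs V"
  shows "irr_dim X V = (\<Sum>Z\<leftarrow>Zs. irr_dim X Z)"
proof -
  obtain \<iota> \<pi> where dd: "ds Zs V \<iota> \<pi>" using d unfolding direct_sum_iff by blast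
  note XO = local_objD(1)[OF X] and D = dsD[OF dd]
  have "fin_subspace K (Mor C X V) (rad X V) \<and>
      kdim K (Mor C X V) (rad X V) = (\<Sum>Z\<leftarrow>Zs. kdim K (Mor C X Z) (rad X Z))"
  proof (rule kdim_subfunctor_direct_sum[OF dd XO])
    show "subspace K (rad X Z) (Mor C X Z)" if "Z \<in> Obj C" for Z using rad_subspace X that .
    show "fin_subspace K (Mor C X Z) (rad X Z)" if "Z \<in> set Zs" for Z using rad_fin(1)[OF X] D(2) that by blast
    show "h \<cdot> f \<in> rad X Z2" if "arr Z1 Z2 h" "f \<in> rad X Z1" for Z1 Z2 f h using rad_post[OF XO that] .
  qed
  then have "irr_dim X V = (\<Sum>Z\<leftarrow>Zs. hd X Z) - (\<Sum>Z\<leftarrow>Zs. kdim K (Mor C X Z) (rad X Z))"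
    unfolding irr_dim_def hd_direct_sum_right[OF d XO] by simp
  also have "\<dots> = (\<Sum>Z\<leftarrow>Zs. irr_dim X Z)"
  proof -
    have "set Ys \<subseteq> Obj C \<Longrightarrow> (\<Sum>Z\<leftarrow>Ys. irr_dim X Z) + (\<Sum>Z\<leftarrow>Ys. kdim K (Mor C X Z) (rad X Z)) = (\<Sum>Z\<leftarrow>Ys. hd X Z)" for Ys
    proof (induction Ys)
      case (Cons Y Ys)
      then show ?case using rad_fin(2)[OF X, of Y] by (simp add: irr_dim_def)
    qed simp
    from this[OF D(2)] show ?thesis by simp
  qed
  finally show ?thesis .
qed

text \<open>A morphism out of \<open>X\<close> that is not in the radical has a left inverse, so
  between local objects it is an isomorphism.\<close>

lemma irr_dim_indec:
  assumes X: "local_obj X" and Z: "local_obj Z"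
  shows "irr_dim X Z = (if isomorphic C X Z then irr_dim X X else 0)"
proof (cases "isomorphic C X Z")
  case True
  then show ?thesis using irr_dim_direct_sum[OF X direct_sum_single[OF True]] by simp
next
  case False
  note O = local_objD(1)[OF X] local_objD(1)[OF Z]
  have "f \<in> rad X Z" if f: "f \<in> H X Z" for f
  proof -
    have fa: "arr X Z f" using f O by (simp add: arr_def)
    have "\<not> isom X X (g \<cdot> f)" if g: "arr Z X g" for g
    proof
      assume "isom X X (g \<cdot> f)"
      then obtain h where h: "arr X X h" "h \<cdot> (g \<cdot> f) = idm X" unfolding isom_def inverse_of_def by blast
      then have "h \<cdot> g \<cdot> f = idm X" using assoc[OF fa g h(1)] by simp
      then have "isom X Z f" using split_mono_isom[OF X Z fa arr_comp[OF g h(1)]] by blast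
      then show False using False unfolding isomorphic_iff by blast
    qed
    then show ?thesis using f by (simp add: rad_def)
  qed
  then have "rad X Z = H X Z" by (auto simp: rad_def)
  then show ?thesis using False by (simp add: irr_dim_def hd_def)
qed

lemma irr_dim_pos: assumes X: "local_obj X" shows "irr_dim X X > 0"
proof (rule ccontr)
  note O = local_objD(1)[OF X]
  assume "\<not> irr_dim X X > 0"
  then have "kdim K (Mor C X X) (rad X X) = kdim K (Mor C X X) (H X X)"
    using rad_fin(2)[OF X O] by (simp add: irr_dim_def hd_def)
  then have "rad X X = H X X"
    by (intro kdim_eq_subspace[OF hom_fin_all[OF O O] rad_subspace[OF X O]]) (auto simp: rad_def)
  then have "idm X \<in> rad X X" using arrD(3)[OF arr_id[OF O]] by simp
  then show False using arr_id[OF O] id_left[OF arr_id[OF O]] isom_id[OF O] by (auto simp: rad_def)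
qed

text \<open>The left-hand side does not depend on the decomposition and the weight
  \<open>irr_dim X X\<close> is positive, so multiplicities are unique. This is the uniqueness half
  of the Krull-Schmidt theorem and justifies the definite description in
  \<open>summand_mult\<close>.\<close>

lemma irr_dim_count:
  assumes X: "indecomposable C X" and d: "Defs.direct_sum C Zs V" and Zs: "\<forall>Z\<in>set Zs. indecomposable C Z"
  shows "irr_dim X V = length (filter (isomorphic C X) Zs) * irr_dim X X"
proof -
  note l = indec_local[OF X]
  have "\<forall>Z\<in>set Ys. indecomposable C Z \<Longrightarrow> (\<Sum>Z\<leftarrow>Ys. irr_dim X Z) = length (filter (isomorphic C X) Ys) * irr_dim X X" for Ys
  proof (induction Ys)
    case (Cons Y Ys)
    then have "irr_dim X Y = (if isomorphic C X Y then irr_dim X X else 0)"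
      by (intro irr_dim_indec[OF l indec_local]) simp
    then show ?case using Cons by simp
  qed simp
  then show ?thesis using irr_dim_direct_sum[OF l d] Zs by simp
qed

lemma summand_mult_irr_dim:
  assumes X: "indecomposable C X" and V: "V \<in> Obj C"
  shows "irr_dim X V = summand_mult C X V * irr_dim X X"
proof -
  obtain Zs where Zs: "Defs.direct_sum C Zs V" "\<forall>Z\<in>set Zs. indecomposable C Z" by (rule ks_decomp[OF V])
  have "summand_mult C X V = length (filter (isomorphic C X) Zs)"
    unfolding summand_mult_def
  proof (rule the_equality)
    fix n assume "\<exists>Xs. Defs.direct_sum C Xs V \<and> (\<forall>Z\<in>set Xs. indecomposable C Z) \<and> n = length (filter (isomorphic C X) Xs)"
    then obtain Xs where Xs: "Defs.direct_sum C Xs V" "\<forall>Z\<in>set Xs. indecomposable C Z" "n = length (filter (isomorphic C X) Xs)" by blast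
    then have "n * irr_dim X X = length (filter (isomorphic C X) Zs) * irr_dim X X"
      using irr_dim_count[OF X Zs] irr_dim_count[OF X Xs(1,2)] by simp
    then show "n = length (filter (isomorphic C X) Zs)" using irr_dim_pos[OF indec_local[OF X]] by simp
  qed (use Zs in blast)
  then show ?thesis using irr_dim_count[OF X Zs] by simp
qed

lemma summand_mult_eq:
  assumes X: "indecomposable C X" and d: "Defs.direct_sum C Zs V" and Zs: "\<forall>Z\<in>set Zs. indecomposable C Z"
  shows "summand_mult C X V = length (filter (isomorphic C X) Zs)"
proof -
  have "V \<in> Obj C" using d by (simp add: Defs.direct_sum_def)
  then show ?thesis
    using summand_mult_irr_dim[OF X] irr_dim_count[OF X d Zs] irr_dim_pos[OF indec_local[OF X]] by simp
qed

text \<open>Goes through locality. For a decomposition of \<open>Y\<close>, let \<open>e\<close> be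
  the idempotent onto the first summand: one of \<open>e\<close> and \<open>1 - e\<close> is
  invertible, and each of them kills one of the two summands.\<close>

lemma indec_iso:
  assumes X: "indecomposable C X" and i: "isomorphic C X Y"
  shows "indecomposable C Y"
  unfolding indecomposable_def
proof (intro conjI ballI impI)
  obtain a b where ab: "inverse_of X Y a b" using i unfolding isomorphic_iff isom_def by blast
  have l: "local_obj Y" using local_obj_iso[OF indec_local[OF X] ab] .
  show Y: "Y \<in> Obj C" using local_objD(1)[OF l] .
  show "\<not> zero_object C Y" using local_objD(2)[OF l] zero_object_iff by blast
  fix A B assume AB: "A \<in> Obj C" "B \<in> Obj C" "Defs.direct_sum C [A, B] Y"
  then obtain \<iota> \<pi> where d: "ds [A, B] Y \<iota> \<pi>" unfolding direct_sum_iff by blast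
  note D = dsD[OF d]
  have A: "arr A Y (\<iota> 0)" "arr Y A (\<pi> 0)" "\<pi> 0 \<cdot> \<iota> 0 = idm A" "\<pi> 1 \<cdot> \<iota> 0 = zr A B"
    and B: "arr B Y (\<iota> 1)" "arr Y B (\<pi> 1)" "\<pi> 1 \<cdot> \<iota> 1 = idm B" "\<pi> 0 \<cdot> \<iota> 1 = zr B A"
    using D(3)[of 0] D(4)[of 0] D(5)[of 0] D(6)[of 0 1] D(3)[of 1] D(4)[of 1] D(5)[of 1] D(6)[of 1 0] by simp_all
  let ?e = "\<iota> 0 \<cdot> \<pi> 0"
  have e: "arr Y Y ?e" using arr_comp A by blast
  have eA: "?e \<cdot> \<iota> 0 = \<iota> 0" using assoc[OF A(1) A(2) A(1)] A(3) id_right[OF A(1)] by simp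
  have eB: "?e \<cdot> \<iota> 1 = zr B Y" using assoc[OF B(1) A(2) A(1)] B(4) zero_right[OF AB(2) A(1)] by simp
  from local_objD(3)[OF l e] show "zero_object C A \<or> zero_object C B"
  proof
    assume "isom Y Y ?e"
    then obtain g where g: "arr Y Y g" "g \<cdot> ?e = idm Y" unfolding isom_def inverse_of_def by blast
    have "\<iota> 1 = g \<cdot> (?e \<cdot> \<iota> 1)" using assoc[OF B(1) e g(1)] g(2) id_left[OF B(1)] by simp
    then have "\<iota> 1 = zr B Y" using eB zero_right[OF AB(2) g(1)] by simp
    then have "idm B = zr B B" using B(3) zero_right[OF AB(2) B(2)] by simp
    then show ?thesis using AB zero_object_iff by blast
  next
    assume "isom Y Y (dif Y Y (idm Y) ?e)"
    then obtain g where g: "arr Y Y g" "g \<cdot> dif Y Y (idm Y) ?e = idm Y" unfolding isom_def inverse_of_def by blast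
    have d0: "dif Y Y (idm Y) ?e \<cdot> \<iota> 0 = zr A Y"
      using dif_left[OF A(1) arr_id[OF Y] e] eA id_left[OF A(1)] dif_eq_zero_iff[OF A(1) A(1)] by simp
    have "\<iota> 0 = g \<cdot> (dif Y Y (idm Y) ?e \<cdot> \<iota> 0)"
      using assoc[OF A(1) arr_dif[OF arr_id[OF Y] e] g(1)] g(2) id_left[OF A(1)] by simp
    then have "\<iota> 0 = zr A Y" using d0 zero_right[OF AB(1) g(1)] by simp
    then have "idm A = zr A A" using A(3) zero_right[OF AB(1) A(2)] by simp
    then show ?thesis using AB zero_object_iff by blast
  qed
qed

text \<open>Some summand \<open>Z\<close> of \<open>X\<close> has nonzero
  \<open>irr_dim X Z\<close>, which forces an isomorphism.\<close>

lemma local_indec: "local_obj X \<Longrightarrow> \<exists>Z. indecomposable C Z \<and> isomorphic C Z X"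
proof -
  assume l: "local_obj X"
  obtain Zs where Zs: "Defs.direct_sum C Zs X" "\<forall>Z\<in>set Zs. indecomposable C Z" by (rule ks_decomp[OF local_objD(1)[OF l]])
  have "irr_dim X X = (\<Sum>Z\<leftarrow>Zs. irr_dim X Z)" using irr_dim_direct_sum[OF l Zs(1)] .
  then have "\<exists>Z\<in>set Zs. irr_dim X Z \<noteq> 0" using irr_dim_pos[OF l] by (metis (no_types, lifting) less_numeral_extra(3) sum_list_eq_0_iff image_iff list.set_map)
  then show ?thesis using irr_dim_indec[OF l indec_local] Zs(2) isomorphic_sym by metis
qed

lemma indec_iff_local: "indecomposable C X \<longleftrightarrow> local_obj X"
  using indec_local local_indec indec_iso by blast

end

section \<open>Triangulated Krull-Schmidt categories and Auslander-Reiten triangles\<close>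

locale ks_tri = triangulated_category K C
  for K :: "('k, 'r) ring_scheme" (structure) and C :: "('k, 'o, 'm, 'z) tri_cat_scheme" +
  assumes hom_fin: "hom_finite K C" and ks: "krull_schmidt C"

sublocale ks_tri \<subseteq> ks_category K C
  by unfold_locales (fact hom_fin ks)+

context ks_tri
begin

abbreviation sh where "sh \<equiv> shift C"
abbreviation sm where "sm \<equiv> shift_mor C"
abbreviation neg where "neg X Y f \<equiv> \<ominus>\<^bsub>Mor C X Y\<^esub> f"

section \<open>The shift on morphisms, isomorphisms and local objects\<close>

lemma arr_sm: "arr X Y f \<Longrightarrow> arr (sh X) (sh Y) (sm f)"
  using shift_closed shift_fully_faithful bij_betwE unfolding arr_def by blast

lemma sm_full: assumes "X \<in> Obj C" "Y \<in> Obj C" "arr (sh X) (sh Y) g" obtains f where "arr X Y f" "sm f = g"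
proof -
  have "g \<in> sm ` H X Y" using shift_fully_faithful[OF assms(1,2)] arrD(3)[OF assms(3)] by (simp add: bij_betw_def)
  then show thesis using that assms(1,2) unfolding arr_def by blast
qed

lemma sm_inj: "arr X Y f \<Longrightarrow> arr X Y g \<Longrightarrow> sm f = sm g \<Longrightarrow> f = g"
  using shift_fully_faithful[of X Y] unfolding arr_def bij_betw_def inj_on_def by blast

lemma sm_comp: "arr X Y f \<Longrightarrow> arr Y Z g \<Longrightarrow> sm (g \<cdot> f) = sm g \<cdot> sm f"
  unfolding arr_def using shift_comp by blast

lemma sm_id: "X \<in> Obj C \<Longrightarrow> sm (idm X) = idm (sh X)"
  by (rule shift_ident)

lemma sm_pls: "arr X Y f \<Longrightarrow> arr X Y g \<Longrightarrow> sm (pls X Y f g) = pls (sh X) (sh Y) (sm f) (sm g)"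
  unfolding arr_def using shift_add by blast

lemma sm_zero: assumes "X \<in> Obj C" "Y \<in> Obj C" shows "sm (zr X Y) = zr (sh X) (sh Y)"
proof -
  interpret A: abelian_group "Mor C X Y" using hom_ab assms by blast
  interpret B: abelian_group "Mor C (sh X) (sh Y)" using hom_ab assms shift_closed by blast
  have z: "arr X Y (zr X Y)" using arr_zero assms .
  have "sm (pls X Y (zr X Y) (zr X Y)) = pls (sh X) (sh Y) (sm (zr X Y)) (sm (zr X Y))" by (rule sm_pls[OF z z])
  then show ?thesis using arrD(3)[OF arr_sm[OF z]] by simp
qed

lemma sm_neg: assumes "arr X Y f" shows "sm (neg X Y f) = neg (sh X) (sh Y) (sm f)"
proof -
  interpret A: abelian_group "Mor C X Y" using hom_ab arrD[OF assms] by blast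
  interpret B: abelian_group "Mor C (sh X) (sh Y)" using hom_ab arrD[OF assms] shift_closed by blast
  have "sm (pls X Y (neg X Y f) f) = pls (sh X) (sh Y) (sm (neg X Y f)) (sm f)" by (rule sm_pls[OF arr_neg[OF assms] assms])
  then have "pls (sh X) (sh Y) (sm (neg X Y f)) (sm f) = zr (sh X) (sh Y)"
    using sm_zero[OF arrD(1,2)[OF assms]] arrD(3)[OF assms] by (simp add: A.l_neg)
  then show ?thesis
    using B.minus_equality[of "sm (neg X Y f)" "sm f"] arrD(3)[OF arr_sm[OF assms]] arrD(3)[OF arr_sm[OF arr_neg[OF assms]]] by simp
qed

lemma sm_zero_iff: "arr X Y f \<Longrightarrow> sm f = zr (sh X) (sh Y) \<longleftrightarrow> f = zr X Y"
  using sm_inj[of X Y f "zr X Y"] sm_zero[of X Y] arr_zero[of X Y] arrD(1,2)[of X Y f] by auto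

lemma inverse_of_sm:
  assumes f: "arr X Y f" and g: "arr Y X g"
  shows "inverse_of (sh X) (sh Y) (sm f) (sm g) \<longleftrightarrow> inverse_of X Y f g"
proof -
  note O = arrD(1,2)[OF f]
  have "sm g \<cdot> sm f = idm (sh X) \<longleftrightarrow> g \<cdot> f = idm X"
    using sm_comp[OF f g] sm_id[OF O(1)] sm_inj[OF arr_comp[OF f g] arr_id[OF O(1)]] by auto
  moreover have "sm f \<cdot> sm g = idm (sh Y) \<longleftrightarrow> f \<cdot> g = idm Y"
    using sm_comp[OF g f] sm_id[OF O(2)] sm_inj[OF arr_comp[OF g f] arr_id[OF O(2)]] by auto
  ultimately show ?thesis using f g arr_sm[OF f] arr_sm[OF g] by (simp add: inverse_of_def)
qed

lemma isom_sm: assumes f: "arr X Y f" shows "isom (sh X) (sh Y) (sm f) \<longleftrightarrow> isom X Y f"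
proof
  assume "isom X Y f"
  then obtain g where "inverse_of X Y f g" unfolding isom_def by blast
  then show "isom (sh X) (sh Y) (sm f)" using inverse_of_sm[OF f, of g] unfolding isom_def inverse_of_def by blast
next
  assume "isom (sh X) (sh Y) (sm f)"
  then obtain g where g: "inverse_of (sh X) (sh Y) (sm f) g" unfolding isom_def by blast
  then have "arr (sh Y) (sh X) g" by (simp add: inverse_of_def)
  then obtain g' where "arr Y X g'" "sm g' = g" using sm_full arrD[OF f] by metis
  then show "isom X Y f" using inverse_of_sm[OF f, of g'] g unfolding isom_def by blast
qed

lemma isomorphic_sh: assumes "X \<in> Obj C" "Y \<in> Obj C" shows "isomorphic C (sh X) (sh Y) \<longleftrightarrow> isomorphic C X Y"
proof
  assume "isomorphic C (sh X) (sh Y)"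
  then obtain g where g: "isom (sh X) (sh Y) g" unfolding isomorphic_iff by blast
  obtain f where "arr X Y f" "sm f = g" using sm_full[OF assms isom_arr[OF g]] .
  then show "isomorphic C X Y" using g isom_sm unfolding isomorphic_iff by blast
next
  assume "isomorphic C X Y"
  then obtain f where "isom X Y f" unfolding isomorphic_iff by blast
  then show "isomorphic C (sh X) (sh Y)" using isom_sm isom_arr unfolding isomorphic_iff by blast
qed

lemma local_obj_sh: assumes "X \<in> Obj C" shows "local_obj (sh X) \<longleftrightarrow> local_obj X"
proof -
  have d: "sm (dif X X (idm X) f) = dif (sh X) (sh X) (idm (sh X)) (sm f)" if "arr X X f" for f
    unfolding a_minus_def using sm_pls[OF arr_id[OF assms] arr_neg[OF that]] sm_neg[OF that] sm_id[OF assms] by simp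
  have da: "arr X X f \<Longrightarrow> arr X X (dif X X (idm X) f)" for f using arr_dif arr_id assms by blast
  have nz: "idm (sh X) \<noteq> zr (sh X) (sh X) \<longleftrightarrow> idm X \<noteq> zr X X"
    using sm_zero_iff[OF arr_id[OF assms]] sm_id[OF assms] by simp
  show ?thesis
  proof
    assume l: "local_obj (sh X)"
    have "isom X X f \<or> isom X X (dif X X (idm X) f)" if f: "arr X X f" for f
      using local_objD(3)[OF l arr_sm[OF f]] d[OF f] isom_sm[OF f] isom_sm[OF da[OF f]] by simp
    then show "local_obj X" using l assms nz by (simp add: local_obj_def)
  next
    assume l: "local_obj X"
    have "isom (sh X) (sh X) g \<or> isom (sh X) (sh X) (dif (sh X) (sh X) (idm (sh X)) g)" if g: "arr (sh X) (sh X) g" for g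
    proof -
      obtain f where f: "arr X X f" "sm f = g" using sm_full[OF assms assms g] .
      then show ?thesis using local_objD(3)[OF l f(1)] d[OF f(1)] isom_sm[OF f(1)] isom_sm[OF da[OF f(1)]] by simp
    qed
    then show "local_obj (sh X)" using l shift_closed[OF assms] nz by (simp add: local_obj_def)
  qed
qed

lemma indec_sh: "X \<in> Obj C \<Longrightarrow> indecomposable C (sh X) \<longleftrightarrow> indecomposable C X"
  using indec_iff_local local_obj_sh by blast

section \<open>Exactness of distinguished triangles\<close>

lemma dist_arr: assumes "Dist C X Y Z u v w" shows "arr X Y u" "arr Y Z v" "arr Z (sh X) w"
  using dist_closed[OF assms] shift_closed by (auto simp: arr_def)

lemma rot: assumes "Dist C X Y Z u v w" shows "Dist C Y Z (sh X) v w (neg (sh X) (sh Y) (sm u))"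
  using TR2[of X Y Z u v w] dist_closed[OF assms] assms by blast

lemma ex_zero: obtains Z where "zero_object C Z" "Z \<in> Obj C"
  using ex_direct_sum[of "[]"] by auto

lemma sh_zero_object: "zero_object C Z \<Longrightarrow> zero_object C (sh Z)"
  using zero_object_iff shift_closed sm_id[of Z] sm_zero[of Z Z] by simp

text \<open>Comparison with the trivial triangle \<open>X -> X -> 0\<close>: completing
  \<open>(id, u)\<close> to a map of triangles makes \<open>v \<cdot> u\<close> factor through a
  zero object.\<close>

lemma dist_comp_zero: assumes D: "Dist C X Y Z u v w" shows "v \<cdot> u = zr X Z"
proof -
  note a = dist_arr[OF D]
  obtain O0 where O: "zero_object C O0" "O0 \<in> Obj C" by (rule ex_zero)
  note X = arrD(1)[OF a(1)]
  have "idm X \<in> H X X" "u \<in> H X Y" "u \<cdot> idm X = u \<cdot> idm X" using arrD(3)[OF arr_id[OF X]] arrD(3)[OF a(1)] by auto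
  then obtain h where h: "h \<in> H O0 Z" "h \<cdot> zr X O0 = v \<cdot> u" using TR3[OF TR1_ident[OF X O(1)] D] by blast
  then show ?thesis using zero_right[OF X arrI[OF O(2) arrD(2)[OF a(2)] h(1)]] by simp
qed

text \<open>Exactness of Hom(-, \<open>N\<close>): \<open>(0, f)\<close> extends by TR3 to a map
  into the triangle \<open>0 -> N -> N\<close>, which is a rotation of the trivial one.\<close>

lemma weak_cokernel:
  assumes D: "Dist C X Y Z u v w" and f: "arr Y N f" "f \<cdot> u = zr X N"
  obtains g where "arr Z N g" "f = g \<cdot> v"
proof -
  note a = dist_arr[OF D]
  obtain O0 where O: "zero_object C O0" "O0 \<in> Obj C" by (rule ex_zero)
  note X = arrD(1)[OF a(1)] and N = arrD(2)[OF f(1)]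
  have n: "neg (sh O0) (sh N) (sm (zr O0 N)) = zr (sh O0) (sh N)"
    using sm_zero[OF O(2) N] neg_eq_zero_iff[OF arr_zero[OF shift_closed[OF O(2)] shift_closed[OF N]]] by simp
  have "Dist C N N (sh O0) (idm N) (zr N (sh O0)) (zr (sh O0) (sh N))"
    by (rule TR1_ident[OF N sh_zero_object[OF O(1)]])
  then have T: "Dist C O0 N N (zr O0 N) (idm N) (zr N (sh O0))"
    using TR2[OF O(2) N N arrD(3)[OF arr_zero[OF O(2) N]] arrD(3)[OF arr_id[OF N]] arrD(3)[OF arr_zero[OF N shift_closed[OF O(2)]]]] n by simp
  have c: "f \<cdot> u = zr O0 N \<cdot> zr X O0" using f(2) zero_left[OF N arr_zero[OF X O(2)]] by simp
  obtain h where h: "h \<in> H Z N" "h \<cdot> v = idm N \<cdot> f"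
    using TR3[OF D T arrD(3)[OF arr_zero[OF X O(2)]] arrD(3)[OF f(1)] c] by blast
  show thesis by (rule that[of h]) (use h id_left[OF f(1)] arrI[OF arrD(2)[OF a(2)] N] in auto)
qed

text \<open>The dual costs a shift: TR3 applied to \<open>N -> 0 -> N[1]\<close> produces a morphism
  \<open>N[1] -> X[1]\<close>, which full faithfulness of the shift brings back. The signs of the
  two rotations cancel.\<close>

lemma weak_kernel:
  assumes D: "Dist C X Y Z u v w" and f: "arr N Y f" "v \<cdot> f = zr N Z"
  obtains g where "arr N X g" "f = u \<cdot> g"
proof -
  note a = dist_arr[OF D]
  obtain O0 where O: "zero_object C O0" "O0 \<in> Obj C" by (rule ex_zero)
  note X = arrD(1)[OF a(1)] and N = arrD(1)[OF f(1)] and Y = arrD(2)[OF a(1)] and Z = arrD(2)[OF a(2)]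
  have T: "Dist C N O0 (sh N) (zr N O0) (zr O0 (sh N)) (neg (sh N) (sh N) (sm (idm N)))"
    by (rule rot[OF TR1_ident[OF N O(1)]])
  have c: "zr O0 Z \<cdot> zr N O0 = v \<cdot> f" using f(2) zero_left[OF Z arr_zero[OF N O(2)]] by simp
  obtain h where h: "h \<in> H (sh N) (sh X)" "sm f \<cdot> neg (sh N) (sh N) (sm (idm N)) = neg (sh X) (sh Y) (sm u) \<cdot> h"
    using TR3[OF T rot[OF D] arrD(3)[OF f(1)] arrD(3)[OF arr_zero[OF O(2) Z]] c] by blast
  have ha: "arr (sh N) (sh X) h" using h(1) shift_closed N X by (simp add: arr_def)
  obtain g where g: "arr N X g" "sm g = h" using sm_full[OF N X ha] .
  have ug: "arr N Y (u \<cdot> g)" using arr_comp[OF g(1) a(1)] .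
  have "neg (sh N) (sh Y) (sm f) = neg (sh N) (sh Y) (sm (u \<cdot> g))"
    using h(2) neg_right[OF arr_sm[OF arr_id[OF N]] arr_sm[OF f(1)]] sm_id[OF N] id_right[OF arr_sm[OF f(1)]]
      neg_left[OF ha arr_sm[OF a(1)]] sm_comp[OF g(1) a(1)] g(2) by simp
  then have "sm f = sm (u \<cdot> g)" using neg_neg[OF arr_sm[OF f(1)]] neg_neg[OF arr_sm[OF ug]] by metis
  then show thesis using that[OF g(1)] sm_inj[OF f(1) ug] by blast
qed

text \<open>The difference \<open>n = k - 1\<close> satisfies \<open>n v = 0\<close> and
  \<open>w n = 0\<close>, so \<open>n\<close> factors through \<open>w\<close> and
  \<open>n n = 0\<close>; hence \<open>1 - n\<close> inverts \<open>k = 1 + n\<close>.\<close>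

lemma dist_endo_isom:
  assumes D: "Dist C X Y Z u v w" and k: "arr Z Z k" "k \<cdot> v = v" "w \<cdot> k = w"
  shows "isom Z Z k"
proof -
  note a = dist_arr[OF D]
  note Z = arrD(2)[OF a(2)]
  interpret A: abelian_group "Mor C Z Z" using hom_ab[OF Z Z] .
  let ?n = "dif Z Z k (idm Z)"
  have n: "arr Z Z ?n" using arr_dif[OF k(1) arr_id[OF Z]] .
  have "?n \<cdot> v = zr Y Z" using dif_left[OF a(2) k(1) arr_id[OF Z]] k(2) id_left[OF a(2)] dif_eq_zero_iff[OF a(2) a(2)] by simp
  then obtain s where s: "arr (sh X) Z s" "?n = s \<cdot> w" using weak_cokernel[OF rot[OF D] n] by metis
  have "w \<cdot> ?n = zr Z (sh X)" using dif_right[OF k(1) arr_id[OF Z] a(3)] k(3) id_right[OF a(3)] dif_eq_zero_iff[OF a(3) a(3)] by simp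
  then have nn: "?n \<cdot> ?n = zr Z Z" using s assoc[OF n a(3) s(1)] zero_right[OF Z s(1)] by simp
  have kn: "arr Z Z (k \<cdot> ?n)" "arr Z Z (?n \<cdot> k)" using arr_comp n k(1) by blast+
  have "k \<cdot> ?n = ?n" using nn dif_left[OF n k(1) arr_id[OF Z]] id_left[OF n] dif_eq_zero_iff[OF kn(1) n] by simp
  moreover have "?n \<cdot> k = ?n" using nn dif_right[OF k(1) arr_id[OF Z] n] id_right[OF n] dif_eq_zero_iff[OF kn(2) n] by simp
  moreover have kk: "dif Z Z k ?n = idm Z"
    using arrD(3)[OF k(1)] arrD(3)[OF arr_id[OF Z]] unfolding A.minus_eq
    by (simp add: A.minus_add A.a_assoc[symmetric] A.r_neg)
  ultimately have "k \<cdot> dif Z Z (idm Z) ?n = idm Z" "dif Z Z (idm Z) ?n \<cdot> k = idm Z"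
    using dif_right[OF arr_id[OF Z] n k(1)] dif_left[OF k(1) arr_id[OF Z] n] id_right[OF k(1)] id_left[OF k(1)] by simp_all
  then show ?thesis unfolding isom_def inverse_of_def using k(1) arr_dif[OF arr_id[OF Z] n] by blast
qed

text \<open>TR3 gives a map of triangles in the opposite direction. Both composites are of the kind
  treated in \<open>dist_endo_isom\<close>, so \<open>h\<close> has a left and a right
  inverse.\<close>

lemma dist_five:
  assumes D: "Dist C X Y Z u v w" and D': "Dist C X' Y' Z' u' v' w'"
    and f: "isom X X' f" and g: "isom Y Y' g" and h: "arr Z Z' h"
    and c: "g \<cdot> u = u' \<cdot> f" "h \<cdot> v = v' \<cdot> g" "sm f \<cdot> w = w' \<cdot> h"
  shows "isom Z Z' h"
proof -
  note a = dist_arr[OF D] and a' = dist_arr[OF D']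
  obtain f' where f': "arr X X' f" "arr X' X f'" "f' \<cdot> f = idm X" "f \<cdot> f' = idm X'" using f unfolding isom_def inverse_of_def by blast
  obtain g' where g': "arr Y Y' g" "arr Y' Y g'" "g' \<cdot> g = idm Y" "g \<cdot> g' = idm Y'" using g unfolding isom_def inverse_of_def by blast
  have c': "g' \<cdot> u' = u \<cdot> f'"
  proof -
    have "g' \<cdot> u' = g' \<cdot> (u' \<cdot> f \<cdot> f')" using assoc[OF f'(2) f'(1) a'(1)] f'(4) id_right[OF a'(1)] by simp
    also have "\<dots> = g' \<cdot> (g \<cdot> (u \<cdot> f'))" using c(1) assoc[OF f'(2) a(1) g'(1)] by simp
    also have "\<dots> = u \<cdot> f'" using assoc[OF arr_comp[OF f'(2) a(1)] g'(1) g'(2)] g'(3) id_left[OF arr_comp[OF f'(2) a(1)]] by simp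
    finally show ?thesis .
  qed
  obtain h' where h': "h' \<in> H Z' Z" "h' \<cdot> v' = v \<cdot> g'" "sm f' \<cdot> w' = w \<cdot> h'"
    using TR3[OF D' D arrD(3)[OF f'(2)] arrD(3)[OF g'(2)] c'] by blast
  have ha': "arr Z' Z h'" using h'(1) arrD(2)[OF a(2)] arrD(2)[OF a'(2)] by (simp add: arr_def)
  have "h' \<cdot> h \<cdot> v = v" using assoc[OF a(2) h ha'] c(2) assoc[OF g'(1) a'(2) ha'] h'(2) assoc[OF g'(1) g'(2) a(2)] g'(3) id_right[OF a(2)] by simp
  moreover have "w \<cdot> (h' \<cdot> h) = w"
    using assoc[OF h ha' a(3)] h'(3) assoc[OF h a'(3) arr_sm[OF f'(2)]] c(3) assoc[OF a(3) arr_sm[OF f'(1)] arr_sm[OF f'(2)]]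
      sm_comp[OF f'(1,2)] f'(3) sm_id[OF arrD(1)[OF f'(1)]] id_left[OF a(3)] by simp
  ultimately have 1: "isom Z Z (h' \<cdot> h)" using dist_endo_isom[OF D arr_comp[OF h ha']] by blast
  have "h \<cdot> h' \<cdot> v' = v'" using assoc[OF a'(2) ha' h] h'(2) assoc[OF g'(2) a(2) h] c(2) assoc[OF g'(2) g'(1) a'(2)] g'(4) id_right[OF a'(2)] by simp
  moreover have "w' \<cdot> (h \<cdot> h') = w'"
    using assoc[OF ha' h a'(3)] c(3) assoc[OF ha' a(3) arr_sm[OF f'(1)]] h'(3) assoc[OF a'(3) arr_sm[OF f'(2)] arr_sm[OF f'(1)]]
      sm_comp[OF f'(2,1)] f'(4) sm_id[OF arrD(2)[OF f'(1)]] id_left[OF a'(3)] by simp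
  ultimately have 2: "isom Z' Z' (h \<cdot> h')" using dist_endo_isom[OF D' arr_comp[OF ha' h]] by blast
  obtain p where p: "arr Z Z p" "p \<cdot> (h' \<cdot> h) = idm Z" using 1 unfolding isom_def inverse_of_def by blast
  obtain q where q: "arr Z' Z' q" "h \<cdot> h' \<cdot> q = idm Z'" using 2 unfolding isom_def inverse_of_def by blast
  show ?thesis
    by (rule isom_of_split[OF h arr_comp[OF ha' p(1)] _ arr_comp[OF q(1) ha']])
      (use assoc[OF h ha' p(1)] p(2) assoc[OF q(1) ha' h] q(2) in simp_all)
qed

text \<open>\<open>e\<close> is the fibre of \<open>s\<close>: in the triangle
  \<open>E -> A -> B\<close> the morphism \<open>s\<close> is a weak cokernel of \<open>e\<close>.
  The shift is only an equivalence, so the cone of \<open>s\<close> must first be replaced by an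
  isomorphic shifted object.\<close>

lemma ex_kernel:
  assumes s: "arr A B s"
  obtains E e where "arr E A e" "s \<cdot> e = zr E B"
    "\<And>N g. arr A N g \<Longrightarrow> g \<cdot> e = zr E N \<Longrightarrow> \<exists>g'. arr B N g' \<and> g = g' \<cdot> s"
proof -
  note O = arrD(1,2)[OF s]
  obtain Z b c where D: "Dist C A B Z s b c" using TR1_cone[OF O arrD(3)[OF s]] by blast
  note a = dist_arr[OF D] and D2 = rot[OF rot[OF D]]
  obtain E where E: "E \<in> Obj C" "isomorphic C (sh E) Z" using shift_ess_surj arrD(2)[OF a(2)] by blast
  obtain t t' where t: "arr (sh E) Z t" "arr Z (sh E) t'" "t' \<cdot> t = idm (sh E)" "t \<cdot> t' = idm Z"
    using E(2) unfolding isomorphic_iff isom_def inverse_of_def by blast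
  obtain e where e: "arr E A e" "sm e = c \<cdot> t" using sm_full[OF E(1) O(1) arr_comp[OF t(1) a(3)]] .
  have sc: "neg (sh A) (sh B) (sm s) \<cdot> c = zr Z (sh B)" using dist_comp_zero[OF D2] .
  then have "neg Z (sh B) (sm s \<cdot> c) = zr Z (sh B)" using neg_left[OF a(3) arr_sm[OF s]] by simp
  then have sc0: "sm s \<cdot> c = zr Z (sh B)" using neg_eq_zero_iff[OF arr_comp[OF a(3) arr_sm[OF s]]] by simp
  have "sm (s \<cdot> e) = zr (sh E) (sh B)"
    using sm_comp[OF e(1) s] e(2) assoc[OF t(1) a(3) arr_sm[OF s]] sc0 zero_left[OF _ t(1), of "sh B"] shift_closed[OF O(2)] by simp
  then have se: "s \<cdot> e = zr E B" using sm_zero_iff[OF arr_comp[OF e(1) s]] by simp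
  have "\<exists>g'. arr B N g' \<and> g = g' \<cdot> s" if g: "arr A N g" "g \<cdot> e = zr E N" for N g
  proof -
    note NO = arrD(2)[OF g(1)]
    have "sm g \<cdot> (c \<cdot> t) = zr (sh E) (sh N)" using sm_comp[OF e(1) g(1)] g(2) e(2) sm_zero[OF E(1) NO] by simp
    then have "sm g \<cdot> c \<cdot> t \<cdot> t' = zr Z (sh N)"
      using assoc[OF t(1) a(3) arr_sm[OF g(1)]] zero_left[OF shift_closed[OF NO] t(2)] by simp
    then have "sm g \<cdot> c = zr Z (sh N)"
      using assoc[OF t(2) t(1) arr_comp[OF a(3) arr_sm[OF g(1)]]] t(4) id_right[OF arr_comp[OF a(3) arr_sm[OF g(1)]]] by simp
    then obtain g1 where g1: "arr (sh B) (sh N) g1" "sm g = g1 \<cdot> neg (sh A) (sh B) (sm s)"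
      using weak_cokernel[OF D2 arr_sm[OF g(1)]] by metis
    obtain g2 where g2: "arr B N g2" "sm g2 = g1" using sm_full[OF O(2) NO g1(1)] .
    have "sm g = sm (neg B N g2 \<cdot> s)"
      using g1(2) g2 neg_right[OF arr_sm[OF s] g1(1)] sm_comp[OF s arr_neg[OF g2(1)]] sm_neg[OF g2(1)] neg_left[OF arr_sm[OF s] g1(1)] by simp
    then show ?thesis using sm_inj[OF g(1) arr_comp[OF s arr_neg[OF g2(1)]]] arr_neg[OF g2(1)] by blast
  qed
  then show thesis using that[OF e(1) se] by blast
qed

end

section \<open>Almost split properties and Serre duality\<close>

context ks_tri
begin

lemma ARD:
  assumes "AR_triangle C U V W u v w"
  shows "Dist C U V W u v w" "indecomposable C U" "indecomposable C W" "w \<noteq> zr W (sh U)"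
    "arr U V u" "arr V W v" "arr W (sh U) w" "local_obj U" "local_obj W" "local_obj (sh U)"
proof -
  show D: "Dist C U V W u v w" and U: "indecomposable C U" and W: "indecomposable C W" and "w \<noteq> zr W (sh U)"
    using assms by (auto simp: AR_triangle_def)
  show "arr U V u" "arr V W v" "arr W (sh U) w" using dist_arr[OF D] .
  show "local_obj U" "local_obj W" "local_obj (sh U)"
    using indec_local[OF U] indec_local[OF W] local_obj_sh[OF indec_obj[OF U]] by auto
qed

text \<open>A section \<open>s\<close> of \<open>f\<close> gives \<open>w = w f s\<close>, so
  \<open>w f\<close> cannot vanish; without a section \<open>f\<close> factors through
  \<open>v\<close>, and \<open>w v = 0\<close>. Lifting questions at \<open>W\<close> thus become
  vanishing questions for \<open>w\<close>.\<close>

lemma AR_right: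
  assumes A: "AR_triangle C U V W u v w" and f: "arr X W f"
  shows "w \<cdot> f = zr X (sh U) \<longleftrightarrow> \<not> (\<exists>s. arr W X s \<and> f \<cdot> s = idm W)"
proof
  note D = ARD[OF A]
  assume z: "w \<cdot> f = zr X (sh U)"
  show "\<not> (\<exists>s. arr W X s \<and> f \<cdot> s = idm W)"
  proof
    assume "\<exists>s. arr W X s \<and> f \<cdot> s = idm W"
    then obtain s where s: "arr W X s" "f \<cdot> s = idm W" by blast
    have "w = w \<cdot> f \<cdot> s" using assoc[OF s(1) f D(7)] s(2) id_right[OF D(7)] by simp
    then show False using z zero_left[OF arrD(2)[OF D(7)] s(1)] D(4) by simp
  qed
next
  note D = ARD[OF A]
  assume "\<not> (\<exists>s. arr W X s \<and> f \<cdot> s = idm W)"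
  then have "\<not> split_epi C X W f" using split_epi_iff[OF f] by blast
  then obtain g where g: "g \<in> H X V" "f = v \<cdot> g" using A arrD[OF f] unfolding AR_triangle_def by blast
  have ga: "arr X V g" using g(1) arrD(1)[OF f] arrD(1)[OF D(6)] by (simp add: arr_def)
  have "w \<cdot> v = zr V (sh U)" using dist_comp_zero[OF rot[OF D(1)]] .
  then show "w \<cdot> f = zr X (sh U)" using g(2) assoc[OF ga D(6,7)] zero_left[OF arrD(2)[OF D(7)] ga] by simp
qed

lemma AR_factor:
  assumes A: "AR_triangle C U V W u v w" and f: "arr X W f" "\<not> (\<exists>s. arr W X s \<and> f \<cdot> s = idm W)"
  obtains g where "arr X V g" "f = v \<cdot> g"
  using AR_right[OF A f(1)] f weak_kernel[OF rot[OF ARD(1)[OF A]] f(1)] by blast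

text \<open>The definition of an Auslander-Reiten triangle contains the lifting property at
  \<open>W\<close> only; this is the dual one at \<open>U\<close>, shifted. If \<open>c w\<close> is
  nonzero, its fibre \<open>e\<close> is not a split epimorphism, so \<open>w e = 0\<close> and
  \<open>w = f c w\<close> for some \<open>f\<close>. Then \<open>f c\<close> fixes
  \<open>w\<close>, is invertible, and \<open>c\<close> splits.\<close>

lemma AR_left:
  assumes A: "AR_triangle C U V W u v w" and c: "arr (sh U) Z c"
  shows "c \<cdot> w = zr W Z \<longleftrightarrow> \<not> (\<exists>l. arr Z (sh U) l \<and> l \<cdot> c = idm (sh U))"
proof
  note D = ARD[OF A]
  assume z: "c \<cdot> w = zr W Z"
  show "\<not> (\<exists>l. arr Z (sh U) l \<and> l \<cdot> c = idm (sh U))"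
  proof
    assume "\<exists>l. arr Z (sh U) l \<and> l \<cdot> c = idm (sh U)"
    then obtain l where l: "arr Z (sh U) l" "l \<cdot> c = idm (sh U)" by blast
    have "w = l \<cdot> (c \<cdot> w)" using assoc[OF D(7) c l(1)] l(2) id_left[OF D(7)] by simp
    then show False using z zero_right[OF arrD(1)[OF D(7)] l(1)] D(4) by simp
  qed
next
  note D = ARD[OF A]
  assume n: "\<not> (\<exists>l. arr Z (sh U) l \<and> l \<cdot> c = idm (sh U))"
  show "c \<cdot> w = zr W Z"
  proof (rule ccontr)
    assume nz: "c \<cdot> w \<noteq> zr W Z"
    have s: "arr W Z (c \<cdot> w)" using arr_comp[OF D(7) c] .
    obtain E e where e: "arr E W e" "c \<cdot> w \<cdot> e = zr E Z"
      "\<And>N g. arr W N g \<Longrightarrow> g \<cdot> e = zr E N \<Longrightarrow> \<exists>g'. arr Z N g' \<and> g = g' \<cdot> (c \<cdot> w)"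
      using ex_kernel[OF s] by metis
    have "\<not> (\<exists>t. arr W E t \<and> e \<cdot> t = idm W)"
    proof
      assume "\<exists>t. arr W E t \<and> e \<cdot> t = idm W"
      then obtain t where t: "arr W E t" "e \<cdot> t = idm W" by blast
      have "c \<cdot> w = c \<cdot> w \<cdot> e \<cdot> t" using assoc[OF t(1) e(1) s] t(2) id_right[OF s] by simp
      then show False using e(2) zero_left[OF arrD(2)[OF s] t(1)] nz by simp
    qed
    then have "w \<cdot> e = zr E (sh U)" using AR_right[OF A e(1)] by blast
    then obtain f where f: "arr Z (sh U) f" "w = f \<cdot> (c \<cdot> w)" using e(3)[OF D(7)] by blast
    have fc: "arr (sh U) (sh U) (f \<cdot> c)" using arr_comp[OF c f(1)] .
    have "f \<cdot> c \<cdot> w = w" using assoc[OF D(7) c f(1)] f(2) by simp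
    then have "isom (sh U) (sh U) (f \<cdot> c)" using isom_unit_kill[OF D(10) fc D(7,4)] by blast
    then obtain h where h: "arr (sh U) (sh U) h" "h \<cdot> (f \<cdot> c) = idm (sh U)" unfolding isom_def inverse_of_def by blast
    have "h \<cdot> f \<cdot> c = idm (sh U)" using assoc[OF c f(1) h(1)] h(2) by simp
    then show False using n arr_comp[OF f(1) h(1)] by blast
  qed
qed

text \<open>Serre duality at \<open>W\<close>; the pairing is composition followed by a functional not vanishing on \<open>w\<close>.\<close>
lemma AR_serre:
  assumes A: "AR_triangle C U V W u v w" and Y: "Y \<in> Obj C"
  shows "hd W Y = hd Y (sh U)"
proof -
  note D = ARD[OF A]
  note W = arrD(1)[OF D(7)] and S = arrD(2)[OF D(7)]
  obtain l where l: "\<And>x. x \<in> H W (sh U) \<Longrightarrow> l x \<in> carrier K"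
    "\<And>x y. x \<in> H W (sh U) \<Longrightarrow> y \<in> H W (sh U) \<Longrightarrow> l (pls W (sh U) x y) = l x \<oplus>\<^bsub>K\<^esub> l y"
    "\<And>a x. a \<in> carrier K \<Longrightarrow> x \<in> H W (sh U) \<Longrightarrow> l (a \<odot>\<^bsub>Mor C W (sh U)\<^esub> x) = a \<otimes>\<^bsub>K\<^esub> l x" "l w \<noteq> \<zero>\<^bsub>K\<^esub>"
    using ex_functional[OF hom_fin_all[OF W S] arrD(3)[OF D(7)] D(4)] by blast
  have aW: "arr W Y f" if "f \<in> H W Y" for f using that W Y by (simp add: arr_def)
  have aS: "arr Y (sh U) g" if "g \<in> H Y (sh U)" for g using that S Y by (simp add: arr_def)
  have comp: "g \<cdot> f \<in> H W (sh U)" if "f \<in> H W Y" "g \<in> H Y (sh U)" for f g using arrD(3)[OF arr_comp[OF aW aS]] that by blast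
  have bil: "\<And>f g. f \<in> H W Y \<Longrightarrow> g \<in> H Y (sh U) \<Longrightarrow> l (g \<cdot> f) \<in> carrier K"
    "\<And>f f' g. f \<in> H W Y \<Longrightarrow> f' \<in> H W Y \<Longrightarrow> g \<in> H Y (sh U) \<Longrightarrow> l (g \<cdot> pls W Y f f') = l (g \<cdot> f) \<oplus>\<^bsub>K\<^esub> l (g \<cdot> f')"
    "\<And>a f g. a \<in> carrier K \<Longrightarrow> f \<in> H W Y \<Longrightarrow> g \<in> H Y (sh U) \<Longrightarrow> l (g \<cdot> (a \<odot>\<^bsub>Mor C W Y\<^esub> f)) = a \<otimes>\<^bsub>K\<^esub> l (g \<cdot> f)"
    "\<And>f g g'. f \<in> H W Y \<Longrightarrow> g \<in> H Y (sh U) \<Longrightarrow> g' \<in> H Y (sh U) \<Longrightarrow> l (pls Y (sh U) g g' \<cdot> f) = l (g \<cdot> f) \<oplus>\<^bsub>K\<^esub> l (g' \<cdot> f)"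
    "\<And>a f g. a \<in> carrier K \<Longrightarrow> f \<in> H W Y \<Longrightarrow> g \<in> H Y (sh U) \<Longrightarrow> l ((a \<odot>\<^bsub>Mor C Y (sh U)\<^esub> g) \<cdot> f) = a \<otimes>\<^bsub>K\<^esub> l (g \<cdot> f)"
    subgoal using l(1) comp by blast
    subgoal using l(2)[OF comp comp] pls_right[OF aW aW aS] by simp
    subgoal using l(3)[OF _ comp] smult_right[OF _ aW aS] by simp
    subgoal using l(2)[OF comp comp] pls_left[OF aW aS aS] by simp
    subgoal using l(3)[OF _ comp] smult_left[OF _ aW aS] by simp
    done
  have "hd W Y \<le> hd Y (sh U)"
    unfolding hd_def
  proof (rule kdim_pairing_le[OF field_axioms hom_fin_all[OF W Y] hom_fin_all[OF Y S], of "\<lambda>f g. l (g \<cdot> f)"])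
    fix f assume f: "f \<in> H W Y" "\<forall>g\<in>H Y (sh U). l (g \<cdot> f) = \<zero>\<^bsub>K\<^esub>"
    show "f = zr W Y"
    \<comment> \<open>A nonzero \<open>f\<close> divides \<open>w\<close>: its fibre
      \<open>e\<close> is not a split epimorphism, so \<open>w e = 0\<close> and
      \<open>w = g f\<close> for some \<open>g\<close>. The functional does not vanish at this
      product.\<close>
    proof (rule ccontr)
      assume nz: "f \<noteq> zr W Y"
      note fa = aW[OF f(1)]
      obtain E e where e: "arr E W e" "f \<cdot> e = zr E Y"
        "\<And>N g. arr W N g \<Longrightarrow> g \<cdot> e = zr E N \<Longrightarrow> \<exists>g'. arr Y N g' \<and> g = g' \<cdot> f"
        using ex_kernel[OF fa] by metis
      have "\<not> (\<exists>t. arr W E t \<and> e \<cdot> t = idm W)"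
      proof
        assume "\<exists>t. arr W E t \<and> e \<cdot> t = idm W"
        then obtain t where t: "arr W E t" "e \<cdot> t = idm W" by blast
        have "f = f \<cdot> e \<cdot> t" using assoc[OF t(1) e(1) fa] t(2) id_right[OF fa] by simp
        then show False using e(2) zero_left[OF Y t(1)] nz by simp
      qed
      then have "w \<cdot> e = zr E (sh U)" using AR_right[OF A e(1)] by blast
      then obtain g where "arr Y (sh U) g" "w = g \<cdot> f" using e(3)[OF D(7)] by blast
      then show False using f(2) l(4) arrD(3) by blast
    qed
  qed (fact bil)+
  moreover have "hd Y (sh U) \<le> hd W Y"
    unfolding hd_def
  proof (rule kdim_pairing_le[OF field_axioms hom_fin_all[OF Y S] hom_fin_all[OF W Y], of "\<lambda>g f. l (g \<cdot> f)"])
    fix g assume g: "g \<in> H Y (sh U)" "\<forall>f\<in>H W Y. l (g \<cdot> f) = \<zero>\<^bsub>K\<^esub>"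
    show "g = zr Y (sh U)"
    \<comment> \<open>Dually, a nonzero \<open>g\<close> divides \<open>w\<close>: the morphism from
      \<open>U[1]\<close> to the cone of \<open>g\<close> is not a split monomorphism, so it kills
      \<open>w\<close>, which then factors through \<open>g\<close>.\<close>
    proof (rule ccontr)
      assume nz: "g \<noteq> zr Y (sh U)"
      note ga = aS[OF g(1)]
      obtain Z c d where T: "Dist C Y (sh U) Z g c d" using TR1_cone[OF Y S g(1)] by blast
      note a = dist_arr[OF T]
      have "\<not> (\<exists>t. arr Z (sh U) t \<and> t \<cdot> c = idm (sh U))"
      proof
        assume "\<exists>t. arr Z (sh U) t \<and> t \<cdot> c = idm (sh U)"
        then obtain t where t: "arr Z (sh U) t" "t \<cdot> c = idm (sh U)" by blast
        have "g = t \<cdot> (c \<cdot> g)" using assoc[OF ga a(2) t(1)] t(2) id_left[OF ga] by simp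
        then show False using dist_comp_zero[OF T] zero_right[OF Y t(1)] nz by simp
      qed
      then have "c \<cdot> w = zr W Z" using AR_left[OF A a(2)] by blast
      then obtain f where "arr W Y f" "w = g \<cdot> f" using weak_kernel[OF T D(7)] by blast
      then show False using g(2) l(4) arrD(3) by blast
    qed
  qed (use bil in blast)+
  ultimately show ?thesis by simp
qed

lemma hd_sh: assumes "X \<in> Obj C" "Y \<in> Obj C" shows "hd (sh X) (sh Y) = hd X Y"
proof -
  have "kdim K (Mor C (sh X) (sh Y)) (sm ` H X Y) = kdim K (Mor C X Y) (H X Y)"
  proof (rule kdim_linear_image[OF hom_fin_all[OF assms] hom_vs[OF shift_closed[OF assms(1)] shift_closed[OF assms(2)]]])
    have a: "arr X Y f" if "f \<in> H X Y" for f using that assms by (simp add: arr_def)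
    show "sm f \<in> carrier (Mor C (sh X) (sh Y))" if "f \<in> H X Y" for f using arrD(3)[OF arr_sm[OF a[OF that]]] .
    show "sm (pls X Y f g) = pls (sh X) (sh Y) (sm f) (sm g)" if "f \<in> H X Y" "g \<in> H X Y" for f g
      using sm_pls[OF a a] that .
    show "sm (c \<odot>\<^bsub>Mor C X Y\<^esub> f) = c \<odot>\<^bsub>Mor C (sh X) (sh Y)\<^esub> sm f" if "c \<in> carrier K" "f \<in> H X Y" for c f
      using shift_smult[OF assms that] .
    show "f = zr X Y" if "f \<in> H X Y" "sm f = zr (sh X) (sh Y)" for f
      using sm_zero_iff[OF a[OF that(1)]] that(2) by simp
  qed
  moreover have "sm ` H X Y = H (sh X) (sh Y)" using shift_fully_faithful[OF assms] by (simp add: bij_betw_def)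
  ultimately show ?thesis by (simp add: hd_def)
qed

text \<open>Serre duality at both triangles identifies the dimensions of Hom(\<open>W\<close>,
  \<open>W'\<close>), Hom(\<open>W'\<close>, \<open>U[1]\<close>) and Hom(\<open>U[1]\<close>,
  \<open>U'[1]\<close>).\<close>

lemma AR_tau_hd:
  assumes A: "AR_triangle C U V W u v w" and B: "AR_triangle C U' V' W' u' v' w'"
  shows "hd U U' = hd W W'"
proof -
  note D = ARD[OF A] and E = ARD[OF B]
  have O: "U \<in> Obj C" "U' \<in> Obj C" "W' \<in> Obj C" "sh U \<in> Obj C"
    using local_objD(1) D(8,10) E(8,9) by blast+
  have "hd W W' = hd W' (sh U)" by (rule AR_serre[OF A O(3)])
  also have "\<dots> = hd (sh U) (sh U')" by (rule AR_serre[OF B O(4)])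
  also have "\<dots> = hd U U'" by (rule hd_sh[OF O(1,2)])
  finally show ?thesis ..
qed

text \<open>Hom(\<open>M\<close>, -) makes the triangle short exact unless \<open>M\<close> is
  special. The last map fails to be onto only if some \<open>M -> W\<close> is an isomorphism; the
  kernel of the first map consists of composites of \<open>w\<close> with morphisms
  \<open>M[1] -> W\<close>, which vanish unless one of these is an isomorphism.\<close>

lemma AR_mesh_cov:
  assumes A: "AR_triangle C U V W u v w" and M: "indecomposable C M"
    and n: "\<not> isomorphic C M W" "\<not> isomorphic C (sh M) W"
  shows "hd M V = hd M U + hd M W"
proof -
  note D = ARD[OF A]
  note l = indec_local[OF M]
  note MO = local_objD(1)[OF l] and O = arrD(1)[OF D(5)] arrD(2)[OF D(5)] arrD(2)[OF D(6)]
  have aV: "arr M V f" if "f \<in> H M V" for f using that MO O by (simp add: arr_def)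
  have aU: "arr M U f" if "f \<in> H M U" for f using that MO O by (simp add: arr_def)
  have "kdim K (Mor C M V) (H M V) = kdim K (Mor C M U) (H M U) + kdim K (Mor C M W) ((\<lambda>f. v \<cdot> f) ` H M V)"
  proof (rule kdim_exact[OF hom_fin_all[OF MO O(2)] hom_fin_all[OF MO O(1)] hom_vs[OF MO O(3)], where J = "\<lambda>f. u \<cdot> f"])
    show "v \<cdot> x \<in> H M W" if "x \<in> H M V" for x using arrD(3)[OF arr_comp[OF aV[OF that] D(6)]] .
    show "v \<cdot> pls M V x y = pls M W (v \<cdot> x) (v \<cdot> y)" if "x \<in> H M V" "y \<in> H M V" for x y using pls_right[OF aV aV D(6)] that .
    show "v \<cdot> (a \<odot>\<^bsub>Mor C M V\<^esub> x) = a \<odot>\<^bsub>Mor C M W\<^esub> (v \<cdot> x)" if "a \<in> carrier K" "x \<in> H M V" for a x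
      using smult_right[OF that(1) aV[OF that(2)] D(6)] .
    show "u \<cdot> x \<in> H M V" if "x \<in> H M U" for x using arrD(3)[OF arr_comp[OF aU[OF that] D(5)]] .
    show "u \<cdot> pls M U x y = pls M V (u \<cdot> x) (u \<cdot> y)" if "x \<in> H M U" "y \<in> H M U" for x y using pls_right[OF aU aU D(5)] that .
    show "u \<cdot> (a \<odot>\<^bsub>Mor C M U\<^esub> x) = a \<odot>\<^bsub>Mor C M V\<^esub> (u \<cdot> x)" if "a \<in> carrier K" "x \<in> H M U" for a x
      using smult_right[OF that(1) aU[OF that(2)] D(5)] .
    show "f = zr M U" if f: "f \<in> H M U" "u \<cdot> f = zr M V" for f
    proof -
      note fa = aU[OF f(1)]
      have "sm u \<cdot> sm f = zr (sh M) (sh V)" using sm_comp[OF fa D(5)] f(2) sm_zero[OF MO O(2)] by simp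
      then have "neg (sh U) (sh V) (sm u) \<cdot> sm f = zr (sh M) (sh V)"
        using neg_left[OF arr_sm[OF fa] arr_sm[OF D(5)]] neg_eq_zero_iff[OF arr_zero[OF shift_closed[OF MO] shift_closed[OF O(2)]]] by simp
      then obtain g where g: "arr (sh M) W g" "sm f = w \<cdot> g" using weak_kernel[OF rot[OF rot[OF D(1)]] arr_sm[OF fa]] by blast
      have "\<not> (\<exists>s. arr W (sh M) s \<and> g \<cdot> s = idm W)"
        using split_epi_isom[OF _ D(9) g(1)] local_obj_sh[OF MO] l n(2) unfolding isomorphic_iff by blast
      then have "sm f = zr (sh M) (sh U)" using AR_right[OF A g(1)] g(2) by simp
      then show ?thesis using sm_zero_iff[OF fa] by simp
    qed
    show "(\<lambda>f. u \<cdot> f) ` H M U = {x \<in> H M V. v \<cdot> x = zr M W}"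
    proof
      show "(\<lambda>f. u \<cdot> f) ` H M U \<subseteq> {x \<in> H M V. v \<cdot> x = zr M W}"
      proof
        fix y assume "y \<in> (\<lambda>f. u \<cdot> f) ` H M U"
        then obtain f where f: "f \<in> H M U" "y = u \<cdot> f" by blast
        have "v \<cdot> (u \<cdot> f) = zr M W" using assoc[OF aU[OF f(1)] D(5,6)] dist_comp_zero[OF D(1)] zero_left[OF O(3) aU[OF f(1)]] by simp
        then show "y \<in> {x \<in> H M V. v \<cdot> x = zr M W}" using f arrD(3)[OF arr_comp[OF aU[OF f(1)] D(5)]] by simp
      qed
      show "{x \<in> H M V. v \<cdot> x = zr M W} \<subseteq> (\<lambda>f. u \<cdot> f) ` H M U"
      proof
        fix x assume x: "x \<in> {x \<in> H M V. v \<cdot> x = zr M W}"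
        then have x1: "x \<in> H M V" and x2: "v \<cdot> x = zr M W" by auto
        obtain g where "arr M U g" "x = u \<cdot> g" using weak_kernel[OF D(1) aV[OF x1] x2] .
        then show "x \<in> (\<lambda>f. u \<cdot> f) ` H M U" using arrD(3) by blast
      qed
    qed
  qed
  moreover have "(\<lambda>f. v \<cdot> f) ` H M V = H M W"
  proof
    show "(\<lambda>f. v \<cdot> f) ` H M V \<subseteq> H M W" using arrD(3)[OF arr_comp[OF aV D(6)]] by blast
    show "H M W \<subseteq> (\<lambda>f. v \<cdot> f) ` H M V"
    proof
      fix f assume "f \<in> H M W"
      then have f: "arr M W f" using MO O by (simp add: arr_def)
      have "\<not> (\<exists>s. arr W M s \<and> f \<cdot> s = idm W)"
        using split_epi_isom[OF l D(9) f] n(1) unfolding isomorphic_iff by blast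
      then obtain g where "arr M V g" "f = v \<cdot> g" by (rule AR_factor[OF A f])
      then show "f \<in> (\<lambda>f. v \<cdot> f) ` H M V" using arrD(3) by blast
    qed
  qed
  ultimately show ?thesis by (simp add: hd_def)
qed

text \<open>The exceptional objects are now \<open>U\<close> and \<open>U[1]\<close>: extension
  along \<open>u\<close> fails only at split monomorphisms out of \<open>U\<close>, and the kernel
  of composition with \<open>v\<close> consists of composites of \<open>w\<close> with morphisms
  \<open>U[1] -> Y\<close>.\<close>

lemma AR_mesh_contra:
  assumes A: "AR_triangle C U V W u v w" and Y: "indecomposable C Y"
    and n: "\<not> isomorphic C U Y" "\<not> isomorphic C (sh U) Y"
  shows "hd V Y = hd U Y + hd W Y"
proof -
  note D = ARD[OF A]
  note l = indec_local[OF Y]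
  note YO = local_objD(1)[OF l] and O = arrD(1)[OF D(5)] arrD(2)[OF D(5)] arrD(2)[OF D(6)]
  have aV: "arr V Y f" if "f \<in> H V Y" for f using that YO O by (simp add: arr_def)
  have aW: "arr W Y f" if "f \<in> H W Y" for f using that YO O by (simp add: arr_def)
  have "kdim K (Mor C V Y) (H V Y) = kdim K (Mor C W Y) (H W Y) + kdim K (Mor C U Y) ((\<lambda>f. f \<cdot> u) ` H V Y)"
  proof (rule kdim_exact[OF hom_fin_all[OF O(2) YO] hom_fin_all[OF O(3) YO] hom_vs[OF O(1) YO], where J = "\<lambda>f. f \<cdot> v"])
    show "x \<cdot> u \<in> H U Y" if "x \<in> H V Y" for x using arrD(3)[OF arr_comp[OF D(5) aV[OF that]]] .
    show "pls V Y x y \<cdot> u = pls U Y (x \<cdot> u) (y \<cdot> u)" if "x \<in> H V Y" "y \<in> H V Y" for x y using pls_left[OF D(5) aV aV] that .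
    show "(a \<odot>\<^bsub>Mor C V Y\<^esub> x) \<cdot> u = a \<odot>\<^bsub>Mor C U Y\<^esub> (x \<cdot> u)" if "a \<in> carrier K" "x \<in> H V Y" for a x
      using smult_left[OF that(1) D(5) aV[OF that(2)]] .
    show "x \<cdot> v \<in> H V Y" if "x \<in> H W Y" for x using arrD(3)[OF arr_comp[OF D(6) aW[OF that]]] .
    show "pls W Y x y \<cdot> v = pls V Y (x \<cdot> v) (y \<cdot> v)" if "x \<in> H W Y" "y \<in> H W Y" for x y using pls_left[OF D(6) aW aW] that .
    show "(a \<odot>\<^bsub>Mor C W Y\<^esub> x) \<cdot> v = a \<odot>\<^bsub>Mor C V Y\<^esub> (x \<cdot> v)" if "a \<in> carrier K" "x \<in> H W Y" for a x
      using smult_left[OF that(1) D(6) aW[OF that(2)]] .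
    show "g = zr W Y" if g: "g \<in> H W Y" "g \<cdot> v = zr V Y" for g
    proof -
      obtain h where h: "arr (sh U) Y h" "g = h \<cdot> w" using weak_cokernel[OF rot[OF D(1)] aW[OF g(1)] g(2)] .
      have "\<not> (\<exists>t. arr Y (sh U) t \<and> t \<cdot> h = idm (sh U))"
        using split_mono_isom[OF D(10) l h(1)] n(2) unfolding isomorphic_iff by blast
      then show ?thesis using AR_left[OF A h(1)] h(2) by simp
    qed
    show "(\<lambda>f. f \<cdot> v) ` H W Y = {x \<in> H V Y. x \<cdot> u = zr U Y}"
    proof
      show "(\<lambda>f. f \<cdot> v) ` H W Y \<subseteq> {x \<in> H V Y. x \<cdot> u = zr U Y}"
      proof
        fix y assume "y \<in> (\<lambda>f. f \<cdot> v) ` H W Y"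
        then obtain f where f: "f \<in> H W Y" "y = f \<cdot> v" by blast
        have "f \<cdot> v \<cdot> u = zr U Y" using assoc[OF D(5,6) aW[OF f(1)]] dist_comp_zero[OF D(1)] zero_right[OF O(1) aW[OF f(1)]] by simp
        then show "y \<in> {x \<in> H V Y. x \<cdot> u = zr U Y}" using f arrD(3)[OF arr_comp[OF D(6) aW[OF f(1)]]] by simp
      qed
      show "{x \<in> H V Y. x \<cdot> u = zr U Y} \<subseteq> (\<lambda>f. f \<cdot> v) ` H W Y"
      proof
        fix x assume x: "x \<in> {x \<in> H V Y. x \<cdot> u = zr U Y}"
        then have x1: "x \<in> H V Y" and x2: "x \<cdot> u = zr U Y" by auto
        obtain g where "arr W Y g" "x = g \<cdot> v" using weak_cokernel[OF D(1) aV[OF x1] x2] .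
        then show "x \<in> (\<lambda>f. f \<cdot> v) ` H W Y" using arrD(3) by blast
      qed
    qed
  qed
  moreover have "(\<lambda>f. f \<cdot> u) ` H V Y = H U Y"
  proof
    show "(\<lambda>f. f \<cdot> u) ` H V Y \<subseteq> H U Y" using arrD(3)[OF arr_comp[OF D(5) aV]] by blast
    show "H U Y \<subseteq> (\<lambda>f. f \<cdot> u) ` H V Y"
    proof
      fix f assume "f \<in> H U Y"
      then have f: "arr U Y f" using YO O by (simp add: arr_def)
      have sf: "arr (sh U) (sh Y) (sm f)" using arr_sm[OF f] .
      have "\<not> (\<exists>t. arr (sh Y) (sh U) t \<and> t \<cdot> sm f = idm (sh U))"
        using split_mono_isom[OF D(10) _ sf] local_obj_sh[OF YO] l isom_sm[OF f] n(1) unfolding isomorphic_iff by blast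
      then have "sm f \<cdot> w = zr W (sh Y)" using AR_left[OF A sf] by simp
      then obtain g where g: "arr (sh V) (sh Y) g" "sm f = g \<cdot> neg (sh U) (sh V) (sm u)"
        using weak_cokernel[OF rot[OF rot[OF D(1)]] sf] by blast
      obtain g' where g': "arr V Y g'" "sm g' = g" using sm_full[OF O(2) YO g(1)] .
      have "sm f = sm (neg V Y g' \<cdot> u)"
        using g g' neg_right[OF arr_sm[OF D(5)] g(1)] sm_comp[OF D(5) arr_neg[OF g'(1)]] sm_neg[OF g'(1)] neg_left[OF arr_sm[OF D(5)] g(1)] by simp
      then have "f = neg V Y g' \<cdot> u" using sm_inj[OF f arr_comp[OF D(5) arr_neg[OF g'(1)]]] by blast
      then show "f \<in> (\<lambda>f. f \<cdot> u) ` H V Y" using arrD(3)[OF arr_neg[OF g'(1)]] by blast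
    qed
  qed
  ultimately show ?thesis by (simp add: hd_def)
qed

text \<open>The isomorphism \<open>a\<close> of the end terms satisfies \<open>w' a v = 0\<close>,
  so \<open>w' a = b w\<close> for some \<open>b\<close>. As this is nonzero, \<open>b\<close> is a
  split monomorphism between local objects, hence an isomorphism, and the middle terms follow from
  \<open>dist_five\<close>.\<close>

lemma AR_unique:
  assumes A: "AR_triangle C U V W u v w" and B: "AR_triangle C U' V' W' u' v' w'" and i: "isomorphic C W W'"
  shows "isomorphic C U U'" "isomorphic C V V'"
proof -
  note D = ARD[OF A] and E = ARD[OF B]
  obtain a where ia: "isom W W' a" using i unfolding isomorphic_iff by blast
  obtain a' where a: "arr W W' a" "arr W' W a'" "a' \<cdot> a = idm W" "a \<cdot> a' = idm W'" using ia unfolding isom_def inverse_of_def by blast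
  note O = arrD(1)[OF D(5)] arrD(2)[OF D(5)] arrD(1)[OF E(5)] arrD(2)[OF E(5)]
  have av: "arr V W' (a \<cdot> v)" and wa: "arr W (sh U') (w' \<cdot> a)" using arr_comp D(6) a(1) E(7) by blast+
  have "\<not> (\<exists>s. arr W' V s \<and> a \<cdot> v \<cdot> s = idm W')"
  proof
    assume "\<exists>s. arr W' V s \<and> a \<cdot> v \<cdot> s = idm W'"
    then obtain s where s: "arr W' V s" "a \<cdot> v \<cdot> s = idm W'" by blast
    have "a \<cdot> (v \<cdot> s) = idm W'" using s assoc[OF s(1) D(6) a(1)] by simp
    then have "v \<cdot> s = a'" using assoc[OF arr_comp[OF s(1) D(6)] a(1,2)] a(3) id_left[OF arr_comp[OF s(1) D(6)]] id_right[OF a(2)] by simp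
    then have "v \<cdot> (s \<cdot> a) = idm W" using assoc[OF a(1) s(1) D(6)] a(3) by simp
    moreover have "w \<cdot> v = zr V (sh U)" using dist_comp_zero[OF rot[OF D(1)]] .
    ultimately show False using AR_right[OF A D(6)] arr_comp[OF a(1) s(1)] by blast
  qed
  then have "w' \<cdot> a \<cdot> v = zr V (sh U')" using AR_right[OF B av] assoc[OF D(6) a(1) E(7)] by simp
  then obtain b where b: "arr (sh U) (sh U') b" "w' \<cdot> a = b \<cdot> w" using weak_cokernel[OF rot[OF D(1)] wa] by blast
  have "b \<cdot> w \<noteq> zr W (sh U')"
  proof
    assume "b \<cdot> w = zr W (sh U')"
    then have "w' \<cdot> a \<cdot> a' = zr W' (sh U')" using b(2) zero_left[OF arrD(2)[OF E(7)] a(2)] by simp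
    then show False using assoc[OF a(2,1) E(7)] a(4) id_right[OF E(7)] E(4) by simp
  qed
  then obtain l where "arr (sh U') (sh U) l" "l \<cdot> b = idm (sh U)" using AR_left[OF A b(1)] by blast
  then have ib: "isom (sh U) (sh U') b" using split_mono_isom[OF D(10) E(10) b(1)] by blast
  then show "isomorphic C U U'" using isomorphic_sh[OF O(1,3)] unfolding isomorphic_iff by blast
  \<comment> \<open>Two rotations put \<open>V[1]\<close> in third position, where
    \<open>TR3\<close> supplies a morphism and \<open>dist_five\<close> makes it invertible.\<close>
  obtain h where h: "h \<in> H (sh V) (sh V')"
    "h \<cdot> neg (sh U) (sh V) (sm u) = neg (sh U') (sh V') (sm u') \<cdot> b"
    "sm a \<cdot> neg (sh V) (sh W) (sm v) = neg (sh V') (sh W') (sm v') \<cdot> h"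
    using TR3[OF rot[OF rot[OF D(1)]] rot[OF rot[OF E(1)]] arrD(3)[OF a(1)] arrD(3)[OF b(1)] b(2)[symmetric]] by blast
  have ha: "arr (sh V) (sh V') h" using h(1) shift_closed O by (simp add: arr_def)
  have "isom (sh V) (sh V') h"
    by (rule dist_five[OF rot[OF rot[OF D(1)]] rot[OF rot[OF E(1)]] ia ib ha b(2)[symmetric] h(2,3)])
  then show "isomorphic C V V'" using isomorphic_sh[OF O(2,4)] unfolding isomorphic_iff by blast
qed

text \<open>Completing \<open>(t, 1)\<close> to a map of triangles gives an endomorphism of
  \<open>U[1]\<close> that fixes \<open>w\<close>, hence an isomorphism; then \<open>t\<close> is
  one by the five lemma. In other words, \<open>v\<close> is right minimal.\<close>

lemma AR_minimal:
  assumes A: "AR_triangle C U V W u v w" and t: "arr V V t" "v \<cdot> t = v"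
  shows "isom V V t"
proof -
  note D = ARD[OF A]
  note W = arrD(2)[OF D(6)]
  have c: "idm W \<cdot> v = v \<cdot> t" using t(2) id_left[OF D(6)] by simp
  obtain h where h: "h \<in> H (sh U) (sh U)" "h \<cdot> w = w \<cdot> idm W" "sm t \<cdot> neg (sh U) (sh V) (sm u) = neg (sh U) (sh V) (sm u) \<cdot> h"
    using TR3[OF rot[OF D(1)] rot[OF D(1)] arrD(3)[OF t(1)] arrD(3)[OF arr_id[OF W]] c] by blast
  have hw: "h \<cdot> w = w" using h(2) id_right[OF D(7)] by simp
  have ha: "arr (sh U) (sh U) h" using h(1) arrD(2)[OF D(7)] by (simp add: arr_def)
  have ih: "isom (sh U) (sh U) h" by (rule isom_unit_kill[OF D(10) ha D(7,4) hw])
  have st: "arr (sh V) (sh V) (sm t)" using arr_sm[OF t(1)] .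
  have sv: "sm (idm W) \<cdot> neg (sh V) (sh W) (sm v) = neg (sh V) (sh W) (sm v) \<cdot> sm t"
    using sm_id[OF W] id_left[OF arr_neg[OF arr_sm[OF D(6)]]] neg_left[OF st arr_sm[OF D(6)]] sm_comp[OF t(1) D(6)] t(2) by simp
  have "isom (sh V) (sh V) (sm t)"
    by (rule dist_five[OF rot[OF rot[OF D(1)]] rot[OF rot[OF D(1)]] isom_id[OF W] ih st h(2) h(3) sv])
  then show ?thesis using isom_sm[OF t(1)] by simp
qed

text \<open>In a factorisation \<open>h g\<close> of a component of \<open>v\<close> where
  \<open>h\<close> is not a split epimorphism, \<open>h = v k\<close> for some \<open>k\<close>.
  Minimality of \<open>v\<close> then makes \<open>g\<close> a split monomorphism.\<close>

lemma AR_summand_irreducible: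
  assumes A: "AR_triangle C U V W u v w" and d: "ds Zs V \<iota> \<pi>" and i: "i < length Zs" "indecomposable C (Zs ! i)"
  shows "irreducible_mor C (Zs ! i) W (v \<cdot> \<iota> i)"
proof -
  note D = ARD[OF A] and E = dsD[OF d]
  let ?Z = "Zs ! i" and ?f = "v \<cdot> \<iota> i"
  note io = E(3)[OF i(1)] and pi = E(4)[OF i(1)] and lZ = indec_local[OF i(2)]
  have f: "arr ?Z W ?f" using arr_comp[OF io D(6)] .
  have wv: "w \<cdot> v = zr V (sh U)" using dist_comp_zero[OF rot[OF D(1)]] .
  have nse: "\<not> (\<exists>s. arr W ?Z s \<and> ?f \<cdot> s = idm W)"
    using AR_right[OF A f] assoc[OF io D(6,7)] wv zero_left[OF arrD(2)[OF D(7)] io] by simp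
  have "\<not> split_mono C ?Z W ?f"
  proof
    assume "split_mono C ?Z W ?f"
    then have "isom ?Z W ?f" using split_mono_isom[OF lZ D(9) f] unfolding split_mono_iff[OF f] by blast
    then show False using nse unfolding isom_def inverse_of_def by blast
  qed
  moreover have "\<not> split_epi C ?Z W ?f" using nse split_epi_iff[OF f] by blast
  moreover have "split_mono C ?Z N g \<or> split_epi C N W h" if N: "N \<in> Obj C" "g \<in> H ?Z N" "h \<in> H N W" and e: "?f = h \<cdot> g" for N g h
  proof (cases "split_epi C N W h")
    case False
    have g: "arr ?Z N g" and h: "arr N W h" using N arrD[OF f] by (auto simp: arr_def)
    have "\<not> (\<exists>s. arr W N s \<and> h \<cdot> s = idm W)" using False split_epi_iff[OF h] by blast
    then obtain k where k: "arr N V k" "h = v \<cdot> k" by (rule AR_factor[OF A h])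
    let ?e = "\<iota> i \<cdot> \<pi> i" and ?m = "k \<cdot> g \<cdot> \<pi> i"
    have kg: "arr ?Z V (k \<cdot> g)" using arr_comp[OF g k(1)] .
    have ea: "arr V V ?e" and ma: "arr V V ?m" using arr_comp[OF pi io] arr_comp[OF pi kg] .
    let ?d = "dif V V ?m ?e"
    have da: "arr V V ?d" using arr_dif[OF ma ea] .
    \<comment> \<open>\<open>?t\<close> is the identity with its restriction to the chosen summand
      replaced by \<open>k \<cdot> g\<close>. It satisfies \<open>v t = v\<close>, so it is
      invertible, and its inverse yields a left inverse of \<open>g\<close>.\<close>
    let ?t = "pls V V (idm V) ?d"
    have ta: "arr V V ?t" using arr_pls[OF arr_id[OF E(1)] da] .
    have vm: "v \<cdot> ?m = v \<cdot> ?e"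
      using assoc[OF pi kg D(6)] assoc[OF g k(1) D(6)] k(2) e assoc[OF pi io D(6)] by simp
    have ve: "arr V W (v \<cdot> ?e)" using arr_comp[OF ea D(6)] .
    have vd: "v \<cdot> ?d = zr V W" using dif_right[OF ma ea D(6)] vm dif_eq_zero_iff[OF ve ve] by simp
    interpret P: abelian_group "Mor C V W" using hom_ab arrD[OF D(6)] by blast
    have "v \<cdot> ?t = v" using pls_right[OF arr_id[OF E(1)] da D(6)] vd id_right[OF D(6)] arrD(3)[OF D(6)] by simp
    then have "isom V V ?t" by (rule AR_minimal[OF A ta])
    then obtain q where q: "arr V V q" "q \<cdot> ?t = idm V" unfolding isom_def inverse_of_def by blast
    have "?m \<cdot> \<iota> i = k \<cdot> g" "?e \<cdot> \<iota> i = \<iota> i"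
      using assoc[OF io pi kg] assoc[OF io pi io] E(5)[OF i(1)] id_right[OF kg] id_right[OF io] by simp_all
    then have "?t \<cdot> \<iota> i = pls ?Z V (\<iota> i) (dif ?Z V (k \<cdot> g) (\<iota> i))"
      using pls_left[OF io arr_id[OF E(1)] da] dif_left[OF io ma ea] id_left[OF io] by simp
    then have tio: "?t \<cdot> \<iota> i = k \<cdot> g" using pls_dif_cancel[OF kg io] by simp
    let ?l = "\<pi> i \<cdot> q \<cdot> k"
    have qk: "arr N V (q \<cdot> k)" using arr_comp[OF k(1) q(1)] .
    have piq: "arr V ?Z (\<pi> i \<cdot> q)" using arr_comp[OF q(1) pi] .
    have "?l \<cdot> g = \<pi> i \<cdot> q \<cdot> (?t \<cdot> \<iota> i)" using assoc[OF g k(1) piq] tio by simp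
    also have "\<dots> = \<pi> i \<cdot> (q \<cdot> ?t) \<cdot> \<iota> i" using assoc[OF io ta piq] assoc[OF ta q(1) pi] by simp
    also have "\<dots> = idm ?Z" using q(2) id_right[OF pi] E(5)[OF i(1)] by simp
    finally have "split_mono C ?Z N g" unfolding split_mono_iff[OF g] using arr_comp[OF k(1) piq] by blast
    then show ?thesis ..
  qed simp
  ultimately show ?thesis unfolding irreducible_mor_def using arrD(3)[OF f] by blast
qed

text \<open>Three rotations shift a triangle and change the sign of each morphism. In the lifting
  property the test object is first replaced by an isomorphic shifted one.\<close>

lemma AR_shift:
  assumes A: "AR_triangle C U V W u v w"
  shows "\<exists>u' v' w'. AR_triangle C (sh U) (sh V) (sh W) u' v' w'"
proof -
  note D = ARD[OF A]
  note O = arrD(1)[OF D(5)] arrD(2)[OF D(5)] arrD(2)[OF D(6)]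
  let ?u = "neg (sh U) (sh V) (sm u)" and ?v = "neg (sh V) (sh W) (sm v)" and ?w = "neg (sh W) (sh (sh U)) (sm w)"
  have "?w \<noteq> zr (sh W) (sh (sh U))"
    using neg_eq_zero_iff[OF arr_sm[OF D(7)]] sm_zero_iff[OF D(7)] D(4) by simp
  moreover have "\<exists>g\<in>H X (sh V). f = ?v \<cdot> g" if X: "X \<in> Obj C" "f \<in> H X (sh W)" and ns: "\<not> split_epi C X (sh W) f" for X f
  proof -
    have f: "arr X (sh W) f" using X shift_closed O by (simp add: arr_def)
    obtain X' where X': "X' \<in> Obj C" "isomorphic C (sh X') X" using shift_ess_surj X(1) by blast
    obtain t t' where t: "arr (sh X') X t" "arr X (sh X') t'" "t' \<cdot> t = idm (sh X')" "t \<cdot> t' = idm X"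
      using X'(2) unfolding isomorphic_iff isom_def inverse_of_def by blast
    obtain f' where f': "arr X' W f'" "sm f' = f \<cdot> t" using sm_full[OF X'(1) O(3) arr_comp[OF t(1) f]] .
    have "\<not> (\<exists>s. arr W X' s \<and> f' \<cdot> s = idm W)"
    proof
      assume "\<exists>s. arr W X' s \<and> f' \<cdot> s = idm W"
      then obtain s where s: "arr W X' s" "f' \<cdot> s = idm W" by blast
      have "f \<cdot> (t \<cdot> sm s) = idm (sh W)"
        using assoc[OF arr_sm[OF s(1)] t(1) f] f'(2) sm_comp[OF s(1) f'(1)] s(2) sm_id[OF O(3)] by simp
      then show False using ns split_epi_iff[OF f] arr_comp[OF arr_sm[OF s(1)] t(1)] by blast
    qed
    then obtain g where g: "arr X' V g" "f' = v \<cdot> g" by (rule AR_factor[OF A f'(1)])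
    have gt: "arr X (sh V) (sm g \<cdot> t')" using arr_comp[OF t(2) arr_sm[OF g(1)]] .
    have "f = sm f' \<cdot> t'" using f'(2) assoc[OF t(2,1) f] t(4) id_right[OF f] by simp
    also have "\<dots> = sm v \<cdot> (sm g \<cdot> t')" using g(2) sm_comp[OF g(1) D(6)] assoc[OF t(2) arr_sm[OF g(1)] arr_sm[OF D(6)]] by simp
    also have "\<dots> = ?v \<cdot> neg X (sh V) (sm g \<cdot> t')"
      using neg_right[OF gt arr_neg[OF arr_sm[OF D(6)]]] neg_left[OF gt arr_sm[OF D(6)]] neg_neg[OF arr_comp[OF gt arr_sm[OF D(6)]]] by simp
    finally show ?thesis using arrD(3)[OF arr_neg[OF gt]] by blast
  qed
  moreover have "Dist C (sh U) (sh V) (sh W) ?u ?v ?w" using rot[OF rot[OF rot[OF D(1)]]] .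
  ultimately have "AR_triangle C (sh U) (sh V) (sh W) ?u ?v ?w"
    unfolding AR_triangle_def using indec_sh[OF O(1)] indec_sh[OF O(3)] D(2,3) by blast
  then show ?thesis by blast
qed

section \<open>Irreducible morphisms under isomorphism and shift\<close>

lemma split_mono_sm: assumes "arr X Y f" shows "split_mono C (sh X) (sh Y) (sm f) \<longleftrightarrow> split_mono C X Y f"
proof -
  note O = arrD(1,2)[OF assms]
  have e: "sm l \<cdot> sm f = idm (sh X) \<longleftrightarrow> l \<cdot> f = idm X" if l: "arr Y X l" for l
    using sm_comp[OF assms l] sm_id[OF O(1)] sm_inj[OF arr_comp[OF assms l] arr_id[OF O(1)]] by auto
  have "(\<exists>l. arr (sh Y) (sh X) l \<and> l \<cdot> sm f = idm (sh X)) \<longleftrightarrow> (\<exists>l. arr Y X l \<and> l \<cdot> f = idm X)"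
    using e arr_sm sm_full[OF O(2,1)] by metis
  then show ?thesis unfolding split_mono_iff[OF assms] split_mono_iff[OF arr_sm[OF assms]] .
qed

lemma split_epi_sm: assumes "arr X Y f" shows "split_epi C (sh X) (sh Y) (sm f) \<longleftrightarrow> split_epi C X Y f"
proof -
  note O = arrD(1,2)[OF assms]
  have e: "sm f \<cdot> sm l = idm (sh Y) \<longleftrightarrow> f \<cdot> l = idm Y" if l: "arr Y X l" for l
    using sm_comp[OF l assms] sm_id[OF O(2)] sm_inj[OF arr_comp[OF l assms] arr_id[OF O(2)]] by auto
  have "(\<exists>l. arr (sh Y) (sh X) l \<and> sm f \<cdot> l = idm (sh Y)) \<longleftrightarrow> (\<exists>l. arr Y X l \<and> f \<cdot> l = idm Y)"
    using e arr_sm sm_full[OF O(2,1)] by metis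
  then show ?thesis unfolding split_epi_iff[OF assms] split_epi_iff[OF arr_sm[OF assms]] .
qed

lemma irreducible_arr: "irreducible_mor C X Y f \<Longrightarrow> X \<in> Obj C \<Longrightarrow> Y \<in> Obj C \<Longrightarrow> arr X Y f"
  by (simp add: irreducible_mor_def arr_def)

lemma irreducible_iso:
  assumes f: "arr X Y f" and ir: "irreducible_mor C X Y f"
    and a: "inverse_of X X' a a'" and b: "inverse_of Y Y' b b'"
  shows "irreducible_mor C X' Y' (b \<cdot> f \<cdot> a')"
proof -
  have a: "arr X X' a" "arr X' X a'" "a' \<cdot> a = idm X" "a \<cdot> a' = idm X'"
    and b: "arr Y Y' b" "arr Y' Y b'" "b' \<cdot> b = idm Y" "b \<cdot> b' = idm Y'" using a b by (auto simp: inverse_of_def)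
  let ?f = "b \<cdot> f \<cdot> a'"
  have bf: "arr X Y' (b \<cdot> f)" using arr_comp[OF f b(1)] .
  have fa: "arr X' Y' ?f" using arr_comp[OF a(2) bf] .
  have fe: "b' \<cdot> ?f \<cdot> a = f"
  proof -
    have "?f \<cdot> a = b \<cdot> f" using assoc[OF a(1,2) bf] a(3) id_right[OF bf] by simp
    then show ?thesis using assoc[OF a(1) fa b(2)] assoc[OF f b(1,2)] b(3) id_left[OF f] by simp
  qed
  have fe': "b' \<cdot> (?f \<cdot> a) = f" using fe assoc[OF a(1) fa b(2)] by simp
  have "\<not> split_mono C X' Y' ?f"
  proof
    assume "split_mono C X' Y' ?f"
    then obtain l where l: "arr Y' X' l" "l \<cdot> ?f = idm X'" unfolding split_mono_iff[OF fa] by blast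
    have "a' \<cdot> l \<cdot> b \<cdot> f = idm X"
    proof -
      have al: "arr Y' X (a' \<cdot> l)" using arr_comp[OF l(1) a(2)] .
      have "a' \<cdot> l \<cdot> b \<cdot> f = a' \<cdot> (l \<cdot> (b \<cdot> f))" using assoc[OF f b(1) al] assoc[OF bf l(1) a(2)] by simp
      also have "b \<cdot> f = ?f \<cdot> a" using assoc[OF a(1,2) bf] a(3) id_right[OF bf] by simp
      finally show ?thesis using assoc[OF a(1) fa l(1)] l(2) id_left[OF a(1)] a(3) by simp
    qed
    then have "split_mono C X Y f" unfolding split_mono_iff[OF f] using arr_comp[OF b(1) arr_comp[OF l(1) a(2)]] by blast
    then show False using ir by (simp add: irreducible_mor_def)
  qed
  moreover have "\<not> split_epi C X' Y' ?f"
  proof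
    assume "split_epi C X' Y' ?f"
    then obtain s where s: "arr Y' X' s" "?f \<cdot> s = idm Y'" unfolding split_epi_iff[OF fa] by blast
    have as: "arr Y' X (a' \<cdot> s)" using arr_comp[OF s(1) a(2)] .
    have "b \<cdot> (f \<cdot> (a' \<cdot> s)) = idm Y'" using assoc[OF as f b(1)] assoc[OF s(1) a(2) bf] s(2) by simp
    then have "f \<cdot> (a' \<cdot> s) = b'" using assoc[OF arr_comp[OF as f] b(1,2)] b(3) id_left[OF arr_comp[OF as f]] id_right[OF b(2)] by simp
    then have "f \<cdot> (a' \<cdot> s \<cdot> b) = idm Y" using assoc[OF b(1) as f] b(3) by simp
    then have "split_epi C X Y f" unfolding split_epi_iff[OF f] using arr_comp[OF b(1) as] by blast
    then show False using ir by (simp add: irreducible_mor_def)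
  qed
  moreover have "split_mono C X' N g \<or> split_epi C N Y' h" if N: "N \<in> Obj C" "g \<in> H X' N" "h \<in> H N Y'" and e: "?f = h \<cdot> g" for N g h
  proof -
    have g: "arr X' N g" and h: "arr N Y' h" using N arrD[OF fa] by (auto simp: arr_def)
    have ga: "arr X N (g \<cdot> a)" and bh: "arr N Y (b' \<cdot> h)" using arr_comp[OF a(1) g] arr_comp[OF h b(2)] .
    have "f = b' \<cdot> h \<cdot> (g \<cdot> a)" using fe' e assoc[OF ga h b(2)] assoc[OF a(1) g h] by simp
    then have "split_mono C X N (g \<cdot> a) \<or> split_epi C N Y (b' \<cdot> h)"
      using ir N(1) arrD(3)[OF ga] arrD(3)[OF bh] unfolding irreducible_mor_def by blast
    then show ?thesis
    proof
      assume "split_mono C X N (g \<cdot> a)"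
      then obtain l where l: "arr N X l" "l \<cdot> (g \<cdot> a) = idm X" unfolding split_mono_iff[OF ga] by blast
      have lg: "arr X' X (l \<cdot> g)" using arr_comp[OF g l(1)] .
      have "l \<cdot> g = a'" using l(2) assoc[OF a(1) g l(1)] assoc[OF a(2,1) lg] a(4) id_right[OF lg] id_left[OF a(2)] by simp
      then have "a \<cdot> l \<cdot> g = idm X'" using assoc[OF g l(1) a(1)] a(4) by simp
      then show ?thesis unfolding split_mono_iff[OF g] using arr_comp[OF l(1) a(1)] by blast
    next
      assume "split_epi C N Y (b' \<cdot> h)"
      then obtain s where s: "arr Y N s" "b' \<cdot> h \<cdot> s = idm Y" unfolding split_epi_iff[OF bh] by blast
      have hs: "arr Y Y' (h \<cdot> s)" using arr_comp[OF s(1) h] .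
      have "b' \<cdot> (h \<cdot> s) = idm Y" using s(2) assoc[OF s(1) h b(2)] by simp
      then have "h \<cdot> s = b" using assoc[OF hs b(2,1)] b(4) id_left[OF hs] id_right[OF b(1)] by simp
      then have "h \<cdot> (s \<cdot> b') = idm Y'" using assoc[OF b(2) s(1) h] b(4) by simp
      then show ?thesis unfolding split_epi_iff[OF h] using arr_comp[OF b(2) s(1)] by blast
    qed
  qed
  ultimately show ?thesis unfolding irreducible_mor_def using arrD(3)[OF fa] by blast
qed

lemma irreducible_sm:
  assumes f: "arr X Y f"
  shows "irreducible_mor C (sh X) (sh Y) (sm f) \<longleftrightarrow> irreducible_mor C X Y f"
proof
  assume ir: "irreducible_mor C (sh X) (sh Y) (sm f)"
  have "split_mono C X N g \<or> split_epi C N Y h" if N: "N \<in> Obj C" "g \<in> H X N" "h \<in> H N Y" and e: "f = h \<cdot> g" for N g h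
  proof -
    have g: "arr X N g" and h: "arr N Y h" using N arrD[OF f] by (auto simp: arr_def)
    have "sm f = sm h \<cdot> sm g" using e sm_comp[OF g h] by simp
    then have "split_mono C (sh X) (sh N) (sm g) \<or> split_epi C (sh N) (sh Y) (sm h)"
      using ir shift_closed[OF N(1)] arrD(3)[OF arr_sm[OF g]] arrD(3)[OF arr_sm[OF h]] unfolding irreducible_mor_def by blast
    then show ?thesis using split_mono_sm[OF g] split_epi_sm[OF h] by blast
  qed
  then show "irreducible_mor C X Y f"
    using ir split_mono_sm[OF f] split_epi_sm[OF f] arrD(3)[OF f] unfolding irreducible_mor_def by blast
next
  assume ir: "irreducible_mor C X Y f"
  note fs = arr_sm[OF f]
  have "split_mono C (sh X) N g \<or> split_epi C N (sh Y) h" if N: "N \<in> Obj C" "g \<in> H (sh X) N" "h \<in> H N (sh Y)" and e: "sm f = h \<cdot> g" for N g h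
  proof -
    have g: "arr (sh X) N g" and h: "arr N (sh Y) h" using N arrD[OF fs] by (auto simp: arr_def)
    \<comment> \<open>The intermediate object need not itself be a shift; it is only isomorphic to
      one.\<close>
    obtain N' where N': "N' \<in> Obj C" "isomorphic C (sh N') N" using shift_ess_surj N(1) by blast
    obtain t t' where t: "arr (sh N') N t" "arr N (sh N') t'" "t' \<cdot> t = idm (sh N')" "t \<cdot> t' = idm N"
      using N'(2) unfolding isomorphic_iff isom_def inverse_of_def by blast
    obtain g' where g': "arr X N' g'" "sm g' = t' \<cdot> g" using sm_full[OF arrD(1)[OF f] N'(1) arr_comp[OF g t(2)]] .
    obtain h' where h': "arr N' Y h'" "sm h' = h \<cdot> t" using sm_full[OF N'(1) arrD(2)[OF f] arr_comp[OF t(1) h]] .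
    have "sm (h' \<cdot> g') = h \<cdot> (t \<cdot> (t' \<cdot> g))" using sm_comp[OF g'(1) h'(1)] g'(2) h'(2) assoc[OF arr_comp[OF g t(2)] t(1) h] by simp
    also have "t \<cdot> (t' \<cdot> g) = g" using assoc[OF g t(2,1)] t(4) id_left[OF g] by simp
    finally have "f = h' \<cdot> g'" using e sm_inj[OF f arr_comp[OF g'(1) h'(1)]] by simp
    then have "split_mono C X N' g' \<or> split_epi C N' Y h'"
      using ir N'(1) arrD(3)[OF g'(1)] arrD(3)[OF h'(1)] unfolding irreducible_mor_def by blast
    then have "split_mono C (sh X) (sh N') (t' \<cdot> g) \<or> split_epi C (sh N') (sh Y) (h \<cdot> t)"
      using split_mono_sm[OF g'(1)] split_epi_sm[OF h'(1)] g'(2) h'(2) by simp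
    then show ?thesis
    proof
      assume "split_mono C (sh X) (sh N') (t' \<cdot> g)"
      then obtain l where l: "arr (sh N') (sh X) l" "l \<cdot> (t' \<cdot> g) = idm (sh X)" unfolding split_mono_iff[OF arr_comp[OF g t(2)]] by blast
      have "l \<cdot> t' \<cdot> g = idm (sh X)" using l(2) assoc[OF g t(2) l(1)] by simp
      then show ?thesis unfolding split_mono_iff[OF g] using arr_comp[OF t(2) l(1)] by blast
    next
      assume "split_epi C (sh N') (sh Y) (h \<cdot> t)"
      then obtain s where s: "arr (sh Y) (sh N') s" "h \<cdot> t \<cdot> s = idm (sh Y)" unfolding split_epi_iff[OF arr_comp[OF t(1) h]] by blast
      have "h \<cdot> (t \<cdot> s) = idm (sh Y)" using s(2) assoc[OF s(1) t(1) h] by simp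
      then show ?thesis unfolding split_epi_iff[OF h] using arr_comp[OF s(1) t(1)] by blast
    qed
  qed
  then show "irreducible_mor C (sh X) (sh Y) (sm f)"
    using ir split_mono_sm[OF f] split_epi_sm[OF f] arrD(3)[OF fs] unfolding irreducible_mor_def by blast
qed

end

section \<open>Valued trees with a positive additive function\<close>

lemma valued_treeD:
  assumes "valued_tree T"
  shows vtree_edge_sym: "tedge T y x = map_option prod.swap (tedge T x y)"
    and vtree_adj_verts: "tadj T x y \<Longrightarrow> x \<in> tverts T \<and> y \<in> tverts T"
    and vtree_adj_neq: "tadj T x y \<Longrightarrow> x \<noteq> y"
    and vtree_val_pos: "tedge T x y = Some (a, b) \<Longrightarrow> a > 0 \<and> b > 0"
    and vtree_connected: "x \<in> tverts T \<Longrightarrow> y \<in> tverts T \<Longrightarrow> (tadj T)\<^sup>*\<^sup>* x y"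
    and vtree_acyclic: "distinct xs \<Longrightarrow> length xs \<ge> 3 \<Longrightarrow> successively (tadj T) xs \<Longrightarrow> \<not> tadj T (last xs) (hd xs)"
    and vtree_nonempty: "tverts T \<noteq> {}"
  using assms unfolding valued_tree_def by blast+

lemma vtree_adj_sym: "valued_tree T \<Longrightarrow> tadj T x y \<Longrightarrow> tadj T y x"
  using vtree_edge_sym[of T y x] by auto

text \<open>Everything is read off from the ratios \<open>r x y\<close>: additivity says that they sum to \<open>2\<close> over the
  neighbours \<open>y\<close> of \<open>x\<close>, and \<open>r x y * r y x\<close> is the product of the two entries of the valuation.\<close>
locale additive_tree =
  fixes T :: "'v vtree" and F :: "'v \<Rightarrow> real"
  assumes tree: "valued_tree T"
    and fin: "finite {y. tadj T x y}"
    and F_pos: "x \<in> tverts T \<Longrightarrow> F x > 0"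
    and additive: "x \<in> tverts T \<Longrightarrow> (\<Sum>y | tadj T x y. real (fst (the (tedge T y x))) * F y) = 2 * F x"
begin

definition N :: "'v \<Rightarrow> 'v set" where "N x = {y. tadj T x y}"
definition wt :: "'v \<Rightarrow> 'v \<Rightarrow> nat" where "wt x y = fst (the (tedge T y x))"
definition r :: "'v \<Rightarrow> 'v \<Rightarrow> real" where "r x y = real (wt x y) * F y / F x"

lemma N_sym: "y \<in> N x \<Longrightarrow> x \<in> N y"
  using vtree_adj_sym[OF tree] by (simp add: N_def)

lemma N_verts: "y \<in> N x \<Longrightarrow> x \<in> tverts T" "y \<in> N x \<Longrightarrow> y \<in> tverts T"
  using vtree_adj_verts[OF tree] by (auto simp: N_def)

lemma N_neq: "y \<in> N x \<Longrightarrow> x \<noteq> y"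
  using vtree_adj_neq[OF tree] by (auto simp: N_def)

lemma finite_N: "finite (N x)"
  using fin by (simp add: N_def)

lemma edge_eq: "y \<in> N x \<Longrightarrow> tedge T x y = Some (wt y x, wt x y)"
  using vtree_edge_sym[OF tree, of y x] by (auto simp: N_def wt_def)

lemma wt_pos: "y \<in> N x \<Longrightarrow> wt x y \<ge> 1"
  using vtree_val_pos[OF tree edge_eq] by (simp add: Suc_le_eq)

lemma r_pos: "y \<in> N x \<Longrightarrow> r x y > 0"
  using wt_pos[of y x] F_pos N_verts[of y x] by (auto simp: r_def)

lemma r_prod: "y \<in> N x \<Longrightarrow> r x y * r y x = real (wt x y * wt y x)"
  using F_pos[of x] F_pos[of y] N_verts[of y x] by (auto simp: r_def field_simps)

lemma sum_r: "x \<in> tverts T \<Longrightarrow> (\<Sum>y\<in>N x. r x y) = 2"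
  using additive[of x] F_pos[of x]
  by (simp add: r_def N_def wt_def flip: sum_divide_distrib)

lemma sum_others: "y \<in> N x \<Longrightarrow> (\<Sum>z\<in>N x - {y}. r x z) = 2 - r x y"
  using sum_r[of x] N_verts[of y x] sum.remove[OF finite_N, of y x "r x"] by simp

lemma r_le2: "y \<in> N x \<Longrightarrow> r x y \<le> 2"
  using sum_others[of y x] sum_nonneg[of "N x - {y}" "r x"] r_pos[of _ x] by (force simp: less_imp_le)

text \<open>The product with the opposite ratio is at least 1, and that ratio is at most 2.\<close>

lemma r_ge_half: assumes "y \<in> N x" shows "r x y \<ge> 1/2"
proof -
  have "1 \<le> wt x y * wt y x" using wt_pos[OF assms] wt_pos[OF N_sym[OF assms]] by simp
  then have "1 \<le> r x y * r y x" using r_prod[OF assms] by linarith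
  also have "\<dots> \<le> r x y * 2" using r_le2[OF N_sym[OF assms]] r_pos[OF assms] by simp
  finally show ?thesis by simp
qed

text \<open>Every ratio is at least 1/2, so what remains of the total 2 bounds the number of further
  neighbours.\<close>

lemma card_others: assumes "y \<in> N x" shows "real (card (N x - {y})) / 2 \<le> 2 - r x y"
  using sum_bounded_below[of "N x - {y}" "1/2" "r x"] r_ge_half sum_others[OF assms]
  by simp

lemma unvalued_edge: assumes "y \<in> N x" "wt x y * wt y x = 1" shows "tedge T x y = Some (1, 1)"
  using edge_eq[OF assms(1)] assms(2) by simp

lemma r_eq_2D: assumes "y \<in> N x" "r x y = 2" shows "N x = {y}"
proof -
  have "card (N x - {y}) = 0" using card_others[OF assms(1)] unfolding assms(2) by simp
  then have "N x - {y} = {}" using finite_N[of x] by (metis card_0_eq finite_Diff)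
  then show ?thesis using assms(1) by blast
qed

lemma others_lt_1:
  assumes "y \<in> N x" "r x y > 1"
  shows "N x = {y} \<and> r x y = 2 \<or> (\<exists>z. z \<noteq> y \<and> N x = {y, z} \<and> r x z = 2 - r x y)"
proof -
  have "card (N x - {y}) < 2" using card_others[OF assms(1)] assms(2) by simp
  then consider "N x - {y} = {}" | z where "N x - {y} = {z}"
    using finite_N[of x] by (metis card_0_eq card_1_singletonE finite_Diff less_2_cases One_nat_def)
  then show ?thesis
  proof cases
    case 1
    then have "r x y = 2" using sum_others[OF assms(1)] unfolding 1 by simp
    then show ?thesis using assms(1) 1 by blast
  next
    case 2
    then have "r x z = 2 - r x y" using sum_others[OF assms(1)] unfolding 2 by simp
    then show ?thesis using assms(1) 2 by blast
  qed
qed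

text \<open>The remaining neighbours share the sum 1 in portions of at least 1/2, so there are one
  or two of them.\<close>

lemma others_eq_1:
  assumes y: "y \<in> N x" "r x y = 1"
  shows "(\<exists>z. z \<noteq> y \<and> N x = {y, z} \<and> r x z = 1) \<or>
    (\<exists>z z'. z \<noteq> y \<and> z' \<noteq> y \<and> z \<noteq> z' \<and> N x = {y, z, z'} \<and> r x z = 1/2 \<and> r x z' = 1/2)"
proof -
  have c: "card (N x - {y}) \<le> 2" using card_others[OF y(1)] y(2) by simp
  have s: "(\<Sum>z\<in>N x - {y}. r x z) = 1" using sum_others[OF y(1)] y(2) by simp
  consider "card (N x - {y}) = 0" | "card (N x - {y}) = 1" | "card (N x - {y}) = 2" using c by linarith
  then show ?thesis
  proof cases
    case 1
    then have "N x - {y} = {}" using finite_N[of x] by simp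
    then have "(\<Sum>z\<in>N x - {y}. r x z) = 0" by (simp only: sum.empty)
    then show ?thesis using s by simp
  next
    case 2
    then obtain z where z: "N x - {y} = {z}" by (metis card_1_singletonE)
    then have "r x z = 1" using s unfolding z by simp
    moreover have "z \<noteq> y" "N x = {y, z}" using z y(1) by blast+
    ultimately show ?thesis by blast
  next
    case 3
    then obtain z z' where z: "N x - {y} = {z, z'}" "z \<noteq> z'" by (meson card_2_iff)
    have "r x z + r x z' = 1" using s z(2) unfolding z(1) by simp
    moreover have "z \<in> N x" "z' \<in> N x" using z by auto
    ultimately have "r x z = 1/2" "r x z' = 1/2" using r_ge_half[of z x] r_ge_half[of z' x] by linarith+
    moreover have "z \<noteq> y" "z' \<noteq> y" "N x = {y, z, z'}" using z y(1) by blast+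
    ultimately show ?thesis using z(2) by blast
  qed
qed

text \<open>The opposite ratio is at least 2, which is the maximum and is attained only at a
  leaf.\<close>

lemma r_half_leaf:
  assumes "y \<in> N x" "r x y = 1/2"
  shows "N y = {x} \<and> tedge T x y = Some (1, 1)"
proof -
  have p: "r y x = 2 * real (wt x y * wt y x)" using r_prod[OF assms(1)] assms(2) by (simp add: field_simps)
  have "1 \<le> wt x y * wt y x" using wt_pos[OF assms(1)] wt_pos[OF N_sym[OF assms(1)]] by simp
  moreover have "2 * real (wt x y * wt y x) \<le> 2" using r_le2[OF N_sym[OF assms(1)]] p by simp
  ultimately have 1: "wt x y * wt y x = 1" by linarith
  then have "r y x = 2" using p by simp
  then show ?thesis using r_eq_2D[OF N_sym[OF assms(1)]] unvalued_edge[OF assms(1) 1] by simp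
qed

text \<open>\<open>arm m p\<close>: beyond \<open>p 0\<close>, the branch containing \<open>p 1\<close> is the unvalued path \<open>p 1, \<dots>, p m\<close>.\<close>
definition arm :: "nat \<Rightarrow> (nat \<Rightarrow> 'v) \<Rightarrow> bool" where
  "arm m p \<longleftrightarrow> m \<ge> 1 \<and> (\<forall>i<m. p (Suc i) \<in> N (p i) \<and> tedge T (p i) (p (Suc i)) = Some (1, 1)) \<and>
     (\<forall>i. Suc i < m \<longrightarrow> N (p (Suc i)) = {p i, p (Suc (Suc i))} \<and> p i \<noteq> p (Suc (Suc i))) \<and>
     N (p m) = {p (m - 1)}"

lemma arm_extend:
  assumes p: "arm m p" and e: "tedge T x (p 0) = Some (1, 1)" and Ny: "N (p 0) = {x, p 1}" "x \<noteq> p 1"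
  shows "arm (Suc m) (case_nat x p)"
proof -
  have x: "p 0 \<in> N x" using Ny N_sym by blast
  have "1 \<le> Suc m" by simp
  moreover have "case_nat x p (Suc i) \<in> N (case_nat x p i) \<and> tedge T (case_nat x p i) (case_nat x p (Suc i)) = Some (1, 1)"
    if "i < Suc m" for i
    using that p e x by (cases i) (auto simp: arm_def)
  moreover have "N (case_nat x p (Suc i)) = {case_nat x p i, case_nat x p (Suc (Suc i))} \<and>
      case_nat x p i \<noteq> case_nat x p (Suc (Suc i))" if "Suc i < Suc m" for i
    using that p Ny by (cases i) (auto simp: arm_def)
  moreover have "N (case_nat x p (Suc m)) = {case_nat x p (Suc m - 1)}"
    using p by (cases m) (auto simp: arm_def)
  ultimately show ?thesis unfolding arm_def by blast
qed

text \<open>With ratio \<open>t < 1\<close> the edge is plain and the opposite ratio is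
  \<open>1/t > 1\<close>, which leaves \<open>y\<close> at most one further neighbour
  \<open>z\<close>, with ratio \<open>2 - 1/t\<close>. This map sends \<open>(n+1)/(n+2)\<close> to
  \<open>n/(n+1)\<close>, so the bound drops by one at each step and the branch is a finite
  path.\<close>

lemma arm_ex_aux:
  assumes "y \<in> N x" "r x y \<le> real n / real (Suc n)"
  shows "\<exists>m p. arm m p \<and> p 0 = x \<and> p 1 = y \<and> r x y = real m / real (Suc m)"
  using assms
proof (induction n arbitrary: x y)
  case 0
  then show ?case using r_pos[of y x] by simp
next
  case (Suc n)
  note y = Suc.prems(1)
  note x = N_sym[OF y]
  let ?ab = "wt x y * wt y x"
  have lt1: "r x y < 1" using Suc.prems(2) by (rule le_less_trans) simp
  have ab1: "1 \<le> ?ab" using wt_pos[OF y] wt_pos[OF x] by simp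
  have "1 \<le> r x y * r y x" using ab1 r_prod[OF y] by linarith
  moreover have "r x y * r y x < 1 * r y x" using lt1 r_pos[OF x] by (intro mult_strict_right_mono) auto
  ultimately have gt1: "r y x > 1" by simp
  have "real ?ab < 2" using r_prod[OF y] r_le2[OF x] \<open>r x y * r y x < 1 * r y x\<close> by simp
  then have ab: "?ab = 1" using ab1 by linarith
  then have rr: "r x y * r y x = 1" using r_prod[OF y] by simp
  have e: "tedge T x y = Some (1, 1)" using unvalued_edge[OF y ab] .
  from others_lt_1[OF x gt1] show ?case
  proof
    assume a: "N y = {x} \<and> r y x = 2"
    then have "r x y = 1/2" using rr by simp
    moreover have "arm 1 (\<lambda>i. if i = 0 then x else y)" using a e y by (simp add: arm_def)
    ultimately show ?thesis by (intro exI[of _ 1] exI[of _ "\<lambda>i. if i = 0 then x else y"]) simp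
  next
    assume "\<exists>z. z \<noteq> x \<and> N y = {x, z} \<and> r y z = 2 - r y x"
    then obtain z where z: "z \<noteq> x" "N y = {x, z}" "r y z = 2 - r y x" by blast
    have zy: "z \<in> N y" using z by simp
    have "r y x = 1 / r x y" using rr r_pos[OF y] by (simp add: field_simps)
    moreover have "1 / r x y \<ge> real (Suc (Suc n)) / real (Suc n)"
      using Suc.prems(2) r_pos[OF y] by (simp add: field_simps)
    ultimately have "r y z \<le> 2 - real (Suc (Suc n)) / real (Suc n)" using z by simp
    also have "\<dots> = real n / real (Suc n)" by (simp add: field_simps)
    finally obtain m p where p: "arm m p" "p 0 = y" "p 1 = z" "r y z = real m / real (Suc m)"
      using Suc.IH[OF zy] by blast
    let ?q = "case_nat x p"
    have "arm (Suc m) ?q"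
      using arm_extend[OF p(1), of x] p z e by auto
    moreover have "r x y = real (Suc m) / real (Suc (Suc m))"
    proof -
      have "r y x = 2 - real m / real (Suc m)" using p z by simp
      then have ryx: "r y x = real (Suc (Suc m)) / real (Suc m)" by (simp add: field_simps)
      have "r x y = 1 / r y x" using rr r_pos[OF x] by (simp add: field_simps)
      then show ?thesis using ryx by simp
    qed
    ultimately show ?thesis using p(2) by (intro exI[of _ "Suc m"] exI[of _ ?q]) simp
  qed
qed

lemma arm_ex:
  assumes "y \<in> N x" "r x y < 1"
  obtains m p where "arm m p" "p 0 = x" "p 1 = y" "r x y = real m / real (Suc m)"
proof -
  obtain n :: nat where "1 / (1 - r x y) \<le> real n" using real_arch_simple by blast
  then have "1 \<le> real n * (1 - r x y)" using assms(2) by (simp add: field_simps)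
  moreover have "real n * r x y + r x y \<le> real n * r x y + 1" using assms by simp
  ultimately have "r x y * real (Suc n) \<le> real n" by (simp add: algebra_simps)
  then have "r x y \<le> real n / real (Suc n)" by (simp add: field_simps)
  then show thesis using arm_ex_aux[OF assms(1)] that by blast
qed

text \<open>Coming from \<open>u\<close>, the tree passes through \<open>v\<close> to
  \<open>w\<close> along a plain edge without branching. The last clause hands the ratio 1 on, so
  that the step can be repeated from \<open>v\<close> and \<open>w\<close>.\<close>

definition st :: "'v \<Rightarrow> 'v \<Rightarrow> 'v \<Rightarrow> bool" where
  "st u v w \<longleftrightarrow> N v = {u, w} \<and> u \<noteq> w \<and> tedge T v w = Some (1, 1) \<and> r w v = 1"

abbreviation straight :: "(nat \<Rightarrow> 'v) \<Rightarrow> nat \<Rightarrow> bool" where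
  "straight p i \<equiv> st (p i) (p (Suc i)) (p (Suc (Suc i)))"

definition val_end :: "'v \<Rightarrow> 'v \<Rightarrow> 'v \<Rightarrow> bool" where
  "val_end u v w \<longleftrightarrow> N v = {u, w} \<and> u \<noteq> w \<and> N w = {v} \<and> tedge T v w \<in> {Some (1, 2), Some (2, 1)} \<and> r v w = 1"

definition fork_end :: "'v \<Rightarrow> 'v \<Rightarrow> 'v \<Rightarrow> 'v \<Rightarrow> bool" where
  "fork_end u v w w' \<longleftrightarrow> N v = {u, w, w'} \<and> u \<noteq> w \<and> u \<noteq> w' \<and> w \<noteq> w' \<and> N w = {v} \<and> N w' = {v} \<and>
     tedge T v w = Some (1, 1) \<and> tedge T v w' = Some (1, 1)"

text \<open>The opposite ratio equals the product of the two valuation entries and is at most 2; the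
  value 2 makes \<open>z\<close> a leaf at the end of a valued edge.\<close>

lemma r_1_step:
  assumes z: "z \<in> N v" "r v z = 1"
  shows "tedge T v z = Some (1, 1) \<and> r z v = 1 \<or>
    N z = {v} \<and> tedge T v z \<in> {Some (1, 2), Some (2, 1)}"
proof -
  let ?ab = "wt v z * wt z v"
  have p: "r z v = real ?ab" using r_prod[OF z(1)] z(2) by simp
  have w: "1 \<le> wt v z" "1 \<le> wt z v" using wt_pos[OF z(1)] wt_pos[OF N_sym[OF z(1)]] .
  then have "1 \<le> ?ab" by simp
  moreover have "?ab \<le> 2" using r_le2[OF N_sym[OF z(1)]] unfolding p by linarith
  ultimately consider "?ab = 1" | "?ab = 2" by linarith
  then show ?thesis
  proof cases
    case 1
    then show ?thesis using p unvalued_edge[OF z(1)] by simp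
  next
    case 2
    then have l: "N z = {v}" using p r_eq_2D[OF N_sym[OF z(1)]] by simp
    have "wt v z dvd 2" using 2 by (metis dvd_triv_left)
    then have "wt v z \<le> 2" by (rule dvd_imp_le) simp
    then have "wt v z = 1 \<and> wt z v = 2 \<or> wt v z = 2 \<and> wt z v = 1"
      using 2 w by (cases "wt v z = 1") (auto simp: le_Suc_eq numeral_2_eq_2)
    then show ?thesis using l edge_eq[OF z(1)] by auto
  qed
qed

lemma r_1_cases:
  assumes u: "u \<in> N v" "r v u = 1"
  shows "(\<exists>w. st u v w) \<or>
    (\<exists>w. val_end u v w) \<or> (\<exists>w w'. fork_end u v w w')"
  using others_eq_1[OF u]
proof
  assume "\<exists>z. z \<noteq> u \<and> N v = {u, z} \<and> r v z = 1"
  then obtain z where z: "z \<noteq> u" "N v = {u, z}" "r v z = 1" by blast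
  then have "z \<in> N v" by simp
  from r_1_step[OF this z(3)] show ?thesis
    using z unfolding val_end_def st_def by blast
next
  assume "\<exists>z z'. z \<noteq> u \<and> z' \<noteq> u \<and> z \<noteq> z' \<and> N v = {u, z, z'} \<and> r v z = 1/2 \<and> r v z' = 1/2"
  then obtain z z' where z: "z \<noteq> u" "z' \<noteq> u" "z \<noteq> z'" "N v = {u, z, z'}" "r v z = 1/2" "r v z' = 1/2" by blast
  then have "z \<in> N v" "z' \<in> N v" by auto
  then have "fork_end u v z z'" using r_half_leaf z unfolding fork_end_def by metis
  then show ?thesis by blast
qed

text \<open>A ratio 1 pointing back at \<open>u\<close> propagates along the tree until the branch
  ends in a valued edge or in a fork, or forever. These rays produce the Euclidean families of
  unbounded size and all the infinite trees except \<open>A_inf\<close>.\<close>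

lemma ray_ex:
  assumes u: "u \<in> N v" "r v u = 1"
  obtains p where "p 0 = u" "p 1 = v"
    "(\<forall>i. straight p i) \<or> (\<exists>k. (\<forall>i<k. straight p i) \<and>
       (val_end (p k) (p (Suc k)) (p (Suc (Suc k))) \<or> (\<exists>w w'. fork_end (p k) (p (Suc k)) w w')))"
proof -
  \<comment> \<open>The choice prefers a straight continuation and otherwise takes the leaf of a
    valued end, so one sequence records the ray together with that last vertex. The two leaves of a
    fork are given separately.\<close>
  define good where "good a b w \<longleftrightarrow> (if \<exists>w'. st a b w' then st a b w else val_end a b w)" for a b w
  define nx where "nx = (\<lambda>(a, b). (b, SOME w. good a b w))"
  define p where "p i = fst ((nx ^^ i) (u, v))" for i
  have p2: "(nx ^^ i) (u, v) = (p i, p (Suc i))" for i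
  proof -
    have "fst (nx q) = snd q" for q by (cases q) (simp add: nx_def)
    then show ?thesis unfolding p_def by (metis funpow.simps(2) comp_apply prod.collapse)
  qed
  have p01: "p 0 = u" "p 1 = v" using p2[of 0] by auto
  have pS: "p (Suc (Suc i)) = (SOME w. good (p i) (p (Suc i)) w)" for i
  proof -
    have "(p (Suc i), p (Suc (Suc i))) = nx (p i, p (Suc i))" using p2[of "Suc i"] p2[of i] by simp
    then show ?thesis unfolding nx_def prod.case prod.inject by (rule conjunct2)
  qed
  have step: "straight p i \<or> val_end (p i) (p (Suc i)) (p (Suc (Suc i))) \<or> (\<exists>w w'. fork_end (p i) (p (Suc i)) w w')"
    if "p i \<in> N (p (Suc i))" "r (p (Suc i)) (p i) = 1" for i
  proof (cases "\<exists>w. good (p i) (p (Suc i)) w")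
    case True
    then have "good (p i) (p (Suc i)) (p (Suc (Suc i)))" unfolding pS[of i] by (rule someI_ex)
    then show ?thesis unfolding good_def by (meson)
  next
    case False
    then show ?thesis using r_1_cases[OF that] unfolding good_def by meson
  qed
  have inv: "p i \<in> N (p (Suc i)) \<and> r (p (Suc i)) (p i) = 1" if "\<forall>j<i. straight p j" for i
  proof (cases i)
    case 0 then show ?thesis using u p01 by simp
  next
    case (Suc j)
    then have "straight p j" using that by simp
    then show ?thesis using Suc N_sym by (auto simp: st_def)
  qed
  show thesis
  proof (rule that[OF p01], cases "\<forall>i. straight p i")
    case False
    define k where "k = (LEAST i. \<not> straight p i)"
    have "\<not> straight p k" "\<forall>i<k. straight p i"
      using False LeastI_ex[of "\<lambda>i. \<not> straight p i"] not_less_Least unfolding k_def by blast+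
    then show "(\<forall>i. straight p i) \<or> (\<exists>k. (\<forall>i<k. straight p i) \<and>
       (val_end (p k) (p (Suc k)) (p (Suc (Suc k))) \<or> (\<exists>w w'. fork_end (p k) (p (Suc k)) w w')))"
      using step[of k] inv[of k] by blast
  qed blast
qed

end

section \<open>Recognising a tree from its neighbourhoods\<close>

lemma nonbacktracking_walk_ends:
  assumes T: "valued_tree T" and adj: "\<And>i. i < n \<Longrightarrow> tadj T (h i) (h (Suc i))"
    and nb: "\<And>i. Suc (Suc i) \<le> n \<Longrightarrow> h i \<noteq> h (Suc (Suc i))" and n: "n > 0"
  shows "h 0 \<noteq> h n"
proof
  assume eq: "h 0 = h n"
  let ?P = "\<lambda>d. d > 0 \<and> (\<exists>i. i + d \<le> n \<and> h i = h (i + d))"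
  \<comment> \<open>A shortest closed stretch of the walk repeats no vertex. Lengths 1 and 2 are
    excluded by the absence of loops and of backtracking, so it is a cycle of length at least
    3.\<close>
  define d where "d = (LEAST d. ?P d)"
  have "?P n" using eq n by (auto intro: exI[of _ 0])
  then have "?P d" unfolding d_def by (rule LeastI)
  then obtain i where d: "d > 0" and i: "i + d \<le> n" "h i = h (i + d)" by blast
  have least: "d \<le> e" if "?P e" for e unfolding d_def using that by (rule Least_le)
  have "d \<noteq> 1" using vtree_adj_neq[OF T adj[of i]] i by auto
  moreover have "d \<noteq> 2" using nb[of i] i by auto
  ultimately have d3: "d \<ge> 3" using d by linarith
  define ys where "ys = map h [i..<i + d]"
  have "distinct ys"
  proof -
    have "a = b" if "a \<in> {i..<i + d}" "b \<in> {i..<i + d}" "h a = h b" "a \<le> b" for a b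
    proof (rule ccontr)
      assume "a \<noteq> b"
      then have "?P (b - a)" using that i(1) by (auto intro!: exI[of _ a])
      then show False using least[of "b - a"] that by auto
    qed
    then have "inj_on h {i..<i + d}" by (metis inj_onI nle_le)
    then show ?thesis by (simp add: ys_def distinct_map)
  qed
  moreover have "length ys \<ge> 3" using d3 by (simp add: ys_def)
  moreover have "successively (tadj T) ys"
    unfolding successively_conv_nth ys_def using i(1) adj by auto
  moreover have "tadj T (last ys) (hd ys)"
  proof -
    have "last ys = h (i + d - 1)" "hd ys = h i" using d by (auto simp: ys_def last_map hd_map)
    moreover have "Suc (i + d - 1) = i + d" using d by simp
    ultimately show ?thesis using adj[of "i + d - 1"] i d by simp
  qed
  ultimately show False using vtree_acyclic[OF T] by blast
qed

text \<open>Local conditions suffice because \<open>T\<close> has no cycles: two vertices with equal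
  image under \<open>g\<close> are joined by a shortest path, whose image would be a closed walk
  without backtracking. Surjectivity follows from connectedness of \<open>T\<close>.\<close>

lemma vtree_of_iso:
  fixes T :: "'v vtree" and g :: "'d \<Rightarrow> 'v"
  defines "A E \<equiv> \<lambda>i j. E (i, j) \<noteq> None \<or> E (j, i) \<noteq> None"
  assumes T: "valued_tree T" and i0: "i0 \<in> V"
    and E: "\<And>i j v. E (i, j) = Some v \<Longrightarrow> i \<in> V \<and> j \<in> V \<and> E (j, i) = None"
    and conn: "\<And>i. i \<in> V \<Longrightarrow> (A E)\<^sup>*\<^sup>* i0 i"
    and verts: "g i0 \<in> tverts T"
    and edge: "\<And>i j v. E (i, j) = Some v \<Longrightarrow> tedge T (g i) (g j) = Some v"
    and inj: "\<And>i. i \<in> V \<Longrightarrow> inj_on g {j. A E i j}"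
    and nbr: "\<And>i. i \<in> V \<Longrightarrow> {y. tadj T (g i) y} \<subseteq> g ` {j. A E i j}"
  shows "T \<cong>\<^sub>T vtree_of V E"
proof -
  let ?D = "vtree_of V E" and ?A = "A E"
  have A: "tadj ?D i j \<longleftrightarrow> ?A i j" for i j
    by (auto simp: vtree_of_def A_def split: option.splits)
  have AV: "i \<in> V \<and> j \<in> V" if "?A i j" for i j using that E unfolding A_def by blast
  have Asym: "?A i j \<Longrightarrow> ?A j i" for i j unfolding A_def by blast
  have ed: "tedge T (g i) (g j) = tedge ?D i j" if "?A i j" for i j
  proof (cases "E (i, j)")
    case (Some v)
    then show ?thesis using edge by (simp add: vtree_of_def)
  next
    case None
    then have "E (j, i) \<noteq> None" using that unfolding A_def by blast
    then obtain v where v: "E (j, i) = Some v" by blast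
    have "tedge T (g i) (g j) = map_option prod.swap (tedge T (g j) (g i))" by (rule vtree_edge_sym[OF T])
    then show ?thesis using edge[OF v] None v by (simp add: vtree_of_def)
  qed
  have adjT: "tadj T (g i) (g j)" if "?A i j" for i j using ed[OF that] that A by metis
  have injV: "i = j" if ij: "i \<in> V" "j \<in> V" "g i = g j" for i j
  proof (rule ccontr)
    assume ne: "i \<noteq> j"
    have "?A\<^sup>*\<^sup>* i i0" using conn[OF ij(1)]
    proof (induction rule: rtranclp_induct)
      case (step y z)
      then show ?case using Asym by (meson converse_rtranclp_into_rtranclp)
    qed simp
    then have "?A\<^sup>*\<^sup>* i j" using conn[OF ij(2)] by (rule rtranclp_trans)
    then obtain m where m: "(?A ^^ m) i j" by (meson rtranclp_power)
    define n where "n = (LEAST m. (?A ^^ m) i j)"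
    have "(?A ^^ n) i j" unfolding n_def using m by (rule LeastI)
    then obtain f where f: "f 0 = i" "f n = j" "\<And>k. k < n \<Longrightarrow> ?A (f k) (f (Suc k))"
      unfolding relpowp_fun_conv by blast
    have least: "n \<le> m" if "(?A ^^ m) i j" for m unfolding n_def using that by (rule Least_le)
    have nbf: "f k \<noteq> f (Suc (Suc k))" if k: "Suc (Suc k) \<le> n" for k
    proof
      assume fe: "f k = f (Suc (Suc k))"
      \<comment> \<open>Cutting out a backtracking step shortens the path by two, against
        minimality.\<close>
      let ?f = "\<lambda>l. if l \<le> k then f l else f (l + 2)"
      have "?A (?f l) (?f (Suc l))" if "l < n - 2" for l
      proof -
        consider "l < k" | "l = k" | "l > k" by linarith
        then show ?thesis
        proof cases
          case 1 then show ?thesis using f(3)[of l] k by simp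
        next
          case 2 then show ?thesis using f(3)[of "Suc (Suc k)"] that fe by simp
        next
          case 3 then show ?thesis using f(3)[of "l + 2"] that by simp
        qed
      qed
      moreover have "?f 0 = i" using f by simp
      moreover have "?f (n - 2) = j"
      proof (cases "n - 2 \<le> k")
        case True
        then have "n = Suc (Suc k)" using k by simp
        then show ?thesis using f(2) fe by simp
      next
        case False
        then have "n - 2 + 2 = n" by linarith
        then show ?thesis using False f(2) by simp
      qed
      ultimately have "(?A ^^ (n - 2)) i j" unfolding relpowp_fun_conv by (intro exI[of _ ?f]) blast
      then show False using least[of "n - 2"] k by linarith
    qed
    have "n \<noteq> 0" using f ne by metis
    have "g (f 0) \<noteq> g (f n)"
    proof (rule nonbacktracking_walk_ends[OF T, of n "\<lambda>k. g (f k)"])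
      show "tadj T (g (f k)) (g (f (Suc k)))" if "k < n" for k using adjT f(3)[OF that] by blast
      show "g (f k) \<noteq> g (f (Suc (Suc k)))" if k: "Suc (Suc k) \<le> n" for k
      proof
        assume "g (f k) = g (f (Suc (Suc k)))"
        moreover have "?A (f (Suc k)) (f k)" "?A (f (Suc k)) (f (Suc (Suc k)))"
          using f(3)[of k] f(3)[of "Suc k"] k Asym by auto
        ultimately show False using nbf[OF k] inj[of "f (Suc k)"] AV by (metis inj_onD mem_Collect_eq)
      qed
    qed (use \<open>n \<noteq> 0\<close> in simp)
    then show False using f ij by simp
  qed
  have gV: "g ` V \<subseteq> tverts T"
  proof
    fix y assume "y \<in> g ` V"
    then obtain i where i: "i \<in> V" "y = g i" by blast
    show "y \<in> tverts T"
    proof (cases "i = i0")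
      case False
      then obtain j where "?A j i" using conn[OF i(1)] by (metis rtranclp.cases)
      then show ?thesis using adjT vtree_adj_verts[OF T] i by blast
    qed (use verts i in simp)
  qed
  have "tverts T \<subseteq> g ` V"
  proof
    fix y assume "y \<in> tverts T"
    with verts have "(tadj T)\<^sup>*\<^sup>* (g i0) y" by (rule vtree_connected[OF T])
    then show "y \<in> g ` V"
    proof (induction rule: rtranclp_induct)
      case base then show ?case using i0 by blast
    next
      case (step y z)
      then obtain i where i: "i \<in> V" "y = g i" by blast
      then have "z \<in> g ` {j. ?A i j}" using nbr[OF i(1)] step by blast
      then show ?case using AV by blast
    qed
  qed
  then have bij: "bij_betw g V (tverts T)" using gV injV by (auto simp: bij_betw_def inj_on_def)
  have edge_all: "tedge T (g x) (g y) = tedge ?D x y" if xy: "x \<in> V" "y \<in> V" for x y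
  proof (cases "?A x y")
    case True then show ?thesis by (rule ed)
  next
    case False
    have "\<not> tadj T (g x) (g y)"
    proof
      assume "tadj T (g x) (g y)"
      then obtain j where "?A x j" "g y = g j" using nbr[OF xy(1)] by blast
      then show False using False injV[OF xy(2), of j] AV by blast
    qed
    then show ?thesis using False A by metis
  qed
  let ?f = "the_inv_into V g"
  have b: "bij_betw ?f (tverts T) V" using bij by (rule bij_betw_the_inv_into)
  show ?thesis unfolding vtree_iso_def
  proof (intro exI[of _ ?f] conjI ballI)
    show "bij_betw ?f (tverts T) (tverts ?D)" using b by (simp add: vtree_of_def)
    fix x y assume xy: "x \<in> tverts T" "y \<in> tverts T"
    have "g (?f x) = x" "g (?f y) = y" using bij xy by (auto simp: bij_betw_def f_the_inv_into_f)
    then show "tedge ?D (?f x) (?f y) = tedge T x y"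
      using edge_all[of "?f x" "?f y"] bij_betwE[OF b] xy by simp
  qed
qed

definition nbr :: "(('d \<times> 'd) \<times> 'e) list \<Rightarrow> 'd \<Rightarrow> 'd set" where
  "nbr L i = {j. \<exists>v. ((i, j), v) \<in> set L \<or> ((j, i), v) \<in> set L}"

text \<open>Edges are listed from smaller to larger vertices; \<open>par\<close> gives every vertex
  except 0 a smaller neighbour, so the listed graph is connected by induction.\<close>

lemma list_tree_iso:
  fixes g :: "nat \<Rightarrow> 'v"
  assumes T: "valued_tree T" and n: "n \<ge> 2"
    and L: "\<And>i j v. ((i, j), v) \<in> set L \<Longrightarrow> i < j \<and> j < n" "distinct (map fst L)"
    and par: "\<And>j. 0 < j \<Longrightarrow> j < n \<Longrightarrow> \<exists>i v. ((i, j), v) \<in> set L"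
    and edge: "\<And>i j v. ((i, j), v) \<in> set L \<Longrightarrow> tedge T (g i) (g j) = Some v"
    and nb: "\<And>i. i < n \<Longrightarrow> inj_on g (nbr L i) \<and> {y. tadj T (g i) y} = g ` nbr L i"
  shows "T \<cong>\<^sub>T vtree_of {..<n} (map_of L)"
proof -
  have mo: "map_of L (i, j) = Some v \<longleftrightarrow> ((i, j), v) \<in> set L" for i j v using L(2) by simp
  have N: "map_of L (i, j) \<noteq> None \<or> map_of L (j, i) \<noteq> None \<longleftrightarrow> j \<in> nbr L i" for i j
    unfolding nbr_def using mo by auto
  obtain i v where "((i, 1), v) \<in> set L" using par[of 1] n by auto
  then have e01: "((0, 1), v) \<in> set L" using L(1)[of i 1 v] by simp
  show ?thesis
  proof (rule vtree_of_iso[OF T, of 0], unfold N)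
    show "(0::nat) \<in> {..<n}" using n by simp
    show "g 0 \<in> tverts T" using vtree_adj_verts[OF T, of "g 0" "g 1"] edge[OF e01] by simp
    show "i \<in> {..<n} \<and> j \<in> {..<n} \<and> map_of L (j, i) = None" if "map_of L (i, j) = Some v" for i j v
    proof -
      have "((i, j), v) \<in> set L" using that mo by simp
      moreover have "map_of L (j, i) = None"
      proof (rule ccontr)
        assume "map_of L (j, i) \<noteq> None"
        then obtain v' where "((j, i), v') \<in> set L" using mo by auto
        then show False using L(1)[of j i v'] L(1)[of i j v] calculation by simp
      qed
      ultimately show ?thesis using L(1)[of i j v] by simp
    qed
    show "tedge T (g i) (g j) = Some v" if "map_of L (i, j) = Some v" for i j v
      using that edge mo by blast
    show "(\<lambda>i j. j \<in> nbr L i)\<^sup>*\<^sup>* 0 i" if "i \<in> {..<n}" for i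
      using that
    proof (induction i rule: less_induct)
      case (less j)
      show ?case
      proof (cases "j = 0")
        case False
        then obtain i v where i: "((i, j), v) \<in> set L" using par[of j] less.prems by blast
        then have "i < j" using L(1) by blast
        then have "(\<lambda>i j. j \<in> nbr L i)\<^sup>*\<^sup>* 0 i" using less by simp
        moreover have "j \<in> nbr L i" using i unfolding nbr_def by blast
        ultimately show ?thesis by (rule rtranclp.rtrancl_into_rtrancl)
      qed simp
    qed
    show "inj_on g {j. j \<in> nbr L i}" if "i \<in> {..<n}" for i using nb that by simp
    show "{y. tadj T (g i) y} \<subseteq> g ` {j. j \<in> nbr L i}" if "i \<in> {..<n}" for i using nb that by simp
  qed
qed

lemma half_line_iso:
  assumes T: "valued_tree T" and edge: "\<And>i. tedge T (g i) (g (Suc i)) = Some (l i)"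
    and N0: "{y. tadj T (g 0) y} = {g 1}"
    and NS: "\<And>i. {y. tadj T (g (Suc i)) y} = {g i, g (Suc (Suc i))} \<and> g i \<noteq> g (Suc (Suc i))"
  shows "T \<cong>\<^sub>T half_line l"
  unfolding half_line_def
proof (rule vtree_of_iso[OF T, of 0])
  let ?E = "\<lambda>(i, j). if j = Suc i then Some (l i) else None"
  have N: "{j. ?E (i, j) \<noteq> None \<or> ?E (j, i) \<noteq> None} = (case i of 0 \<Rightarrow> {1} | Suc k \<Rightarrow> {k, Suc (Suc k)})" for i
    by (auto split: nat.splits)
  show "(\<lambda>i j. ?E (i, j) \<noteq> None \<or> ?E (j, i) \<noteq> None)\<^sup>*\<^sup>* 0 i" for i
  proof (induction i)
    case (Suc i)
    then show ?case by (rule rtranclp.rtrancl_into_rtrancl) simp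
  qed simp
  show "g 0 \<in> tverts T" using vtree_adj_verts[OF T, of "g 0" "g 1"] edge[of 0] by simp
  show "inj_on g {j. ?E (i, j) \<noteq> None \<or> ?E (j, i) \<noteq> None}" for i
    unfolding N using NS by (simp split: nat.splits)
  show "{y. tadj T (g i) y} \<subseteq> g ` {j. ?E (i, j) \<noteq> None \<or> ?E (j, i) \<noteq> None}" for i
    unfolding N using N0 NS by (simp split: nat.splits)
qed (use edge in \<open>auto split: if_splits\<close>)

lemma nbr_append: "nbr (A @ B) i = nbr A i \<union> nbr B i"
  by (auto simp: nbr_def)

lemma nbr_Nil: "nbr [] i = {}"
  by (simp add: nbr_def)

lemma nbr_Cons: "nbr (((a, b), v) # L) i = (if i = a then {b} else {}) \<union> (if i = b then {a} else {}) \<union> nbr L i"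
  by (auto simp: nbr_def)

lemma set_line: "((i, j), v) \<in> set (line n l) \<longleftrightarrow> j = Suc i \<and> Suc i < n \<and> v = l i"
  by (auto simp: line_def)

lemma distinct_line: "distinct (map fst (line n l))"
  by (simp add: line_def o_def distinct_map inj_on_def)

lemma nbr_line: "nbr (line n l) i = {j. j = Suc i \<and> Suc i < n \<or> i = Suc j \<and> i < n}"
  unfolding nbr_def set_line by blast

lemma line_tree_iso:
  assumes T: "valued_tree T" and n: "n \<ge> 2" and edge: "\<And>i. Suc i < n \<Longrightarrow> tedge T (g i) (g (Suc i)) = Some (l i)"
    and N0: "{y. tadj T (g 0) y} = {g 1}" and Nl: "{y. tadj T (g (n - 1)) y} = {g (n - 2)}"
    and NS: "\<And>i. Suc (Suc i) < n \<Longrightarrow> {y. tadj T (g (Suc i)) y} = {g i, g (Suc (Suc i))} \<and> g i \<noteq> g (Suc (Suc i))"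
  shows "T \<cong>\<^sub>T line_tree n l"
  unfolding line_tree_def
proof (rule list_tree_iso[OF T n, where g = g])
  show "\<exists>i v. ((i, j), v) \<in> set (line n l)" if "0 < j" "j < n" for j
    using that by (intro exI[of _ "j - 1"]) (simp add: set_line)
  show "inj_on g (nbr (line n l) i) \<and> {y. tadj T (g i) y} = g ` nbr (line n l) i" if i: "i < n" for i
  proof -
    have "i = 0 \<or> (\<exists>k. i = Suc k) \<and> Suc i < n \<or> i = n - 1 \<and> i > 0" using i by (cases i) auto
    then consider "i = 0" | k where "i = Suc k" "Suc i < n" | "i = n - 1" "i > 0" by blast
    then show ?thesis
    proof cases
      case 1
      then have "nbr (line n l) i = {1}" using n by (auto simp: nbr_line)
      then show ?thesis using N0 1 by simp
    next
      case 2
      then have "nbr (line n l) i = {k, Suc (Suc k)}" by (auto simp: nbr_line)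
      then show ?thesis using NS[of k] 2 by simp
    next
      case 3
      then have "nbr (line n l) i = {n - 2}" unfolding nbr_line using n by auto
      then show ?thesis using Nl 3 by simp
    qed
  qed
qed (use edge in \<open>auto simp: set_line distinct_line\<close>)

lemma BD_tree_iso:
  assumes T: "valued_tree T" and k: "k \<ge> 1"
    and edge: "\<And>i. i < k \<Longrightarrow> tedge T (g i) (g (Suc i)) = Some ((unvalued(0 := p)) i)"
    and N0: "{y. tadj T (g 0) y} = {g 1}"
    and NS: "\<And>i. Suc i < k \<Longrightarrow> {y. tadj T (g (Suc i)) y} = {g i, g (Suc (Suc i))} \<and> g i \<noteq> g (Suc (Suc i))"
    and Nk: "{y. tadj T (g k) y} = {g (k - 1), w, w'}" "distinct [g (k - 1), w, w']"
    and ww: "{y. tadj T w y} = {g k}" "{y. tadj T w' y} = {g k}"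
      "tedge T (g k) w = Some (1, 1)" "tedge T (g k) w' = Some (1, 1)"
  shows "T \<cong>\<^sub>T vtree_of {..<k + 3} (map_of (line (k + 2) (unvalued(0 := p)) @ [((k, k + 2), (1, 1))]))"
proof -
  \<comment> \<open>The leaf \<open>w\<close> continues the numbering of the line as vertex
    \<open>k + 1\<close>; \<open>w'\<close> is the additional vertex \<open>k + 2\<close>.\<close>
  define h where "h i = (if i \<le> k then g i else if i = k + 1 then w else w')" for i
  let ?L = "line (k + 2) (unvalued(0 := p)) @ [((k, k + 2), (1, 1))]"
  have nL: "nbr ?L i = {j. j = Suc i \<and> i < Suc k \<or> i = Suc j \<and> i < k + 2 \<or> i = k \<and> j = k + 2 \<or> i = k + 2 \<and> j = k}" for i
    unfolding nbr_append nbr_line nbr_Cons nbr_Nil by auto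
  show ?thesis
  proof (rule list_tree_iso[OF T, where g = h])
    show "\<exists>i v. ((i, j), v) \<in> set ?L" if "0 < j" "j < k + 3" for j
    proof (cases "j = k + 2")
      case False
      then have "((j - 1, j), (unvalued(0 := p)) (j - 1)) \<in> set ?L" using that by (simp add: set_line)
      then show ?thesis by blast
    qed auto
    show "i < j \<and> j < k + 3" if "((i, j), v) \<in> set ?L" for i j v using that by (auto simp: set_line)
    show "distinct (map fst ?L)" by (auto simp: distinct_line set_line)
    show "tedge T (h i) (h j) = Some v" if e: "((i, j), v) \<in> set ?L" for i j v
    proof -
      have "j = Suc i \<and> i < k + 1 \<and> v = (unvalued(0 := p)) i \<or> i = k \<and> j = k + 2 \<and> v = (1, 1)"
        using e by (auto simp: set_line)
      then consider "j = Suc i" "i < k" "v = (unvalued(0 := p)) i" | "j = Suc i" "i = k" "v = (unvalued(0 := p)) i"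
        | "i = k" "j = k + 2" "v = (1, 1)" by (metis Suc_eq_plus1 less_Suc_eq)
      then show ?thesis
        by cases (use edge ww k in \<open>auto simp: h_def\<close>)
    qed
    show "inj_on h (nbr ?L i) \<and> {y. tadj T (h i) y} = h ` nbr ?L i" if i: "i < k + 3" for i
    proof -
      have "i = 0 \<or> (\<exists>m. i = Suc m \<and> i < k) \<or> (\<exists>m. i = k \<and> k = Suc m) \<or> i = k + 1 \<or> i = k + 2"
        using i k by presburger
      then consider "i = 0" | m where "i = Suc m" "i < k" | m where "i = k" "k = Suc m" | "i = k + 1" | "i = k + 2"
        by blast
      then show ?thesis
      proof cases
        case 1
        then have "nbr ?L i = {1}" using k unfolding nL by auto
        then show ?thesis using N0 1 k by (simp add: h_def)
      next
        case 2
        then have "nbr ?L i = {m, Suc (Suc m)}" unfolding nL by auto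
        then show ?thesis using NS[of m] 2 by (simp add: h_def)
      next
        case 3
        then have "nbr ?L i = {m, k + 1, k + 2}" unfolding nL by auto
        then show ?thesis using Nk 3 by (simp add: h_def insert_commute)
      next
        case 4
        then have "nbr ?L i = {k}" unfolding nL by auto
        then show ?thesis using ww 4 by (simp add: h_def)
      next
        case 5
        then have "nbr ?L i = {k}" unfolding nL by auto
        then show ?thesis using ww 5 by (simp add: h_def)
      qed
    qed
  qed simp
qed

text \<open>Here \<open>g 0, \<dots>, g k\<close> is the path between the two branching vertices.\<close>
lemma D_tree_iso:
  assumes T: "valued_tree T" and k: "k \<ge> 1"
    and edge: "\<And>i. i < k \<Longrightarrow> tedge T (g i) (g (Suc i)) = Some (1, 1)"
    and N0: "{y. tadj T (g 0) y} = {u, u', g 1}" "distinct [u, u', g 1]"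
    and NS: "\<And>i. Suc i < k \<Longrightarrow> {y. tadj T (g (Suc i)) y} = {g i, g (Suc (Suc i))} \<and> g i \<noteq> g (Suc (Suc i))"
    and Nk: "{y. tadj T (g k) y} = {g (k - 1), w, w'}" "distinct [g (k - 1), w, w']"
    and uu: "{y. tadj T u y} = {g 0}" "{y. tadj T u' y} = {g 0}"
      "tedge T (g 0) u = Some (1, 1)" "tedge T (g 0) u' = Some (1, 1)"
    and ww: "{y. tadj T w y} = {g k}" "{y. tadj T w' y} = {g k}"
      "tedge T (g k) w = Some (1, 1)" "tedge T (g k) w' = Some (1, 1)"
  shows "T \<cong>\<^sub>T vtree_of {..k + 4} (map_of (line (k + 3) unvalued @ [((1, k + 3), (1, 1)), ((k + 1, k + 4), (1, 1))]))"
proof -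
  \<comment> \<open>The leaf \<open>u\<close> becomes vertex 0, which moves the path
    \<open>g\<close> up by one, and \<open>w\<close> closes the line; \<open>u'\<close> and
    \<open>w'\<close> are the two vertices attached to it.\<close>
  define h where "h i = (if i = 0 then u else if i \<le> k + 1 then g (i - 1) else if i = k + 2 then w
    else if i = k + 3 then u' else w')" for i
  let ?L = "line (k + 3) unvalued @ [((1, k + 3), (1, 1)), ((k + 1, k + 4), (1, 1))]"
  have nL: "nbr ?L i = {j. j = Suc i \<and> i < k + 2 \<or> i = Suc j \<and> i < k + 3 \<or> i = 1 \<and> j = k + 3 \<or> i = k + 3 \<and> j = 1
      \<or> i = k + 1 \<and> j = k + 4 \<or> i = k + 4 \<and> j = k + 1}" for i
    unfolding nbr_append nbr_line nbr_Cons nbr_Nil by auto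
  have u: "tedge T u (g 0) = Some (1, 1)" using vtree_edge_sym[OF T, of u "g 0"] uu(3) by simp
  have "T \<cong>\<^sub>T vtree_of {..<k + 5} (map_of ?L)"
  proof (rule list_tree_iso[OF T, where g = h])
    show "\<exists>i v. ((i, j), v) \<in> set ?L" if "0 < j" "j < k + 5" for j
    proof (cases "j < k + 3")
      case True
      then have "((j - 1, j), (1, 1)) \<in> set ?L" using that by (simp add: set_line)
      then show ?thesis by blast
    next
      case False
      then have "j = k + 3 \<or> j = k + 4" using that by linarith
      then show ?thesis by auto
    qed
    show "i < j \<and> j < k + 5" if "((i, j), v) \<in> set ?L" for i j v using that by (auto simp: set_line)
    show "distinct (map fst ?L)" by (auto simp: distinct_line set_line)
    show "tedge T (h i) (h j) = Some v" if e: "((i, j), v) \<in> set ?L" for i j v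
    proof -
      consider "j = Suc i" "i = 0" "v = (1, 1)" | m where "j = Suc i" "i = Suc m" "m < k" "v = (1, 1)"
        | "j = Suc i" "i = k + 1" "v = (1, 1)" | "i = 1" "j = k + 3" "v = (1, 1)"
        | "i = k + 1" "j = k + 4" "v = (1, 1)"
      proof -
        have "j = Suc i \<and> i < k + 2 \<and> v = (1, 1) \<or> i = 1 \<and> j = k + 3 \<and> v = (1, 1) \<or> i = k + 1 \<and> j = k + 4 \<and> v = (1, 1)"
          using e by (auto simp: set_line)
        moreover have "i < k + 2 \<Longrightarrow> i = 0 \<or> (\<exists>m. i = Suc m \<and> m < k) \<or> i = k + 1" by presburger
        ultimately show thesis using that by blast
      qed
      then show ?thesis
        by cases (use edge ww uu u k in \<open>auto simp: h_def\<close>)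
    qed
    show "inj_on h (nbr ?L i) \<and> {y. tadj T (h i) y} = h ` nbr ?L i" if i: "i < k + 5" for i
    proof -
      have "i = 0 \<or> i = 1 \<or> (\<exists>m. i = Suc (Suc m) \<and> Suc m < k) \<or> i = k + 1 \<or> i = k + 2 \<or> i = k + 3 \<or> i = k + 4"
        using i by presburger
      then consider "i = 0" | "i = 1" | m where "i = Suc (Suc m)" "Suc m < k" | "i = k + 1" | "i = k + 2" | "i = k + 3" | "i = k + 4"
        by blast
      then show ?thesis
      proof cases
        case 1
        then have "nbr ?L i = {1}" using k unfolding nL by auto
        then show ?thesis using uu 1 k by (simp add: h_def)
      next
        case 2
        then have "nbr ?L i = {0, k + 3, 2}" using k unfolding nL by auto
        then show ?thesis using N0 2 k by (simp add: h_def insert_commute) metis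
      next
        case 3
        then have "nbr ?L i = {Suc m, Suc (Suc (Suc m))}" unfolding nL by auto
        then show ?thesis using NS[of m] 3 by (simp add: h_def)
      next
        case 4
        then have "nbr ?L i = {k, k + 2, k + 4}" using k unfolding nL by auto
        then show ?thesis using Nk 4 k by (simp add: h_def insert_commute)
      next
        case 5
        then have "nbr ?L i = {k + 1}" unfolding nL by auto
        then show ?thesis using ww 5 by (simp add: h_def)
      next
        case 6
        then have "nbr ?L i = {1}" unfolding nL by auto
        then show ?thesis using uu 6 by (simp add: h_def)
      next
        case 7
        then have "nbr ?L i = {k + 1}" unfolding nL by auto
        then show ?thesis using ww 7 by (simp add: h_def)
      qed
    qed
  qed simp
  moreover have "{..<k + 5} = {..k + 4}" by auto
  ultimately show ?thesis by simp
qed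

lemma D_inf_iso:
  assumes T: "valued_tree T" and edge: "\<And>i. tedge T (g i) (g (Suc i)) = Some (1, 1)"
    and N0: "{y. tadj T (g 0) y} = {u, u', g 1}" "distinct [u, u', g 1]"
    and NS: "\<And>i. {y. tadj T (g (Suc i)) y} = {g i, g (Suc (Suc i))} \<and> g i \<noteq> g (Suc (Suc i))"
    and uu: "{y. tadj T u y} = {g 0}" "{y. tadj T u' y} = {g 0}"
      "tedge T (g 0) u = Some (1, 1)" "tedge T (g 0) u' = Some (1, 1)"
  shows "T \<cong>\<^sub>T D_inf"
proof -
  let ?E = "\<lambda>(i::nat, j). if (i, j) = (0, 2) \<or> 1 \<le> i \<and> j = Suc i then Some (1::nat, 1::nat) else None"
  let ?A = "\<lambda>i j. ?E (i, j) \<noteq> None \<or> ?E (j, i) \<noteq> None"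
  define h where "h i = (case i of 0 \<Rightarrow> u | Suc 0 \<Rightarrow> u' | Suc (Suc m) \<Rightarrow> g m)" for i
  have h: "h 0 = u" "h 1 = u'" "h (Suc 0) = u'" "h (Suc (Suc m)) = g m" "h 2 = g 0" "h 3 = g 1" for m
    by (simp_all add: h_def numeral_2_eq_2 numeral_3_eq_3)
  have u: "tedge T u (g 0) = Some (1, 1)" "tedge T u' (g 0) = Some (1, 1)"
    using vtree_edge_sym[OF T, of _ "g 0"] uu(3,4) by simp_all
  have "T \<cong>\<^sub>T vtree_of UNIV ?E"
  proof (rule vtree_of_iso[OF T, of 0])
    have 02: "?A\<^sup>*\<^sup>* 0 2" by (rule r_into_rtranclp) simp
    have "?A\<^sup>*\<^sup>* 0 (Suc (Suc m))" for m
    proof (induction m)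
      case 0 then show ?case using 02 by (simp add: numeral_2_eq_2)
    next
      case (Suc m)
      then show ?case by (rule rtranclp.rtrancl_into_rtrancl) simp
    qed
    moreover have "?A\<^sup>*\<^sup>* 0 1" using 02 by (rule rtranclp.rtrancl_into_rtrancl) simp
    moreover have "i = 0 \<or> i = 1 \<or> (\<exists>m. i = Suc (Suc m))" for i :: nat by presburger
    ultimately show "?A\<^sup>*\<^sup>* 0 i" for i
      by (metis (no_types, lifting) rtranclp.rtrancl_refl)
    show "h 0 \<in> tverts T" using vtree_adj_verts[OF T, of u "g 0"] u by (simp add: h)
    show "tedge T (h i) (h j) = Some v" if "?E (i, j) = Some v" for i j v
    proof -
      have v: "v = (1, 1)" and c: "(i, j) = (0, 2) \<or> 1 \<le> i \<and> j = Suc i" using that by (auto split: if_splits)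
      consider "i = 0" "j = 2" | "i = 1" "j = 2" | m where "i = Suc (Suc m)" "j = Suc i"
      proof -
        have "i = 0 \<and> j = 2 \<or> i = 1 \<and> j = 2 \<or> (\<exists>m. i = Suc (Suc m) \<and> j = Suc i)" using c unfolding prod.inject by presburger
        then show thesis using that by blast
      qed
      then show ?thesis using v u edge by cases (auto simp: h)
    qed
    have "inj_on h {j. ?A i j} \<and> {y. tadj T (h i) y} \<subseteq> h ` {j. ?A i j}" for i
    proof -
      consider "i = 0" | "i = 1" | "i = 2" | m where "i = Suc (Suc (Suc m))"
      proof -
        have "i = 0 \<or> i = 1 \<or> i = 2 \<or> (\<exists>m. i = Suc (Suc (Suc m)))" by presburger
        then show thesis using that by blast
      qed
      then show ?thesis
      proof cases
        case 1
        then have "{j. ?A i j} = {2}" by auto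
        then show ?thesis using uu 1 by (simp add: h)
      next
        case 2
        then have "{j. ?A i j} = {2}" by auto
        then show ?thesis using uu 2 by (simp add: h)
      next
        case 3
        then have "{j. ?A i j} = {0, 1, 3}" by auto
        then show ?thesis using N0 3 by (simp add: h)
      next
        case 4
        then have "{j. ?A i j} = {Suc (Suc m), Suc (Suc (Suc (Suc m)))}" by auto
        then show ?thesis using NS[of m] 4 by (simp add: h)
      qed
    qed
    then show "inj_on h {j. ?A i j}" "{y. tadj T (h i) y} \<subseteq> h ` {j. ?A i j}" for i by blast+
  qed (auto split: if_splits)
  then show ?thesis by (simp only: D_inf_def)
qed

lemma A_inf_inf_iso:
  fixes g :: "int \<Rightarrow> 'v"
  assumes T: "valued_tree T" and edge: "\<And>i. tedge T (g i) (g (i + 1)) = Some (1, 1)"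
    and N: "\<And>i. {y. tadj T (g i) y} = {g (i - 1), g (i + 1)} \<and> g (i - 1) \<noteq> g (i + 1)"
  shows "T \<cong>\<^sub>T A_inf_inf"
  unfolding A_inf_inf_def
proof (rule vtree_of_iso[OF T, of 0])
  let ?E = "\<lambda>(i::int, j). if j = i + 1 then Some (1::nat, 1::nat) else None"
  let ?A = "\<lambda>i j. ?E (i, j) \<noteq> None \<or> ?E (j, i) \<noteq> None"
  have A: "{j. ?A i j} = {i - 1, i + 1}" for i by auto
  show "?A\<^sup>*\<^sup>* 0 i" for i
  proof (induction i rule: int_induct[where k = 0])
    case (step1 i)
    from step1(2) show ?case by (rule rtranclp.rtrancl_into_rtrancl) simp
  next
    case (step2 i)
    from step2(2) show ?case by (rule rtranclp.rtrancl_into_rtrancl) simp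
  qed simp
  show "g 0 \<in> tverts T" using vtree_adj_verts[OF T, of "g 0" "g 1"] edge[of 0] by simp
  show "inj_on g {j. ?A i j}" "{y. tadj T (g i) y} \<subseteq> g ` {j. ?A i j}" for i
    unfolding A using N[of i] by simp_all
qed (use edge in \<open>auto split: if_splits\<close>)

section \<open>Classification: trees with a ratio equal to one, and three plain arms\<close>

context additive_tree
begin

lemma N_adj: "{y. tadj T x y} = N x"
  by (simp add: N_def)

lemma edge_rev: "tedge T x y = Some (a, b) \<Longrightarrow> tedge T y x = Some (b, a)"
  using vtree_edge_sym[OF tree, of y x] by simp

lemma armD:
  assumes "arm m p"
  shows "m \<ge> 1" "\<And>i. i < m \<Longrightarrow> tedge T (p i) (p (Suc i)) = Some (1, 1)"
    "\<And>i. Suc i < m \<Longrightarrow> N (p (Suc i)) = {p i, p (Suc (Suc i))} \<and> p i \<noteq> p (Suc (Suc i))"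
    "N (p m) = {p (m - 1)}" "p 1 \<in> N (p 0)"
  using assms unfolding arm_def by (auto simp: Suc_le_eq)

definition has_val_end :: bool where
  "has_val_end \<longleftrightarrow> (\<exists>v w. w \<in> N v \<and> r v w = 1 \<and> N w = {v} \<and> tedge T v w \<in> {Some (1, 2), Some (2, 1)})"

text \<open>The ratio towards a valued end is 1, so a ray starts there. Its far end decides the
  tree: none gives \<open>B_inf\<close> or \<open>C_inf\<close>, a valued edge gives the diagrams
  with two valued ends, a fork those with one valued end.\<close>

lemma classify_val_end:
  assumes has_val_end
  shows "extended_dynkin T \<or> T \<cong>\<^sub>T B_inf \<or> T \<cong>\<^sub>T C_inf"
proof -
  obtain v w where vw: "w \<in> N v" "r v w = 1" "N w = {v}" "tedge T v w \<in> {Some (1, 2), Some (2, 1)}"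
    using assms unfolding has_val_end_def by blast
  obtain P where P: "tedge T w v = Some P" "P \<in> {(1, 2), (2, 1)}" using vw(4) edge_rev by blast
  obtain p where p: "p 0 = w" "p 1 = v" and c: "(\<forall>i. straight p i) \<or> (\<exists>k. (\<forall>i<k. straight p i) \<and>
       (val_end (p k) (p (Suc k)) (p (Suc (Suc k))) \<or> (\<exists>w w'. fork_end (p k) (p (Suc k)) w w')))"
    using ray_ex[OF vw(1,2)] by blast
  have N0: "N (p 0) = {p 1}" and e0: "tedge T (p 0) (p (Suc 0)) = Some P" using p vw P by auto
  from c consider "\<forall>i. straight p i" | k where "\<forall>i<k. straight p i" "val_end (p k) (p (Suc k)) (p (Suc (Suc k)))"
    | k z z' where "\<forall>i<k. straight p i" "fork_end (p k) (p (Suc k)) z z'" by blast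
  then show ?thesis
  proof cases
    case 1
    have "T \<cong>\<^sub>T half_line (unvalued(0 := P))"
    proof (rule half_line_iso[OF tree, of p], unfold N_adj)
      show "tedge T (p i) (p (Suc i)) = Some ((unvalued(0 := P)) i)" for i
        using 1 e0 by (cases i) (auto simp: st_def)
      show "N (p (Suc i)) = {p i, p (Suc (Suc i))} \<and> p i \<noteq> p (Suc (Suc i))" for i
        using 1 by (auto simp: st_def)
    qed (rule N0)
    then show ?thesis using P(2) unfolding B_inf_def C_inf_def by blast
  next
    case 2
    note k = 2(1)[rule_format] and ve = 2(2)[unfolded val_end_def]
    obtain Q where Q: "tedge T (p (Suc k)) (p (Suc (Suc k))) = Some Q" "Q \<in> {(1, 2), (2, 1)}" using ve by blast
    have "T \<cong>\<^sub>T line_tree (k + 3) (unvalued(0 := P, k + 3 - 2 := Q))"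
    proof (rule line_tree_iso[OF tree, where g = p], unfold N_adj)
      show "tedge T (p i) (p (Suc i)) = Some ((unvalued(0 := P, k + 3 - 2 := Q)) i)" if i: "Suc i < k + 3" for i
      proof -
        have "i = 0 \<or> (\<exists>m. i = Suc m \<and> m < k) \<or> i = Suc k" using i by presburger
        then show ?thesis using e0 Q k by (auto simp: st_def)
      qed
      show "N (p (k + 3 - 1)) = {p (k + 3 - 2)}" using ve by simp
      show "N (p (Suc i)) = {p i, p (Suc (Suc i))} \<and> p i \<noteq> p (Suc (Suc i))" if i: "Suc (Suc i) < k + 3" for i
      proof -
        have "i < k \<or> i = k" using i by linarith
        then show ?thesis using k ve by (auto simp: st_def)
      qed
    qed (use N0 in auto)
    moreover have "euclidean_diagram (line_tree (k + 3) (unvalued(0 := P, k + 3 - 2 := Q)))"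
      by (rule B_C_BC_tilde) (use P Q in auto)
    ultimately show ?thesis unfolding extended_dynkin_def by blast
  next
    case 3
    note k = 3(1)[rule_format] and fe = 3(2)[unfolded fork_end_def]
    have "T \<cong>\<^sub>T vtree_of {..<Suc k + 3} (map_of (line (Suc k + 2) (unvalued(0 := P)) @ [((Suc k, Suc k + 2), (1, 1))]))"
    proof (rule BD_tree_iso[OF tree, where g = p and w = z and w' = z'], unfold N_adj)
      show "tedge T (p i) (p (Suc i)) = Some ((unvalued(0 := P)) i)" if "i < Suc k" for i
        using k that e0 by (cases i) (auto simp: st_def)
      show "N (p (Suc i)) = {p i, p (Suc (Suc i))} \<and> p i \<noteq> p (Suc (Suc i))" if "Suc i < Suc k" for i
        using k that by (auto simp: st_def)
    qed (use fe N0 in auto)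
    moreover have "euclidean_diagram (vtree_of {..<Suc k + 3} (map_of (line (Suc k + 2) (unvalued(0 := P)) @ [((Suc k, Suc k + 2), (1, 1))])))"
      using BD_CD_tilde[of "Suc k + 3" P] P by (simp add: eval_nat_numeral)
    ultimately show ?thesis unfolding extended_dynkin_def by blast
  qed
qed

text \<open>The two leaves take 1/2 each, which leaves ratio 1 in the remaining direction. With
  valued ends excluded, the ray starting there runs forever or meets a second fork.\<close>

lemma classify_fork:
  assumes nv: "\<not> has_val_end" and f: "fork_end u c w w'"
  shows "extended_dynkin T \<or> T \<cong>\<^sub>T D_inf"
proof -
  note f = f[unfolded fork_end_def]
  have w: "w \<in> N c" "w' \<in> N c" and u: "u \<in> N c" using f by auto
  have half: "r c z = 1/2" if "z \<in> N c" "N z = {c}" "tedge T c z = Some (1, 1)" for z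
  proof -
    have "z \<in> tverts T" using N_verts that by blast
    then have "r z c = 2" using sum_r[of z] that by simp
    moreover have "wt c z * wt z c = 1" using edge_eq[OF that(1)] that(3) by simp
    ultimately show ?thesis using r_prod[OF that(1)] by simp
  qed
  have "(\<Sum>z\<in>N c. r c z) = 2" using sum_r N_verts u by blast
  then have "r c u + (r c w + r c w') = 2" using f by simp
  then have ru: "r c u = 1" using half[of w] half[of w'] w f by simp
  from r_1_step[OF u ru] have e: "tedge T c u = Some (1, 1)" "r u c = 1"
    using nv u ru unfolding has_val_end_def by blast+
  obtain p where p: "p 0 = c" "p 1 = u" and cs: "(\<forall>i. straight p i) \<or> (\<exists>k. (\<forall>i<k. straight p i) \<and>
       (val_end (p k) (p (Suc k)) (p (Suc (Suc k))) \<or> (\<exists>w w'. fork_end (p k) (p (Suc k)) w w')))"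
    using ray_ex[OF N_sym[OF u] e(2)] by blast
  have nve: "\<not> val_end a b d" for a b d
    using nv unfolding has_val_end_def val_end_def by blast
  have p1: "p (Suc 0) = u" using p by simp
  have N0: "N (p 0) = {w, w', p 1}" "distinct [w, w', p 1]" using p f by auto
  from cs nve consider "\<forall>i. straight p i" | k z z' where "\<forall>i<k. straight p i" "fork_end (p k) (p (Suc k)) z z'" by blast
  then show ?thesis
  proof cases
    case 1
    have "T \<cong>\<^sub>T D_inf"
    proof (rule D_inf_iso[OF tree, of p w w'], unfold N_adj)
      show "tedge T (p i) (p (Suc i)) = Some (1, 1)" for i
        using 1 e p p1 by (cases i) (auto simp: st_def)
      show "N (p (Suc i)) = {p i, p (Suc (Suc i))} \<and> p i \<noteq> p (Suc (Suc i))" for i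
        using 1 by (auto simp: st_def)
    qed (use N0 f p in auto)
    then show ?thesis by blast
  next
    case 2
    note k = 2(1)[rule_format] and fe = 2(2)[unfolded fork_end_def]
    have "T \<cong>\<^sub>T vtree_of {..Suc k + 4} (map_of (line (Suc k + 3) unvalued @ [((1, Suc k + 3), (1, 1)), ((Suc k + 1, Suc k + 4), (1, 1))]))"
    proof (rule D_tree_iso[OF tree, where g = p and u = w and u' = w' and w = z and w' = z'], unfold N_adj)
      show "tedge T (p i) (p (Suc i)) = Some (1, 1)" if "i < Suc k" for i
        using k that e p p1 by (cases i) (auto simp: st_def)
      show "N (p (Suc i)) = {p i, p (Suc (Suc i))} \<and> p i \<noteq> p (Suc (Suc i))" if "Suc i < Suc k" for i
        using k that by (auto simp: st_def)
    qed (use fe N0 f p in auto)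
    moreover have "euclidean_diagram (vtree_of {..Suc k + 4} (map_of (line (Suc k + 3) unvalued @ [((1, Suc k + 3), (1, 1)), ((Suc k + 1, Suc k + 4), (1, 1))])))"
      using D_tilde[of "Suc k + 4"] by (simp add: eval_nat_numeral)
    ultimately show ?thesis unfolding extended_dynkin_def by blast
  qed
qed

text \<open>Without valued ends and forks, the rays in both directions along the edge are infinite
  and together form the doubly infinite line.\<close>

lemma classify_ratio_1:
  assumes xy: "y \<in> N x" "r x y = 1"
  shows "extended_dynkin T \<or> T \<cong>\<^sub>T B_inf \<or> T \<cong>\<^sub>T C_inf \<or> T \<cong>\<^sub>T D_inf \<or> T \<cong>\<^sub>T A_inf_inf"
proof (cases "has_val_end \<or> (\<exists>u c w w'. fork_end u c w w')")
  case True
  then show ?thesis using classify_val_end classify_fork by blast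
next
  case False
  then have nv: "\<not> has_val_end" and nf: "\<not> fork_end u c w w'" for u c w w' by blast+
  have nve: "\<not> val_end a b d" for a b d
    using nv unfolding has_val_end_def val_end_def by blast
  from r_1_step[OF xy] have e: "tedge T x y = Some (1, 1)" "r y x = 1"
    using nv xy unfolding has_val_end_def by blast+
  obtain p where p: "p 0 = x" "p 1 = y" "\<forall>i. straight p i"
    using ray_ex[OF N_sym[OF xy(1)] e(2)] nve nf by metis
  obtain q where q: "q 0 = y" "q 1 = x" "\<forall>i. straight q i"
    using ray_ex[OF xy] nve nf by metis
  note ps = p(3)[rule_format, unfolded st_def] and qs = q(3)[rule_format, unfolded st_def]
  \<comment> \<open>\<open>p\<close> starts with \<open>x, y\<close> and \<open>q\<close> with
    \<open>y, x\<close>; the two rays overlap in this edge, which explains the offset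
    \<open>1 - i\<close>.\<close>
  define g where "g i = (if i \<ge> 0 then p (nat i) else q (nat (1 - i)))" for i :: int
  have gp: "g (int i) = p i" for i by (simp add: g_def)
  have gq: "g (1 - int i) = q i" for i
  proof (cases i)
    case 0 then show ?thesis using p q by (simp add: g_def)
  next
    case (Suc j)
    then show ?thesis using p q by (cases j) (auto simp: g_def nat_add_distrib)
  qed
  have cases: "(\<exists>k. i = int (Suc k)) \<or> (\<exists>k. i = 1 - int (Suc k))" for i :: int
  proof (cases "i \<ge> 1")
    case True
    then have "i = int (Suc (nat (i - 1)))" by simp
    then show ?thesis by blast
  next
    case False
    then have "i = 1 - int (Suc (nat (- i)))" by simp
    then show ?thesis by blast
  qed
  have "T \<cong>\<^sub>T A_inf_inf"
  proof (rule A_inf_inf_iso[OF tree, of g], unfold N_adj)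
    fix i :: int
    consider k where "i = int (Suc k)" | k where "i = 1 - int (Suc k)" using cases by blast
    then have "tedge T (g i) (g (i + 1)) = Some (1, 1) \<and> N (g i) = {g (i - 1), g (i + 1)} \<and> g (i - 1) \<noteq> g (i + 1)"
    proof cases
      case 1
      then have "g i = p (Suc k)" "g (i + 1) = p (Suc (Suc k))" "g (i - 1) = p k"
        using gp[of "Suc k"] gp[of "Suc (Suc k)"] gp[of k] by (simp_all add: algebra_simps)
      then show ?thesis using ps[of k] by simp
    next
      case 2
      have i: "i - 1 = 1 - int (Suc (Suc k))" "i + 1 = 1 - int k" using 2 by simp_all
      have "g i = q (Suc k)" "g (i - 1) = q (Suc (Suc k))" "g (i + 1) = q k"
        unfolding i unfolding 2 by (rule gq)+
      moreover have "tedge T (q (Suc k)) (q k) = Some (1, 1)"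
      proof (cases k)
        case 0 then show ?thesis using e q by simp
      next
        case (Suc j)
        then show ?thesis using qs[of j] by (simp add: edge_rev[where a = "Suc 0" and b = "Suc 0", of "q (Suc j)" "q (Suc (Suc j))"])
      qed
      ultimately show ?thesis using qs[of k] by (metis insert_commute)
    qed
    then show "tedge T (g i) (g (i + 1)) = Some (1, 1)" "N (g i) = {g (i - 1), g (i + 1)} \<and> g (i - 1) \<noteq> g (i + 1)"
      by blast+
  qed
  then show ?thesis by blast
qed

text \<open>Bounded quantifiers over explicit sets let simplification evaluate every condition on a
  concrete tree.\<close>

lemma small_tree_iso:
  fixes g :: "nat \<Rightarrow> 'v"
  assumes n: "n \<ge> 2"
    and L: "\<forall>((i, j), v)\<in>set L. i < j \<and> j < n" "distinct (map fst L)"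
    and par: "\<forall>j\<in>{1..<n}. j \<in> set (map (snd \<circ> fst) L)"
    and edge: "\<forall>((i, j), v)\<in>set L. tedge T (g i) (g j) = Some v"
    and nb: "\<forall>i\<in>{..<n}. inj_on g (nbr L i) \<and> N (g i) = g ` nbr L i"
  shows "T \<cong>\<^sub>T vtree_of {..<n} (map_of L)"
proof (rule list_tree_iso[OF tree n, where g = g])
  show "\<exists>i v. ((i, j), v) \<in> set L" if "0 < j" "j < n" for j
  proof -
    have "j \<in> set (map (snd \<circ> fst) L)" using par that by simp
    then show ?thesis by (auto simp: image_iff; metis)
  qed
  show "inj_on g (nbr L i) \<and> {y. tadj T (g i) y} = g ` nbr L i" if "i < n" for i
    using nb that unfolding N_adj by blast
qed (use L edge in blast)+

lemma extended_dynkinI: "euclidean_diagram D \<Longrightarrow> T \<cong>\<^sub>T D \<Longrightarrow> extended_dynkin T"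
  unfolding extended_dynkin_def by blast

lemmas tree_simps = nbr_append nbr_Nil nbr_Cons line_def upt_rec numeral_eq_Suc lessThan_Suc atLeastLessThanSuc

text \<open>The three triples are the arm lengths at the branching vertex of
  \<open>E6_tilde\<close>, \<open>E7_tilde\<close> and \<open>E8_tilde\<close>, in this
  order.\<close>

lemma classify_three_arms:
  assumes x: "N x = {p 1, q 1, s 1}" "distinct [p 1, q 1, s 1]" "p 0 = x" "q 0 = x" "s 0 = x"
    and arms: "arm a p" "arm b q" "arm c s"
    and abc: "(a, b, c) \<in> {(2, 2, 2), (1, 3, 3), (1, 2, 5)}"
  shows "extended_dynkin T"
proof -
  note P = armD[OF arms(1)] and Q = armD[OF arms(2)] and S = armD[OF arms(3)]
  note Pr = edge_rev[OF P(2)] and Qr = edge_rev[OF Q(2)] and Sr = edge_rev[OF S(2)]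
  from abc consider "a = 2" "b = 2" "c = 2" | "a = 1" "b = 3" "c = 3" | "a = 1" "b = 2" "c = 5" by auto
  then show ?thesis
  proof cases
    case 1
    define g where "g i = [p 2, p 1, x, q 1, q 2, s 1, s 2] ! i" for i
    have "T \<cong>\<^sub>T vtree_of {..<7} (map_of (line 5 unvalued @ [((2, 5), (1, 1)), ((5, 6), (1, 1))]))"
      using 1 x P(2)[of 0] Pr[of 0] P(2)[of 1] Pr[of 1] P(3)[of 0] P(4) Q(2)[of 0] Qr[of 0] Q(2)[of 1] Qr[of 1] Q(3)[of 0] Q(4) S(2)[of 0] Sr[of 0] S(2)[of 1] Sr[of 1] S(3)[of 0] S(4)
      by (intro small_tree_iso[where g = g])
        (simp_all add: g_def tree_simps insert_commute, auto)
    then show ?thesis by (rule extended_dynkinI[OF E6_tilde])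
  next
    case 2
    define g where "g i = [q 3, q 2, q 1, x, s 1, s 2, s 3, p 1] ! i" for i
    have "T \<cong>\<^sub>T vtree_of {..<8} (map_of (line 7 unvalued @ [((3, 7), (1, 1))]))"
      using 2 x P(2)[of 0] Pr[of 0] P(4) Q(2)[of 0] Qr[of 0] Q(2)[of 1] Qr[of 1] Q(2)[of 2] Qr[of 2] Q(3)[of 0] Q(3)[of 1] Q(4)
        S(2)[of 0] Sr[of 0] S(2)[of 1] Sr[of 1] S(2)[of 2] Sr[of 2] S(3)[of 0] S(3)[of 1] S(4)
      by (intro small_tree_iso[where g = g])
        (simp_all add: g_def tree_simps insert_commute, auto)
    then show ?thesis by (rule extended_dynkinI[OF E7_tilde])
  next
    case 3
    define g where "g i = [q 2, q 1, x, s 1, s 2, s 3, s 4, s 5, p 1] ! i" for i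
    have "T \<cong>\<^sub>T vtree_of {..<9} (map_of (line 8 unvalued @ [((2, 8), (1, 1))]))"
      using 3 x P(2)[of 0] Pr[of 0] P(4) Q(2)[of 0] Qr[of 0] Q(2)[of 1] Qr[of 1] Q(3)[of 0] Q(4)
        S(2)[of 0] Sr[of 0] S(2)[of 1] Sr[of 1] S(2)[of 2] Sr[of 2] S(2)[of 3] Sr[of 3] S(2)[of 4] Sr[of 4] S(3)[of 0] S(3)[of 1] S(3)[of 2] S(3)[of 3] S(4)
      by (intro small_tree_iso[where g = g])
        (simp_all add: g_def tree_simps insert_commute, auto)
    then show ?thesis by (rule extended_dynkinI[OF E8_tilde])
  qed
qed

end

text \<open>Equivalent to 1/(a+1) + 1/(b+1) + 1/(c+1) = 1, whose ordered solutions with denominators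
  at least 2 are (3,3,3), (2,4,4) and (2,3,6).\<close>

lemma three_arms_arith:
  fixes a b c :: nat
  assumes eq: "real a / real (Suc a) + real b / real (Suc b) + real c / real (Suc c) = 2"
    and ord: "1 \<le> a" "a \<le> b" "b \<le> c"
  shows "(a, b, c) \<in> {(2, 2, 2), (1, 3, 3), (1, 2, 5)}"
proof -
  define A B C where "A = real a + 1" and "B = real b + 1" and "C = real c + 1"
  have pos: "A > 0" "B > 0" "C > 0" by (simp_all add: A_def B_def C_def)
  have abc: "real a = A - 1" "real b = B - 1" "real c = C - 1" "real (Suc a) = A" "real (Suc b) = B" "real (Suc c) = C"
    by (simp_all add: A_def B_def C_def)
  have "(A - 1) / A + (B - 1) / B + (C - 1) / C = 2" using eq unfolding abc .
  then have "A * B * C = B * C + A * C + A * B" using pos by (simp add: field_simps)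
  then have "real a * real b * real c = real a + real b + real c + 2" unfolding abc by (simp add: algebra_simps)
  then have "real (a * b * c) = real (a + b + c + 2)" by simp
  then have e: "a * b * c = a + b + c + 2" by (simp only: of_nat_eq_iff)
  \<comment> \<open>If \<open>a b\<close> were at least 5, then \<open>5 c\<close> would be at most
    \<open>3 c + 2\<close>, so \<open>c = 1\<close> and therefore \<open>a b = 1\<close>.\<close>
  have ab: "a * b \<le> 4"
  proof (rule ccontr)
    assume "\<not> a * b \<le> 4"
    then have "5 * c \<le> a * b * c" by (intro mult_right_mono) auto
    then have "c \<le> 1" using e ord by linarith
    then have "a = 1" "b = 1" using ord by auto
    then show False using \<open>\<not> a * b \<le> 4\<close> by simp
  qed
  have "a \<le> 2"
  proof (rule ccontr)
    assume "\<not> a \<le> 2"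
    then have "3 * 3 \<le> a * b" using ord by (intro mult_le_mono) auto
    then show False using ab by simp
  qed
  then consider "a = 1" | "a = 2" using ord by linarith
  then show ?thesis
  proof cases
    case 1
    then have "b \<le> 4" using ab by simp
    moreover have "b \<noteq> 4"
    proof
      assume "b = 4"
      then have "3 * c = 7" using e 1 by simp
      then show False by presburger
    qed
    ultimately consider "b = 1" | "b = 2" | "b = 3" using ord by linarith
    then show ?thesis using e 1 by cases auto
  next
    case 2
    then have "b = 2" using ab ord by simp
    then show ?thesis using e 2 by auto
  qed
qed

text \<open>\<open>k\<close> is the product of \<open>(m+2)/(m+1)\<close> and
  \<open>(l+2)/(l+1)\<close>. For \<open>k\<close> at least 2 this bounds \<open>m l\<close> by 2,
  and only three cases survive integrality.\<close>

lemma two_arms_arith: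
  fixes m l k :: nat
  assumes eq: "(m + 2) * (l + 2) = k * ((m + 1) * (l + 1))" and k: "k \<ge> 2" and ord: "m \<le> l"
  shows "(m, l, k) \<in> {(0, 0, 4), (0, 1, 3), (1, 2, 2)}"
proof -
  have "2 * ((m + 1) * (l + 1)) \<le> (m + 2) * (l + 2)" unfolding eq using k by (intro mult_right_mono) auto
  then have ml: "m * l \<le> 2" by (simp add: algebra_simps)
  have "m * m \<le> m * l" using ord by simp
  then have "m * m \<le> 2" using ml by linarith
  have "m < 2"
  proof (rule ccontr)
    assume "\<not> m < 2"
    then have "2 * 2 \<le> m * m" by (intro mult_le_mono) auto
    then show False using \<open>m * m \<le> 2\<close> by simp
  qed
  then consider "m = 0" | "m = 1" by linarith
  then show ?thesis
  proof cases
    case 1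
    have "k \<noteq> 2" using eq 1 by auto
    then have "3 * (l + 1) \<le> k * (l + 1)" using k by (intro mult_right_mono) auto
    then have "3 * (l + 1) \<le> 2 * (l + 2)" using eq 1 by simp
    then have "l = 0 \<or> l = 1" by presburger
    then consider "l = 0" | "l = 1" by blast
    then show ?thesis using eq 1 by cases auto
  next
    case 2
    then consider "l = 1" | "l = 2" using ml ord by force
    then show ?thesis
    proof cases
      assume "l = 1"
      then have "9 = k * 4" using eq 2 by simp
      then have False by presburger
      then show ?thesis ..
    next
      assume "l = 2"
      then show ?thesis using eq 2 by auto
    qed
  qed
qed

section \<open>Classification: centres, valued inner edges and escaping rays\<close>

context additive_tree
begin

text \<open>This is the smallest member of the family \<open>D_tilde\<close>, where both forks sit
  at the same vertex.\<close>

lemma classify_four_leaves: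
  assumes x: "N x = {a, b, c, d}" "distinct [a, b, c, d]" and r: "\<And>y. y \<in> N x \<Longrightarrow> r x y = 1/2"
  shows "extended_dynkin T"
proof -
  have l: "N y = {x}" "tedge T x y = Some (1, 1)" "tedge T y x = Some (1, 1)" if "y \<in> N x" for y
    using r_half_leaf[OF that r[OF that]] edge_rev by blast+
  have abcd: "a \<in> N x" "b \<in> N x" "c \<in> N x" "d \<in> N x" using x by auto
  define g where "g i = [a, x, b, c, d] ! i" for i
  have "T \<cong>\<^sub>T vtree_of {..<5} (map_of (line 3 unvalued @ [((1, 3), (1, 1)), ((1, 4), (1, 1))]))"
    using l[OF abcd(1)] l[OF abcd(2)] l[OF abcd(3)] l[OF abcd(4)] x
    by (intro small_tree_iso[where g = g]) (simp_all add: g_def tree_simps insert_commute)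
  moreover have "{..<5} = {..4::nat}" by auto
  ultimately have "T \<cong>\<^sub>T vtree_of {..4} (map_of (line (4 - 1) unvalued @ [((1, 4 - 1), (1, 1)), ((4 - 3, 4), (1, 1))]))"
    by simp
  then show ?thesis using extended_dynkinI[OF D_tilde[of 4]] by simp
qed

text \<open>Ratios in [1/2, 1) with sum 2 allow only three or four neighbours. Three of them start
  plain arms whose lengths satisfy the equation of \<open>three_arms_arith\<close>; four must all
  have ratio 1/2 and are leaves.\<close>

lemma classify_centre:
  assumes x: "x \<in> tverts T" and lt: "\<And>y. y \<in> N x \<Longrightarrow> r x y < 1"
  shows "extended_dynkin T"
proof -
  have s: "(\<Sum>y\<in>N x. r x y) = 2" using sum_r[OF x] .
  have "real (card (N x)) / 2 \<le> 2"
    using sum_bounded_below[of "N x" "1/2" "r x"] r_ge_half s by simp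
  then have c4: "card (N x) \<le> 4" by simp
  have ne: "N x \<noteq> {}" using s by (metis sum.empty zero_neq_numeral)
  have "(\<Sum>y\<in>N x. r x y) < (\<Sum>y\<in>N x. 1)"
    by (rule sum_strict_mono) (use lt ne finite_N in auto)
  then have "2 < card (N x)" using s by simp
  then consider "card (N x) = 3" | "card (N x) = 4" using c4 by linarith
  then show ?thesis
  proof cases
    case 1
    then obtain u v w where uvw: "N x = {u, v, w}" "u \<noteq> v" "u \<noteq> w" "v \<noteq> w"
      unfolding card_3_iff by blast
    have N: "u \<in> N x" "v \<in> N x" "w \<in> N x" using uvw by auto
    obtain a p where a: "arm a p" "p 0 = x" "p 1 = u" "r x u = real a / real (Suc a)" using arm_ex[OF N(1) lt[OF N(1)]] by blast
    obtain b q where b: "arm b q" "q 0 = x" "q 1 = v" "r x v = real b / real (Suc b)" using arm_ex[OF N(2) lt[OF N(2)]] by blast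
    obtain c t where c: "arm c t" "t 0 = x" "t 1 = w" "r x w = real c / real (Suc c)" using arm_ex[OF N(3) lt[OF N(3)]] by blast
    have sm: "r x u + (r x v + r x w) = 2" using s uvw by simp
    note pos = armD(1)[OF a(1)] armD(1)[OF b(1)] armD(1)[OF c(1)]
    consider "a \<le> b" "b \<le> c" | "a \<le> c" "c \<le> b" | "b \<le> a" "a \<le> c" | "b \<le> c" "c \<le> a"
      | "c \<le> a" "a \<le> b" | "c \<le> b" "b \<le> a" by linarith
    then show ?thesis
    proof cases
      case 1
      show ?thesis
        by (rule classify_three_arms[of x p q t a b c])
          (use a b c uvw three_arms_arith[of a b c] 1 pos sm in \<open>auto simp: insert_commute\<close>)
    next
      case 2
      show ?thesis
        by (rule classify_three_arms[of x p t q a c b])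
          (use a b c uvw three_arms_arith[of a c b] 2 pos sm in \<open>auto simp: insert_commute\<close>)
    next
      case 3
      show ?thesis
        by (rule classify_three_arms[of x q p t b a c])
          (use a b c uvw three_arms_arith[of b a c] 3 pos sm in \<open>auto simp: insert_commute\<close>)
    next
      case 4
      show ?thesis
        by (rule classify_three_arms[of x q t p b c a])
          (use a b c uvw three_arms_arith[of b c a] 4 pos sm in \<open>auto simp: insert_commute\<close>)
    next
      case 5
      show ?thesis
        by (rule classify_three_arms[of x t p q c a b])
          (use a b c uvw three_arms_arith[of c a b] 5 pos sm in \<open>auto simp: insert_commute\<close>)
    next
      case 6
      show ?thesis
        by (rule classify_three_arms[of x t q p c b a])
          (use a b c uvw three_arms_arith[of c b a] 6 pos sm in \<open>auto simp: insert_commute\<close>)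
    qed
  next
    case 2
    have half: "r x y = 1/2" if y: "y \<in> N x" for y
    proof -
      have "card (N x - {y}) = 3" using 2 y by simp
      then show ?thesis using card_others[OF y] r_ge_half[OF y] by simp
    qed
    obtain u A where A: "N x = insert u A" "u \<notin> A" "card A = 3" using 2 by (metis card_eq_SucD eval_nat_numeral(2) semiring_norm(26,27) numeral_3_eq_3)
    then obtain v w z where "A = {v, w, z}" "v \<noteq> w" "v \<noteq> z" "w \<noteq> z" unfolding card_3_iff by blast
    then show ?thesis using classify_four_leaves[of x u v w z] A half by auto
  qed
qed

text \<open>On the side away from \<open>y\<close>, the tree beyond \<open>x\<close> is a plain path
  with \<open>m\<close> vertices; the ratio towards \<open>y\<close> is then 2 minus the ratio
  \<open>m/(m+1)\<close> of that arm.\<close>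

definition tail :: "'v \<Rightarrow> 'v \<Rightarrow> nat \<Rightarrow> (nat \<Rightarrow> 'v) \<Rightarrow> bool" where
  "tail y x m p \<longleftrightarrow> p 0 = x \<and> r x y = real (m + 2) / real (m + 1) \<and>
     (m = 0 \<and> N x = {y} \<or> arm m p \<and> p 1 \<noteq> y \<and> N x = {y, p 1})"

lemma tail_ex:
  assumes y: "y \<in> N x" "r x y > 1"
  obtains m p where "tail y x m p"
proof -
  from others_lt_1[OF y] show thesis
  proof
    assume "N x = {y} \<and> r x y = 2"
    then have "tail y x 0 (\<lambda>_. x)" by (simp add: tail_def)
    then show thesis by (rule that)
  next
    assume "\<exists>z. z \<noteq> y \<and> N x = {y, z} \<and> r x z = 2 - r x y"
    then obtain z where z: "z \<noteq> y" "N x = {y, z}" "r x z = 2 - r x y" by blast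
    have zx: "z \<in> N x" using z(2) by simp
    have "r x z < 1" using z(3) y(2) by simp
    then obtain m p where p: "arm m p" "p 0 = x" "p 1 = z" "r x z = real m / real (Suc m)"
      using arm_ex[OF zx] by blast
    have "r x y = 2 - real m / real (Suc m)" using p z by simp
    also have "\<dots> = real (m + 2) / real (m + 1)" by (simp add: field_simps)
    finally have "tail y x m p" using p z by (simp add: tail_def)
    then show thesis by (rule that)
  qed
qed

text \<open>The product of the ratios of the two tails is the product of the valuation entries, and
  \<open>two_arms_arith\<close> leaves the values 4, 3 and 2. They belong to the diagrams with two
  vertices, to \<open>G2_tilde\<close> and to \<open>F4_tilde\<close>.\<close>

lemma classify_two_tails:
  assumes y: "y \<in> N x" and t: "tail y x m p" "tail x y l q" and ml: "m \<le> l" and gt: "wt x y * wt y x \<ge> 2"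
  shows "extended_dynkin T"
proof -
  let ?k = "wt x y * wt y x"
  have w: "tedge T x y = Some (wt y x, wt x y)" "tedge T y x = Some (wt x y, wt y x)"
    using edge_eq[OF y] edge_eq[OF N_sym[OF y]] by simp_all
  have "real ?k = (real (m + 2) / real (m + 1)) * (real (l + 2) / real (l + 1))"
    using r_prod[OF y] t by (simp add: tail_def)
  then have "real ?k = real ((m + 2) * (l + 2)) / real ((m + 1) * (l + 1))"
    by (simp only: times_divide_times_eq of_nat_mult)
  then have "real ?k * real ((m + 1) * (l + 1)) = real ((m + 2) * (l + 2))"
    by (subst (asm) nonzero_eq_divide_eq) (simp_all only: of_nat_eq_0_iff, simp)
  then have "real ((m + 2) * (l + 2)) = real (?k * ((m + 1) * (l + 1)))"
    by (simp only: of_nat_mult)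
  then have "(m + 2) * (l + 2) = ?k * ((m + 1) * (l + 1))" using of_nat_eq_iff by blast
  from two_arms_arith[OF this gt ml] consider "m = 0" "l = 0" "?k = 4" | "m = 0" "l = 1" "?k = 3" | "m = 1" "l = 2" "?k = 2"
    by blast
  then show ?thesis
  proof cases
    case 1
    have "wt x y dvd 4" using 1 by (metis dvd_triv_left)
    then have "wt x y \<le> 4" by (rule dvd_imp_le) simp
    then have "wt x y = 1 \<or> wt x y = 2 \<or> wt x y = 3 \<or> wt x y = 4" using 1 by (cases "wt x y = 0") auto
    moreover have "wt x y \<noteq> 3"
    proof
      assume "wt x y = 3"
      then have "3 * wt y x = 4" using 1 by simp
      then show False by presburger
    qed
    ultimately have c: "(wt y x, wt x y) \<in> {(1, 4), (4, 1)} \<or> (wt y x, wt x y) = (2, 2)" using 1 by auto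
    define g where "g i = [x, y] ! i" for i
    have "T \<cong>\<^sub>T line_tree 2 (\<lambda>_. (wt y x, wt x y))"
      unfolding line_tree_def using 1 t w N_neq[OF y]
      by (intro small_tree_iso[where g = g]) (simp_all add: g_def tree_simps insert_commute tail_def arm_def)
    moreover have "euclidean_diagram (line_tree 2 (\<lambda>_. (wt y x, wt x y)))"
      using c A11_tilde A12_tilde by metis
    ultimately show ?thesis using extended_dynkinI by blast
  next
    case 2
    have "wt x y dvd 3" using 2 by (metis dvd_triv_left)
    then have "wt x y \<le> 3" by (rule dvd_imp_le) simp
    then have "wt x y = 1 \<or> wt x y = 2 \<or> wt x y = 3" using 2 by (cases "wt x y = 0") auto
    moreover have "wt x y \<noteq> 2"
    proof
      assume "wt x y = 2"
      then have "2 * wt y x = 3" using 2 by simp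
      then show False by presburger
    qed
    ultimately have c: "(wt x y, wt y x) \<in> {(1, 3), (3, 1)}" using 2 by auto
    have q: "arm 1 q" "N y = {x, q 1}" "q 1 \<noteq> x" "q 0 = y" and Nx: "N x = {y}" using t 2 by (auto simp: tail_def arm_def)
    have e: "tedge T (q 1) y = Some (1, 1)" "N (q 1) = {y}" using edge_rev[OF armD(2)[OF q(1), of 0]] armD(4)[OF q(1)] q by auto
    define g where "g i = [q 1, y, x] ! i" for i
    have "T \<cong>\<^sub>T line_tree 3 (unvalued(1 := (wt x y, wt y x)))"
      unfolding line_tree_def using q e w Nx N_neq[OF y]
      by (intro small_tree_iso[where g = g]) (simp_all add: g_def tree_simps insert_commute)
    then show ?thesis using extended_dynkinI[OF G2_tilde[OF c]] by blast
  next
    case 3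
    have "wt x y dvd 2" using 3 by (metis dvd_triv_left)
    then have "wt x y \<le> 2" by (rule dvd_imp_le) simp
    then have "wt x y = 1 \<or> wt x y = 2" using 3 by (cases "wt x y = 0") auto
    then have c: "(wt x y, wt y x) \<in> {(1, 2), (2, 1)}" using 3 by auto
    have q: "arm 2 q" "N y = {x, q 1}" "q 1 \<noteq> x" "q 0 = y" and p: "arm 1 p" "N x = {y, p 1}" "p 1 \<noteq> y" "p 0 = x"
      using t 3 by (auto simp: tail_def)
    have e: "tedge T x (p 1) = Some (1, 1)" "N (p 1) = {x}" using armD(2)[OF p(1), of 0] armD(4)[OF p(1)] p by auto
    have eq: "tedge T (q 1) y = Some (1, 1)" "tedge T (q 2) (q 1) = Some (1, 1)" "N (q 2) = {q 1}" "N (q 1) = {y, q 2}" "y \<noteq> q 2"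
      using edge_rev[OF armD(2)[OF q(1), of 0]] edge_rev[OF armD(2)[OF q(1), of 1]] armD(3)[OF q(1), of 0] armD(4)[OF q(1)] q
      by (auto simp: numeral_2_eq_2)
    define g where "g i = [q 2, q 1, y, x, p 1] ! i" for i
    have "T \<cong>\<^sub>T line_tree 5 (unvalued(2 := (wt x y, wt y x)))"
      unfolding line_tree_def using q e eq p w N_neq[OF y]
      by (intro small_tree_iso[where g = g]) (simp_all add: g_def tree_simps insert_commute)
    then show ?thesis using extended_dynkinI[OF F4_tilde[OF c]] by blast
  qed
qed

text \<open>A ratio above 1 leaves at most one other neighbour, so moving on in its direction never
  branches and never stops. Backwards the ratio is below 1, so the part of the tree behind the first
  step is a finite plain path.\<close>

lemma classify_escaping:
  assumes esc: "\<And>x. x \<in> tverts T \<Longrightarrow> \<exists>y\<in>N x. r x y > 1 \<and> r y x < 1"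
  shows "T \<cong>\<^sub>T A_inf"
proof -
  obtain x0 where x0: "x0 \<in> tverts T" using vtree_nonempty[OF tree] by blast
  define nx where "nx x = (SOME y. y \<in> N x \<and> r x y > 1 \<and> r y x < 1)" for x
  have nx: "nx x \<in> N x \<and> r x (nx x) > 1 \<and> r (nx x) x < 1" if "x \<in> tverts T" for x
    unfolding nx_def using esc[OF that] by (rule someI2_bex) blast
  define h where "h i = (nx ^^ i) x0" for i
  have h0: "h 0 = x0" and hS: "h (Suc i) = nx (h i)" for i by (simp_all add: h_def)
  have hV: "h i \<in> tverts T" for i
  proof (induction i)
    case (Suc i)
    then show ?case using nx[OF Suc] N_verts(2) unfolding hS by blast
  qed (simp add: h0 x0)
  note h = nx[OF hV, folded hS]
  have ne: "h i \<noteq> h (Suc (Suc i))" for i using h[of i] h[of "Suc i"] by auto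
  have NS: "N (h (Suc i)) = {h i, h (Suc (Suc i))}" for i
  proof -
    have "h i \<in> N (h (Suc i))" using h N_sym by blast
    then show ?thesis using others_lt_1[of "h (Suc (Suc i))" "h (Suc i)"] h[of "Suc i"] ne[of i] by auto
  qed
  have e: "tedge T (h i) (h (Suc i)) = Some (1, 1)" for i
  proof -
    have "h i \<in> N (h (Suc i))" using h N_sym by blast
    then obtain m p where p: "arm m p" "p 0 = h (Suc i)" "p 1 = h i" using arm_ex h by blast
    then show ?thesis using edge_rev[OF armD(2)[OF p(1), of 0]] armD(1)[OF p(1)] by auto
  qed
  have "h 0 \<in> N (h 1)" using h N_sym by simp
  moreover have "r (h 1) (h 0) < 1" using h[of 0] by simp
  ultimately obtain m p where p: "arm m p" "p 0 = h 1" "p 1 = h 0" using arm_ex by blast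
  note P = armD[OF p(1)]
  \<comment> \<open>The path behind \<open>h 1\<close> is traversed from its leaf \<open>p m\<close>
    to \<open>p 0 = h 1\<close>; the ray takes over with \<open>h 2\<close> at index
    \<open>m + 1\<close>.\<close>
  define g where "g i = (if i \<le> m then p (m - i) else h (i - m + 1))" for i
  show ?thesis unfolding A_inf_def
  proof (rule half_line_iso[OF tree, of g], unfold N_adj)
    show "tedge T (g i) (g (Suc i)) = Some (1, 1)" for i
    proof -
      consider "i < m" | "i = m" | "i > m" by linarith
      then show ?thesis
      proof cases
        case 1
        then have "Suc (m - Suc i) = m - i" by simp
        then show ?thesis using edge_rev[OF P(2)[of "m - Suc i"]] 1 by (simp add: g_def)
      next
        case 2
        then show ?thesis using e[of 1] p by (simp add: g_def)
      next
        case 3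
        then have "Suc i - m + 1 = Suc (i - m + 1)" by simp
        then show ?thesis using e[of "i - m + 1"] 3 unfolding g_def by simp
      qed
    qed
    show "N (g 0) = {g 1}" using P(1,4) by (simp add: g_def)
    show "N (g (Suc i)) = {g i, g (Suc (Suc i))} \<and> g i \<noteq> g (Suc (Suc i))" for i
    proof -
      consider "Suc i < m" | "Suc i = m" | "i = m" | "i > m" by linarith
      then show ?thesis
      proof cases
        case 1
        then have "m - Suc i = Suc (m - Suc (Suc i))" "m - i = Suc (Suc (m - Suc (Suc i)))" by simp_all
        then have "g (Suc i) = p (Suc (m - Suc (Suc i)))" "g i = p (Suc (Suc (m - Suc (Suc i))))" "g (Suc (Suc i)) = p (m - Suc (Suc i))"
          using 1 by (simp_all add: g_def)
        moreover have "Suc (m - Suc (Suc i)) < m" using 1 by linarith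
        ultimately show ?thesis using P(3)[of "m - Suc (Suc i)"] by auto
      next
        case 2
        then have "g (Suc i) = h 1" "g i = h 0" "g (Suc (Suc i)) = h 2" using p by (simp_all add: g_def numeral_2_eq_2 flip: 2)
        then show ?thesis using NS[of 0] ne[of 0] by (simp add: numeral_2_eq_2)
      next
        case 3
        then have "g (Suc i) = h 2" "g i = h 1" "g (Suc (Suc i)) = h 3" using p by (simp_all add: g_def eval_nat_numeral)
        then show ?thesis using NS[of 1] ne[of 1] by (simp add: eval_nat_numeral)
      next
        case 4
        then have "Suc i - m + 1 = Suc (i - m + 1)" "Suc (Suc i) - m + 1 = Suc (Suc (i - m + 1))" by simp_all
        then have "g i = h (i - m + 1)" "g (Suc i) = h (Suc (i - m + 1))" "g (Suc (Suc i)) = h (Suc (Suc (i - m + 1)))"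
          using 4 unfolding g_def by simp_all
        then show ?thesis using NS[of "i - m + 1"] ne[of "i - m + 1"] by simp
      qed
    qed
  qed
qed

text \<open>If no ratio equals 1, a vertex either has all its ratios below 1 or has a neighbour with
  ratio above 1. In the second situation the opposite ratio decides between an edge with two tails
  and an escape to infinity.\<close>

theorem classification:
  "extended_dynkin T \<or> T \<cong>\<^sub>T A_inf \<or> T \<cong>\<^sub>T B_inf \<or> T \<cong>\<^sub>T C_inf \<or> T \<cong>\<^sub>T D_inf \<or> T \<cong>\<^sub>T A_inf_inf"
proof -
  consider x y where "y \<in> N x" "r x y = 1"
    | x where "x \<in> tverts T" "\<forall>y\<in>N x. r x y < 1"
    | x y where "y \<in> N x" "r x y > 1" "r y x > 1"
    | "\<forall>x\<in>tverts T. \<exists>y\<in>N x. r x y > 1 \<and> r y x < 1"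
    by (metis N_sym linorder_neqE_linordered_idom)
  then show ?thesis
  proof cases
    case 1
    then show ?thesis using classify_ratio_1 by blast
  next
    case 2
    then show ?thesis using classify_centre by blast
  next
    case 3
    obtain m p where m: "tail y x m p" using tail_ex[OF 3(1,2)] .
    obtain l q where l: "tail x y l q" using tail_ex[OF N_sym[OF 3(1)] 3(3)] .
    have "1 * 1 < r x y * r y x" using 3 by (intro mult_strict_mono) auto
    then have "real 1 < real (wt x y * wt y x)" unfolding r_prod[OF 3(1)] by simp
    then have "2 \<le> wt x y * wt y x" unfolding of_nat_less_iff by linarith
    then show ?thesis using classify_two_tails[OF 3(1) m l] classify_two_tails[OF N_sym[OF 3(1)] l m]
      by (metis mult.commute nle_le)
  next
    case 4
    then show ?thesis using classify_escaping by blast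
  qed
qed

end

section \<open>Additive functions on translation quivers of Euclidean trees\<close>

text \<open>The multiplicity of \<open>y\<close> in a mesh ending at \<open>x\<close>: the first
  entry of the valuation of an arrow from \<open>y\<close> to \<open>x\<close>.\<close>

definition emult :: "'v vtree \<Rightarrow> 'v \<Rightarrow> 'v \<Rightarrow> nat" where
  "emult T x y = fst (the (tedge T y x))"

text \<open>\<open>\<delta>\<close> is the null root and \<open>d\<close> symmetrises the Cartan
  matrix. The last clause provides a leaf, where a mesh has a single middle vertex;
  \<open>ZT_additive_q0\<close> uses it to exclude a drift along \<open>\<delta>\<close>.\<close>

definition null_data :: "'v vtree \<Rightarrow> ('v \<Rightarrow> nat) \<Rightarrow> ('v \<Rightarrow> nat) \<Rightarrow> bool" where
  "null_data T \<delta> d \<longleftrightarrow> finite (tverts T) \<and> (\<forall>x\<in>tverts T. \<delta> x > 0 \<and> d x > 0) \<and>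
     (\<forall>x\<in>tverts T. (\<Sum>y | tadj T x y. emult T x y * \<delta> y) = 2 * \<delta> x) \<and>
     (\<forall>x y. tadj T x y \<longrightarrow> d x * emult T x y = d y * emult T y x) \<and>
     (\<exists>x y. {z. tadj T x z} = {y})"

lemma null_data_iso:
  assumes T: "valued_tree T" and i: "T \<cong>\<^sub>T D" and D: "null_data D \<delta> d"
    and DV: "\<And>x y. tadj D x y \<Longrightarrow> x \<in> tverts D \<and> y \<in> tverts D"
  shows "\<exists>\<delta> d. null_data T \<delta> d"
proof -
  obtain f where f: "bij_betw f (tverts T) (tverts D)" "\<And>x y. x \<in> tverts T \<Longrightarrow> y \<in> tverts T \<Longrightarrow> tedge D (f x) (f y) = tedge T x y"
    using i unfolding vtree_iso_def by blast
  note TV = vtree_adj_verts[OF T]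
  have fV: "f x \<in> tverts D" if "x \<in> tverts T" for x using f(1) that bij_betwE by blast
  have inj: "inj_on f (tverts T)" using f(1) by (simp add: bij_betw_def)
  have nb: "{y. tadj D (f x) y} = f ` {y. tadj T x y}" if x: "x \<in> tverts T" for x
  proof
    show "{y. tadj D (f x) y} \<subseteq> f ` {y. tadj T x y}"
    proof
      fix y assume "y \<in> {y. tadj D (f x) y}"
      then have y: "tadj D (f x) y" by simp
      then have "y \<in> f ` tverts T" using DV f(1) by (auto simp: bij_betw_def)
      then obtain z where z: "z \<in> tverts T" "y = f z" by blast
      then show "y \<in> f ` {y. tadj T x y}" using y f(2)[OF x z(1)] by simp
    qed
    show "f ` {y. tadj T x y} \<subseteq> {y. tadj D (f x) y}"
    proof
      fix y assume "y \<in> f ` {y. tadj T x y}"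
      then obtain z where z: "tadj T x z" "y = f z" by blast
      then show "y \<in> {y. tadj D (f x) y}" using f(2)[OF x] TV[of x z] by simp
    qed
  qed
  have m: "emult D (f x) (f y) = emult T x y" if "x \<in> tverts T" "y \<in> tverts T" for x y
    using f(2)[OF that(2,1)] by (simp add: emult_def)
  have "null_data T (\<delta> \<circ> f) (d \<circ> f)"
    unfolding null_data_def
  proof (intro conjI ballI allI impI)
    show "finite (tverts T)" using D f(1) bij_betw_finite unfolding null_data_def by blast
    fix x assume x: "x \<in> tverts T"
    show "0 < (\<delta> \<circ> f) x" "0 < (d \<circ> f) x" using D fV[OF x] by (auto simp: null_data_def)
    have "(\<Sum>y | tadj D (f x) y. emult D (f x) y * \<delta> y) = (\<Sum>y | tadj T x y. emult T x y * (\<delta> \<circ> f) y)"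
      unfolding nb[OF x]
    proof (subst sum.reindex)
      show "inj_on f {y. tadj T x y}" by (rule inj_on_subset[OF inj]) (use TV in blast)
      show "sum ((\<lambda>y. emult D (f x) y * \<delta> y) \<circ> f) {y. tadj T x y} = (\<Sum>y | tadj T x y. emult T x y * (\<delta> \<circ> f) y)"
        by (rule sum.cong) (use m x TV in auto)
    qed
    then show "(\<Sum>y | tadj T x y. emult T x y * (\<delta> \<circ> f) y) = 2 * (\<delta> \<circ> f) x"
      using D fV[OF x] by (simp add: null_data_def)
  next
    fix x y assume xy: "tadj T x y"
    then have v: "x \<in> tverts T" "y \<in> tverts T" using TV by blast+
    have "tadj D (f x) (f y)" using f(2)[OF v] xy by simp
    then have "d (f x) * emult D (f x) (f y) = d (f y) * emult D (f y) (f x)" using D unfolding null_data_def by blast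
    then show "(d \<circ> f) x * emult T x y = (d \<circ> f) y * emult T y x" by (simp add: m v)
  next
    obtain a b where ab: "{z. tadj D a z} = {b}" using D by (auto simp: null_data_def)
    then have "tadj D a b" by blast
    then have "a \<in> tverts D" using DV by blast
    then obtain x where x: "x \<in> tverts T" "a = f x" using f(1) by (auto simp: bij_betw_def)
    have e: "f ` {z. tadj T x z} = {b}" using nb[OF x(1)] ab x by simp
    then obtain y where y: "tadj T x y" by blast
    have "z = y" if z: "tadj T x z" for z
    proof -
      have "f z \<in> f ` {z. tadj T x z}" "f y \<in> f ` {z. tadj T x z}" using y z by blast+
      then have "f z = f y" unfolding e by simp
      then show ?thesis using inj_onD[OF inj, of z y] TV[OF z] TV[OF y] by blast
    qed
    then have "{z. tadj T x z} = {y}" using y by blast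
    then show "\<exists>x y. {z. tadj T x z} = {y}" by blast
  qed
  then show ?thesis by blast
qed

section \<open>Null roots of the Euclidean diagrams\<close>

definition wtL :: "((nat \<times> nat) \<times> (nat \<times> nat)) list \<Rightarrow> nat \<Rightarrow> nat \<Rightarrow> nat" where
  "wtL L x y = (case map_of L (y, x) of Some p \<Rightarrow> fst p | None \<Rightarrow> (case map_of L (x, y) of Some p \<Rightarrow> snd p | None \<Rightarrow> 0))"

text \<open>Null data for a tree given by its list of edges; the last clause makes vertex 0 the leaf
  asked for in \<open>null_data\<close>.\<close>

definition balanced_list :: "nat \<Rightarrow> ((nat \<times> nat) \<times> (nat \<times> nat)) list \<Rightarrow> (nat \<Rightarrow> nat) \<Rightarrow> (nat \<Rightarrow> nat) \<Rightarrow> bool" where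
  "balanced_list n L \<delta> d \<longleftrightarrow> (\<forall>((i, j), v)\<in>set L. i < j \<and> j < n) \<and> distinct (map fst L) \<and>
     (\<forall>i\<in>{..<n}. \<delta> i > 0 \<and> d i > 0) \<and>
     (\<forall>i\<in>{..<n}. (\<Sum>j\<in>nbr L i. wtL L i j * \<delta> j) = 2 * \<delta> i) \<and>
     (\<forall>((i, j), v)\<in>set L. d i * snd v = d j * fst v) \<and> nbr L 0 = {1}"

lemma balanced_list_null_data:
  assumes "balanced_list n L \<delta> d"
  shows "null_data (vtree_of {..<n} (map_of L)) \<delta> d"
    "\<And>x y. tadj (vtree_of {..<n} (map_of L)) x y \<Longrightarrow> x < n \<and> y < n"
proof -
  let ?D = "vtree_of {..<n} (map_of L)"
  have L: "\<And>i j v. ((i, j), v) \<in> set L \<Longrightarrow> i < j \<and> j < n" "distinct (map fst L)"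
    "\<And>i. i < n \<Longrightarrow> \<delta> i > 0 \<and> d i > 0" "\<And>i. i < n \<Longrightarrow> (\<Sum>j\<in>nbr L i. wtL L i j * \<delta> j) = 2 * \<delta> i"
    "\<And>i j v. ((i, j), v) \<in> set L \<Longrightarrow> d i * snd v = d j * fst v" "nbr L 0 = {1}"
    using assms unfolding balanced_list_def by blast+
  have mo: "map_of L (i, j) = Some v \<longleftrightarrow> ((i, j), v) \<in> set L" for i j v using L(2) by simp
  have adj': "tadj ?D i j \<longleftrightarrow> map_of L (i, j) \<noteq> None \<or> map_of L (j, i) \<noteq> None" for i j
    by (auto simp: vtree_of_def split: option.splits)
  have adj: "tadj ?D i j \<longleftrightarrow> j \<in> nbr L i" for i j
    unfolding adj' nbr_def using mo by auto
  have one: "map_of L (j, i) = None" if "map_of L (i, j) = Some v" for i j v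
  proof (rule ccontr)
    assume "map_of L (j, i) \<noteq> None"
    then obtain v' where "map_of L (j, i) = Some v'" by blast
    then show False using that L(1)[of i j v] L(1)[of j i v'] mo by simp
  qed
  have m: "emult ?D i j = wtL L i j" if "j \<in> nbr L i" for i j
  proof (cases "map_of L (j, i)")
    case (Some v)
    then show ?thesis by (simp add: emult_def vtree_of_def wtL_def)
  next
    case None
    then have "map_of L (i, j) \<noteq> None" using that adj[of i j] adj'[of i j] by blast
    then obtain v where "map_of L (i, j) = Some v" by blast
    then show ?thesis using None by (simp add: emult_def vtree_of_def wtL_def)
  qed
  show nn: "x < n \<and> y < n" if "tadj ?D x y" for x y
    using that L(1) unfolding adj nbr_def by fastforce
  have sym: "d x * emult ?D x y = d y * emult ?D y x" if "map_of L (x, y) = Some v" for x y v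
  proof -
    have "((x, y), v) \<in> set L" using that mo by simp
    then have "d x * snd v = d y * fst v" by (rule L(5))
    then show ?thesis using that one[OF that] by (simp add: emult_def vtree_of_def)
  qed
  show "null_data ?D \<delta> d"
    unfolding null_data_def
  proof (intro conjI ballI allI impI)
    show "finite (tverts ?D)" by (simp add: vtree_of_def)
    fix x assume x: "x \<in> tverts ?D"
    then have xn: "x < n" by (simp add: vtree_of_def)
    show "0 < \<delta> x" "0 < d x" using L(3)[OF xn] by simp_all
    have "(\<Sum>y | tadj ?D x y. emult ?D x y * \<delta> y) = (\<Sum>j\<in>nbr L x. wtL L x j * \<delta> j)"
      by (rule sum.cong) (use adj m in auto)
    then show "(\<Sum>y | tadj ?D x y. emult ?D x y * \<delta> y) = 2 * \<delta> x" using L(4)[OF xn] by simp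
  next
    fix x y assume "tadj ?D x y"
    then have "map_of L (x, y) \<noteq> None \<or> map_of L (y, x) \<noteq> None" unfolding adj' .
    then show "d x * emult ?D x y = d y * emult ?D y x" 
    proof
      assume "map_of L (x, y) \<noteq> None"
      then show ?thesis using sym by blast
    next
      assume "map_of L (y, x) \<noteq> None"
      then obtain v where "map_of L (y, x) = Some v" by blast
      from sym[OF this] show ?thesis by (rule HOL.sym)
    qed
  next
    have "{z. tadj ?D 0 z} = {1}" using adj L(6) by blast
    then show "\<exists>x y. {z. tadj ?D x z} = {y}" by blast
  qed
qed

lemma map_of_line: "map_of (line n l) (i, j) = (if j = Suc i \<and> Suc i < n then Some (l i) else None)"
proof (cases "j = Suc i \<and> Suc i < n")
  case True
  then have "((i, j), l i) \<in> set (line n l)" by (simp add: set_line)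
  then show ?thesis using True distinct_line[of n l] by simp
next
  case False
  have "map_of (line n l) (i, j) = None"
  proof (rule ccontr)
    assume "map_of (line n l) (i, j) \<noteq> None"
    then obtain v where "map_of (line n l) (i, j) = Some v" by blast
    then have "((i, j), v) \<in> set (line n l)" by (rule map_of_SomeD)
    then show False using False by (simp add: set_line)
  qed
  then show ?thesis using False by simp
qed

lemma wtL_line:
  assumes "Suc i < n"
  shows "wtL (line n l) (Suc i) i = fst (l i)" "wtL (line n l) i (Suc i) = snd (l i)"
  using assms by (simp_all add: wtL_def map_of_line)

text \<open>With 2 on all inner vertices, the equation at vertex 0 forces
  \<open>\<delta> 0 = snd p\<close>, and at its neighbour the end contributes
  \<open>fst p * snd p = 2\<close> like an inner vertex. Likewise
  \<open>d 0 * snd p = 2 * fst p\<close> is solved by \<open>fst p ^ 2\<close>, again because the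
  entries multiply to 2. At the other end the entries of \<open>q\<close> are read in the opposite
  direction.\<close>

lemma balanced_BC:
  assumes n: "n \<ge> 3" and p: "p \<in> {(1, 2), (2, 1)}" and q: "q \<in> {(1, 2), (2, 1)}"
  shows "balanced_list n (line n (unvalued(0 := p, n - 2 := q)))
    (\<lambda>i. if i = 0 then snd p else if i = n - 1 then fst q else 2)
    (\<lambda>i. if i = 0 then fst p ^ 2 else if i = n - 1 then snd q ^ 2 else 2)"
    (is "balanced_list n ?L ?\<delta> ?d")
  unfolding balanced_list_def
proof (intro conjI)
  show "\<forall>((i, j), v)\<in>set ?L. i < j \<and> j < n" by (auto simp: set_line)
  show "distinct (map fst ?L)" by (rule distinct_line)
  show "\<forall>i\<in>{..<n}. 0 < ?\<delta> i \<and> 0 < ?d i" using p q by auto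
  show "nbr ?L 0 = {1}" unfolding nbr_line using n by auto
  have pq: "fst p * snd p = 2" "fst q * snd q = 2" using p q by auto
  show "\<forall>i\<in>{..<n}. (\<Sum>j\<in>nbr ?L i. wtL ?L i j * ?\<delta> j) = 2 * ?\<delta> i"
  proof
    fix i assume "i \<in> {..<n}"
    then have i: "i < n" by simp
    have "i = 0 \<or> i = n - 1 \<and> i > 0 \<or> (\<exists>k. i = Suc k \<and> Suc i < n)" using i by presburger
    then consider "i = 0" | "i = n - 1" "i > 0" | k where "i = Suc k" "Suc i < n" by blast
    then show "(\<Sum>j\<in>nbr ?L i. wtL ?L i j * ?\<delta> j) = 2 * ?\<delta> i"
    proof cases
      case 1
      then have "nbr ?L i = {1}" unfolding nbr_line using n by auto
      moreover have "Suc 0 \<noteq> n - Suc 0" using n by simp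
      ultimately show ?thesis using 1 n by (simp add: wtL_def map_of_line)
    next
      case 2
      then have "nbr ?L i = {n - 2}" unfolding nbr_line using n by auto
      moreover have "Suc (n - 2) = n - 1" using n by simp
      ultimately show ?thesis using 2 n by (simp add: wtL_def map_of_line)
    next
      case 3
      then have nb: "nbr ?L i = {k, Suc i}" unfolding nbr_line using n by auto
      have n2: "n - 2 \<noteq> 0" "k \<noteq> n - 2" "k \<noteq> n - 1" "i \<noteq> n - 1" "i \<noteq> 0" using n 3 by simp_all
      have "fst ((unvalued(0 := p, n - 2 := q)) k) * ?\<delta> k = 2"
        using n2 pq by (cases "k = 0") simp_all
      moreover have "snd ((unvalued(0 := p, n - 2 := q)) i) * ?\<delta> (Suc i) = 2"
      proof (cases "i = n - 2")
        case True
        then have "Suc i = n - 1" using n by simp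
        then show ?thesis using True n2 pq by (simp add: mult.commute)
      next
        case False
        then have "Suc i \<noteq> n - 1" by simp
        then show ?thesis using False n2 by simp
      qed
      moreover have "wtL ?L i k = fst ((unvalued(0 := p, n - 2 := q)) k)" unfolding 3(1) by (rule wtL_line) (use 3 in simp)
      moreover have "wtL ?L i (Suc i) = snd ((unvalued(0 := p, n - 2 := q)) i)" by (rule wtL_line) (use 3 in simp)
      moreover have "?\<delta> i = 2" using n2 by simp
      moreover have "k \<noteq> Suc i" using 3 by simp
      ultimately show ?thesis unfolding nb by simp
    qed
  qed
  show "\<forall>((i, j), v)\<in>set ?L. ?d i * snd v = ?d j * fst v"
    using n p q by (auto simp: set_line)
qed

lemma balanced_BD:
  assumes k: "k \<ge> 1" and p: "p \<in> {(1, 2), (2, 1)}"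
  shows "balanced_list (k + 3) (line (k + 2) (unvalued(0 := p)) @ [((k, k + 2), (1, 1))])
    (\<lambda>i. if i = 0 then snd p else if i \<le> k then 2 else 1) (\<lambda>i. if i = 0 then fst p ^ 2 else 2)"
    (is "balanced_list _ ?L ?\<delta> ?d")
  unfolding balanced_list_def
proof (intro conjI)
  have nL: "nbr ?L i = {j. j = Suc i \<and> i < Suc k \<or> i = Suc j \<and> i < k + 2 \<or> i = k \<and> j = k + 2 \<or> i = k + 2 \<and> j = k}" for i
    unfolding nbr_append nbr_line nbr_Cons nbr_Nil by auto
  show "\<forall>((i, j), v)\<in>set ?L. i < j \<and> j < k + 3" by (auto simp: set_line)
  show "distinct (map fst ?L)" by (auto simp: distinct_line set_line)
  show "\<forall>i\<in>{..<k + 3}. 0 < ?\<delta> i \<and> 0 < ?d i" using p by auto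
  show "nbr ?L 0 = {1}" unfolding nL using k by auto
  have pq: "fst p * snd p = 2" using p by auto
  have mo: "map_of ?L (i, j) = (if i = k \<and> j = k + 2 then Some (1, 1) else if j = Suc i \<and> Suc i < k + 2 then Some ((unvalued(0 := p)) i) else None)" for i j
    by (auto simp: map_add_def map_of_line)
  define l where "l = unvalued(0 := p)"
  have l: "l 0 = p" "\<And>i. i > 0 \<Longrightarrow> l i = (1, 1)" by (simp_all add: l_def)
  have w1: "wtL ?L (Suc i) i = fst (l i)" if "i < k + 1" for i unfolding wtL_def mo l_def using that by simp
  have w2: "wtL ?L i (Suc i) = snd (l i)" if "i < k + 1" for i unfolding wtL_def mo l_def using that by simp
  have w3: "wtL ?L (k + 2) k = 1" "wtL ?L k (k + 2) = 1" unfolding wtL_def mo by simp_all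
  have fl: "fst (l m) * ?\<delta> m = 2" if "m \<le> k" for m using l pq that by (cases "m = 0") simp_all
  show "\<forall>i\<in>{..<k + 3}. (\<Sum>j\<in>nbr ?L i. wtL ?L i j * ?\<delta> j) = 2 * ?\<delta> i"
  proof
    fix i assume "i \<in> {..<k + 3}"
    then have i: "i < k + 3" by simp
    have "i = 0 \<or> (\<exists>m. i = Suc m \<and> i < k) \<or> (\<exists>m. i = k \<and> k = Suc m) \<or> i = k + 1 \<or> i = k + 2" using i k by presburger
    then consider "i = 0" | m where "i = Suc m" "i < k" | m where "i = k" "k = Suc m" | "i = k + 1" | "i = k + 2" by blast
    then show "(\<Sum>j\<in>nbr ?L i. wtL ?L i j * ?\<delta> j) = 2 * ?\<delta> i"
    proof cases
      case 1
      then have nb: "nbr ?L i = {Suc 0}" using k unfolding nL by auto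
      show ?thesis unfolding nb using 1 k w2[of 0] l by simp
    next
      case 2
      then have nb: "nbr ?L i = {m, Suc i}" unfolding nL by auto
      have "wtL ?L i m = fst (l m)" "wtL ?L i (Suc i) = 1" using 2 w1[of m] w2[of i] l(2)[of i] by simp_all
      then show ?thesis unfolding nb using 2 fl[of m] by simp
    next
      case 3
      then have nb: "nbr ?L i = {m, Suc i, k + 2}" unfolding nL by auto
      have "wtL ?L i m = fst (l m)" "wtL ?L i (Suc i) = 1" "wtL ?L i (k + 2) = 1"
        using 3 w1[of m] w2[of i] w3 l(2)[of i] by simp_all
      then show ?thesis unfolding nb using 3 fl[of m] by simp
    next
      case 4
      then have nb: "nbr ?L i = {k}" unfolding nL by auto
      have "wtL ?L i k = 1" using 4 w1[of k] l(2)[of k] k by simp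
      then show ?thesis unfolding nb using 4 k by simp
    next
      case 5
      then have nb: "nbr ?L i = {k}" unfolding nL by auto
      have "wtL ?L i k = 1" using 5 w3 by simp
      then show ?thesis unfolding nb using 5 k by simp
    qed
  qed
  show "\<forall>((i, j), v)\<in>set ?L. ?d i * snd v = ?d j * fst v" using p k by (auto simp: set_line)
qed

text \<open>This is \<open>D_tilde\<close> for \<open>n = k + 3\<close>: the vertices 1 to
  \<open>k\<close> form the inner path and 0, \<open>k + 1\<close>, \<open>k + 2\<close>,
  \<open>k + 3\<close> are the leaves. For \<open>k = 1\<close> all leaves sit at one
  vertex.\<close>

lemma balanced_D:
  assumes k: "k \<ge> 1"
  shows "balanced_list (k + 4) (line (k + 2) unvalued @ [((1, k + 2), (1, 1)), ((k, k + 3), (1, 1))])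
    (\<lambda>i. if i = 0 \<or> k < i then 1 else 2) (\<lambda>_. 1)"
    (is "balanced_list _ ?L ?\<delta> ?d")
  unfolding balanced_list_def
proof (intro conjI)
  have nL: "nbr ?L i = {j. j = Suc i \<and> i < k + 1 \<or> i = Suc j \<and> i < k + 2 \<or> i = 1 \<and> j = k + 2 \<or> i = k + 2 \<and> j = 1
      \<or> i = k \<and> j = k + 3 \<or> i = k + 3 \<and> j = k}" for i
    unfolding nbr_append nbr_line nbr_Cons nbr_Nil by auto
  show "\<forall>((i, j), v)\<in>set ?L. i < j \<and> j < k + 4" using k by (auto simp: set_line)
  show "distinct (map fst ?L)" using k by (auto simp: distinct_line set_line)
  show "\<forall>i\<in>{..<k + 4}. 0 < ?\<delta> i \<and> 0 < ?d i" by auto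
  show "nbr ?L 0 = {1}" unfolding nL using k by auto
  have w: "wtL ?L i j = 1" if "j \<in> nbr ?L i" for i j
  proof -
    have "fst v = 1 \<and> snd v = 1" if "map_of ?L e = Some v" for e v
      using map_of_SomeD[OF that] by (cases e) (auto simp: set_line)
    moreover have "map_of ?L (i, j) \<noteq> None \<or> map_of ?L (j, i) \<noteq> None"
    proof -
      obtain v where "((i, j), v) \<in> set ?L \<or> ((j, i), v) \<in> set ?L" using \<open>j \<in> nbr ?L i\<close> unfolding nbr_def by blast
      then have "(\<exists>v. map_of ?L (i, j) = Some v) \<or> (\<exists>v. map_of ?L (j, i) = Some v)" using weak_map_of_SomeI by fast
      then show ?thesis by (simp only: not_None_eq)
    qed
    ultimately show ?thesis unfolding wtL_def by (cases "map_of ?L (j, i)"; cases "map_of ?L (i, j)") (auto simp del: map_of_append)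
  qed
  show "\<forall>i\<in>{..<k + 4}. (\<Sum>j\<in>nbr ?L i. wtL ?L i j * ?\<delta> j) = 2 * ?\<delta> i"
  proof
    fix i assume "i \<in> {..<k + 4}"
    then have i: "i < k + 4" by simp
    have s: "(\<Sum>j\<in>nbr ?L i. wtL ?L i j * ?\<delta> j) = (\<Sum>j\<in>nbr ?L i. ?\<delta> j)" by (rule sum.cong) (use w in auto)
    have "i = 0 \<or> i = 1 \<and> k = 1 \<or> i = 1 \<and> k > 1 \<or> (\<exists>m. i = Suc (Suc m) \<and> i < k) \<or> i = k \<and> k > 1 \<or> i = k + 1 \<or> i = k + 2 \<or> i = k + 3"
      using i k by presburger
    then consider "i = 0" | "i = 1" "k = 1" | "i = 1" "k > 1" | m where "i = Suc (Suc m)" "i < k" | "i = k" "k > 1" | "i = k + 1" | "i = k + 2" | "i = k + 3" by blast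
    then show "(\<Sum>j\<in>nbr ?L i. wtL ?L i j * ?\<delta> j) = 2 * ?\<delta> i"
      unfolding s
    proof cases
      case 1
      then have "nbr ?L i = {1}" using k unfolding nL by auto
      then show "(\<Sum>j\<in>nbr ?L i. ?\<delta> j) = 2 * ?\<delta> i" using 1 k by simp
    next
      case 2
      then have "nbr ?L i = {0, 2, 3, 4}" unfolding nL by auto
      then show "(\<Sum>j\<in>nbr ?L i. ?\<delta> j) = 2 * ?\<delta> i" using 2 by simp
    next
      case 3
      then have "nbr ?L i = {0, 2, k + 2}" unfolding nL by auto
      then show "(\<Sum>j\<in>nbr ?L i. ?\<delta> j) = 2 * ?\<delta> i" using 3 by simp
    next
      case 4
      then have "nbr ?L i = {Suc m, Suc (Suc (Suc m))}" unfolding nL by auto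
      then show "(\<Sum>j\<in>nbr ?L i. ?\<delta> j) = 2 * ?\<delta> i" using 4 by simp
    next
      case 5
      then obtain m where m: "k = Suc (Suc m)" by (metis One_nat_def less_imp_Suc_add add_Suc)
      then have "nbr ?L i = {Suc m, k + 1, k + 3}" using 5 unfolding nL by auto
      then show "(\<Sum>j\<in>nbr ?L i. ?\<delta> j) = 2 * ?\<delta> i" using 5 m by simp
    next
      case 6
      then have "nbr ?L i = {k}" using k unfolding nL by auto
      then show "(\<Sum>j\<in>nbr ?L i. ?\<delta> j) = 2 * ?\<delta> i" using 6 k by simp
    next
      case 7
      then have "nbr ?L i = {1}" unfolding nL by auto
      then show "(\<Sum>j\<in>nbr ?L i. ?\<delta> j) = 2 * ?\<delta> i" using 7 k by simp
    next
      case 8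
      then have "nbr ?L i = {k}" unfolding nL by auto
      then show "(\<Sum>j\<in>nbr ?L i. ?\<delta> j) = 2 * ?\<delta> i" using 8 k by simp
    qed
  qed
  show "\<forall>((i, j), v)\<in>set ?L. ?d i * snd v = ?d j * fst v" by (auto simp: set_line)
qed

text \<open>An executable form for concrete diagrams. Sums run over all vertices, which is harmless
  because \<open>wtL\<close> is 0 off the edges; positivity of the valuation entries is included so
  that adjacency can be read off from \<open>wtL\<close>.\<close>

definition check_balanced :: "nat \<Rightarrow> ((nat \<times> nat) \<times> (nat \<times> nat)) list \<Rightarrow> (nat \<Rightarrow> nat) \<Rightarrow> (nat \<Rightarrow> nat) \<Rightarrow> bool" where
  "check_balanced n L \<delta> d \<longleftrightarrow>
     list_all (\<lambda>((i, j), v). i < j \<and> j < n \<and> d i * snd v = d j * fst v \<and> fst v > 0 \<and> snd v > 0) L \<and>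
     distinct (map fst L) \<and>
     list_all (\<lambda>i. \<delta> i > 0 \<and> d i > 0 \<and> (\<Sum>j\<leftarrow>[0..<n]. wtL L i j * \<delta> j) = 2 * \<delta> i) [0..<n] \<and>
     n > 1 \<and> list_all (\<lambda>j. (wtL L 0 j > 0) = (j = 1)) [0..<n]"

lemma check_balanced:
  assumes "check_balanced n L \<delta> d"
  shows "balanced_list n L \<delta> d"
proof -
  have L: "\<And>i j v. ((i, j), v) \<in> set L \<Longrightarrow> i < j \<and> j < n \<and> d i * snd v = d j * fst v \<and> fst v > 0 \<and> snd v > 0"
    "distinct (map fst L)" "\<And>i. i < n \<Longrightarrow> \<delta> i > 0 \<and> d i > 0 \<and> (\<Sum>j\<leftarrow>[0..<n]. wtL L i j * \<delta> j) = 2 * \<delta> i"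
    "n > 1" "\<And>j. j < n \<Longrightarrow> (wtL L 0 j > 0) = (j = 1)"
    using assms unfolding check_balanced_def list_all_iff set_upt by fastforce+
  have wt: "wtL L i j > 0 \<longleftrightarrow> j \<in> nbr L i" for i j
  proof
    assume "wtL L i j > 0"
    then have "map_of L (j, i) \<noteq> None \<or> map_of L (i, j) \<noteq> None" unfolding wtL_def by (auto split: option.splits)
    then show "j \<in> nbr L i" unfolding nbr_def using map_of_SomeD by fast
  next
    assume "j \<in> nbr L i"
    then obtain v where v: "((i, j), v) \<in> set L \<or> ((j, i), v) \<in> set L" unfolding nbr_def by blast
    show "wtL L i j > 0"
    proof (cases "map_of L (j, i)")
      case None
      then have "((j, i), v) \<notin> set L" using weak_map_of_SomeI by force
      then have "((i, j), v) \<in> set L" using v by blast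
      then have "map_of L (i, j) = Some v" "snd v > 0" using map_of_is_SomeI[OF L(2)] L(1) by blast+
      then show ?thesis using None unfolding wtL_def by simp
    next
      case (Some u)
      have "fst u > 0" using L(1) map_of_SomeD[OF Some] by blast
      then show ?thesis using Some unfolding wtL_def by simp
    qed
  qed
  have nb: "j < n" if "j \<in> nbr L i" for i j using that L(1) unfolding nbr_def by fastforce
  have s: "(\<Sum>j\<in>nbr L i. wtL L i j * \<delta> j) = (\<Sum>j\<leftarrow>[0..<n]. wtL L i j * \<delta> j)" for i
  proof -
    have "(\<Sum>j\<leftarrow>[0..<n]. wtL L i j * \<delta> j) = (\<Sum>j\<in>{..<n}. wtL L i j * \<delta> j)"
      by (simp add: interv_sum_list_conv_sum_set_nat atLeast0LessThan)
    also have "\<dots> = (\<Sum>j\<in>nbr L i. wtL L i j * \<delta> j)"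
      by (rule sum.mono_neutral_right) (use nb wt in auto)
    finally show ?thesis ..
  qed
  have "nbr L 0 = {1}" using wt[of 0] L(4,5) nb[of _ 0] by blast
  then show ?thesis unfolding balanced_list_def s using L(1-3) by blast
qed

text \<open>Up to a common factor, the values of \<open>\<delta>\<close> are the marks of the affine
  diagrams. The entries of \<open>p\<close> enter in such a way that one formula serves both
  directions of the valued edge.\<close>

lemma balanced_finite:
  "p \<in> {(1, 4), (4, 1), (2, 2)} \<Longrightarrow> balanced_list 2 (line 2 (\<lambda>_. p)) (\<lambda>i. [snd p, 2] ! i) (\<lambda>i. [fst p, snd p] ! i)"
  "p \<in> {(1, 3), (3, 1)} \<Longrightarrow> balanced_list 3 (line 3 (unvalued(1 := p))) (\<lambda>i. [1, 2, fst p] ! i) (\<lambda>i. [fst p, fst p, snd p] ! i)"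
  "p \<in> {(1, 2), (2, 1)} \<Longrightarrow> balanced_list 5 (line 5 (unvalued(2 := p)))
     (\<lambda>i. [1, 2, 3, 2 * fst p, fst p] ! i) (\<lambda>i. [fst p, fst p, fst p, snd p, snd p] ! i)"
  "balanced_list 7 (line 5 unvalued @ [((2, 5), (1, 1)), ((5, 6), (1, 1))]) (\<lambda>i. [1, 2, 3, 2, 1, 2, 1] ! i) (\<lambda>_. 1)"
  "balanced_list 8 (line 7 unvalued @ [((3, 7), (1, 1))]) (\<lambda>i. [1, 2, 3, 4, 3, 2, 1, 2] ! i) (\<lambda>_. 1)"
  "balanced_list 9 (line 8 unvalued @ [((2, 8), (1, 1))]) (\<lambda>i. [2, 4, 6, 5, 4, 3, 2, 1, 3] ! i) (\<lambda>_. 1)"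
  subgoal by (rule check_balanced, elim insertE emptyE; hypsubst) code_simp+
  subgoal by (rule check_balanced, elim insertE emptyE; hypsubst) code_simp+
  subgoal by (rule check_balanced, elim insertE emptyE; hypsubst) code_simp+
  subgoal by (rule check_balanced) code_simp
  subgoal by (rule check_balanced) code_simp
  subgoal by (rule check_balanced) code_simp
  done

lemma euclidean_balanced:
  assumes "euclidean_diagram D"
  shows "\<exists>n L \<delta> d. D = vtree_of {..<n} (map_of L) \<and> balanced_list n L \<delta> d"
  using assms
proof cases
  case (A11_tilde p)
  then have "p \<in> {(1, 4), (4, 1), (2, 2)}" by blast
  from A11_tilde(1)[unfolded line_tree_def] balanced_finite(1)[OF this] show ?thesis by blast
next
  case A12_tilde
  have "(2, 2) \<in> {(1, 4), (4, 1), (2, 2) :: nat \<times> nat}" by blast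
  from A12_tilde[unfolded line_tree_def] balanced_finite(1)[OF this] show ?thesis by blast
next
  case (B_C_BC_tilde n p q)
  from B_C_BC_tilde(1)[unfolded line_tree_def] balanced_BC[OF B_C_BC_tilde(2-)] show ?thesis by blast
next
  case (BD_CD_tilde n p)
  define k where "k = n - 3"
  have k: "n = k + 3" "k \<ge> 1" using BD_CD_tilde(2) by (simp_all add: k_def)
  have "n - 1 = k + 2" "n - 3 = k" using k by simp_all
  from BD_CD_tilde(1)[unfolded this, unfolded k(1)] balanced_BD[OF k(2) BD_CD_tilde(3)] show ?thesis by blast
next
  case (D_tilde n)
  define k where "k = n - 3"
  have k: "n = k + 3" "k \<ge> 1" using D_tilde(2) by (simp_all add: k_def)
  have "n - 1 = k + 2" "n - 3 = k" "{..n} = {..<k + 4}" using k by auto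
  from D_tilde(1)[unfolded this, unfolded k(1)] balanced_D[OF k(2)] show ?thesis by blast
next
  case E6_tilde
  from E6_tilde balanced_finite(4) show ?thesis by blast
next
  case E7_tilde
  from E7_tilde balanced_finite(5) show ?thesis by blast
next
  case E8_tilde
  from E8_tilde balanced_finite(6) show ?thesis by blast
next
  case (F4_tilde p)
  from F4_tilde(1)[unfolded line_tree_def] balanced_finite(3)[OF F4_tilde(2)] show ?thesis by blast
next
  case (G2_tilde p)
  from G2_tilde(1)[unfolded line_tree_def] balanced_finite(2)[OF G2_tilde(2)] show ?thesis by blast
qed

lemma extended_dynkin_null_data:
  assumes T: "valued_tree T" and e: "extended_dynkin T"
  obtains \<delta> d where "null_data T \<delta> d"
proof -
  obtain D where D: "euclidean_diagram D" "T \<cong>\<^sub>T D" using e unfolding extended_dynkin_def by blast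
  obtain n L \<delta> d where L: "D = vtree_of {..<n} (map_of L)" "balanced_list n L \<delta> d" using euclidean_balanced[OF D(1)] by blast
  have V: "tverts D = {..<n}" unfolding L(1) by (simp add: vtree_of_def)
  have "x \<in> tverts D \<and> y \<in> tverts D" if "tadj D x y" for x y
    unfolding V lessThan_iff using that unfolding L(1) by (rule balanced_list_null_data(2)[OF L(2)])
  with balanced_list_null_data(1)[OF L(2)] have "\<exists>\<delta> d. null_data T \<delta> d"
    unfolding L(1)[symmetric] by (rule null_data_iso[OF T D(2)])
  then show thesis using that by blast
qed

text \<open>The predecessor of \<open>(n, x)\<close> in \<open>ZT T ori\<close> lying over \<open>y\<close>.\<close>
definition zpred :: "('v \<Rightarrow> 'v \<Rightarrow> bool) \<Rightarrow> int \<Rightarrow> 'v \<Rightarrow> 'v \<Rightarrow> int \<times> 'v" where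
  "zpred ori n x y = (if ori y x then n else n - 1, y)"

definition ZT_additive :: "'v vtree \<Rightarrow> ('v \<Rightarrow> 'v \<Rightarrow> bool) \<Rightarrow> (int \<times> 'v \<Rightarrow> real) \<Rightarrow> bool" where
  "ZT_additive T ori f \<longleftrightarrow> (\<forall>n. \<forall>x\<in>tverts T.
     f (n - 1, x) + f (n, x) = (\<Sum>y | tadj T x y. real (emult T x y) * f (zpred ori n x y)))"

section \<open>The quadratic form of a Euclidean tree and periodicity\<close>

locale euclidean_tree =
  fixes T :: "'v vtree" and ori :: "'v \<Rightarrow> 'v \<Rightarrow> bool" and \<delta> d :: "'v \<Rightarrow> nat"
  assumes tree: "valued_tree T" and ori: "orientation T ori" and null: "null_data T \<delta> d"
begin

abbreviation V where "V \<equiv> tverts T"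
abbreviation E where "E \<equiv> {(x, y). ori x y}"
text \<open>The off-diagonal entry of the symmetrised Cartan matrix, up to sign.\<close>

definition s :: "'v \<Rightarrow> 'v \<Rightarrow> real" where "s x y = real (d x * emult T x y)"

lemma finV: "finite V" using null by (simp add: null_data_def)
lemma dpos: "x \<in> V \<Longrightarrow> \<delta> x \<ge> 1" "x \<in> V \<Longrightarrow> d x \<ge> 1" using null by (auto simp: null_data_def Suc_le_eq)
lemma delta: "x \<in> V \<Longrightarrow> (\<Sum>y | tadj T x y. real (emult T x y) * real (\<delta> y)) = 2 * real (\<delta> x)"
proof -
  assume "x \<in> V"
  then have "(\<Sum>y | tadj T x y. emult T x y * \<delta> y) = 2 * \<delta> x" using null by (simp add: null_data_def)
  then have "real (\<Sum>y | tadj T x y. emult T x y * \<delta> y) = real (2 * \<delta> x)" by simp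
  then show ?thesis by simp
qed
lemma s_sym: assumes "tadj T x y" shows "s x y = s y x"
proof -
  have "d x * emult T x y = d y * emult T y x" using null assms unfolding null_data_def by blast
  then show ?thesis unfolding s_def by (rule arg_cong)
qed
lemma ori_adj: "ori x y \<Longrightarrow> tadj T x y" using ori by (auto simp: orientation_def)
lemma adj_ori: "tadj T x y \<Longrightarrow> ori x y \<noteq> ori y x" using ori by (auto simp: orientation_def)
lemma adjV: "tadj T x y \<Longrightarrow> x \<in> V \<and> y \<in> V" by (rule vtree_adj_verts[OF tree])
lemma adj_sym: "tadj T x y \<Longrightarrow> tadj T y x" by (rule vtree_adj_sym[OF tree])
lemma ori_V: "ori x y \<Longrightarrow> x \<in> V" "ori x y \<Longrightarrow> y \<in> V" using ori_adj adjV by blast+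
lemma finE: "finite E"
  by (rule finite_subset[of _ "V \<times> V"]) (use finV ori_adj adjV in blast)+
lemma fin_nb: "finite {y. tadj T x y}"
  by (rule finite_subset[OF _ finV]) (use adjV in blast)

lemma s_ge_1: assumes "tadj T x y" shows "s x y \<ge> 1"
proof -
  obtain a b where "tedge T y x = Some (a, b)" using adj_sym[OF assms] by auto
  then have "emult T x y \<ge> 1" using vtree_val_pos[OF tree] by (simp add: emult_def Suc_le_eq)
  moreover have "d x \<ge> 1" using dpos adjV[OF assms] by blast
  ultimately have "1 \<le> d x * emult T x y" by simp
  then show ?thesis by (simp add: s_def del: of_nat_mult)
qed

lemma split_nb: "{y. tadj T x y} = {y. ori y x} \<union> {y. ori x y}" "{y. ori y x} \<inter> {y. ori x y} = {}"
  using ori_adj adj_sym adj_ori by blast+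

lemma fin_ori: "finite {y. ori y x}" "finite {y. ori x y}"
  using fin_nb[of x] unfolding split_nb(1) by auto

lemma sum_split_nb: "(\<Sum>y | tadj T x y. g y) = (\<Sum>y | ori y x. g y) + (\<Sum>y | ori x y. (g y :: real))"
  unfolding split_nb(1) by (rule sum.union_disjoint[OF fin_ori split_nb(2)])

lemma sum_in: "(\<Sum>x\<in>V. \<Sum>y | ori y x. g y x) = (\<Sum>(y, x)\<in>E. (g y x :: real))"
proof -
  have "(\<Sum>x\<in>V. \<Sum>y | ori y x. g y x) = (\<Sum>(x, y)\<in>(SIGMA x:V. {y. ori y x}). g y x)"
    by (rule sum.Sigma[OF finV]) (use fin_ori in blast)
  also have "\<dots> = (\<Sum>(y, x)\<in>E. g y x)"
    by (rule sum.reindex_bij_witness[where i = "\<lambda>(y, x). (x, y)" and j = "\<lambda>(x, y). (y, x)"])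
      (auto intro: ori_V)
  finally show ?thesis .
qed

lemma sum_out: "(\<Sum>x\<in>V. \<Sum>y | ori x y. g x y) = (\<Sum>(x, y)\<in>E. (g x y :: real))"
proof -
  have "(\<Sum>x\<in>V. \<Sum>y | ori x y. g x y) = (\<Sum>(x, y)\<in>(SIGMA x:V. {y. ori x y}). g x y)"
    by (rule sum.Sigma[OF finV]) (use fin_ori in blast)
  also have "(SIGMA x:V. {y. ori x y}) = E" using ori_adj adjV by blast
  finally show ?thesis .
qed

text \<open>Half the quadratic form of the symmetrised Cartan matrix; each edge is counted once, in
  the direction of the orientation.\<close>

definition q :: "('v \<Rightarrow> real) \<Rightarrow> real" where
  "q u = (\<Sum>x\<in>V. real (d x) * u x ^ 2) - (\<Sum>(x, y)\<in>E. s x y * u x * u y)"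

text \<open>Passing from one slice to the next is a product of reflections for the form \<open>q\<close>.\<close>
lemma q_invariant:
  assumes f: "ZT_additive T ori f"
  shows "q (\<lambda>x. f (n, x)) = q (\<lambda>x. f (n - 1, x))"
proof -
  let ?u = "\<lambda>x. f (n - 1, x)" and ?v = "\<lambda>x. f (n, x)"
  \<comment> \<open>The mesh relation at \<open>(n, x)\<close>: arrows \<open>y -> x\<close>
    contribute from slice \<open>n\<close>, arrows \<open>x -> y\<close> from slice
    \<open>n - 1\<close>.\<close>
  have m: "?u x + ?v x = (\<Sum>y | ori y x. real (emult T x y) * ?v y) + (\<Sum>y | ori x y. real (emult T x y) * ?u y)"
    if "x \<in> V" for x
  proof -
    have 1: "(\<Sum>y | ori y x. real (emult T x y) * f (zpred ori n x y)) = (\<Sum>y | ori y x. real (emult T x y) * ?v y)"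
      by (rule sum.cong) (auto simp: zpred_def)
    have 2: "(\<Sum>y | ori x y. real (emult T x y) * f (zpred ori n x y)) = (\<Sum>y | ori x y. real (emult T x y) * ?u y)"
    proof (rule sum.cong[OF refl])
      fix y assume "y \<in> {y. ori x y}"
      then have "\<not> ori y x" using adj_ori ori_adj by blast
      then show "real (emult T x y) * f (zpred ori n x y) = real (emult T x y) * ?u y" by (simp add: zpred_def)
    qed
    have "?u x + ?v x = (\<Sum>y | tadj T x y. real (emult T x y) * f (zpred ori n x y))"
      using f that unfolding ZT_additive_def by blast
    then show ?thesis unfolding sum_split_nb 1 2 .
  qed
  have "real (d x) * ?v x ^ 2 - real (d x) * ?u x ^ 2 =
      (\<Sum>y | ori y x. s x y * (?v x - ?u x) * ?v y) + (\<Sum>y | ori x y. s x y * (?v x - ?u x) * ?u y)" if x: "x \<in> V" for x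
  proof -
    have "real (d x) * ?v x ^ 2 - real (d x) * ?u x ^ 2 = real (d x) * (?v x - ?u x) * (?u x + ?v x)"
      by (simp add: power2_eq_square algebra_simps)
    then show ?thesis unfolding m[OF x] by (simp add: sum_distrib_left distrib_left s_def mult_ac)
  qed
  then have "(\<Sum>x\<in>V. real (d x) * ?v x ^ 2) - (\<Sum>x\<in>V. real (d x) * ?u x ^ 2) =
      (\<Sum>x\<in>V. \<Sum>y | ori y x. s x y * (?v x - ?u x) * ?v y) + (\<Sum>x\<in>V. \<Sum>y | ori x y. s x y * (?v x - ?u x) * ?u y)"
    by (simp add: sum.distrib flip: sum_subtractf)
  also have "\<dots> = (\<Sum>(y, x)\<in>E. s x y * (?v x - ?u x) * ?v y) + (\<Sum>(x, y)\<in>E. s x y * (?v x - ?u x) * ?u y)"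
    unfolding sum_in[of "\<lambda>y x. s x y * (?v x - ?u x) * ?v y"] sum_out ..
  \<comment> \<open>Along an edge \<open>x -> y\<close> the two sums contribute
    \<open>(v y - u y) v x\<close> and \<open>(v x - u x) u y\<close>, up to the common factor
    \<open>s x y\<close>; the mixed products cancel.\<close>
  also have "\<dots> = (\<Sum>(x, y)\<in>E. s x y * ?v x * ?v y - s x y * ?u x * ?u y)"
    unfolding sum.distrib[symmetric]
  proof (rule sum.cong[OF refl])
    fix e assume "e \<in> E"
    then obtain x y where e: "e = (x, y)" "ori x y" by blast
    have "s y x = s x y" by (rule s_sym[OF ori_adj[OF e(2)], symmetric])
    then show "(case e of (y, x) \<Rightarrow> s x y * (?v x - ?u x) * ?v y) + (case e of (x, y) \<Rightarrow> s x y * (?v x - ?u x) * ?u y) =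
        (case e of (x, y) \<Rightarrow> s x y * ?v x * ?v y - s x y * ?u x * ?u y)"
      unfolding e by (simp add: algebra_simps)
  qed
  also have "\<dots> = (\<Sum>(x, y)\<in>E. s x y * ?v x * ?v y) - (\<Sum>(x, y)\<in>E. s x y * ?u x * ?u y)"
    by (simp add: case_prod_unfold sum_subtractf)
  finally show ?thesis by (simp add: q_def)
qed

text \<open>The null root turns the diagonal into edge terms: \<open>2 * d x\<close> is the sum of
  \<open>s x y * \<delta> y / \<delta> x\<close> over the neighbours \<open>y\<close>. Completing
  the square on each edge shows that \<open>q\<close> is semidefinite and vanishes only on multiples
  of \<open>\<delta>\<close>.\<close>

lemma q_squares:
  "q u = (\<Sum>(x, y)\<in>E. s x y / (2 * real (\<delta> x) * real (\<delta> y)) * (real (\<delta> y) * u x - real (\<delta> x) * u y) ^ 2)"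
proof -
  have e: "2 * (real (d x) * u x ^ 2) = (\<Sum>y | ori y x. s x y * real (\<delta> y) / real (\<delta> x) * u x ^ 2) +
      (\<Sum>y | ori x y. s x y * real (\<delta> y) / real (\<delta> x) * u x ^ 2)" if x: "x \<in> V" for x
  proof -
    have "2 * (real (d x) * u x ^ 2) = real (d x) * (2 * real (\<delta> x)) / real (\<delta> x) * u x ^ 2" using dpos(1)[OF x] by simp
    also have "\<dots> = (\<Sum>y | tadj T x y. s x y * real (\<delta> y) / real (\<delta> x) * u x ^ 2)"
      unfolding delta[OF x, symmetric]
      by (simp add: sum_distrib_left sum_distrib_right sum_divide_distrib s_def mult_ac)
    finally show ?thesis unfolding sum_split_nb .
  qed
  have "2 * (\<Sum>x\<in>V. real (d x) * u x ^ 2) = (\<Sum>x\<in>V. (\<Sum>y | ori y x. s x y * real (\<delta> y) / real (\<delta> x) * u x ^ 2)) +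
      (\<Sum>x\<in>V. \<Sum>y | ori x y. s x y * real (\<delta> y) / real (\<delta> x) * u x ^ 2)"
    unfolding sum_distrib_left sum.distrib[symmetric] by (rule sum.cong) (use e in auto)
  also have "\<dots> = (\<Sum>(y, x)\<in>E. s x y * real (\<delta> y) / real (\<delta> x) * u x ^ 2) + (\<Sum>(x, y)\<in>E. s x y * real (\<delta> y) / real (\<delta> x) * u x ^ 2)"
    unfolding sum_in[of "\<lambda>y x. s x y * real (\<delta> y) / real (\<delta> x) * u x ^ 2"] sum_out ..
  finally have "2 * q u = (\<Sum>(y, x)\<in>E. s x y * real (\<delta> y) / real (\<delta> x) * u x ^ 2) + (\<Sum>(x, y)\<in>E. s x y * real (\<delta> y) / real (\<delta> x) * u x ^ 2)
      - (\<Sum>(x, y)\<in>E. 2 * (s x y * u x * u y))"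
    by (simp add: q_def sum_distrib_left case_prod_unfold)
  also have "\<dots> = (\<Sum>(x, y)\<in>E. s y x * real (\<delta> x) / real (\<delta> y) * u y ^ 2 + s x y * real (\<delta> y) / real (\<delta> x) * u x ^ 2 - 2 * (s x y * u x * u y))"
    by (simp add: case_prod_unfold sum.distrib sum_subtractf)
  also have "\<dots> = (\<Sum>(x, y)\<in>E. 2 * (s x y / (2 * real (\<delta> x) * real (\<delta> y)) * (real (\<delta> y) * u x - real (\<delta> x) * u y) ^ 2))"
  proof (rule sum.cong[OF refl])
    fix e assume "e \<in> E"
    then obtain x y where e: "e = (x, y)" "ori x y" by blast
    then have a: "tadj T x y" by (simp add: ori_adj)
    have "\<delta> x \<ge> 1" "\<delta> y \<ge> 1" using dpos adjV[OF a] by blast+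
    then have p: "real (\<delta> x) > 0" "real (\<delta> y) > 0" by simp_all
    have "s y x = s x y" using s_sym[OF a] by simp
    then show "(case e of (x, y) \<Rightarrow> s y x * real (\<delta> x) / real (\<delta> y) * u y ^ 2 + s x y * real (\<delta> y) / real (\<delta> x) * u x ^ 2 - 2 * (s x y * u x * u y)) =
      (case e of (x, y) \<Rightarrow> 2 * (s x y / (2 * real (\<delta> x) * real (\<delta> y)) * (real (\<delta> y) * u x - real (\<delta> x) * u y) ^ 2))"
      using p e by (simp add: field_simps power2_eq_square)
  qed
  finally have "2 * q u = 2 * (\<Sum>(x, y)\<in>E. s x y / (2 * real (\<delta> x) * real (\<delta> y)) * (real (\<delta> y) * u x - real (\<delta> x) * u y) ^ 2)"
    by (simp add: sum_distrib_left case_prod_unfold)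
  then show ?thesis by simp
qed

text \<open>All summands of \<open>q_squares\<close> are nonnegative and \<open>s\<close> is at
  least 1, so on each edge the deviation from proportionality to \<open>\<delta>\<close> is
  controlled by \<open>q\<close>.\<close>

lemma edge_term_le:
  assumes "ori x y"
  shows "(real (\<delta> y) * u x - real (\<delta> x) * u y) ^ 2 \<le> 2 * real (\<delta> x) * real (\<delta> y) * q u"
proof -
  have a: "tadj T x y" by (rule ori_adj[OF assms])
  have "\<delta> x \<ge> 1" "\<delta> y \<ge> 1" using dpos adjV[OF a] by blast+
  then have p: "real (\<delta> x) > 0" "real (\<delta> y) > 0" by simp_all
  let ?t = "\<lambda>(x, y). s x y / (2 * real (\<delta> x) * real (\<delta> y)) * (real (\<delta> y) * u x - real (\<delta> x) * u y) ^ 2"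
  have nonneg: "0 \<le> ?t e" if "e \<in> E" for e
  proof -
    obtain x y where e: "e = (x, y)" by (cases e)
    then have "s x y \<ge> 1" using s_ge_1 ori_adj that by blast
    then show ?thesis using e by simp
  qed
  have "?t (x, y) \<le> sum ?t E" by (rule member_le_sum) (use nonneg finE assms in auto)
  then have "?t (x, y) \<le> q u" unfolding q_squares .
  then have "s x y * (real (\<delta> y) * u x - real (\<delta> x) * u y) ^ 2 \<le> 2 * real (\<delta> x) * real (\<delta> y) * q u"
    using p by (simp add: field_simps)
  moreover have "1 * (real (\<delta> y) * u x - real (\<delta> x) * u y) ^ 2 \<le> s x y * (real (\<delta> y) * u x - real (\<delta> x) * u y) ^ 2"
    by (rule mult_right_mono[OF s_ge_1[OF a]]) simp
  ultimately show ?thesis by simp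
qed

lemma proportional:
  assumes "\<And>x y. ori x y \<Longrightarrow> real (\<delta> y) * u x = real (\<delta> x) * u y"
  obtains c where "\<And>x. x \<in> V \<Longrightarrow> u x = c * real (\<delta> x)"
proof -
  obtain x0 where x0: "x0 \<in> V" using vtree_nonempty[OF tree] by blast
  have "u x = u x0 / real (\<delta> x0) * real (\<delta> x)" if "x \<in> V" for x
    using vtree_connected[OF tree x0 that]
  proof (induction rule: rtranclp_induct)
    case base
    then show ?case using dpos(1)[OF x0] by simp
  next
    case (step y z)
    have p: "real (\<delta> y) > 0" "real (\<delta> z) > 0" using dpos adjV[OF step(2)] by force+
    have "real (\<delta> z) * u y = real (\<delta> y) * u z"
    proof (cases "ori y z")
      case True then show ?thesis by (rule assms)
    next
      case False
      then have "ori z y" using adj_ori[OF step(2)] by blast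
      then show ?thesis using assms by metis
    qed
    then have "u z = u y * real (\<delta> z) / real (\<delta> y)" using p by (simp add: field_simps)
    then show ?case unfolding step(3) using p by simp
  qed
  then show thesis by (rule that)
qed

text \<open>A zero slice forces \<open>q = 0\<close> on all slices, so slice \<open>n\<close> is a
  multiple \<open>c n\<close> of \<open>\<delta>\<close>. The mesh at a leaf says that
  \<open>c (n - 1) + c n\<close> is twice one of its two terms, so \<open>c\<close> is constant.
  This replaces an induction along the orientation.\<close>

lemma ZT_additive_q0:
  assumes f: "ZT_additive T ori f" and z: "\<And>x. x \<in> V \<Longrightarrow> f (n0, x) = 0"
  shows "x \<in> V \<Longrightarrow> f (n, x) = 0"
proof -
  have q0: "q (\<lambda>x. f (n, x)) = 0" for n
  proof (induction n rule: int_induct[where k = n0])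
    case base
    have "(\<Sum>x\<in>V. real (d x) * f (n0, x) ^ 2) = 0" using z by simp
    moreover have "(\<Sum>(x, y)\<in>E. s x y * f (n0, x) * f (n0, y)) = 0"
      by (rule sum.neutral) (use z ori_adj adjV in force)
    ultimately show ?case by (simp add: q_def)
  next
    case (step1 i)
    then show ?case using q_invariant[OF f, of "i + 1"] by simp
  next
    case (step2 i)
    then show ?case using q_invariant[OF f, of i] by simp
  qed
  have "\<exists>c. \<forall>x\<in>V. f (n, x) = c * real (\<delta> x)" for n
  proof -
    have "real (\<delta> y) * f (n, x) = real (\<delta> x) * f (n, y)" if "ori x y" for x y
      using edge_term_le[OF that, of "\<lambda>x. f (n, x)"] q0 by simp
    then show ?thesis using proportional[of "\<lambda>x. f (n, x)"] by metis
  qed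
  then obtain c where c: "\<And>n x. x \<in> V \<Longrightarrow> f (n, x) = c n * real (\<delta> x)" by metis
  obtain l m where lm: "{z. tadj T l z} = {m}" using null by (auto simp: null_data_def)
  have ml: "tadj T l m" using lm by blast
  have lV: "l \<in> V" and mV: "m \<in> V" using adjV[OF ml] by blast+
  have dl: "real (emult T l m) * real (\<delta> m) = 2 * real (\<delta> l)" using delta[OF lV] unfolding lm by simp
  have step: "c n = c (n - 1)" for n
  proof -
    have "f (n - 1, l) + f (n, l) = real (emult T l m) * f (zpred ori n l m)"
      using f lV lm unfolding ZT_additive_def by simp
    then have "(c (n - 1) + c n) * real (\<delta> l) = real (emult T l m) * real (\<delta> m) * c (if ori m l then n else n - 1)"
      using c[OF lV] c[OF mV] by (simp add: zpred_def algebra_simps)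
    then have "(c (n - 1) + c n) * real (\<delta> l) = (2 * c (if ori m l then n else n - 1)) * real (\<delta> l)"
      using dl by simp
    moreover have "real (\<delta> l) \<noteq> 0" using dpos(1)[OF lV] by simp
    ultimately have "c (n - 1) + c n = 2 * c (if ori m l then n else n - 1)" using mult_right_cancel by blast
    then show ?thesis by (simp split: if_splits)
  qed
  have "c n = 0" for n
  proof (induction n rule: int_induct[where k = n0])
    case base
    show ?case using c[OF lV, of n0] z[OF lV] dpos(1)[OF lV] by simp
  next
    case (step1 i)
    then show ?case using step[of "i + 1"] by simp
  next
    case (step2 i)
    then show ?case using step[of i] by simp
  qed
  then show "x \<in> V \<Longrightarrow> f (n, x) = 0" using c by simp
qed

theorem ZT_additive_periodic:
  assumes f: "ZT_additive T ori (\<lambda>p. real (f p))"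
  obtains p :: nat where "p > 0" "\<And>n x. x \<in> V \<Longrightarrow> f (n + int p, x) = f (n, x)"
proof -
  let ?f = "\<lambda>p. real (f p)"
  have qc: "q (\<lambda>x. ?f (n, x)) = q (\<lambda>x. ?f (0, x))" for n
  proof (induction n rule: int_induct[where k = 0])
    case (step1 i)
    then show ?case using q_invariant[OF f, of "i + 1"] by simp
  next
    case (step2 i)
    then show ?case using q_invariant[OF f, of i] by simp
  qed simp
  define Q where "Q = q (\<lambda>x. ?f (0, x))"
  \<comment> \<open>The integers \<open>\<delta> y * f x - \<delta> x * f y\<close> on the edges
    determine a slice up to a multiple of \<open>\<delta>\<close>. By \<open>edge_term_le\<close>
    they are bounded independently of the slice, so two slices share them by the pigeonhole
    principle.\<close>
  define g where "g n = restrict (\<lambda>(x, y). int (\<delta> y) * int (f (int n, x)) - int (\<delta> x) * int (f (int n, y))) E" for n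
  define b where "b = (\<lambda>(x, y). \<lceil>2 * real (\<delta> x) * real (\<delta> y) * Q\<rceil>)"
  have "g n \<in> (\<Pi>\<^sub>E e\<in>E. {- b e..b e})" for n
  proof (rule PiE_I)
    fix e assume "e \<in> E"
    then obtain x y where e: "e = (x, y)" "ori x y" by blast
    let ?k = "int (\<delta> y) * int (f (int n, x)) - int (\<delta> x) * int (f (int n, y))"
    have "(real_of_int ?k) ^ 2 \<le> 2 * real (\<delta> x) * real (\<delta> y) * Q"
      using edge_term_le[OF e(2), of "\<lambda>x. ?f (int n, x)"] qc[of "int n"] by (simp add: Q_def)
    then have "real_of_int (?k ^ 2) \<le> 2 * real (\<delta> x) * real (\<delta> y) * Q" unfolding of_int_power .
    then have "?k ^ 2 \<le> b e" unfolding b_def e prod.case by (meson le_of_int_ceiling of_int_le_iff order_trans)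
    \<comment> \<open>For an integer, a bound on the square also bounds the absolute value, so no
      square root enters.\<close>
    moreover have "\<bar>?k\<bar> \<le> ?k ^ 2"
    proof (cases "?k = 0")
      case False
      then have "\<bar>?k\<bar> * 1 \<le> \<bar>?k\<bar> * \<bar>?k\<bar>" by (intro mult_left_mono) auto
      then show ?thesis by (simp add: power2_eq_square)
    qed simp
    ultimately have "\<bar>?k\<bar> \<le> b e" by linarith
    then show "g n e \<in> {- b e..b e}" using e by (simp add: g_def abs_le_iff)
  qed (simp add: g_def)
  then have "g ` UNIV \<subseteq> (\<Pi>\<^sub>E e\<in>E. {- b e..b e})" by blast
  then have "finite (g ` UNIV)" by (rule finite_subset) (intro finite_PiE finE finite_atLeastAtMost_int)
  then have "\<not> inj g" using finite_imageD infinite_UNIV_nat by blast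
  then obtain m n where mn: "m < n" "g m = g n" unfolding inj_on_def by (metis linorder_neqE_nat)
  let ?p = "int n - int m"
  have "\<exists>c. \<forall>x\<in>V. ?f (int n, x) - ?f (int m, x) = c * real (\<delta> x)"
  proof -
    have "real (\<delta> y) * (?f (int n, x) - ?f (int m, x)) = real (\<delta> x) * (?f (int n, y) - ?f (int m, y))" if o: "ori x y" for x y
    proof -
      have "g m (x, y) = g n (x, y)" using mn by simp
      then have "int (\<delta> y) * int (f (int m, x)) - int (\<delta> x) * int (f (int m, y)) = int (\<delta> y) * int (f (int n, x)) - int (\<delta> x) * int (f (int n, y))"
        using o by (simp add: g_def)
      then have "real_of_int (int (\<delta> y) * int (f (int m, x)) - int (\<delta> x) * int (f (int m, y))) =
          real_of_int (int (\<delta> y) * int (f (int n, x)) - int (\<delta> x) * int (f (int n, y)))" by (rule arg_cong)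
      then show ?thesis by (simp add: algebra_simps)
    qed
    then show ?thesis using proportional[of "\<lambda>x. ?f (int n, x) - ?f (int m, x)"] by metis
  qed
  then obtain c where c: "\<And>x. x \<in> V \<Longrightarrow> ?f (int n, x) - ?f (int m, x) = c * real (\<delta> x)" by blast
  \<comment> \<open>Translating by \<open>?p\<close> and subtracting \<open>f\<close> and the drift
    gives an additive function that vanishes on slice \<open>m\<close>, hence everywhere; so the
    drift is the same at every slice.\<close>
  define h where "h = (\<lambda>(k, x). ?f (k + ?p, x) - ?f (k, x) - c * real (\<delta> x))"
  have "ZT_additive T ori h"
    unfolding ZT_additive_def
  proof (intro allI ballI)
    fix k x assume x: "x \<in> V"
    have zp: "zpred ori (k + ?p) x y = (fst (zpred ori k x y) + ?p, snd (zpred ori k x y))" for y by (simp add: zpred_def)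
    have "?f (k + ?p - 1, x) + ?f (k + ?p, x) = (\<Sum>y | tadj T x y. real (emult T x y) * ?f (zpred ori (k + ?p) x y))"
      "?f (k - 1, x) + ?f (k, x) = (\<Sum>y | tadj T x y. real (emult T x y) * ?f (zpred ori k x y))"
      using f x unfolding ZT_additive_def by blast+
    moreover have "2 * (c * real (\<delta> x)) = (\<Sum>y | tadj T x y. real (emult T x y) * (c * real (\<delta> y)))"
      using delta[OF x] by (simp add: mult.left_commute[of _ c] flip: sum_distrib_left)
    moreover have "(\<Sum>y | tadj T x y. real (emult T x y) * h (zpred ori k x y)) =
      (\<Sum>y | tadj T x y. real (emult T x y) * ?f (zpred ori (k + ?p) x y)) - (\<Sum>y | tadj T x y. real (emult T x y) * ?f (zpred ori k x y))
       - (\<Sum>y | tadj T x y. real (emult T x y) * (c * real (\<delta> y)))"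
      unfolding sum_subtractf[symmetric] zp
      by (rule sum.cong) (auto simp: h_def zpred_def algebra_simps)
    ultimately show "h (k - 1, x) + h (k, x) = (\<Sum>y | tadj T x y. real (emult T x y) * h (zpred ori k x y))"
      by (simp add: h_def algebra_simps)
  qed
  then have h0: "h (k, x) = 0" if "x \<in> V" for k x
    by (rule ZT_additive_q0[of _ "int m"]) (use c that in \<open>auto simp: h_def\<close>)
  have per: "?f (k + ?p, x) = ?f (k, x) + c * real (\<delta> x)" if "x \<in> V" for k x
    using h0[OF that, of k] by (simp add: h_def)
  have perj: "?f (k + int j * ?p, x) = ?f (k, x) + real j * (c * real (\<delta> x))" if x: "x \<in> V" for k j x
  proof (induction j)
    case (Suc j)
    have "k + int (Suc j) * ?p = (k + int j * ?p) + ?p" by (simp add: algebra_simps)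
    then show ?case using per[OF x, of "k + int j * ?p"] Suc by (simp add: algebra_simps)
  qed simp
  obtain x0 where x0: "x0 \<in> V" using vtree_nonempty[OF tree] by blast
  have "c = 0"
  proof (rule ccontr)
    assume "c \<noteq> 0"
    then have ne: "c * real (\<delta> x0) \<noteq> 0" using dpos(1)[OF x0] by simp
    show False
    proof (cases "c * real (\<delta> x0) < 0")
      case True
      obtain j :: nat where j: "?f (0, x0) < real j * (- (c * real (\<delta> x0)))"
        using ex_less_of_nat_mult[of "- (c * real (\<delta> x0))"] True by auto
      then have "?f (0 + int j * ?p, x0) < 0" unfolding perj[OF x0] by (simp add: algebra_simps)
      then show False by simp
    next
      case False
      then have pos: "c * real (\<delta> x0) > 0" using ne by linarith
      obtain j :: nat where j: "?f (0, x0) < real j * (c * real (\<delta> x0))"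
        using ex_less_of_nat_mult[OF pos] by blast
      have "?f (0, x0) = ?f (- (int j * ?p), x0) + real j * (c * real (\<delta> x0))"
        using perj[OF x0, of "- (int j * ?p)" j] by simp
      then show False using j by simp
    qed
  qed
  then have "f (k + int (n - m), x) = f (k, x)" if "x \<in> V" for k x
    using per[OF that, of k] mn(1) by simp
  then show thesis using that[of "n - m"] mn(1) by simp
qed

text \<open>Pair the defects, right side minus left side, with the positive weights
  \<open>d x * \<delta> x\<close>. Symmetry of \<open>s\<close> moves the neighbour sum onto
  \<open>\<delta>\<close>, and the null root equation makes the total 0; nonnegative defects with
  positive weights and total 0 all vanish.\<close>

lemma subadditive_additive:
  assumes sub: "\<And>x. x \<in> V \<Longrightarrow> (\<Sum>y | tadj T x y. real (emult T x y) * F y) \<le> 2 * F x"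
    and x: "x \<in> V"
  shows "(\<Sum>y | tadj T x y. real (emult T x y) * F y) = 2 * F x"
proof -
  let ?w = "\<lambda>x. real (d x) * real (\<delta> x)"
  let ?g = "\<lambda>x. 2 * F x - (\<Sum>y | tadj T x y. real (emult T x y) * F y)"
  have sw: "(\<Sum>x\<in>V. \<Sum>y | tadj T x y. G x y) = (\<Sum>x\<in>V. \<Sum>y | tadj T x y. (G y x :: real))" for G
  proof -
    define S where "S = (SIGMA x:V. {y. tadj T x y})"
    have S: "prod.swap e \<in> S" if "e \<in> S" for e
    proof (cases e)
      case (Pair x y)
      then have "tadj T x y" using that unfolding S_def by blast
      then have "tadj T y x" "y \<in> V" using adj_sym adjV by blast+
      then show ?thesis unfolding Pair S_def by simp
    qed
    have "(\<Sum>x\<in>V. \<Sum>y | tadj T x y. G x y) = (\<Sum>(x, y)\<in>S. G x y)"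
      unfolding S_def by (rule sum.Sigma[OF finV]) (use fin_nb in blast)
    also have "\<dots> = (\<Sum>(x, y)\<in>S. G y x)"
      by (rule sum.reindex_bij_witness[where i = prod.swap and j = prod.swap]) (simp_all add: S case_prod_unfold)
    also have "\<dots> = (\<Sum>x\<in>V. \<Sum>y | tadj T x y. G y x)"
      unfolding S_def by (rule sum.Sigma[OF finV, symmetric]) (use fin_nb in blast)
    finally show ?thesis .
  qed
  have "(\<Sum>x\<in>V. ?w x * (\<Sum>y | tadj T x y. real (emult T x y) * F y)) = (\<Sum>x\<in>V. \<Sum>y | tadj T x y. s x y * real (\<delta> x) * F y)"
    by (simp add: sum_distrib_left s_def mult_ac)
  also have "\<dots> = (\<Sum>x\<in>V. \<Sum>y | tadj T x y. s y x * real (\<delta> y) * F x)" by (rule sw)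
  also have "\<dots> = (\<Sum>x\<in>V. ?w x * (2 * F x))"
  proof (rule sum.cong[OF refl])
    fix x assume x: "x \<in> V"
    have "(\<Sum>y | tadj T x y. s y x * real (\<delta> y) * F x) = (\<Sum>y | tadj T x y. real (d x) * F x * (real (emult T x y) * real (\<delta> y)))"
    proof (rule sum.cong[OF refl])
      fix y assume "y \<in> {y. tadj T x y}"
      then have "tadj T x y" by blast
      then have "s y x = s x y" by (rule s_sym[symmetric])
      then show "s y x * real (\<delta> y) * F x = real (d x) * F x * (real (emult T x y) * real (\<delta> y))" by (simp add: s_def)
    qed
    then show "(\<Sum>y | tadj T x y. s y x * real (\<delta> y) * F x) = ?w x * (2 * F x)"
      using delta[OF x] by (simp flip: sum_distrib_left)
  qed
  finally have e: "(\<Sum>x\<in>V. ?w x * (\<Sum>y | tadj T x y. real (emult T x y) * F y)) = (\<Sum>x\<in>V. ?w x * (2 * F x))" .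
  have "(\<Sum>x\<in>V. ?w x * ?g x) = 0" unfolding right_diff_distrib sum_subtractf e by (rule diff_self)
  moreover have "0 \<le> ?w x * ?g x" if "x \<in> V" for x by (rule mult_nonneg_nonneg) (use sub[OF that] in simp_all)
  ultimately have "?w x * ?g x = 0" using sum_nonneg_eq_0_iff[OF finV, of "\<lambda>x. ?w x * ?g x"] x by blast
  moreover have "?w x \<noteq> 0" using dpos[OF x] by simp
  ultimately have "?g x = 0" using mult_eq_0_iff by blast
  then show ?thesis by simp
qed

end

section \<open>Coverings of stable components\<close>

lemma sum_list_fibres:
  fixes g :: "'b \<Rightarrow> real"
  assumes "finite A" "h ` set Zs \<subseteq> A"
  shows "(\<Sum>Z\<leftarrow>Zs. g (h Z)) = (\<Sum>M\<in>A. real (length (filter (\<lambda>Z. h Z = M) Zs)) * g M)"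
  using assms(2)
proof (induction Zs)
  case (Cons Z Zs)
  then have Z: "h Z \<in> A" and IH: "(\<Sum>Z\<leftarrow>Zs. g (h Z)) = (\<Sum>M\<in>A. real (length (filter (\<lambda>Z. h Z = M) Zs)) * g M)" by simp_all
  have "(\<Sum>M\<in>A. real (length (filter (\<lambda>Z. h Z = M) (Z # Zs))) * g M) =
      (\<Sum>M\<in>A. (if h Z = M then g M else 0) + real (length (filter (\<lambda>Z. h Z = M) Zs)) * g M)"
    by (rule sum.cong) (auto simp: algebra_simps)
  also have "\<dots> = g (h Z) + (\<Sum>M\<in>A. real (length (filter (\<lambda>Z. h Z = M) Zs)) * g M)"
    using Z assms(1) by (simp add: sum.distrib)
  finally show ?case using IH by simp
qed simp

context ks_category
begin

lemma iso_class_self: "X \<in> Obj C \<Longrightarrow> X \<in> iso_class C X"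
  by (simp add: iso_class_def isomorphic_refl)

lemma summand_mult_iso:
  assumes X: "indecomposable C X" and i: "isomorphic C X X'" "isomorphic C V V'"
  shows "summand_mult C X V = summand_mult C X' V'"
proof -
  have "isomorphic C X Z \<longleftrightarrow> isomorphic C X' Z" for Z using i(1) isomorphic_sym isomorphic_trans by blast
  then have "isomorphic C X = isomorphic C X'" by blast
  then have 1: "summand_mult C X V' = summand_mult C X' V'" by (simp add: summand_mult_def)
  have O: "V \<in> Obj C" "V' \<in> Obj C" using i(2) by (simp_all add: isomorphic_def)
  have "irr_dim X V' = irr_dim X V"
    using irr_dim_direct_sum[OF indec_local[OF X] direct_sum_single[OF i(2)]] by simp
  then have "summand_mult C X V = summand_mult C X V'"
    using summand_mult_irr_dim[OF X O(1)] summand_mult_irr_dim[OF X O(2)] irr_dim_pos[OF indec_local[OF X]] by simp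
  then show ?thesis using 1 by simp
qed

lemma length_filter_class:
  assumes X: "indecomposable C X" and d: "Defs.direct_sum C Zs V" and Zs: "\<forall>Z\<in>set Zs. indecomposable C Z"
  shows "length (filter (\<lambda>Z. iso_class C Z = iso_class C X) Zs) = summand_mult C X V"
proof -
  have "filter (\<lambda>Z. iso_class C Z = iso_class C X) Zs = filter (isomorphic C X) Zs"
  proof (rule filter_cong[OF refl])
    fix Z assume "Z \<in> set Zs"
    then have "Z \<in> Obj C" using Zs indec_obj by blast
    then show "(iso_class C Z = iso_class C X) = isomorphic C X Z"
      using iso_class_eq_iff[OF _ indec_obj[OF X], of Z] isomorphic_sym by blast
  qed
  then show ?thesis using summand_mult_eq[OF X d Zs] by simp
qed

text \<open>Uniqueness of decompositions in the form of sums over the summands, for middle terms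
  that are known only up to isomorphism.\<close>

lemma krull_schmidt_sum:
  fixes g :: "'o set \<Rightarrow> real"
  assumes d: "Defs.direct_sum C Zs V" "\<forall>Z\<in>set Zs. indecomposable C Z"
    and d': "Defs.direct_sum C Zs' V'" "\<forall>Z\<in>set Zs'. indecomposable C Z" and i: "isomorphic C V V'"
  shows "(\<Sum>Z\<leftarrow>Zs. g (iso_class C Z)) = (\<Sum>Z\<leftarrow>Zs'. g (iso_class C Z))"
proof -
  let ?A = "iso_class C ` set Zs \<union> iso_class C ` set Zs'"
  have "(\<Sum>Z\<leftarrow>Zs. g (iso_class C Z)) = (\<Sum>M\<in>?A. real (length (filter (\<lambda>Z. iso_class C Z = M) Zs)) * g M)"
    by (rule sum_list_fibres) auto
  also have "\<dots> = (\<Sum>M\<in>?A. real (length (filter (\<lambda>Z. iso_class C Z = M) Zs')) * g M)"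
  proof (rule sum.cong[OF refl])
    fix M assume "M \<in> ?A"
    then obtain Z where Z: "indecomposable C Z" "M = iso_class C Z" using d(2) d'(2) by blast
    show "real (length (filter (\<lambda>Z. iso_class C Z = M) Zs)) * g M = real (length (filter (\<lambda>Z. iso_class C Z = M) Zs')) * g M"
      unfolding Z(2) length_filter_class[OF Z(1) d] length_filter_class[OF Z(1) d']
        summand_mult_iso[OF Z(1) isomorphic_refl[OF indec_obj[OF Z(1)]] i] ..
  qed
  also have "\<dots> = (\<Sum>Z\<leftarrow>Zs'. g (iso_class C Z))"
    by (rule sum_list_fibres[symmetric]) auto
  finally show ?thesis .
qed

lemma iso_class_indec:
  assumes "iso_class C X = iso_class C Y" "indecomposable C Y"
  shows "indecomposable C X" "isomorphic C X Y"
proof -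
  have "Y \<in> iso_class C X" using iso_class_self[OF indec_obj[OF assms(2)]] assms(1) by simp
  then show i: "isomorphic C X Y" by (simp add: iso_class_def)
  show "indecomposable C X" by (rule indec_iso[OF assms(2) isomorphic_sym[OF i]])
qed

end

section \<open>Translation, valuation and arrows of the Auslander-Reiten quiver\<close>

context ks_tri
begin

abbreviation Q where "Q \<equiv> ar_quiver C"

text \<open>Makes the definite description behind \<open>qtrans\<close> meaningful at the end term
  of an Auslander-Reiten triangle.\<close>

lemma is_tau_unique:
  assumes A: "AR_triangle C U V W u v w" and t: "is_tau C x (iso_class C W)"
  shows "x = iso_class C U"
proof -
  obtain U' V' W' u' v' w' where B: "AR_triangle C U' V' W' u' v' w'" "x = iso_class C U'" "iso_class C W = iso_class C W'"
    using t unfolding is_tau_def by blast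
  have "isomorphic C W W'" by (rule iso_class_indec[OF B(3) ARD(3)[OF B(1)]])
  then have "isomorphic C U U'" by (rule AR_unique[OF A B(1)])
  then show ?thesis using B(2) iso_class_eq_iff indec_obj ARD(2)[OF A] ARD(2)[OF B(1)] by blast
qed

lemma qtrans_AR:
  assumes A: "AR_triangle C U V W u v w"
  shows "qtrans Q (iso_class C W) = iso_class C U"
proof -
  have "is_tau C (iso_class C U) (iso_class C W)" unfolding is_tau_def using A by blast
  then have "(THE x. is_tau C x (iso_class C W)) = iso_class C U" by (rule the_equality) (rule is_tau_unique[OF A])
  then show ?thesis by (simp add: ar_quiver_def)
qed

text \<open>By \<open>AR_unique\<close> the description in \<open>qval\<close> does not depend on
  the chosen triangle. Its first entry is the multiplicity in the mesh ending at \<open>W\<close>,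
  which is where additivity is evaluated.\<close>

lemma qval_AR:
  assumes A: "AR_triangle C U V W u v w" and Z: "indecomposable C Z"
  shows "fst (qval Q (iso_class C Z) (iso_class C W)) = summand_mult C Z V"
proof -
  have "(THE a. \<exists>X\<in>iso_class C Z. \<exists>U V Y u v w. Y \<in> iso_class C W \<and> AR_triangle C U V Y u v w \<and> a = summand_mult C X V)
      = summand_mult C Z V" (is "(THE a. ?P a) = _")
  proof (rule the_equality)
    show "?P (summand_mult C Z V)"
      using iso_class_self[OF indec_obj[OF Z]] iso_class_self[OF indec_obj[OF ARD(3)[OF A]]] A by blast
    fix a assume "?P a"
    then obtain X U' V' Y u' v' w' where B: "X \<in> iso_class C Z" "Y \<in> iso_class C W" "AR_triangle C U' V' Y u' v' w'" "a = summand_mult C X V'"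
      by blast
    have "isomorphic C Z X" "isomorphic C W Y" using B(1,2) by (simp_all add: iso_class_def)
    then have "summand_mult C Z V = summand_mult C X V'" using AR_unique(2)[OF A B(3)] summand_mult_iso[OF Z] by blast
    then show "a = summand_mult C Z V" using B(4) by simp
  qed
  then show ?thesis by (simp add: ar_quiver_def)
qed

lemma qarr_iff:
  assumes X: "indecomposable C X" and Y: "indecomposable C Y"
  shows "qarr Q (iso_class C X) (iso_class C Y) \<longleftrightarrow> (\<exists>f. arr X Y f \<and> irreducible_mor C X Y f)"
proof
  assume "qarr Q (iso_class C X) (iso_class C Y)"
  then obtain X' Y' f where f: "iso_class C X = iso_class C X'" "iso_class C Y = iso_class C Y'"
    "indecomposable C X'" "indecomposable C Y'" "irreducible_mor C X' Y' f" by (auto simp: ar_quiver_def)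
  have "isomorphic C X' X" "isomorphic C Y' Y" using iso_class_indec f isomorphic_sym by blast+
  then obtain a a' b b' where ab: "inverse_of X' X a a'" "inverse_of Y' Y b b'" unfolding isomorphic_iff isom_def by blast
  have "arr X' Y' f" by (rule irreducible_arr[OF f(5) indec_obj[OF f(3)] indec_obj[OF f(4)]])
  then have "irreducible_mor C X Y (b \<cdot> f \<cdot> a')" using irreducible_iso f(5) ab by blast
  then show "\<exists>f. arr X Y f \<and> irreducible_mor C X Y f" using irreducible_arr indec_obj X Y by blast
next
  assume "\<exists>f. arr X Y f \<and> irreducible_mor C X Y f"
  then show "qarr Q (iso_class C X) (iso_class C Y)" using X Y unfolding ar_quiver_def by auto
qed

lemma qarr_sh:
  assumes X: "indecomposable C X" and Y: "indecomposable C Y"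
  shows "qarr Q (iso_class C (sh X)) (iso_class C (sh Y)) \<longleftrightarrow> qarr Q (iso_class C X) (iso_class C Y)"
proof -
  have s: "indecomposable C (sh X)" "indecomposable C (sh Y)" using indec_sh indec_obj X Y by blast+
  show ?thesis unfolding qarr_iff[OF X Y] qarr_iff[OF s]
  proof
    assume "\<exists>f. arr (sh X) (sh Y) f \<and> irreducible_mor C (sh X) (sh Y) f"
    then obtain f where f: "arr (sh X) (sh Y) f" "irreducible_mor C (sh X) (sh Y) f" by blast
    obtain g where g: "arr X Y g" "sm g = f" by (rule sm_full[OF indec_obj[OF X] indec_obj[OF Y] f(1)])
    then show "\<exists>f. arr X Y f \<and> irreducible_mor C X Y f" using irreducible_sm[OF g(1)] f(2) by blast
  next
    assume "\<exists>f. arr X Y f \<and> irreducible_mor C X Y f"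
    then show "\<exists>f. arr (sh X) (sh Y) f \<and> irreducible_mor C (sh X) (sh Y) f" using irreducible_sm arr_sm by blast
  qed
qed

lemma qarr_verts: "qarr Q M N \<Longrightarrow> \<exists>X Y. indecomposable C X \<and> indecomposable C Y \<and> M = iso_class C X \<and> N = iso_class C Y"
  by (auto simp: ar_quiver_def)

lemma qverts_iff: "M \<in> qverts Q \<longleftrightarrow> (\<exists>X. indecomposable C X \<and> M = iso_class C X)"
  by (auto simp: ar_quiver_def)

lemma equivclp_step_closed:
  assumes "equivclp r x y" "P x" "\<And>a b. P a \<Longrightarrow> r a b \<or> r b a \<Longrightarrow> P b"
  shows "P y"
  using assms(1) by (induction rule: equivclp_induct) (use assms(2,3) in blast)+

lemma sm_finsum:
  assumes "finite A" "\<And>i. i \<in> A \<Longrightarrow> arr X Y (a i)" "X \<in> Obj C" "Y \<in> Obj C"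
  shows "sm (finsum (Mor C X Y) a A) = finsum (Mor C (sh X) (sh Y)) (\<lambda>i. sm (a i)) A \<and> arr X Y (finsum (Mor C X Y) a A)"
  using assms(1,2)
proof (induction A rule: finite_induct)
  interpret A: abelian_group "Mor C X Y" using hom_ab assms(3,4) by blast
  interpret B: abelian_group "Mor C (sh X) (sh Y)" using hom_ab assms(3,4) shift_closed by blast
  {
    case empty
    then show ?case using sm_zero[OF assms(3,4)] arr_zero[OF assms(3,4)] by simp
  next
    case (insert i A)
    have IH: "sm (finsum (Mor C X Y) a A) = finsum (Mor C (sh X) (sh Y)) (\<lambda>i. sm (a i)) A" "arr X Y (finsum (Mor C X Y) a A)"
      using insert by blast+
    have ai: "arr X Y (a i)" and aA: "a \<in> A \<rightarrow> H X Y" using insert.prems arrD(3) by blast+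
    have si: "sm (a i) \<in> H (sh X) (sh Y)" and sA: "(\<lambda>i. sm (a i)) \<in> A \<rightarrow> H (sh X) (sh Y)"
      using insert.prems arr_sm arrD(3) by blast+
    have 1: "finsum (Mor C X Y) a (insert i A) = pls X Y (a i) (finsum (Mor C X Y) a A)"
      by (rule A.finsum_insert[OF insert.hyps aA arrD(3)[OF ai]])
    have 2: "finsum (Mor C (sh X) (sh Y)) (\<lambda>i. sm (a i)) (insert i A) =
        pls (sh X) (sh Y) (sm (a i)) (finsum (Mor C (sh X) (sh Y)) (\<lambda>i. sm (a i)) A)"
      by (rule B.finsum_insert[OF insert.hyps sA si])
    have "arr X Y (pls X Y (a i) (finsum (Mor C X Y) a A))"
      using ai IH(2) A.a_closed arrD(3) assms(3,4) by (simp add: arr_def)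
    then show ?case unfolding 1 2 sm_pls[OF ai IH(2)] IH(1) by blast
  }
qed

lemma direct_sum_sh:
  assumes "Defs.direct_sum C Zs V"
  shows "Defs.direct_sum C (map sh Zs) (sh V)"
proof -
  obtain \<iota> \<pi> where d: "ds Zs V \<iota> \<pi>" using assms unfolding direct_sum_iff by blast
  note D = dsD[OF d]
  have O: "Zs ! i \<in> Obj C" if "i < length Zs" for i using D(2) that nth_mem by blast
  have "ds (map sh Zs) (sh V) (\<lambda>i. sm (\<iota> i)) (\<lambda>i. sm (\<pi> i))"
    unfolding ds_def length_map
  proof (intro conjI allI impI)
    show "sh V \<in> Obj C" using D(1) by (rule shift_closed)
    show "set (map sh Zs) \<subseteq> Obj C" using D(2) shift_closed by auto
    fix i assume i: "i < length Zs"
    show "arr (map sh Zs ! i) (sh V) (sm (\<iota> i))" "arr (sh V) (map sh Zs ! i) (sm (\<pi> i))"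
      using arr_sm D(3,4)[OF i] i by simp_all
    show "sm (\<pi> i) \<cdot> sm (\<iota> i) = idm (map sh Zs ! i)"
      using sm_comp[OF D(3)[OF i] D(4)[OF i]] D(5)[OF i] sm_id[OF O[OF i]] i by simp
    fix j assume j: "j < length Zs" "i \<noteq> j"
    show "sm (\<pi> j) \<cdot> sm (\<iota> i) = zr (map sh Zs ! i) (map sh Zs ! j)"
      using sm_comp[OF D(3)[OF i] D(4)[OF j(1)]] D(6)[OF i j] sm_zero[OF O[OF i] O[OF j(1)]] i j by simp
  next
    have e: "sm (\<iota> i) \<cdot> sm (\<pi> i) = sm (\<iota> i \<cdot> \<pi> i)" if "i < length Zs" for i
      using sm_comp[OF D(4)[OF that] D(3)[OF that]] by simp
    have "finsum (Mor C (sh V) (sh V)) (\<lambda>i. sm (\<iota> i \<cdot> \<pi> i)) {..<length Zs} = sm (idm V)"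
      unfolding D(7)[symmetric]
    proof (rule conjunct1[OF sm_finsum, symmetric])
      show "arr V V (\<iota> i \<cdot> \<pi> i)" if "i \<in> {..<length Zs}" for i
        using arr_comp[OF D(4) D(3), of i] that by simp
    qed (simp_all add: D(1))
    moreover have "finsum (Mor C (sh V) (sh V)) (\<lambda>i. sm (\<iota> i) \<cdot> sm (\<pi> i)) {..<length Zs} =
        finsum (Mor C (sh V) (sh V)) (\<lambda>i. sm (\<iota> i \<cdot> \<pi> i)) {..<length Zs}"
    proof -
      interpret B: abelian_group "Mor C (sh V) (sh V)" using hom_ab D(1) shift_closed by blast
      show ?thesis
      proof (rule B.finsum_cong'[OF refl])
        show "(\<lambda>i. sm (\<iota> i \<cdot> \<pi> i)) \<in> {..<length Zs} \<rightarrow> H (sh V) (sh V)"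
        proof (rule funcsetI)
          fix i assume "i \<in> {..<length Zs}"
          then have "arr V V (\<iota> i \<cdot> \<pi> i)" using arr_comp[OF D(4) D(3), of i] by simp
          then show "sm (\<iota> i \<cdot> \<pi> i) \<in> H (sh V) (sh V)" by (rule arrD(3)[OF arr_sm])
        qed
      qed (use e in simp)
    qed
    ultimately show "finsum (Mor C (sh V) (sh V)) (\<lambda>i. sm (\<iota> i) \<cdot> sm (\<pi> i)) {..<length Zs} = idm (sh V)"
      using sm_id[OF D(1)] by simp
  qed
  then show ?thesis unfolding direct_sum_iff by blast
qed

lemma stable_vert:
  assumes "stable_component C \<Gamma>" "M \<in> \<Gamma>"
  obtains X where "indecomposable C X" "M = iso_class C X"
proof -
  have "M \<in> qverts Q" using assms unfolding stable_component_def quiver_component_def by blast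
  then show thesis using that qverts_iff by blast
qed

lemma stable_indec: "stable_component C \<Gamma> \<Longrightarrow> iso_class C X \<in> \<Gamma> \<Longrightarrow> indecomposable C X"
  using stable_vert iso_class_indec(1) by metis

lemma stable_connected:
  assumes "stable_component C \<Gamma>" "M \<in> \<Gamma>"
  shows "N \<in> \<Gamma> \<longleftrightarrow> N \<in> qverts Q \<and> equivclp (qarr Q) M N"
proof -
  obtain x where x: "\<Gamma> = {y \<in> qverts Q. equivclp (qarr Q) x y}"
    using assms(1) unfolding stable_component_def quiver_component_def by blast
  then have "equivclp (qarr Q) x M" using assms(2) by blast
  then show ?thesis unfolding x using equivclp_trans equivclp_sym by (metis mem_Collect_eq)
qed

lemma stable_step:
  assumes "stable_component C \<Gamma>" "M \<in> \<Gamma>" "qarr Q M N \<or> qarr Q N M"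
  shows "N \<in> \<Gamma>"
proof -
  have "N \<in> qverts Q" using assms(3) qarr_verts qverts_iff by blast
  then show ?thesis using assms unfolding stable_component_def by blast
qed

lemma stable_seq:
  assumes "stable_component C \<Gamma>" "M \<in> \<Gamma>"
  shows "\<exists>t :: int \<Rightarrow> 'o set. t 0 = M \<and> (\<forall>n. is_tau C (t (n + 1)) (t n) \<and> t n \<in> \<Gamma>)"
  by (rule assms(1)[unfolded stable_component_def, THEN conjunct2, THEN bspec, OF assms(2), THEN conjunct1])

lemma stable_AR:
  assumes "stable_component C \<Gamma>" "M \<in> \<Gamma>"
  obtains U V W u v w where "AR_triangle C U V W u v w" "M = iso_class C W" "iso_class C U \<in> \<Gamma>"
proof -
  obtain t :: "int \<Rightarrow> 'o set" where t: "t 0 = M \<and> (\<forall>n. is_tau C (t (n + 1)) (t n) \<and> t n \<in> \<Gamma>)"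
    by (rule exE[OF stable_seq[OF assms]])
  have "is_tau C (t (0 + 1)) (t 0)" "t 1 \<in> \<Gamma>" using t by blast+
  then have "is_tau C (t 1) M" using t by simp
  then obtain U V W u v w where A: "AR_triangle C U V W u v w" "t 1 = iso_class C U" "M = iso_class C W"
    unfolding is_tau_def by blast
  show thesis by (rule that[OF A(1,3)]) (use \<open>t 1 \<in> \<Gamma>\<close> A(2) in simp)
qed

lemma stable_tau:
  assumes "stable_component C \<Gamma>" "AR_triangle C U V W u v w" "iso_class C W \<in> \<Gamma>"
  shows "iso_class C U \<in> \<Gamma>"
proof -
  obtain t :: "int \<Rightarrow> 'o set" where t: "t 0 = iso_class C W \<and> (\<forall>n. is_tau C (t (n + 1)) (t n) \<and> t n \<in> \<Gamma>)"
    by (rule exE[OF stable_seq[OF assms(1,3)]])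
  have "is_tau C (t (0 + 1)) (t 0)" "t 1 \<in> \<Gamma>" using t by blast+
  then have "is_tau C (t 1) (iso_class C W)" using t by simp
  then have "t 1 = iso_class C U" by (rule is_tau_unique[OF assms(2)])
  then show ?thesis using \<open>t 1 \<in> \<Gamma>\<close> by simp
qed

text \<open>Phrased through triangles rather than through the quiver, so that it can be moved along
  the shift and checked for Hom dimensions.\<close>

definition AR_additive :: "'o set set \<Rightarrow> ('o set \<Rightarrow> real) \<Rightarrow> bool" where
  "AR_additive \<Gamma> g \<longleftrightarrow> (\<forall>U V W u v w Zs. AR_triangle C U V W u v w \<longrightarrow> iso_class C W \<in> \<Gamma> \<longrightarrow>
     Defs.direct_sum C Zs V \<longrightarrow> (\<forall>Z\<in>set Zs. indecomposable C Z) \<longrightarrow>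
     g (iso_class C U) + g (iso_class C W) = (\<Sum>Z\<leftarrow>Zs. g (iso_class C Z)))"

definition tau_invariant :: "'o set set \<Rightarrow> ('o set \<Rightarrow> real) \<Rightarrow> bool" where
  "tau_invariant \<Gamma> g \<longleftrightarrow> (\<forall>U V W u v w. AR_triangle C U V W u v w \<longrightarrow> iso_class C W \<in> \<Gamma> \<longrightarrow>
     g (iso_class C U) = g (iso_class C W))"

end

section \<open>Pulling meshes back along a covering\<close>

locale stable_covering = ks_tri K C
  for K :: "('k, 'r) ring_scheme" (structure) and C :: "('k, 'o, 'm, 'z) tri_cat_scheme" +
  fixes \<Gamma> :: "'o set set" and T :: "'a vtree" and ori :: "'a \<Rightarrow> 'a \<Rightarrow> bool" and \<phi> :: "int \<times> 'a \<Rightarrow> 'o set"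
  assumes stable: "stable_component C \<Gamma>" and tree: "valued_tree T" and ori: "orientation T ori"
    and cov: "quiver_covering (ZT T ori) (full_subquiver (ar_quiver C) \<Gamma>) \<phi>"
begin

lemma phi_in: "x \<in> tverts T \<Longrightarrow> \<phi> (n, x) \<in> \<Gamma>"
  using cov unfolding quiver_covering_def full_subquiver_def ZT_def by auto

lemma phi_surj: assumes "M \<in> \<Gamma>" obtains n x where "x \<in> tverts T" "M = \<phi> (n, x)"
proof -
  have "M \<in> \<phi> ` (UNIV \<times> tverts T)" using assms cov unfolding quiver_covering_def full_subquiver_def ZT_def by simp
  then show thesis using that by blast
qed

lemma phi_tau:
  assumes A: "AR_triangle C U V W u v w" and W: "iso_class C W = \<phi> (n, x)" and x: "x \<in> tverts T"
  shows "iso_class C U = \<phi> (n - 1, x)"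
proof -
  have v: "(n, x) \<in> qverts (ZT T ori)" using x by (simp add: ZT_def)
  have "\<phi> (qtrans (ZT T ori) (n, x)) = qtrans (full_subquiver Q \<Gamma>) (\<phi> (n, x))"
    using cov v unfolding quiver_covering_def by blast
  then have "\<phi> (n - 1, x) = qtrans Q (iso_class C W)" using W by (simp add: ZT_def full_subquiver_def)
  then show ?thesis using qtrans_AR[OF A] by simp
qed

lemma AR_at:
  assumes x: "x \<in> tverts T"
  obtains U V W u v w Zs where "AR_triangle C U V W u v w" "iso_class C W = \<phi> (n, x)" "iso_class C U = \<phi> (n - 1, x)"
    "Defs.direct_sum C Zs V" "\<forall>Z\<in>set Zs. indecomposable C Z"
proof -
  obtain U V W u v w where A: "AR_triangle C U V W u v w" "\<phi> (n, x) = iso_class C W" "iso_class C U \<in> \<Gamma>"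
    by (rule stable_AR[OF stable phi_in[OF x]])
  have "V \<in> Obj C" using dist_closed[OF ARD(1)[OF A(1)]] by blast
  then obtain Zs where Zs: "Defs.direct_sum C Zs V" "\<forall>Z\<in>set Zs. indecomposable C Z" by (rule ks_decomp)
  show thesis by (rule that[OF A(1) A(2)[symmetric] phi_tau[OF A(1) A(2)[symmetric] x] Zs])
qed

text \<open>The bridge between triangles and the tree. The covering gives a bijection from the
  neighbours of \<open>x\<close> to the predecessors of \<open>\<phi> (n, x)\<close>, and the
  valuations give their multiplicities in \<open>V\<close>; irreducibility of the components of
  \<open>v\<close> shows that no other summand occurs.\<close>

lemma mesh:
  assumes A: "AR_triangle C U V W u v w" and W: "iso_class C W = \<phi> (n, x)" and x: "x \<in> tverts T"
    and d: "Defs.direct_sum C Zs V" "\<forall>Z\<in>set Zs. indecomposable C Z"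
  shows "finite {y. tadj T x y}"
    and "(\<Sum>Z\<leftarrow>Zs. g (iso_class C Z)) = (\<Sum>y | tadj T x y. real (emult T x y) * g (\<phi> (zpred ori n x y)))"
proof -
  let ?P = "{y. tadj T x y}" and ?z = "zpred ori n x" and ?R = "full_subquiver Q \<Gamma>" and ?Z = "ZT T ori"
  have oa: "ori a b \<Longrightarrow> tadj T a b" "tadj T a b \<Longrightarrow> ori a b \<noteq> ori b a" for a b using ori unfolding orientation_def by blast+
  have v: "(n, x) \<in> qverts ?Z" using x by (simp add: ZT_def)
  have zin: "?z y \<in> qverts ?Z" "qarr ?Z (?z y) (n, x)" "qval ?Z (?z y) (n, x) = the (tedge T y x)" if y: "tadj T x y" for y
  proof -
    have "y \<in> tverts T" using vtree_adj_verts[OF tree y] by blast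
    moreover have "ori y x \<or> ori x y" using oa(2)[OF y] by blast
    ultimately show "?z y \<in> qverts ?Z" "qarr ?Z (?z y) (n, x)" "qval ?Z (?z y) (n, x) = the (tedge T y x)"
      by (auto simp: ZT_def zpred_def)
  qed
  have pred: "qpred ?Z (n, x) = ?z ` ?P"
  proof
    show "?z ` ?P \<subseteq> qpred ?Z (n, x)" using zin unfolding qpred_def by blast
    show "qpred ?Z (n, x) \<subseteq> ?z ` ?P"
    proof
      fix p assume p: "p \<in> qpred ?Z (n, x)"
      obtain m y where my: "p = (m, y)" by (cases p)
      have "n = m \<and> ori y x \<or> n = m + 1 \<and> ori x y" using p unfolding my qpred_def ZT_def by simp
      then have "tadj T x y \<and> p = ?z y"
      proof
        assume a: "n = m \<and> ori y x"
        then have "tadj T x y" using oa(1) vtree_adj_sym[OF tree] by blast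
        then show ?thesis using a unfolding my zpred_def by simp
      next
        assume a: "n = m + 1 \<and> ori x y"
        then have "tadj T x y" by (intro oa(1)) blast
        moreover from this have "\<not> ori y x" using oa(2) a by blast
        ultimately show ?thesis using a unfolding my zpred_def by simp
      qed
      then show "p \<in> ?z ` ?P" by blast
    qed
  qed
  have bij: "bij_betw \<phi> (?z ` ?P) (qpred ?R (\<phi> (n, x)))"
    using cov v unfolding quiver_covering_def pred[symmetric] by blast
  have zinj: "inj_on ?z ?P" by (rule inj_onI) (simp add: zpred_def)
  have inj: "inj_on (\<lambda>y. \<phi> (?z y)) ?P" using comp_inj_on[OF zinj bij_betw_imp_inj_on[OF bij]] unfolding o_def .
  have img: "(\<lambda>y. \<phi> (?z y)) ` ?P = qpred ?R (\<phi> (n, x))" using bij unfolding bij_betw_def image_image by blast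
  have qp: "qpred ?R (\<phi> (n, x)) = {M \<in> \<Gamma>. qarr Q M (iso_class C W)}"
    using phi_in[OF x, of n] unfolding W[symmetric] qpred_def full_subquiver_def by auto
  have len: "length (filter (\<lambda>Z. iso_class C Z = \<phi> (?z y)) Zs) = emult T x y" if y: "tadj T x y" for y
  proof -
    have "\<phi> (?z y) \<in> \<Gamma>" using phi_in zin(1)[OF y] by (auto simp: ZT_def)
    then obtain Z where Z: "indecomposable C Z" "\<phi> (?z y) = iso_class C Z" by (rule stable_vert[OF stable])
    have "(n, x) \<in> qsucc ?Z (?z y)" using v zin(2)[OF y] by (simp add: qsucc_def)
    then have "qval ?R (\<phi> (?z y)) (\<phi> (n, x)) = qval ?Z (?z y) (n, x)"
      using cov zin(1)[OF y] unfolding quiver_covering_def by blast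
    then have "qval Q (iso_class C Z) (iso_class C W) = the (tedge T y x)"
      unfolding zin(3)[OF y] Z(2) W by (simp add: full_subquiver_def)
    then have "summand_mult C Z V = emult T x y" using qval_AR[OF A Z(1)] by (simp add: emult_def)
    then show ?thesis unfolding Z(2) length_filter_class[OF Z(1) d] .
  qed
  have pos: "emult T x y > 0" if y: "tadj T x y" for y
  proof -
    obtain a b where ab: "tedge T y x = Some (a, b)" using vtree_adj_sym[OF tree y] by auto
    then show ?thesis using vtree_val_pos[OF tree ab] by (simp add: emult_def)
  qed
  \<comment> \<open>Multiplicities are positive, so every predecessor occurs among the finitely many
    summands of \<open>V\<close>; local finiteness of \<open>T\<close> comes from here.\<close>
  have "(\<lambda>y. \<phi> (?z y)) ` ?P \<subseteq> iso_class C ` set Zs"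
  proof
    fix M assume "M \<in> (\<lambda>y. \<phi> (?z y)) ` ?P"
    then obtain y where y: "tadj T x y" "M = \<phi> (?z y)" by blast
    have "filter (\<lambda>Z. iso_class C Z = M) Zs \<noteq> []" using len[OF y(1)] pos[OF y(1)] unfolding y(2) by auto
    then show "M \<in> iso_class C ` set Zs" unfolding filter_empty_conv by blast
  qed
  then have "finite ((\<lambda>y. \<phi> (?z y)) ` ?P)" by (rule finite_subset) simp
  then show fin: "finite ?P" using inj by (rule finite_imageD)
  have "iso_class C ` set Zs \<subseteq> (\<lambda>y. \<phi> (?z y)) ` ?P"
    unfolding img qp
  proof
    fix M assume "M \<in> iso_class C ` set Zs"
    then obtain Z where Z: "Z \<in> set Zs" "M = iso_class C Z" by blast
    then obtain i where i: "i < length Zs" "Z = Zs ! i" by (metis in_set_conv_nth)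
    obtain \<iota> \<pi> where ds: "ds Zs V \<iota> \<pi>" using d(1) unfolding direct_sum_iff by blast
    have iZ: "indecomposable C Z" using d(2) Z(1) by blast
    then have "irreducible_mor C Z W (v \<cdot> \<iota> i)" using AR_summand_irreducible[OF A ds i(1)] i(2) by simp
    then have "qarr Q M (iso_class C W)"
      unfolding Z(2) qarr_iff[OF iZ ARD(3)[OF A]] using irreducible_arr indec_obj iZ ARD(3)[OF A] by blast
    moreover from this have "M \<in> \<Gamma>" using stable_step[OF stable phi_in[OF x, of n]] unfolding W by blast
    ultimately show "M \<in> {M \<in> \<Gamma>. qarr Q M (iso_class C W)}" by blast
  qed
  then have "(\<Sum>Z\<leftarrow>Zs. g (iso_class C Z)) =
      (\<Sum>M\<in>(\<lambda>y. \<phi> (?z y)) ` ?P. real (length (filter (\<lambda>Z. iso_class C Z = M) Zs)) * g M)"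
    by (rule sum_list_fibres[OF finite_imageI[OF fin]])
  also have "\<dots> = (\<Sum>y\<in>?P. real (length (filter (\<lambda>Z. iso_class C Z = \<phi> (?z y)) Zs)) * g (\<phi> (?z y)))"
    by (rule sum.reindex[OF inj, unfolded o_def])
  also have "\<dots> = (\<Sum>y\<in>?P. real (emult T x y) * g (\<phi> (?z y)))"
  proof (rule sum.cong[OF refl])
    fix y assume "y \<in> ?P"
    then have "tadj T x y" by (rule CollectD)
    then show "real (length (filter (\<lambda>Z. iso_class C Z = \<phi> (?z y)) Zs)) * g (\<phi> (?z y)) = real (emult T x y) * g (\<phi> (?z y))"
      using len by simp
  qed
  finally show "(\<Sum>Z\<leftarrow>Zs. g (iso_class C Z)) = (\<Sum>y | tadj T x y. real (emult T x y) * g (\<phi> (?z y)))" .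
qed

lemma fin_nb: "finite {y. tadj T x y}"
proof (cases "x \<in> tverts T")
  case True
  obtain U V W u v w Zs where A: "AR_triangle C U V W u v w" "iso_class C W = \<phi> (0, x)" "iso_class C U = \<phi> (0 - 1, x)"
    "Defs.direct_sum C Zs V" "\<forall>Z\<in>set Zs. indecomposable C Z" by (rule AR_at[OF True])
  show ?thesis by (rule mesh(1)[OF A(1,2) True A(4,5)])
next
  case False
  then have "{y. tadj T x y} = {}" using vtree_adj_verts[OF tree] by blast
  then show ?thesis by simp
qed

lemma AR_additive_ZT:
  assumes "AR_additive \<Gamma> g"
  shows "ZT_additive T ori (\<lambda>p. g (\<phi> p))"
  unfolding ZT_additive_def
proof (intro allI ballI)
  fix n x assume x: "x \<in> tverts T"
  obtain U V W u v w Zs where A: "AR_triangle C U V W u v w" "iso_class C W = \<phi> (n, x)" "iso_class C U = \<phi> (n - 1, x)"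
    "Defs.direct_sum C Zs V" "\<forall>Z\<in>set Zs. indecomposable C Z" by (rule AR_at[OF x])
  have "iso_class C W \<in> \<Gamma>" unfolding A(2) by (rule phi_in[OF x])
  then have "g (iso_class C U) + g (iso_class C W) = (\<Sum>Z\<leftarrow>Zs. g (iso_class C Z))"
    using assms A(1,4,5) unfolding AR_additive_def by blast
  then show "g (\<phi> (n - 1, x)) + g (\<phi> (n, x)) = (\<Sum>y | tadj T x y. real (emult T x y) * g (\<phi> (zpred ori n x y)))"
    unfolding mesh(2)[OF A(1,2) x A(4,5)] A(2,3) .
qed

end

section \<open>Comparison of two components\<close>

lemma sum_periodic_shift:
  fixes f :: "int \<Rightarrow> real"
  assumes "\<And>n. f (n + int N) = f n"
  shows "(\<Sum>i<N. f (c + int i)) = (\<Sum>i<N. f (int i))"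
proof -
  have s: "(\<Sum>i<N. f (c + 1 + int i)) = (\<Sum>i<N. f (c + int i))" for c
  proof -
    have "(\<Sum>i<Suc N. f (c + int i)) = f c + (\<Sum>i<N. f (c + 1 + int i))"
      unfolding sum.lessThan_Suc_shift by (simp add: add.assoc)
    moreover have "(\<Sum>i<Suc N. f (c + int i)) = (\<Sum>i<N. f (c + int i)) + f c" using assms[of c] by simp
    ultimately show ?thesis by linarith
  qed
  show ?thesis
  proof (induction c rule: int_induct[where k = 0])
    case (step1 i) then show ?case using s[of i] by simp
  next
    case (step2 i) then show ?case using s[of "i - 1"] by simp
  qed simp
qed

lemma sum_periodic_multiple:
  fixes f :: "int \<Rightarrow> real"
  assumes "\<And>n. f (n + int P) = f n"
  shows "(\<Sum>i<P * k. f (int i)) = real k * (\<Sum>i<P. f (int i))"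
proof (induction k)
  case (Suc k)
  have sp: "(\<Sum>i<a + b. g i) = (\<Sum>i<a. g i) + (\<Sum>i<b. g (a + i))" for a b and g :: "nat \<Rightarrow> real"
    by (induction b) simp_all
  have e: "P * Suc k = P * k + P" by simp
  have "(\<Sum>i<P * Suc k. f (int i)) = (\<Sum>i<P * k. f (int i)) + (\<Sum>i<P. f (int (P * k) + int i))"
    unfolding e of_nat_add[symmetric] by (rule sp)
  also have "(\<Sum>i<P. f (int (P * k) + int i)) = (\<Sum>i<P. f (int i))" by (rule sum_periodic_shift) (rule assms)
  finally show ?case using Suc by (simp add: algebra_simps)
qed simp

lemma periodic_multiple:
  assumes "\<And>n. f (n + int P) = f n"
  shows "f (n + int (P * k)) = f n"
proof (induction k)
  case (Suc k)
  have e: "n + int (P * Suc k) = (n + int (P * k)) + int P" by (simp add: algebra_simps)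
  show ?case unfolding e assms by (rule Suc)
qed simp

text \<open>Positivity spreads along edges: \<open>2 F z\<close> is at least
  \<open>emult T z y * F y\<close> for a neighbour \<open>y\<close> of \<open>z\<close>.\<close>

lemma additive_tree_nonneg:
  assumes T: "valued_tree T" and fin: "\<And>x. finite {y. tadj T x y}"
    and F: "\<And>x. x \<in> tverts T \<Longrightarrow> F x \<ge> 0"
      "\<And>x. x \<in> tverts T \<Longrightarrow> (\<Sum>y | tadj T x y. real (emult T x y) * F y) = 2 * F x"
    and x0: "x0 \<in> tverts T" "F x0 > 0"
  shows "additive_tree T F"
proof -
  have "F x > 0" if "x \<in> tverts T" for x
    using vtree_connected[OF T x0(1) that]
  proof (induction rule: rtranclp_induct)
    case base
    show ?case by (rule x0(2))
  next
    case (step y z)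
    have v: "y \<in> tverts T" "z \<in> tverts T" using vtree_adj_verts[OF T step(2)] by blast+
    have zy: "tadj T z y" by (rule vtree_adj_sym[OF T step(2)])
    obtain a b where ab: "tedge T y z = Some (a, b)" using step(2) by auto
    then have m: "emult T z y > 0" using vtree_val_pos[OF T ab] by (simp add: emult_def)
    have "real (emult T z y) * F y \<le> (\<Sum>y | tadj T z y. real (emult T z y) * F y)"
    proof (rule member_le_sum[of y _ "\<lambda>y. real (emult T z y) * F y"])
      fix x assume "x \<in> {y. tadj T z y} - {y}"
      then have "x \<in> tverts T" using vtree_adj_verts[OF T] by blast
      then show "0 \<le> real (emult T z x) * F x" using F(1) by simp
    qed (use zy fin in blast)+
    moreover have "real (emult T z y) * F y > 0" using m step(3) by simp
    ultimately show ?case using F(2)[OF v(2)] by simp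
  qed
  then show ?thesis
    using T fin F(2) unfolding additive_tree_def emult_def by blast
qed

text \<open>The average over a period does not depend on the starting slice, so the offsets in
  \<open>zpred\<close> disappear and the averages are additive on the tree itself. The period may
  change from vertex to vertex.\<close>

lemma periodic_additive_tree:
  assumes T: "valued_tree T" and fin: "\<And>x. finite {y. tadj T x y}" and u: "ZT_additive T ori u"
    and nonneg: "\<And>p. u p \<ge> 0" and per: "\<And>y. y \<in> tverts T \<Longrightarrow> \<exists>P>0. \<forall>n. u (n + int P, y) = u (n, y)"
    and y0: "y0 \<in> tverts T" "u (n0, y0) > 0"
  shows "\<exists>F. additive_tree T F"
proof -
  obtain P where P: "\<And>y. y \<in> tverts T \<Longrightarrow> P y > 0" "\<And>y n. y \<in> tverts T \<Longrightarrow> u (n + int (P y), y) = u (n, y)"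
    using per by metis
  define F where "F y = (\<Sum>i<P y. u (int i, y)) / real (P y)" for y
  have av: "(\<Sum>i<N. u (c + int i, y)) = real N * F y" if y: "y \<in> tverts T" and N: "P y dvd N" for c y N
  proof -
    obtain k where k: "N = P y * k" using N by blast
    have "(\<Sum>i<N. u (c + int i, y)) = (\<Sum>i<N. u (int i, y))"
      by (rule sum_periodic_shift[of "\<lambda>n. u (n, y)"]) (unfold k, rule periodic_multiple[of "\<lambda>n. u (n, y)"], rule P(2)[OF y])
    also have "\<dots> = real k * (\<Sum>i<P y. u (int i, y))"
      unfolding k by (rule sum_periodic_multiple[of "\<lambda>n. u (n, y)"]) (rule P(2)[OF y])
    finally show ?thesis using P(1)[OF y] by (simp add: F_def k)
  qed
  have "additive_tree T F"
  proof (rule additive_tree_nonneg[OF T fin _ _ y0(1)])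
    show "F x \<ge> 0" for x unfolding F_def by (intro divide_nonneg_nonneg sum_nonneg nonneg) simp
    have "0 < u (n0 + int 0, y0)" using y0(2) by simp
    also have "\<dots> \<le> (\<Sum>i<P y0. u (n0 + int i, y0))"
      by (rule member_le_sum) (use P(1)[OF y0(1)] nonneg in auto)
    also have "\<dots> = real (P y0) * F y0" by (rule av[OF y0(1)]) simp
    finally show "0 < F y0" using P(1)[OF y0(1)] by (simp add: zero_less_mult_iff)
    fix x assume x: "x \<in> tverts T"
    let ?N = "{y. tadj T x y}"
    \<comment> \<open>A common multiple of the finitely many periods that enter the mesh at
      \<open>x\<close>; one for all vertices need not exist, since \<open>T\<close> may be
      infinite.\<close>
    define N where "N = prod P (insert x ?N)"
    have V: "y \<in> tverts T" if "y \<in> insert x ?N" for y using x vtree_adj_verts[OF T] that by blast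
    have dv: "P y dvd N" if "y \<in> insert x ?N" for y unfolding N_def by (rule dvd_prodI) (use fin that in simp_all)
    have N0: "N > 0" unfolding N_def by (rule prod_pos) (use P(1) V in blast)
    have z: "(\<Sum>i<N. u (zpred ori (int i) x y)) = real N * F y" if y: "y \<in> ?N" for y
    proof -
      have "zpred ori (int i) x y = ((if ori y x then 0 else - 1) + int i, y)" for i by (simp add: zpred_def)
      then show ?thesis using av[of y N "if ori y x then 0 else - 1"] V dv y by simp
    qed
    have a: "(\<Sum>i<N. u (c + int i, x)) = real N * F x" for c by (rule av[OF x dv]) simp
    have "2 * real N * F x = (\<Sum>i<N. u (- 1 + int i, x)) + (\<Sum>i<N. u (0 + int i, x))"
      unfolding a by simp
    also have "\<dots> = (\<Sum>i<N. u (int i - 1, x) + u (int i, x))" by (simp add: sum.distrib)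
    also have "\<dots> = (\<Sum>i<N. \<Sum>y\<in>?N. real (emult T x y) * u (zpred ori (int i) x y))"
      using u x unfolding ZT_additive_def by simp
    also have "\<dots> = (\<Sum>y\<in>?N. \<Sum>i<N. real (emult T x y) * u (zpred ori (int i) x y))" by (rule sum.swap)
    also have "\<dots> = (\<Sum>y\<in>?N. real N * (real (emult T x y) * F y))"
    proof (rule sum.cong[OF refl])
      fix y assume "y \<in> ?N"
      then show "(\<Sum>i<N. real (emult T x y) * u (zpred ori (int i) x y)) = real N * (real (emult T x y) * F y)"
        unfolding sum_distrib_left[symmetric] using z by simp
    qed
    also have "\<dots> = real N * (\<Sum>y\<in>?N. real (emult T x y) * F y)" by (rule sum_distrib_left[symmetric])
    finally have "real N * (2 * F x) = real N * (\<Sum>y\<in>?N. real (emult T x y) * F y)" by simp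
    then show "(\<Sum>y\<in>?N. real (emult T x y) * F y) = 2 * F x" using N0 by (metis mult_left_cancel of_nat_0_less_iff less_irrefl)
  qed
  then show ?thesis by blast
qed

text \<open>By \<open>inv\<close> the value at \<open>(m, x)\<close>, \<open>(n, y)\<close> depends
  on \<open>m\<close> and \<open>n\<close> only through \<open>m - n\<close>. The periodicity in the
  Euclidean variable therefore passes to the other one, with a period depending on
  \<open>y\<close>.\<close>

lemma biadditive_additive_tree:
  fixes B :: "int \<times> 'a \<Rightarrow> int \<times> 'b \<Rightarrow> nat"
  assumes E: "euclidean_tree T1 ori1 \<delta> d" and T2: "valued_tree T2" and fin: "\<And>x. finite {y. tadj T2 x y}"
    and a1: "\<And>n y. y \<in> tverts T2 \<Longrightarrow> ZT_additive T1 ori1 (\<lambda>p. real (B p (n, y)))"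
    and a2: "\<And>m x. x \<in> tverts T1 \<Longrightarrow> ZT_additive T2 ori2 (\<lambda>q. real (B (m, x) q))"
    and inv: "\<And>m n x y. x \<in> tverts T1 \<Longrightarrow> y \<in> tverts T2 \<Longrightarrow> B (m - 1, x) (n - 1, y) = B (m, x) (n, y)"
    and nz: "B (m0, x0) (n0, y0) \<noteq> 0" "x0 \<in> tverts T1" "y0 \<in> tverts T2"
  shows "\<exists>F. additive_tree T2 F"
proof (rule periodic_additive_tree[OF T2 fin a2[OF nz(2), of m0] _ _ nz(3)])
  show "0 \<le> real (B (m0, x0) p)" for p by simp
  show "0 < real (B (m0, x0) (n0, y0))" using nz(1) by simp
  fix y assume y: "y \<in> tverts T2"
  have sh: "B (m, x0) (n, y) = B (m - n, x0) (0, y)" for m n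
  proof (induction n arbitrary: m rule: int_induct[where k = 0])
    case (step1 i) then show ?case using inv[OF nz(2) y, of m "i + 1"] by (simp add: algebra_simps)
  next
    case (step2 i) then show ?case using inv[OF nz(2) y, of "m + 1" i] by (simp add: algebra_simps)
  qed simp
  obtain P :: nat where P: "P > 0" "\<And>n x. x \<in> tverts T1 \<Longrightarrow> B (n + int P, x) (0, y) = B (n, x) (0, y)"
    by (rule euclidean_tree.ZT_additive_periodic[OF E a1[OF y, of 0]]) blast
  have "B (m0, x0) (n + int P, y) = B (m0, x0) (n, y)" for n
    using P(2)[OF nz(2), of "m0 - n - int P"] unfolding sh[of m0] by (simp add: algebra_simps)
  then show "\<exists>P>0. \<forall>n. real (B (m0, x0) (n + int P, y)) = real (B (m0, x0) (n, y))" using P(1) by auto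
qed

section \<open>Translation invariant functions on a component\<close>

context stable_covering
begin

lemma invariant_additive_tree:
  assumes h: "AR_additive \<Gamma> h" "tau_invariant \<Gamma> h" "\<And>M. M \<in> \<Gamma> \<Longrightarrow> h M > 0"
  shows "\<exists>F. additive_tree T F"
proof -
  define F where "F x = h (\<phi> (0, x))" for x
  have s: "h (\<phi> (n - 1, x)) = h (\<phi> (n, x))" if x: "x \<in> tverts T" for n x
  proof -
    obtain U V W u v w Zs where A: "AR_triangle C U V W u v w" "iso_class C W = \<phi> (n, x)" "iso_class C U = \<phi> (n - 1, x)"
      "Defs.direct_sum C Zs V" "\<forall>Z\<in>set Zs. indecomposable C Z" by (rule AR_at[OF x])
    have "iso_class C W \<in> \<Gamma>" unfolding A(2) by (rule phi_in[OF x])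
    then have "h (iso_class C U) = h (iso_class C W)" using h(2) A(1) unfolding tau_invariant_def by blast
    then show ?thesis unfolding A(2,3) .
  qed
  have e: "h (\<phi> (n, x)) = F x" if x: "x \<in> tverts T" for n x
  proof (induction n rule: int_induct[where k = 0])
    case (step1 i) then show ?case using s[OF x, of "i + 1"] by simp
  next
    case (step2 i) then show ?case using s[OF x, of i] by simp
  qed (simp add: F_def)
  have Fp: "F x > 0" if "x \<in> tverts T" for x unfolding F_def by (rule h(3)[OF phi_in[OF that]])
  have Fa: "(\<Sum>y | tadj T x y. real (emult T x y) * F y) = 2 * F x" if x: "x \<in> tverts T" for x
  proof -
    have "h (\<phi> (0 - 1, x)) + h (\<phi> (0, x)) = (\<Sum>y | tadj T x y. real (emult T x y) * h (\<phi> (zpred ori 0 x y)))"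
      using AR_additive_ZT[OF h(1)] x unfolding ZT_additive_def by blast
    moreover have "(\<Sum>y | tadj T x y. real (emult T x y) * h (\<phi> (zpred ori 0 x y))) = (\<Sum>y | tadj T x y. real (emult T x y) * F y)"
    proof (rule sum.cong[OF refl])
      fix y assume "y \<in> {y. tadj T x y}"
      then have "y \<in> tverts T" using vtree_adj_verts[OF tree] by blast
      then show "real (emult T x y) * h (\<phi> (zpred ori 0 x y)) = real (emult T x y) * F y" using e unfolding zpred_def by simp
    qed
    ultimately show ?thesis using e[OF x] by simp
  qed
  obtain x0 where x0: "x0 \<in> tverts T" using vtree_nonempty[OF tree] by blast
  have "additive_tree T F" by (rule additive_tree_nonneg[OF tree fin_nb _ Fa x0 Fp[OF x0]]) (rule less_imp_le[OF Fp])
  then show ?thesis by blast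
qed

text \<open>The least value of \<open>\<delta>\<close> on a fibre of \<open>\<phi>\<close> is subadditive, hence additive.\<close>
lemma ex_invariant:
  assumes E: "euclidean_tree T ori \<delta> d"
  shows "\<exists>h. AR_additive \<Gamma> h \<and> tau_invariant \<Gamma> h \<and> (\<forall>M\<in>\<Gamma>. h M > 0)"
proof -
  \<comment> \<open>Vertices of the tree whose \<open>\<tau>\<close>-orbits have a common image in
    \<open>\<Gamma>\<close>; the minimum of \<open>\<delta>\<close> is taken over the classes of
    this relation.\<close>
  define R where "R x y \<longleftrightarrow> x \<in> tverts T \<and> y \<in> tverts T \<and> (\<exists>n m. \<phi> (n, x) = \<phi> (m, y))" for x y
  have down: "\<phi> (n - int k, x) = \<phi> (m - int k, y)" if xy: "x \<in> tverts T" "y \<in> tverts T" "\<phi> (n, x) = \<phi> (m, y)" for n m x y k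
  proof (induction k)
    case (Suc k)
    obtain U V W u v w Zs where A: "AR_triangle C U V W u v w" "iso_class C W = \<phi> (n - int k, x)" "iso_class C U = \<phi> (n - int k - 1, x)"
      "Defs.direct_sum C Zs V" "\<forall>Z\<in>set Zs. indecomposable C Z" by (rule AR_at[OF xy(1)])
    have "iso_class C W = \<phi> (m - int k, y)" using A(2) Suc by simp
    then have "iso_class C U = \<phi> (m - int k - 1, y)" by (rule phi_tau[OF A(1) _ xy(2)])
    then show ?case using A(3) by (simp add: algebra_simps)
  qed (use xy in simp)
  have sym: "R x y \<Longrightarrow> R y x" for x y unfolding R_def by metis
  have trans: "R x z" if xy: "R x y" and yz: "R y z" for x y z
  proof -
    obtain a b c e where 1: "\<phi> (a, x) = \<phi> (b, y)" "\<phi> (c, y) = \<phi> (e, z)" "x \<in> tverts T" "y \<in> tverts T" "z \<in> tverts T"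
      using xy yz unfolding R_def by blast
    \<comment> \<open>By \<open>down\<close>, coincidences propagate in the direction of
      \<open>\<tau>\<close>, so both are moved back until they meet \<open>y\<close> in the same
      slice, the smaller of \<open>b\<close> and \<open>c\<close>.\<close>
    define k l where "k = nat (b - min b c)" and "l = nat (c - min b c)"
    have kl: "b - int k = c - int l" by (simp add: k_def l_def)
    have "\<phi> (a - int k, x) = \<phi> (e - int l, z)"
      using down[OF 1(3,4,1), of k] down[OF 1(4,5,2), of l] unfolding kl by simp
    then show ?thesis unfolding R_def using 1 by blast
  qed
  have refl: "R x x" if "x \<in> tverts T" for x using that unfolding R_def by blast
  define F where "F x = (LEAST k. \<exists>y. R x y \<and> k = \<delta> y)" for x
  have Fle: "F x \<le> \<delta> y" if "R x y" for x y unfolding F_def by (rule Least_le) (use that in blast)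
  have Fex: "\<exists>y. R x y \<and> F x = \<delta> y" if "x \<in> tverts T" for x
    unfolding F_def by (rule LeastI[of "\<lambda>k. \<exists>y. R x y \<and> k = \<delta> y" "\<delta> x"]) (use refl[OF that] in blast)
  have Feq: "F x = F y" if xy: "R x y" for x y
  proof -
    have "R x z \<longleftrightarrow> R y z" for z using xy sym trans by blast
    then show ?thesis unfolding F_def by simp
  qed
  define h where "h M = real (F (SOME x. x \<in> tverts T \<and> (\<exists>n. M = \<phi> (n, x))))" for M
  have h: "h (\<phi> (n, x)) = real (F x)" if x: "x \<in> tverts T" for n x
  proof -
    let ?s = "SOME y. y \<in> tverts T \<and> (\<exists>m. \<phi> (n, x) = \<phi> (m, y))"
    have "?s \<in> tverts T \<and> (\<exists>m. \<phi> (n, x) = \<phi> (m, ?s))" by (rule someI[of _ x]) (use x in blast)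
    then have "R x ?s" unfolding R_def using x by blast
    then show ?thesis unfolding h_def using Feq by simp
  qed
  have meshF: "(\<Sum>Z\<leftarrow>Zs. h (iso_class C Z)) = (\<Sum>y | tadj T x y. real (emult T x y) * real (F y))"
    if A: "AR_triangle C U V W u v w" "iso_class C W = \<phi> (n, x)" "x \<in> tverts T"
      "Defs.direct_sum C Zs V" "\<forall>Z\<in>set Zs. indecomposable C Z" for U V W u v w n x Zs
  proof -
    have "(\<Sum>y | tadj T x y. real (emult T x y) * h (\<phi> (zpred ori n x y))) = (\<Sum>y | tadj T x y. real (emult T x y) * real (F y))"
    proof (rule sum.cong[OF HOL.refl])
      fix y assume "y \<in> {y. tadj T x y}"
      then have "y \<in> tverts T" using vtree_adj_verts[OF tree] by blast
      then show "real (emult T x y) * h (\<phi> (zpred ori n x y)) = real (emult T x y) * real (F y)" using h unfolding zpred_def by simp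
    qed
    then show ?thesis using mesh(2)[OF A, of h] by simp
  qed
  \<comment> \<open>The mesh at a vertex of \<open>\<Gamma>\<close> can be computed at any of its
    preimages. At \<open>x'\<close>, where the minimum is attained,
    \<open>F x = \<delta> x'\<close>, while \<open>F\<close> is at most \<open>\<delta>\<close> on
    the neighbours.\<close>
  have sub: "(\<Sum>y | tadj T x y. real (emult T x y) * real (F y)) \<le> 2 * real (F x)" if x: "x \<in> tverts T" for x
  proof -
    obtain x' where x': "R x x'" "F x = \<delta> x'" using Fex[OF x] by blast
    then obtain n m where nm: "\<phi> (n, x) = \<phi> (m, x')" "x' \<in> tverts T" unfolding R_def by blast
    obtain U V W u v w Zs where A: "AR_triangle C U V W u v w" "iso_class C W = \<phi> (n, x)" "iso_class C U = \<phi> (n - 1, x)"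
      "Defs.direct_sum C Zs V" "\<forall>Z\<in>set Zs. indecomposable C Z" by (rule AR_at[OF x])
    have W': "iso_class C W = \<phi> (m, x')" using A(2) nm(1) by simp
    have "(\<Sum>y | tadj T x y. real (emult T x y) * real (F y)) = (\<Sum>y | tadj T x' y. real (emult T x' y) * real (F y))"
      using meshF[OF A(1,2) x A(4,5)] meshF[OF A(1) W' nm(2) A(4,5)] by simp
    also have "\<dots> \<le> (\<Sum>y | tadj T x' y. real (emult T x' y) * real (\<delta> y))"
    proof (rule sum_mono)
      fix y assume "y \<in> {y. tadj T x' y}"
      then have "y \<in> tverts T" using vtree_adj_verts[OF tree] by blast
      then have "F y \<le> \<delta> y" by (rule Fle[OF refl])
      then show "real (emult T x' y) * real (F y) \<le> real (emult T x' y) * real (\<delta> y)" by (intro mult_left_mono) simp_all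
    qed
    also have "\<dots> = 2 * real (\<delta> x')" by (rule euclidean_tree.delta[OF E nm(2)])
    finally show ?thesis unfolding x'(2) .
  qed
  have add: "(\<Sum>y | tadj T x y. real (emult T x y) * real (F y)) = 2 * real (F x)" if "x \<in> tverts T" for x
    by (rule euclidean_tree.subadditive_additive[OF E sub that])
  have at: "\<exists>n x. x \<in> tverts T \<and> iso_class C W = \<phi> (n, x) \<and> iso_class C U = \<phi> (n - 1, x)"
    if A: "AR_triangle C U V W u v w" and W: "iso_class C W \<in> \<Gamma>" for U V W u v w
  proof -
    obtain n x where "x \<in> tverts T" "iso_class C W = \<phi> (n, x)" by (rule phi_surj[OF W])
    then show ?thesis using phi_tau[OF A] by blast
  qed
  have "AR_additive \<Gamma> h"
    unfolding AR_additive_def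
  proof (intro allI impI)
    fix U V W u v w Zs
    assume A: "AR_triangle C U V W u v w" "iso_class C W \<in> \<Gamma>" and d: "Defs.direct_sum C Zs V" "\<forall>Z\<in>set Zs. indecomposable C Z"
    obtain n x where x: "x \<in> tverts T" "iso_class C W = \<phi> (n, x)" "iso_class C U = \<phi> (n - 1, x)" using at[OF A] by blast
    show "h (iso_class C U) + h (iso_class C W) = (\<Sum>Z\<leftarrow>Zs. h (iso_class C Z))"
      unfolding meshF[OF A(1) x(2,1) d] add[OF x(1)] unfolding x(2,3) h[OF x(1)] by simp
  qed
  moreover have "tau_invariant \<Gamma> h"
    unfolding tau_invariant_def
  proof (intro allI impI)
    fix U V W u v w
    assume A: "AR_triangle C U V W u v w" "iso_class C W \<in> \<Gamma>"
    obtain n x where x: "x \<in> tverts T" "iso_class C W = \<phi> (n, x)" "iso_class C U = \<phi> (n - 1, x)" using at[OF A] by blast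
    show "h (iso_class C U) = h (iso_class C W)" unfolding x(2,3) h[OF x(1)] ..
  qed
  moreover have "h M > 0" if M: "M \<in> \<Gamma>" for M
  proof -
    obtain n x where x: "x \<in> tverts T" "M = \<phi> (n, x)" by (rule phi_surj[OF M])
    obtain y where y: "R x y" "F x = \<delta> y" using Fex[OF x(1)] by blast
    then have "\<delta> y \<ge> 1" using euclidean_tree.dpos(1)[OF E] unfolding R_def by blast
    then show ?thesis unfolding x(2) h[OF x(1)] y(2) by simp
  qed
  ultimately show ?thesis by blast
qed

end

section \<open>Hom dimensions between two components\<close>

context ks_tri
begin

lemma AR_additiveI:
  assumes "\<And>U V W u v w Zs. AR_triangle C U V W u v w \<Longrightarrow> iso_class C W \<in> \<Gamma> \<Longrightarrow> Defs.direct_sum C Zs V \<Longrightarrow>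
     \<forall>Z\<in>set Zs. indecomposable C Z \<Longrightarrow> g (iso_class C U) + g (iso_class C W) = (\<Sum>Z\<leftarrow>Zs. g (iso_class C Z))"
  shows "AR_additive \<Gamma> g"
  unfolding AR_additive_def using assms by blast

lemma iso_class_eqI:
  assumes "isomorphic C X Y"
  shows "iso_class C X = iso_class C Y"
proof -
  have "X \<in> Obj C" "Y \<in> Obj C" using assms by (simp_all add: isomorphic_def)
  then show ?thesis using iso_class_eq_iff assms by blast
qed

definition hdc :: "'o set \<Rightarrow> 'o set \<Rightarrow> nat" where
  "hdc M N = hd (SOME X. X \<in> M) (SOME Y. Y \<in> N)"

lemma iso_some: assumes "X \<in> Obj C" shows "isomorphic C X (SOME Y. Y \<in> iso_class C X)"
proof -
  have "(SOME Y. Y \<in> iso_class C X) \<in> iso_class C X" by (rule someI[of "\<lambda>Y. Y \<in> iso_class C X", OF iso_class_self[OF assms]])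
  then show ?thesis by (simp add: iso_class_def)
qed

lemma hdc_eq: "X \<in> Obj C \<Longrightarrow> Y \<in> Obj C \<Longrightarrow> hdc (iso_class C X) (iso_class C Y) = hd X Y"
  unfolding hdc_def by (rule hd_iso[symmetric]) (rule iso_some, assumption)+

lemma hom_nonzero_hd: "X \<in> Obj C \<Longrightarrow> Y \<in> Obj C \<Longrightarrow> hom_nonzero C X Y \<longleftrightarrow> hd X Y \<noteq> 0"
  unfolding hom_nonzero_def hd_def by (simp only: kdim_zero_iff[OF hom_fin_all])

lemma real_sum_list: "(\<And>Z. Z \<in> set Zs \<Longrightarrow> f Z = real (g Z)) \<Longrightarrow> (\<Sum>Z\<leftarrow>Zs. f Z) = real (\<Sum>Z\<leftarrow>Zs. g Z)"
  by (induction Zs) simp_all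

text \<open>The two conditions on \<open>M\<close> keep the exceptional end terms of
  \<open>AR_mesh_cov\<close> out of \<open>\<Gamma>\<close>.\<close>

lemma AR_additive_cov:
  assumes M: "indecomposable C M" and n: "iso_class C M \<notin> \<Gamma>" "iso_class C (sh M) \<notin> \<Gamma>"
  shows "AR_additive \<Gamma> (\<lambda>N. real (hdc (iso_class C M) N))"
proof (rule AR_additiveI)
  fix U V W u v w Zs
  assume A: "AR_triangle C U V W u v w" "iso_class C W \<in> \<Gamma>" "Defs.direct_sum C Zs V" "\<forall>Z\<in>set Zs. indecomposable C Z"
  note MO = indec_obj[OF M] and U = indec_obj[OF ARD(2)[OF A(1)]] and W = indec_obj[OF ARD(3)[OF A(1)]]
  have "\<not> isomorphic C M W" using n(1) A(2) iso_class_eq_iff[OF MO W] by auto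
  moreover have "\<not> isomorphic C (sh M) W" using n(2) A(2) iso_class_eq_iff[OF shift_closed[OF MO] W] by auto
  ultimately have "hd M V = hd M U + hd M W" by (rule AR_mesh_cov[OF A(1) M])
  moreover have "hd M V = (\<Sum>Z\<leftarrow>Zs. hd M Z)" by (rule hd_direct_sum_right[OF A(3) MO])
  moreover have "(\<Sum>Z\<leftarrow>Zs. real (hdc (iso_class C M) (iso_class C Z))) = real (\<Sum>Z\<leftarrow>Zs. hd M Z)"
  proof (rule real_sum_list)
    fix Z assume "Z \<in> set Zs"
    then have "Z \<in> Obj C" using A(4) indec_obj by blast
    then show "real (hdc (iso_class C M) (iso_class C Z)) = real (hd M Z)" using hdc_eq[OF MO] by simp
  qed
  ultimately show "real (hdc (iso_class C M) (iso_class C U)) + real (hdc (iso_class C M) (iso_class C W)) =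
      (\<Sum>Z\<leftarrow>Zs. real (hdc (iso_class C M) (iso_class C Z)))"
    unfolding hdc_eq[OF MO U] hdc_eq[OF MO W] by linarith
qed

text \<open>In the contravariant variable the exceptional triangles are recognised by their left
  term \<open>U\<close>, which lies in \<open>\<Gamma>\<close> by stability.\<close>

lemma AR_additive_contra:
  assumes \<Gamma>: "stable_component C \<Gamma>" and Y: "indecomposable C Y"
    and n: "\<And>U. iso_class C U \<in> \<Gamma> \<Longrightarrow> iso_class C U \<noteq> iso_class C Y \<and> iso_class C (sh U) \<noteq> iso_class C Y"
  shows "AR_additive \<Gamma> (\<lambda>N. real (hdc N (iso_class C Y)))"
proof (rule AR_additiveI)
  fix U V W u v w Zs
  assume A: "AR_triangle C U V W u v w" "iso_class C W \<in> \<Gamma>" "Defs.direct_sum C Zs V" "\<forall>Z\<in>set Zs. indecomposable C Z"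
  note YO = indec_obj[OF Y] and U = indec_obj[OF ARD(2)[OF A(1)]] and W = indec_obj[OF ARD(3)[OF A(1)]]
  have "iso_class C U \<in> \<Gamma>" by (rule stable_tau[OF \<Gamma> A(1,2)])
  then have "\<not> isomorphic C U Y" "\<not> isomorphic C (sh U) Y"
    using n iso_class_eq_iff[OF U YO] iso_class_eq_iff[OF shift_closed[OF U] YO] by blast+
  then have "hd V Y = hd U Y + hd W Y" by (rule AR_mesh_contra[OF A(1) Y])
  moreover have "hd V Y = (\<Sum>Z\<leftarrow>Zs. hd Z Y)" by (rule hd_direct_sum_left[OF A(3) YO])
  moreover have "(\<Sum>Z\<leftarrow>Zs. real (hdc (iso_class C Z) (iso_class C Y))) = real (\<Sum>Z\<leftarrow>Zs. hd Z Y)"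
  proof (rule real_sum_list)
    fix Z assume "Z \<in> set Zs"
    then have "Z \<in> Obj C" using A(4) indec_obj by blast
    then show "real (hdc (iso_class C Z) (iso_class C Y)) = real (hd Z Y)" using hdc_eq[OF _ YO] by simp
  qed
  ultimately show "real (hdc (iso_class C U) (iso_class C Y)) + real (hdc (iso_class C W) (iso_class C Y)) =
      (\<Sum>Z\<leftarrow>Zs. real (hdc (iso_class C Z) (iso_class C Y)))"
    unfolding hdc_eq[OF U YO] hdc_eq[OF W YO] by linarith
qed

lemma hdc_tau:
  assumes S1: "stable_covering K C \<Gamma>1 T1 ori1 \<phi>1" and S2: "stable_covering K C \<Gamma>2 T2 ori2 \<phi>2"
    and x: "x \<in> tverts T1" and y: "y \<in> tverts T2"
  shows "hdc (\<phi>1 (m - 1, x)) (\<phi>2 (n - 1, y)) = hdc (\<phi>1 (m, x)) (\<phi>2 (n, y))"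
proof -
  obtain U V W u v w Zs where A: "AR_triangle C U V W u v w" "iso_class C W = \<phi>1 (m, x)" "iso_class C U = \<phi>1 (m - 1, x)"
    "Defs.direct_sum C Zs V" "\<forall>Z\<in>set Zs. indecomposable C Z" by (rule stable_covering.AR_at[OF S1 x])
  obtain U' V' W' u' v' w' Zs' where B: "AR_triangle C U' V' W' u' v' w'" "iso_class C W' = \<phi>2 (n, y)" "iso_class C U' = \<phi>2 (n - 1, y)"
    "Defs.direct_sum C Zs' V'" "\<forall>Z\<in>set Zs'. indecomposable C Z" by (rule stable_covering.AR_at[OF S2 y])
  note O = ARD(2,3)[OF A(1), THEN indec_obj] ARD(2,3)[OF B(1), THEN indec_obj]
  have "hd U U' = hd W W'" by (rule AR_tau_hd[OF A(1) B(1)])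
  then show ?thesis unfolding A(2,3)[symmetric] B(2,3)[symmetric] hdc_eq[OF O(1,3)] hdc_eq[OF O(2,4)] .
qed

text \<open>The nonzero morphism may go in either direction, so the argument is run with Hom from
  \<open>\<Gamma>1\<close> to \<open>\<Gamma>2\<close> or from \<open>\<Gamma>2\<close> to
  \<open>\<Gamma>1\<close>; the Euclidean variable is the first one of \<open>B\<close> in both
  cases.\<close>

lemma disjoint_case:
  assumes S1: "stable_covering K C \<Gamma>1 T1 ori1 \<phi>1" and S2: "stable_covering K C \<Gamma>2 T2 ori2 \<phi>2"
    and E: "euclidean_tree T1 ori1 \<delta> d"
    and n1: "\<And>U. iso_class C U \<in> \<Gamma>1 \<Longrightarrow> iso_class C U \<notin> \<Gamma>2 \<and> iso_class C (sh U) \<notin> \<Gamma>2"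
    and n2: "\<And>U. iso_class C U \<in> \<Gamma>2 \<Longrightarrow> iso_class C U \<notin> \<Gamma>1 \<and> iso_class C (sh U) \<notin> \<Gamma>1"
    and X: "iso_class C X \<in> \<Gamma>1" and Y: "iso_class C Y \<in> \<Gamma>2"
    and nz: "hom_nonzero C X Y \<or> hom_nonzero C Y X"
  shows "\<exists>F. additive_tree T2 F"
proof -
  interpret S1: stable_covering K C \<Gamma>1 T1 ori1 \<phi>1 by (rule S1)
  interpret S2: stable_covering K C \<Gamma>2 T2 ori2 \<phi>2 by (rule S2)
  have XO: "X \<in> Obj C" and YO: "Y \<in> Obj C"
    using stable_indec[OF S1.stable X] stable_indec[OF S2.stable Y] indec_obj by blast+
  obtain m0 x0 where x0: "x0 \<in> tverts T1" "iso_class C X = \<phi>1 (m0, x0)" by (rule S1.phi_surj[OF X])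
  obtain n0 y0 where y0: "y0 \<in> tverts T2" "iso_class C Y = \<phi>2 (n0, y0)" by (rule S2.phi_surj[OF Y])
  show ?thesis
  proof (cases "hd X Y \<noteq> 0")
    case True
    show ?thesis
    proof (rule biadditive_additive_tree[OF E S2.tree S2.fin_nb, where B = "\<lambda>p q. hdc (\<phi>1 p) (\<phi>2 q)"])
      show "ZT_additive T1 ori1 (\<lambda>p. real (hdc (\<phi>1 p) (\<phi>2 (n, y))))" if y: "y \<in> tverts T2" for n y
      proof -
        obtain Z where Z: "indecomposable C Z" "\<phi>2 (n, y) = iso_class C Z" by (rule stable_vert[OF S2.stable S2.phi_in[OF y]])
        have "iso_class C Z \<in> \<Gamma>2" using S2.phi_in[OF y, of n] Z(2) by simp
        then have "iso_class C U \<noteq> iso_class C Z \<and> iso_class C (sh U) \<noteq> iso_class C Z" if "iso_class C U \<in> \<Gamma>1" for U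
          using n1[OF that] by metis
        then show ?thesis
          unfolding Z(2) by (intro S1.AR_additive_ZT AR_additive_contra[OF S1.stable Z(1)])
      qed
      show "ZT_additive T2 ori2 (\<lambda>q. real (hdc (\<phi>1 (m, x)) (\<phi>2 q)))" if x: "x \<in> tverts T1" for m x
      proof -
        obtain Z where Z: "indecomposable C Z" "\<phi>1 (m, x) = iso_class C Z" by (rule stable_vert[OF S1.stable S1.phi_in[OF x]])
        have "iso_class C Z \<in> \<Gamma>1" using S1.phi_in[OF x, of m] Z(2) by simp
        then show ?thesis
          unfolding Z(2) using n1 by (intro S2.AR_additive_ZT[OF AR_additive_cov[OF Z(1)]]) blast+
      qed
      show "hdc (\<phi>1 (m - 1, x)) (\<phi>2 (n - 1, y)) = hdc (\<phi>1 (m, x)) (\<phi>2 (n, y))"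
        if "x \<in> tverts T1" "y \<in> tverts T2" for m n x y by (rule hdc_tau[OF S1 S2 that])
      show "hdc (\<phi>1 (m0, x0)) (\<phi>2 (n0, y0)) \<noteq> 0"
        unfolding x0(2)[symmetric] y0(2)[symmetric] hdc_eq[OF XO YO] by (rule True)
    qed (rule x0(1) y0(1))+
  next
    case False
    then have nz': "hd Y X \<noteq> 0" using nz hom_nonzero_hd XO YO by blast
    show ?thesis
    proof (rule biadditive_additive_tree[OF E S2.tree S2.fin_nb, where B = "\<lambda>p q. hdc (\<phi>2 q) (\<phi>1 p)"])
      show "ZT_additive T1 ori1 (\<lambda>p. real (hdc (\<phi>2 (n, y)) (\<phi>1 p)))" if y: "y \<in> tverts T2" for n y
      proof -
        obtain Z where Z: "indecomposable C Z" "\<phi>2 (n, y) = iso_class C Z" by (rule stable_vert[OF S2.stable S2.phi_in[OF y]])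
        have "iso_class C Z \<in> \<Gamma>2" using S2.phi_in[OF y, of n] Z(2) by simp
        then show ?thesis
          unfolding Z(2) using n2 by (intro S1.AR_additive_ZT[OF AR_additive_cov[OF Z(1)]]) blast+
      qed
      show "ZT_additive T2 ori2 (\<lambda>q. real (hdc (\<phi>2 q) (\<phi>1 (m, x))))" if x: "x \<in> tverts T1" for m x
      proof -
        obtain Z where Z: "indecomposable C Z" "\<phi>1 (m, x) = iso_class C Z" by (rule stable_vert[OF S1.stable S1.phi_in[OF x]])
        have "iso_class C Z \<in> \<Gamma>1" using S1.phi_in[OF x, of m] Z(2) by simp
        then have "iso_class C U \<noteq> iso_class C Z \<and> iso_class C (sh U) \<noteq> iso_class C Z" if "iso_class C U \<in> \<Gamma>2" for U
          using n2[OF that] by metis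
        then show ?thesis
          unfolding Z(2) by (intro S2.AR_additive_ZT AR_additive_contra[OF S2.stable Z(1)])
      qed
      show "hdc (\<phi>2 (n - 1, y)) (\<phi>1 (m - 1, x)) = hdc (\<phi>2 (n, y)) (\<phi>1 (m, x))"
        if "x \<in> tverts T1" "y \<in> tverts T2" for m n x y by (rule hdc_tau[OF S2 S1 that(2,1)])
      show "hdc (\<phi>2 (n0, y0)) (\<phi>1 (m0, x0)) \<noteq> 0"
        unfolding x0(2)[symmetric] y0(2)[symmetric] hdc_eq[OF YO XO] by (rule nz')
    qed (rule x0(1) y0(1))+
  qed
qed

section \<open>Components related by the shift\<close>

lemma unshift:
  assumes "indecomposable C Y"
  obtains X where "indecomposable C X" "iso_class C Y = iso_class C (sh X)"
proof -
  obtain X where X: "X \<in> Obj C" "isomorphic C (sh X) Y" using shift_ess_surj indec_obj[OF assms] by blast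
  have "indecomposable C (sh X)" by (rule indec_iso[OF assms isomorphic_sym[OF X(2)]])
  then have "indecomposable C X" using indec_sh[OF X(1)] by blast
  moreover have "iso_class C Y = iso_class C (sh X)" by (rule iso_class_eqI[OF X(2), symmetric])
  ultimately show thesis by (rule that)
qed

text \<open>The shift preserves and reflects irreducible morphisms, so its behaviour at the single
  vertex \<open>X0\<close> propagates along unoriented paths to the whole component.\<close>

lemma shift_component:
  assumes S1: "stable_component C \<Gamma>1" and S2: "stable_component C \<Gamma>2"
    and X0: "iso_class C X0 \<in> \<Gamma>1" "iso_class C (sh X0) \<in> \<Gamma>2" and X: "indecomposable C X"
  shows "iso_class C X \<in> \<Gamma>1 \<longleftrightarrow> iso_class C (sh X) \<in> \<Gamma>2"
proof
  have iX0: "indecomposable C X0" by (rule stable_indec[OF S1 X0(1)])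
  have isX0: "indecomposable C (sh X0)" by (rule stable_indec[OF S2 X0(2)])
  have she: "iso_class C (sh A) = iso_class C (sh B) \<longleftrightarrow> iso_class C A = iso_class C B"
    if "indecomposable C A" "indecomposable C B" for A B
    using that indec_obj isomorphic_sh shift_closed iso_class_eq_iff by metis
  {
    assume "iso_class C X \<in> \<Gamma>1"
    then have c: "equivclp (qarr Q) (iso_class C X0) (iso_class C X)" using stable_connected[OF S1 X0(1)] by blast
    \<comment> \<open>Vertices are isomorphism classes while the shift acts on objects, so the
      property carried along the path is quantified over all representatives.\<close>
    have "\<forall>Y. indecomposable C Y \<longrightarrow> iso_class C X = iso_class C Y \<longrightarrow> iso_class C (sh Y) \<in> \<Gamma>2"
    proof (rule equivclp_step_closed[OF c])
      show "\<forall>Y. indecomposable C Y \<longrightarrow> iso_class C X0 = iso_class C Y \<longrightarrow> iso_class C (sh Y) \<in> \<Gamma>2"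
      proof (intro allI impI)
        fix Y assume "indecomposable C Y" "iso_class C X0 = iso_class C Y"
        then have "iso_class C (sh X0) = iso_class C (sh Y)" using she[OF iX0] by blast
        then show "iso_class C (sh Y) \<in> \<Gamma>2" using X0(2) by simp
      qed
      fix a b assume P: "\<forall>Y. indecomposable C Y \<longrightarrow> a = iso_class C Y \<longrightarrow> iso_class C (sh Y) \<in> \<Gamma>2" and q: "qarr Q a b \<or> qarr Q b a"
      show "\<forall>Y. indecomposable C Y \<longrightarrow> b = iso_class C Y \<longrightarrow> iso_class C (sh Y) \<in> \<Gamma>2"
      proof (intro allI impI)
        fix Y assume Y: "indecomposable C Y" "b = iso_class C Y"
        obtain A where A: "indecomposable C A" "a = iso_class C A" using q qarr_verts by blast
        have "iso_class C (sh A) \<in> \<Gamma>2" using P A by blast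
        moreover have "qarr Q (iso_class C (sh A)) (iso_class C (sh Y)) \<or> qarr Q (iso_class C (sh Y)) (iso_class C (sh A))"
          using q unfolding A(2) Y(2) qarr_sh[OF A(1) Y(1)] qarr_sh[OF Y(1) A(1)] .
        ultimately show "iso_class C (sh Y) \<in> \<Gamma>2" by (rule stable_step[OF S2])
      qed
    qed
    then show "iso_class C (sh X) \<in> \<Gamma>2" using X by blast
  next
    assume "iso_class C (sh X) \<in> \<Gamma>2"
    then have c: "equivclp (qarr Q) (iso_class C (sh X0)) (iso_class C (sh X))" using stable_connected[OF S2 X0(2)] by blast
    have "\<forall>Y. indecomposable C Y \<longrightarrow> iso_class C (sh X) = iso_class C (sh Y) \<longrightarrow> iso_class C Y \<in> \<Gamma>1"
    proof (rule equivclp_step_closed[OF c])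
      show "\<forall>Y. indecomposable C Y \<longrightarrow> iso_class C (sh X0) = iso_class C (sh Y) \<longrightarrow> iso_class C Y \<in> \<Gamma>1"
      proof (intro allI impI)
        fix Y assume "indecomposable C Y" "iso_class C (sh X0) = iso_class C (sh Y)"
        then have "iso_class C X0 = iso_class C Y" using she[OF iX0] by blast
        then show "iso_class C Y \<in> \<Gamma>1" using X0(1) by simp
      qed
      fix a b assume P: "\<forall>Y. indecomposable C Y \<longrightarrow> a = iso_class C (sh Y) \<longrightarrow> iso_class C Y \<in> \<Gamma>1" and q: "qarr Q a b \<or> qarr Q b a"
      show "\<forall>Y. indecomposable C Y \<longrightarrow> b = iso_class C (sh Y) \<longrightarrow> iso_class C Y \<in> \<Gamma>1"
      proof (intro allI impI)
        fix Y assume Y: "indecomposable C Y" "b = iso_class C (sh Y)"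
        obtain A' where A': "indecomposable C A'" "a = iso_class C A'" using q qarr_verts by blast
        obtain A where A: "indecomposable C A" "iso_class C A' = iso_class C (sh A)" by (rule unshift[OF A'(1)])
        have a: "a = iso_class C (sh A)" using A'(2) A(2) by simp
        have "iso_class C A \<in> \<Gamma>1" using P A(1) a by blast
        moreover have "qarr Q (iso_class C A) (iso_class C Y) \<or> qarr Q (iso_class C Y) (iso_class C A)"
          using q unfolding a Y(2) qarr_sh[OF A(1) Y(1)] qarr_sh[OF Y(1) A(1)] .
        ultimately show "iso_class C Y \<in> \<Gamma>1" by (rule stable_step[OF S1])
      qed
    qed
    then show "iso_class C X \<in> \<Gamma>1" using X by blast
  }
qed

text \<open>Here \<open>\<Gamma>1\<close> is the shift of \<open>\<Gamma>2\<close>, and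
  \<open>h\<close> is pulled back: triangles and decompositions over \<open>\<Gamma>2\<close> are
  simply shifted forward.\<close>

lemma unshift_invariant:
  assumes S1: "stable_component C \<Gamma>1" and S2: "stable_component C \<Gamma>2"
    and X0: "iso_class C X0 \<in> \<Gamma>2" "iso_class C (sh X0) \<in> \<Gamma>1"
    and h: "AR_additive \<Gamma>1 h" "tau_invariant \<Gamma>1 h" "\<forall>M\<in>\<Gamma>1. h M > 0"
  shows "\<exists>h. AR_additive \<Gamma>2 h \<and> tau_invariant \<Gamma>2 h \<and> (\<forall>M\<in>\<Gamma>2. h M > 0)"
proof -
  define g where "g M = h (iso_class C (sh (SOME Y. Y \<in> M)))" for M
  have g: "g (iso_class C X) = h (iso_class C (sh X))" if X: "indecomposable C X" for X
  proof -
    note XO = indec_obj[OF X]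
    have "isomorphic C X (SOME Y. Y \<in> iso_class C X)" by (rule iso_some[OF XO])
    then have "isomorphic C (sh X) (sh (SOME Y. Y \<in> iso_class C X))"
      using isomorphic_sh[OF XO] by (simp add: isomorphic_def)
    then have "iso_class C (sh X) = iso_class C (sh (SOME Y. Y \<in> iso_class C X))" by (rule iso_class_eqI)
    then show ?thesis unfolding g_def by simp
  qed
  note sc = shift_component[OF S2 S1 X0]
  have sA: "\<exists>u' v' w'. AR_triangle C (sh U) (sh V) (sh W) u' v' w'" "iso_class C (sh W) \<in> \<Gamma>1"
    if A: "AR_triangle C U V W u v w" "iso_class C W \<in> \<Gamma>2" for U V W u v w
    using AR_shift[OF A(1)] sc[OF ARD(3)[OF A(1)]] A(2) by blast+
  have "AR_additive \<Gamma>2 g"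
  proof (rule AR_additiveI)
    fix U V W u v w Zs
    assume A: "AR_triangle C U V W u v w" "iso_class C W \<in> \<Gamma>2" "Defs.direct_sum C Zs V" "\<forall>Z\<in>set Zs. indecomposable C Z"
    obtain u' v' w' where B: "AR_triangle C (sh U) (sh V) (sh W) u' v' w'" using sA(1)[OF A(1,2)] by blast
    have "\<forall>Z\<in>set (map sh Zs). indecomposable C Z" using A(4) indec_sh indec_obj by simp
    then have "h (iso_class C (sh U)) + h (iso_class C (sh W)) = (\<Sum>Z\<leftarrow>map sh Zs. h (iso_class C Z))"
      using h(1) B sA(2)[OF A(1,2)] direct_sum_sh[OF A(3)] unfolding AR_additive_def by blast
    moreover have "(\<Sum>Z\<leftarrow>map sh Zs. h (iso_class C Z)) = (\<Sum>Z\<leftarrow>Zs. g (iso_class C Z))"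
      unfolding map_map o_def by (intro arg_cong[of _ _ sum_list] map_cong[OF refl]) (use g A(4) in simp)
    ultimately show "g (iso_class C U) + g (iso_class C W) = (\<Sum>Z\<leftarrow>Zs. g (iso_class C Z))"
      unfolding g[OF ARD(2)[OF A(1)]] g[OF ARD(3)[OF A(1)]] by simp
  qed
  moreover have "tau_invariant \<Gamma>2 g"
    unfolding tau_invariant_def
  proof (intro allI impI)
    fix U V W u v w
    assume A: "AR_triangle C U V W u v w" "iso_class C W \<in> \<Gamma>2"
    obtain u' v' w' where B: "AR_triangle C (sh U) (sh V) (sh W) u' v' w'" using sA(1)[OF A] by blast
    have "h (iso_class C (sh U)) = h (iso_class C (sh W))" using h(2) B sA(2)[OF A] unfolding tau_invariant_def by blast
    then show "g (iso_class C U) = g (iso_class C W)" unfolding g[OF ARD(2)[OF A(1)]] g[OF ARD(3)[OF A(1)]] .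
  qed
  moreover have "g M > 0" if M: "M \<in> \<Gamma>2" for M
  proof -
    obtain X where X: "indecomposable C X" "M = iso_class C X" by (rule stable_vert[OF S2 M])
    then have "iso_class C (sh X) \<in> \<Gamma>1" using sc M by blast
    then show ?thesis unfolding X(2) g[OF X(1)] using h(3) by blast
  qed
  ultimately show ?thesis by blast
qed

text \<open>Here \<open>\<Gamma>2\<close> is the shift of \<open>\<Gamma>1\<close>, and triangles
  have to be shifted back. A triangle ending in \<open>\<Gamma>2\<close> is compared with the shift
  of one ending in \<open>\<Gamma>1\<close>; by uniqueness their terms agree up to isomorphism, and
  \<open>krull_schmidt_sum\<close> compares the sums over the middle terms.\<close>

lemma shift_invariant:
  assumes S1: "stable_component C \<Gamma>1" and S2: "stable_component C \<Gamma>2"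
    and X0: "iso_class C X0 \<in> \<Gamma>1" "iso_class C (sh X0) \<in> \<Gamma>2"
    and h: "AR_additive \<Gamma>1 h" "tau_invariant \<Gamma>1 h" "\<forall>M\<in>\<Gamma>1. h M > 0"
  shows "\<exists>h. AR_additive \<Gamma>2 h \<and> tau_invariant \<Gamma>2 h \<and> (\<forall>M\<in>\<Gamma>2. h M > 0)"
proof -
  define g where "g M = h (iso_class C (SOME Y. indecomposable C Y \<and> M = iso_class C (sh Y)))" for M
  have g: "g (iso_class C (sh X)) = h (iso_class C X)" if X: "indecomposable C X" for X
  proof -
    let ?Y = "SOME Y. indecomposable C Y \<and> iso_class C (sh X) = iso_class C (sh Y)"
    have Y: "indecomposable C ?Y \<and> iso_class C (sh X) = iso_class C (sh ?Y)" by (rule someI[of _ X]) (use X in blast)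
    have O: "X \<in> Obj C" "?Y \<in> Obj C" using X Y indec_obj by blast+
    have "iso_class C X = iso_class C ?Y"
      using Y isomorphic_sh[OF O] iso_class_eq_iff[OF O] iso_class_eq_iff[OF shift_closed[OF O(1)] shift_closed[OF O(2)]] by blast
    then show ?thesis unfolding g_def by simp
  qed
  note sc = shift_component[OF S1 S2 X0]
  have sA: "\<exists>U1 V1 W1 u1 v1 w1. AR_triangle C U1 V1 W1 u1 v1 w1 \<and> iso_class C W1 \<in> \<Gamma>1 \<and>
      iso_class C U = iso_class C (sh U1) \<and> isomorphic C (sh V1) V \<and> iso_class C W = iso_class C (sh W1)"
    if A: "AR_triangle C U V W u v w" "iso_class C W \<in> \<Gamma>2" for U V W u v w
  proof -
    obtain W0 where W0: "indecomposable C W0" "iso_class C W = iso_class C (sh W0)" by (rule unshift[OF ARD(3)[OF A(1)]])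
    have "iso_class C W0 \<in> \<Gamma>1" using sc[OF W0(1)] A(2) W0(2) by simp
    then obtain U1 V1 W1 u1 v1 w1 where B: "AR_triangle C U1 V1 W1 u1 v1 w1" "iso_class C W0 = iso_class C W1" "iso_class C U1 \<in> \<Gamma>1"
      by (rule stable_AR[OF S1])
    note i1 = ARD(2,3)[OF B(1)]
    obtain u2 v2 w2 where B2: "AR_triangle C (sh U1) (sh V1) (sh W1) u2 v2 w2" using AR_shift[OF B(1)] by blast
    have "isomorphic C W0 W1" by (rule iso_class_indec(2)[OF B(2) i1(2)])
    then have "isomorphic C (sh W0) (sh W1)" using isomorphic_sh indec_obj W0(1) i1(2) by blast
    then have e: "iso_class C (sh W0) = iso_class C (sh W1)" by (rule iso_class_eqI)
    have "isomorphic C W (sh W1)" using iso_class_indec(2)[of W "sh W1"] W0(2) e ARD(3)[OF B2] by simp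
    then have i: "isomorphic C (sh W1) W" by (rule isomorphic_sym)
    have "isomorphic C (sh U1) U" by (rule AR_unique(1)[OF B2 A(1) i])
    then have "iso_class C U = iso_class C (sh U1)" by (rule iso_class_eqI[symmetric])
    moreover have "isomorphic C (sh V1) V" by (rule AR_unique(2)[OF B2 A(1) i])
    moreover have "iso_class C W1 \<in> \<Gamma>1" using \<open>iso_class C W0 \<in> \<Gamma>1\<close> B(2) by simp
    moreover have "iso_class C W = iso_class C (sh W1)" using W0(2) e by simp
    ultimately show ?thesis using B(1) by blast
  qed
  have "AR_additive \<Gamma>2 g"
  proof (rule AR_additiveI)
    fix U V W u v w Zs
    assume A: "AR_triangle C U V W u v w" "iso_class C W \<in> \<Gamma>2" "Defs.direct_sum C Zs V" "\<forall>Z\<in>set Zs. indecomposable C Z"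
    obtain U1 V1 W1 u1 v1 w1 where B: "AR_triangle C U1 V1 W1 u1 v1 w1" "iso_class C W1 \<in> \<Gamma>1"
      "iso_class C U = iso_class C (sh U1)" "isomorphic C (sh V1) V" "iso_class C W = iso_class C (sh W1)" using sA[OF A(1,2)] by blast
    have "V1 \<in> Obj C" using dist_closed[OF ARD(1)[OF B(1)]] by blast
    then obtain Zs1 where Z1: "Defs.direct_sum C Zs1 V1" "\<forall>Z\<in>set Zs1. indecomposable C Z" by (rule ks_decomp)
    have i: "\<forall>Z\<in>set (map sh Zs1). indecomposable C Z" using Z1(2) indec_sh indec_obj by simp
    have "(\<Sum>Z\<leftarrow>Zs. g (iso_class C Z)) = (\<Sum>Z\<leftarrow>map sh Zs1. g (iso_class C Z))"
      by (rule krull_schmidt_sum[OF direct_sum_sh[OF Z1(1)] i A(3,4) B(4), symmetric])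
    also have "\<dots> = (\<Sum>Z\<leftarrow>Zs1. h (iso_class C Z))"
      unfolding map_map o_def by (intro arg_cong[of _ _ sum_list] map_cong[OF refl]) (use g Z1(2) in simp)
    also have "\<dots> = h (iso_class C U1) + h (iso_class C W1)"
      using h(1) B(1,2) Z1 unfolding AR_additive_def by metis
    finally show "g (iso_class C U) + g (iso_class C W) = (\<Sum>Z\<leftarrow>Zs. g (iso_class C Z))"
      unfolding B(3,5) g[OF ARD(2)[OF B(1)]] g[OF ARD(3)[OF B(1)]] by simp
  qed
  moreover have "tau_invariant \<Gamma>2 g"
    unfolding tau_invariant_def
  proof (intro allI impI)
    fix U V W u v w
    assume A: "AR_triangle C U V W u v w" "iso_class C W \<in> \<Gamma>2"
    obtain U1 V1 W1 u1 v1 w1 where B: "AR_triangle C U1 V1 W1 u1 v1 w1" "iso_class C W1 \<in> \<Gamma>1"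
      "iso_class C U = iso_class C (sh U1)" "isomorphic C (sh V1) V" "iso_class C W = iso_class C (sh W1)" using sA[OF A] by blast
    have "h (iso_class C U1) = h (iso_class C W1)" using h(2) B(1,2) unfolding tau_invariant_def by blast
    then show "g (iso_class C U) = g (iso_class C W)" unfolding B(3,5) g[OF ARD(2)[OF B(1)]] g[OF ARD(3)[OF B(1)]] .
  qed
  moreover have "g M > 0" if M: "M \<in> \<Gamma>2" for M
  proof -
    obtain X' where X': "indecomposable C X'" "M = iso_class C X'" by (rule stable_vert[OF S2 M])
    obtain X where X: "indecomposable C X" "iso_class C X' = iso_class C (sh X)" by (rule unshift[OF X'(1)])
    have MX: "M = iso_class C (sh X)" using X'(2) X(2) by simp
    then have "iso_class C X \<in> \<Gamma>1" using sc[OF X(1)] M by simp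
    then show ?thesis unfolding MX g[OF X(1)] using h(3) by blast
  qed
  ultimately show ?thesis by blast
qed

lemma same_component:
  assumes "stable_component C \<Gamma>1" "stable_component C \<Gamma>2" "M \<in> \<Gamma>1" "M \<in> \<Gamma>2"
  shows "\<Gamma>1 = \<Gamma>2"
  using stable_connected[OF assms(1,3)] stable_connected[OF assms(2,4)] by blast

lemma ex_additive_tree:
  assumes S1: "stable_covering K C \<Gamma>1 T1 ori1 \<phi>1" and S2: "stable_covering K C \<Gamma>2 T2 ori2 \<phi>2"
    and E: "euclidean_tree T1 ori1 \<delta> d"
    and X: "iso_class C X \<in> \<Gamma>1" and Y: "iso_class C Y \<in> \<Gamma>2"
    and nz: "hom_nonzero C X Y \<or> hom_nonzero C Y X"
  shows "\<exists>F. additive_tree T2 F"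
proof -
  interpret S1: stable_covering K C \<Gamma>1 T1 ori1 \<phi>1 by (rule S1)
  interpret S2: stable_covering K C \<Gamma>2 T2 ori2 \<phi>2 by (rule S2)
  obtain h where h: "AR_additive \<Gamma>1 h" "tau_invariant \<Gamma>1 h" "\<forall>M\<in>\<Gamma>1. h M > 0" using S1.ex_invariant[OF E] by blast
  have *: ?thesis if "\<exists>h. AR_additive \<Gamma>2 h \<and> tau_invariant \<Gamma>2 h \<and> (\<forall>M\<in>\<Gamma>2. h M > 0)"
    using that S2.invariant_additive_tree by blast
  \<comment> \<open>Exceptional triangles involve an object or its shift only, so these three
    coincidences are all that must be separated from the biadditive case.\<close>
  consider (same) U where "iso_class C U \<in> \<Gamma>1" "iso_class C U \<in> \<Gamma>2"
    | (up) U where "iso_class C U \<in> \<Gamma>1" "iso_class C (sh U) \<in> \<Gamma>2"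
    | (down) U where "iso_class C U \<in> \<Gamma>2" "iso_class C (sh U) \<in> \<Gamma>1"
    | (disjoint) "\<And>U. iso_class C U \<in> \<Gamma>1 \<Longrightarrow> iso_class C U \<notin> \<Gamma>2 \<and> iso_class C (sh U) \<notin> \<Gamma>2"
      "\<And>U. iso_class C U \<in> \<Gamma>2 \<Longrightarrow> iso_class C U \<notin> \<Gamma>1 \<and> iso_class C (sh U) \<notin> \<Gamma>1" by blast
  then show ?thesis
  proof cases
    case same
    then have "\<Gamma>1 = \<Gamma>2" by (rule same_component[OF S1.stable S2.stable])
    then show ?thesis using * h by blast
  next
    case up
    show ?thesis by (rule *[OF shift_invariant[OF S1.stable S2.stable up h]])
  next
    case down
    show ?thesis by (rule *[OF unshift_invariant[OF S1.stable S2.stable down h]])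
  next
    case disjoint
    show ?thesis by (rule disjoint_case[OF S1 S2 E disjoint X Y nz])
  qed
qed

end

theorem theorem1p3:
  fixes K :: "('k, 'r) ring_scheme"
    and C :: "('k, 'o, 'm) tri_cat"
    and \<Gamma>1 \<Gamma>2 :: "'o set set"
    and X Y :: 'o
    and T1 :: "'a vtree"
    and T2 :: "'b vtree"
  assumes "triangulated_category K C"
    and "hom_finite K C"
    and "krull_schmidt C"
    and "connected_category C"
    and "stable_component C \<Gamma>1"
    and "stable_component C \<Gamma>2"
    and "iso_class C X \<in> \<Gamma>1"
    and "iso_class C Y \<in> \<Gamma>2"
    and "hom_nonzero C X Y \<or> hom_nonzero C Y X"
    and "tree_class (full_subquiver (ar_quiver C) \<Gamma>1) T1"
    and "tree_class (full_subquiver (ar_quiver C) \<Gamma>2) T2"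
    and "extended_dynkin T1"
  shows "extended_dynkin T2 \<or> T2 \<cong>\<^sub>T A_inf \<or> T2 \<cong>\<^sub>T B_inf \<or> T2 \<cong>\<^sub>T C_inf \<or>
         T2 \<cong>\<^sub>T D_inf \<or> T2 \<cong>\<^sub>T A_inf_inf"
proof -
  interpret ks_tri K C
    by (rule ks_tri.intro[OF assms(1) ks_tri_axioms.intro[OF assms(2,3)]])
  obtain ori1 \<phi>1 where T1: "valued_tree T1" "orientation T1 ori1"
    "quiver_covering (ZT T1 ori1) (full_subquiver (ar_quiver C) \<Gamma>1) \<phi>1"
    using assms(10) unfolding tree_class_def by blast
  obtain ori2 \<phi>2 where T2: "valued_tree T2" "orientation T2 ori2"
    "quiver_covering (ZT T2 ori2) (full_subquiver (ar_quiver C) \<Gamma>2) \<phi>2"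
    using assms(11) unfolding tree_class_def by blast
  obtain \<delta> d where "null_data T1 \<delta> d" by (rule extended_dynkin_null_data[OF T1(1) assms(12)])
  then have E: "euclidean_tree T1 ori1 \<delta> d" using T1 by (intro euclidean_tree.intro)
  have S1: "stable_covering K C \<Gamma>1 T1 ori1 \<phi>1"
    by (intro stable_covering.intro stable_covering_axioms.intro ks_tri_axioms assms(5) T1)
  have S2: "stable_covering K C \<Gamma>2 T2 ori2 \<phi>2"
    by (intro stable_covering.intro stable_covering_axioms.intro ks_tri_axioms assms(6) T2)
  obtain F where "additive_tree T2 F" using ex_additive_tree[OF S1 S2 E assms(7-9)] by blast
  then show ?thesis by (rule additive_tree.classification)
qed

end
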